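(* Let $0<p<1$, $r\in\mathbb{N}$, and $\varphi(x)=\sqrt{1-x^2}$. There are a number $n(r)\in\mathbb{N}$ and a constant $C$, independent of $f$ and $n$, such that the following holds. Let $f$ be a function on $[-1,1]$ such that $f^{(r-1)}\in AC[-1,1]$, $\varphi^rf^{(r)}\in L_1[-1,1]$, and $$\sum_{\nu=r+1}^\infty\nu^{1-2p}E_{\nu-r}(f^{(r)})_{p,\varphi^r}^p<\infty ,$$ and let $P_n\in\mathcal{P}_n$, $n\in\mathbb{N}$, be such that $\|f-P_n\|_p=E_n(f)_p$. Then for any $n\ge n(r)$, $$\|\varphi^r(f^{(r)}-P_n^{(r)})\|_p\le C\left(E_{n-r}(f^{(r)})_{p,\varphi^r}+n^{2-\frac2p}\left(\sum_{\nu=n+1}^\infty\nu^{1-2p}E_{\nu-r}(f^{(r)})_{p,\varphi^r}^p\right)^{\frac1p}\right).$$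
   Context: $\|f\|_p=\left(\int_{-1}^1|f(x)|^p\,dx\right)^{1/p}$. $AC[-1,1]$ is the set of absolutely continuous functions on $[-1,1]$; when $f^{(r-1)}\in AC[-1,1]$, $f^{(r)}$ denotes the a.e. defined derivative of $f^{(r-1)}$. $\mathcal{P}_n$ is the set of all algebraic polynomials of degree at most $n$. For a weight $w$ on $[-1,1]$, $E_n(f)_{p,w}=\inf_{P\in\mathcal{P}_n}\|w(f-P)\|_p$, and $E_n(f)_p=E_n(f)_{p,1}$ (weight identically $1$). *)

theory Defs
  imports "HOL-Analysis.Analysis"
begin

definition abs_continuous_on_Icc :: "real \<Rightarrow> real \<Rightarrow> (real \<Rightarrow> real) \<Rightarrow> bool" where
  "abs_continuous_on_Icc l u f \<longleftrightarrow>
     (\<forall>\<epsilon>>0. \<exists>\<delta>>0. \<forall>(m::nat) a b.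
        (\<forall>i<m. l \<le> a i \<and> a i \<le> b i \<and> b i \<le> u) \<and>
        (\<forall>i<m. \<forall>j<m. i \<noteq> j \<longrightarrow> {a i<..<b i} \<inter> {a j<..<b j} = {}) \<and>
        (\<Sum>i<m. b i - a i) < \<delta>
        \<longrightarrow> (\<Sum>i<m. \<bar>f (b i) - f (a i)\<bar>) < \<epsilon>)"

(* Derivatives relative to [-1,1], hence one-sided at the endpoints, so that values of f
   outside [-1,1] play no role. Where the derivative does not exist the value is unspecified. *)
fun iter_deriv :: "nat \<Rightarrow> (real \<Rightarrow> real) \<Rightarrow> real \<Rightarrow> real" where
  "iter_deriv 0 f = f"
| "iter_deriv (Suc k) f = (\<lambda>x. vector_derivative (iter_deriv k f) (at x within {-1..1}))"

(* For r >= 1: the derivative of order r - 1 exists on all of [-1,1] and belongs to AC[-1,1]. *)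
definition deriv_in_AC :: "nat \<Rightarrow> (real \<Rightarrow> real) \<Rightarrow> bool" where
  "deriv_in_AC r f \<longleftrightarrow>
     (\<forall>k<r - 1. \<forall>x\<in>{-1..1}. iter_deriv k f differentiable (at x within {-1..1})) \<and>
     abs_continuous_on_Icc (-1) 1 (iter_deriv (r - 1) f)"

(* Real-valued: meaningful only when |f|^p is integrable on [-1,1] (otherwise the Bochner
   integral is 0 by convention). *)
definition Lp_norm :: "real \<Rightarrow> (real \<Rightarrow> real) \<Rightarrow> real" where
  "Lp_norm p f = (LINT x:{-1..1}|lebesgue. \<bar>f x\<bar> powr p) powr (1 / p)"

definition best_approx :: "nat \<Rightarrow> real \<Rightarrow> (real \<Rightarrow> real) \<Rightarrow> (real \<Rightarrow> real) \<Rightarrow> real" where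
  "best_approx n p w f =
     (INF P\<in>{P :: real poly. degree P \<le> n}. Lp_norm p (\<lambda>x. w x * (f x - poly P x)))"

definition phi :: "real \<Rightarrow> real" where
  "phi x = sqrt (1 - x\<^sup>2)"

end

theory Submission
  imports Defs "HOL-Computational_Algebra.Polynomial"
begin

text \<open>
  For \<open>p < 1\<close> there is no control of a function by its derivative in \<open>L\<^sub>p\<close>, except for polynomials, where
  such control holds with a factor depending on the degree. Approximate \<open>f\<close>'s derivative of order \<open>r\<close> by near-best
  \<open>Q\<^sub>k\<close> of degree \<open>2 ^ k * n - r\<close>, and let \<open>F\<^sub>k\<close> be the \<open>r\<close>-fold antiderivative of \<open>Q\<^sub>k\<close> with the Taylor data
  of \<open>f\<close> at the origin, so that \<open>F\<^sub>k\<close> tends to \<open>f\<close>. Each difference of consecutive \<open>F\<^sub>k\<close> is a polynomial and is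
  replaced by one of degree \<open>n\<close>, close to it in \<open>L\<^sub>p\<close> and with controlled derivative of order \<open>r\<close>; the weights
  \<open>\<nu> powr (1 - 2 * p)\<close> in the hypothesis are exactly what sums the degree factors. This yields a
  polynomial of degree \<open>n\<close> that approximates \<open>f\<close> and its derivative simultaneously, and it is compared with the
  best approximant through Bernstein's inequality.
\<close>

text \<open>The exponent \<open>2 - 2 * p\<close> collects the losses due to \<open>p < 1\<close>:
  an integral of \<open>\<bar>G\<bar>\<close> reaches one of \<open>\<bar>G\<bar> powr p\<close>
  only through a supremum, which for degree \<open>N\<close> costs powers of \<open>N\<close>. Going
  from degree \<open>N\<close> down to \<open>n\<close> costs
  \<open>(N / n) powr (2 - 2 * p)\<close>, and up to the power of \<open>n\<close> this is the order
  of the sum of \<open>\<nu> powr (1 - 2 * p)\<close> over a dyadic block near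
  \<open>\<nu> = N\<close>. The obstacle is the endpoints. After \<open>x = cos s\<close> the weight
  \<open>sin s\<close> vanishes there, so estimates are proved with \<open>sin s + 1 / n\<close>,
  which changes moderately at the scale \<open>1 / n\<close>, and are then transferred back. The
  Jackson estimate has to be local: at each point the approximant is compared with a Taylor
  polynomial chosen for that point, which the operator reproduces. Equal Taylor data at the origin
  make the differences of the \<open>F_k\<close> vanish there to order \<open>r\<close>, so that
  their size is governed by their derivative of order \<open>r\<close>. All bounds are on
  \<open>p\<close>-th powers, which are subadditive although the quasi-norm is not.\<close>

section \<open>Trigonometric polynomials\<close>

text \<open>
  A trigonometric polynomial of degree at most \<open>n\<close>, with its factor \<open>cis (- (n * t))\<close> split off
  so that the rest is an ordinary polynomial of degree at most \<open>2 * n\<close> in \<open>cis t\<close>.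
\<close>

definition trigp :: "nat \<Rightarrow> (real \<Rightarrow> complex) \<Rightarrow> bool" where
  "trigp n H \<longleftrightarrow> (\<exists>q::complex poly. degree q \<le> 2 * n \<and>
     (\<forall>t. H t = cis (- (real n * t)) * poly q (cis t)))"

lemma trigp_mono:
  assumes "trigp n H" "n \<le> m" shows "trigp m H"
proof -
  obtain q where q: "degree q \<le> 2 * n" "\<And>t. H t = cis (- (real n * t)) * poly q (cis t)"
    using assms(1) unfolding trigp_def by auto
  have "degree (monom 1 (m - n) * q) \<le> 2 * m"
    using degree_mult_le[of "monom 1 (m - n)" q] q(1) assms(2) degree_monom_le[of "1::complex" "m-n"]
    by linarith
  moreover have "H t = cis (- (real m * t)) * poly (monom 1 (m - n) * q) (cis t)" for t
  proof -
    have "cis (- (real m * t)) * cis (real (m - n) * t) = cis (- (real n * t))"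
      using assms(2) by (simp add: cis_mult of_nat_diff algebra_simps)
    then show ?thesis
      by (simp only: q(2) poly_mult poly_monom Complex.DeMoivre mult_1_left mult.assoc[symmetric])
  qed
  ultimately show ?thesis unfolding trigp_def by blast
qed

lemma trigp_mult:
  assumes "trigp n H" "trigp m K" shows "trigp (n + m) (\<lambda>t. H t * K t)"
proof -
  obtain q where q: "degree q \<le> 2 * n" "\<And>t. H t = cis (- (real n * t)) * poly q (cis t)"
    using assms(1) unfolding trigp_def by auto
  obtain w where w: "degree w \<le> 2 * m" "\<And>t. K t = cis (- (real m * t)) * poly w (cis t)"
    using assms(2) unfolding trigp_def by auto
  have "degree (q * w) \<le> 2 * (n + m)"
    using degree_mult_le[of q w] q(1) w(1) by simp
  moreover have "H t * K t = cis (- (real (n + m) * t)) * poly (q * w) (cis t)" for t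
  proof -
    have e: "cis (- (real (n + m) * t)) = cis (- (real n * t)) * cis (- (real m * t))"
      by (simp add: cis_mult algebra_simps)
    show ?thesis unfolding e q(2) w(2) by simp
  qed
  ultimately show ?thesis unfolding trigp_def by blast
qed

lemma trigp_add:
  assumes "trigp n H" "trigp n K" shows "trigp n (\<lambda>t. H t + K t)"
proof -
  obtain q where q: "degree q \<le> 2 * n" "\<And>t. H t = cis (- (real n * t)) * poly q (cis t)"
    using assms(1) unfolding trigp_def by auto
  obtain w where w: "degree w \<le> 2 * n" "\<And>t. K t = cis (- (real n * t)) * poly w (cis t)"
    using assms(2) unfolding trigp_def by auto
  have "degree (q + w) \<le> 2 * n" using q(1) w(1) by (rule degree_add_le)
  then show ?thesis unfolding trigp_def using q(2) w(2)
    by (intro exI[of _ "q + w"]) (simp add: algebra_simps)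
qed

lemma trigp_const: "trigp n (\<lambda>t. c)"
proof -
  have "trigp 0 (\<lambda>t. c)"
    unfolding trigp_def by (rule exI[of _ "[:c:]"]) simp
  then show ?thesis by (rule trigp_mono) simp
qed

lemma trigp_cmult: "trigp n H \<Longrightarrow> trigp n (\<lambda>t. c * H t)"
  using trigp_mult[of 0 "\<lambda>t. c" n H] trigp_const[of 0 c] by simp

lemma trigp_sum: "(\<And>i. i \<in> I \<Longrightarrow> trigp n (H i)) \<Longrightarrow> trigp n (\<lambda>t. \<Sum>i\<in>I. H i t)"
  by (induction I rule: infinite_finite_induct) (auto intro: trigp_const trigp_add)

lemma trigp_power: "trigp n H \<Longrightarrow> trigp (k * n) (\<lambda>t. H t ^ k)"
proof (induction k)
  case 0
  then show ?case by (simp add: trigp_const)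
next
  case (Suc k)
  then show ?case using trigp_mult[of n H "k * n" "\<lambda>t. H t ^ k"] by simp
qed

lemma trigp_shift:
  assumes "trigp n H" shows "trigp n (\<lambda>t. H (t - a))"
proof -
  obtain q where q: "degree q \<le> 2 * n" "\<And>t. H t = cis (- (real n * t)) * poly q (cis t)"
    using assms(1) unfolding trigp_def by auto
  let ?w = "smult (cis (real n * a)) (pcompose q [:0, cis (- a):])"
  have "degree ?w \<le> 2 * n"
    using q(1) degree_pcompose_le[of q "[:0, cis (- a):]"] degree_smult_le[of "cis (real n * a)" "pcompose q [:0, cis (- a):]"]
    by (auto simp: degree_pCons_eq_if split: if_splits)
  moreover have "H (t - a) = cis (- (real n * t)) * poly ?w (cis t)" for t
  proof -
    have "cis (- (real n * (t - a))) = cis (- (real n * t)) * cis (real n * a)"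
      by (simp add: cis_mult algebra_simps)
    moreover have "cis (t - a) = cis t * cis (- a)" by (simp add: cis_mult)
    ultimately show ?thesis by (simp add: q(2) poly_pcompose mult.commute mult.left_commute)
  qed
  ultimately show ?thesis unfolding trigp_def by blast
qed

lemma trigp_cos1: "trigp 1 (\<lambda>t. of_real (cos t))"
  unfolding trigp_def
proof (intro exI conjI allI)
  let ?q = "[:1/2, 0, 1/2::complex:]"
  show "degree ?q \<le> 2 * 1" by simp
  fix t
  have "cis (-(real 1 * t)) * (1/2 + cis t * (cis t * (1/2))) = (cis (-t) + cis (-t) * cis t * cis t)/2"
    by (simp add: algebra_simps)
  also have "cis (-t) * cis t * cis t = cis t" by (simp only: cis_mult) simp
  also have "(cis (-t) + cis t)/2 = of_real (cos t)" by (simp add: complex_eq_iff)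
  finally show "of_real (cos t) = cis (- (real 1 * t)) * poly ?q (cis t)"
    by simp
qed

lemma trigp_sin1: "trigp 1 (\<lambda>t. of_real (sin t))"
  unfolding trigp_def
proof (intro exI conjI allI)
  let ?q = "[:\<i>/2, 0, -\<i>/2::complex:]"
  show "degree ?q \<le> 2 * 1" by simp
  fix t
  have "cis (-(real 1 * t)) * (\<i>/2 + cis t * (cis t * (-\<i>/2))) = (\<i> * cis (-t) - \<i> * (cis (-t) * cis t * cis t))/2"
    by (simp add: algebra_simps)
  also have "cis (-t) * cis t * cis t = cis t" by (simp only: cis_mult) simp
  also have "(\<i> * cis (-t) - \<i> * cis t)/2 = of_real (sin t)" by (simp add: complex_eq_iff)
  finally show "of_real (sin t) = cis (- (real 1 * t)) * poly ?q (cis t)"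
    by simp
qed

lemma trigp_poly_cos:
  fixes P :: "real poly"
  assumes "degree P \<le> n" shows "trigp n (\<lambda>t. of_real (poly P (cos t)))"
proof -
  have "trigp n (\<lambda>t. \<Sum>i\<le>degree P. of_real (coeff P i) * of_real (cos t) ^ i)"
  proof (intro trigp_sum trigp_cmult)
    fix i assume "i \<in> {..degree P}"
    then show "trigp n (\<lambda>t. of_real (cos t) ^ i)"
      using trigp_power[OF trigp_cos1, of i] assms by (auto intro: trigp_mono)
  qed
  then show ?thesis by (simp add: poly_altdef)
qed

lemma trigp_coeffs:
  assumes "trigp n H"
  obtains c where "\<And>t. H t = (\<Sum>i\<le>2 * n. c i * cis ((real i - real n) * t))"
proof -
  obtain q where q: "degree q \<le> 2 * n" "\<And>t. H t = cis (- (real n * t)) * poly q (cis t)"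
    using assms(1) unfolding trigp_def by auto
  have "poly q z = (\<Sum>i\<le>2*n. coeff q i * z ^ i)" for z
    unfolding poly_altdef
    by (rule sum.mono_neutral_left) (use q(1) in \<open>auto simp: coeff_eq_0\<close>)
  then have "H t = (\<Sum>i\<le>2 * n. coeff q i * cis ((real i - real n) * t))" for t
    unfolding q(2)
    by (auto simp: sum_distrib_left Complex.DeMoivre cis_mult algebra_simps intro!: sum.cong)
  then show ?thesis by (rule that)
qed

lemma has_integral_cis:
  fixes k :: int
  shows "((\<lambda>s. cis (of_int k * s)) has_integral (if k = 0 then 2 * of_real pi else 0)) {-pi..pi}"
proof (cases "k = 0")
  case True
  then show ?thesis using has_integral_const_real[of "1::complex" "-pi" pi] by (simp add: scaleR_conv_of_real)
next
  case False
  let ?F = "\<lambda>s. cis (of_int k * s) / (\<i> * of_int k)"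
  have "((\<lambda>s. cis (of_int k * s)) has_integral (?F pi - ?F (-pi))) {-pi..pi}"
  proof (rule fundamental_theorem_of_calculus)
    fix x assume "x \<in> {-pi..pi}"
    have "((\<lambda>s. exp (\<i> * of_int k * of_real s) / (\<i> * of_int k)) has_vector_derivative
       exp (\<i> * of_int k * of_real x)) (at x within {-pi..pi})"
      by (rule has_vector_derivative_real_field) (use False in \<open>auto intro!: derivative_eq_intros\<close>)
    then show "(?F has_vector_derivative cis (of_int k * x)) (at x within {-pi..pi})"
      by (simp add: cis_conv_exp mult.assoc)
  qed auto
  moreover have "?F pi = ?F (-pi)"
  proof -
    have "cis (of_int k * pi) = cis (- (of_int k * pi)) * cis (of_int k * (2 * pi))"
      by (simp add: cis_mult algebra_simps)
    also have "cis (of_int k * (2 * pi)) = 1"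
      using cis_multiple_2pi[of "of_int k"] by (simp add: mult.commute)
    finally show ?thesis by simp
  qed
  ultimately show ?thesis using False by simp
qed

lemma trigp_coeff_integral:
  assumes "\<And>t. H t = (\<Sum>i\<le>2 * n. c i * cis ((real i - real n) * t))" and "j \<le> 2 * n"
  shows "((\<lambda>s. H s * cis (- ((real j - real n) * s))) has_integral (2 * of_real pi * c j)) {-pi..pi}"
proof -
  have "((\<lambda>s. \<Sum>i\<le>2 * n. c i * cis (of_int (int i - int j) * s)) has_integral
      (\<Sum>i\<le>2*n. c i * (if int i - int j = 0 then 2 * of_real pi else 0))) {-pi..pi}"
    by (intro has_integral_sum has_integral_mult_right has_integral_cis) auto
  moreover have "(\<Sum>i\<le>2 * n. c i * cis (of_int (int i - int j) * s)) = H s * cis (- ((real j - real n) * s))" for s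
    unfolding assms(1) sum_distrib_right
    by (intro sum.cong refl) (simp add: cis_mult mult.assoc algebra_simps)
  moreover have "(\<Sum>i\<le>2*n. c i * (if int i - int j = 0 then 2 * of_real pi else 0))
      = (\<Sum>i\<le>2*n. if i = j then c i * (2 * of_real pi) else 0)"
    by (intro sum.cong refl) auto
  ultimately show ?thesis
    using assms(2) by (simp add: mult.commute mult.left_commute)
qed

lemma trigp_continuous:
  assumes "trigp n H" shows "continuous_on S H"
proof -
  obtain q where q: "\<And>t. H t = cis (- (real n * t)) * poly q (cis t)"
    using assms unfolding trigp_def by auto
  show ?thesis unfolding q by (intro continuous_intros)
qed

lemma trigp_coeff_bound:
  assumes c: "\<And>t. H t = (\<Sum>i\<le>2 * n. c i * cis ((real i - real n) * t))" and j: "j \<le> 2 * n"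
  shows "norm (c j) \<le> integral {-pi..pi} (\<lambda>s. norm (H s)) / (2 * pi)"
proof -
  have H: "continuous_on {-pi..pi} H"
    unfolding c by (intro continuous_intros)
  have I: "((\<lambda>s. H s * cis (- ((real j - real n) * s))) has_integral (2 * of_real pi * c j)) {-pi..pi}"
    using trigp_coeff_integral[OF c j] .
  have "norm (integral {-pi..pi} (\<lambda>s. H s * cis (- ((real j - real n) * s))))
      \<le> integral {-pi..pi} (\<lambda>s. norm (H s))"
    by (rule integral_norm_bound_integral)
      (use I H in \<open>auto intro!: integrable_continuous_real continuous_intros simp: norm_mult\<close>)
  then have "norm (2 * of_real pi * c j) \<le> integral {-pi..pi} (\<lambda>s. norm (H s))"
    using integral_unique[OF I] by simp
  then show ?thesis by (simp add: norm_mult field_simps)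
qed

text \<open>Each of the \<open>2 * n + 1\<close> Fourier coefficients is at most the mean of
  \<open>norm (H s)\<close>. Adding these bounds is crude but has the right order \<open>n\<close>
  for passing from \<open>L_1\<close> to the supremum.\<close>

lemma trigp_sup_bound:
  assumes "trigp n H"
  shows "norm (H t) \<le> real (2 * n + 1) * (integral {-pi..pi} (\<lambda>s. norm (H s)) / (2 * pi))"
proof -
  obtain c where c: "\<And>t. H t = (\<Sum>i\<le>2 * n. c i * cis ((real i - real n) * t))"
    using trigp_coeffs[OF assms] by blast
  have "norm (H t) \<le> (\<Sum>i\<le>2 * n. norm (c i * cis ((real i - real n) * t)))"
    unfolding c by (rule norm_sum)
  also have "\<dots> \<le> (\<Sum>i\<le>2 * n. integral {-pi..pi} (\<lambda>s. norm (H s)) / (2 * pi))"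
    by (intro sum_mono) (use trigp_coeff_bound[OF c] in \<open>simp add: norm_mult\<close>)
  finally show ?thesis by simp
qed

text \<open>Differentiation multiplies each coefficient by a frequency of modulus at most
  \<open>n\<close>, so one factor \<open>n\<close> is added. This \<open>L_1\<close> bound is
  global; the version for \<open>p < 1\<close> is extracted from it by localisation.\<close>

lemma trigp_deriv_bound:
  assumes "trigp n H"
  shows "\<exists>D. (H has_vector_derivative D) (at t) \<and>
    norm D \<le> real n * real (2 * n + 1) * (integral {-pi..pi} (\<lambda>s. norm (H s)) / (2 * pi))"
proof -
  obtain c where c: "\<And>t. H t = (\<Sum>i\<le>2 * n. c i * cis ((real i - real n) * t))"
    using trigp_coeffs[OF assms] by blast
  let ?D = "\<Sum>i\<le>2 * n. c i * (\<i> * of_real (real i - real n) * cis ((real i - real n) * t))"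
  have 1: "((\<lambda>t. cis (a * t)) has_vector_derivative \<i> * of_real a * cis (a * t)) (at t)" for a :: real
  proof -
    have "((\<lambda>s. exp (\<i> * of_real a * of_real s)) has_vector_derivative
       \<i> * of_real a * exp (\<i> * of_real a * of_real t)) (at t)"
      by (rule has_vector_derivative_real_field) (auto intro!: derivative_eq_intros)
    then show ?thesis by (simp add: cis_conv_exp mult.assoc)
  qed
  have "((\<lambda>t. \<Sum>i\<le>2 * n. c i * cis ((real i - real n) * t)) has_vector_derivative ?D) (at t)"
    by (intro has_vector_derivative_sum has_vector_derivative_mult_right 1)
  then have "(H has_vector_derivative ?D) (at t)"
    using c by (metis (no_types, lifting) ext)
  moreover have "norm ?D \<le> (\<Sum>i\<le>2 * n. real n * (integral {-pi..pi} (\<lambda>s. norm (H s)) / (2 * pi)))"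
  proof (rule order_trans[OF norm_sum], rule sum_mono)
    fix i assume i: "i \<in> {..2 * n}"
    have "norm (c i * (\<i> * of_real (real i - real n) * cis ((real i - real n) * t))) = \<bar>real i - real n\<bar> * norm (c i)"
      by (simp add: norm_mult del: of_real_diff)
    also have "\<dots> \<le> real n * (integral {-pi..pi} (\<lambda>s. norm (H s)) / (2 * pi))"
      by (rule mult_mono) (use i trigp_coeff_bound[OF c, of i] in auto)
    finally show "norm (c i * (\<i> * of_real (real i - real n) * cis ((real i - real n) * t)))
       \<le> real n * (integral {-pi..pi} (\<lambda>s. norm (H s)) / (2 * pi))" .
  qed
  ultimately show ?thesis by (intro exI[of _ ?D]) (simp add: algebra_simps)
qed

section \<open>Dirichlet and Fejer kernels\<close>

definition dirichlet :: "nat \<Rightarrow> real \<Rightarrow> real" where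
  "dirichlet L t = 1 + 2 * (\<Sum>k=1..L. cos (real k * t))"

lemma dirichlet_abs_le: "\<bar>dirichlet L t\<bar> \<le> real (2 * L + 1)"
proof -
  have "\<bar>\<Sum>k=1..L. cos (real k * t)\<bar> \<le> (\<Sum>k=1..L. 1)"
    by (rule order_trans[OF sum_abs], rule sum_mono) simp
  then show ?thesis unfolding dirichlet_def by simp
qed

lemma dirichlet_cis: "of_real (dirichlet L t) = (\<Sum>i\<le>2 * L. cis ((real i - real L) * t))"
proof (induction L)
  case 0 then show ?case by (simp add: dirichlet_def)
next
  case (Suc L)
  have "(\<Sum>i\<le>2 * Suc L. cis ((real i - real (Suc L)) * t))
      = (\<Sum>i\<le>Suc (2 * L). cis ((real i - real (Suc L)) * t)) + cis (real (Suc L) * t)"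
    by (simp add: algebra_simps)
  also have "(\<Sum>i\<le>Suc (2 * L). cis ((real i - real (Suc L)) * t))
     = cis (- (real (Suc L) * t)) + (\<Sum>i\<le>2 * L. cis ((real i - real L) * t))"
    by (subst sum.atMost_Suc_shift) (simp add: algebra_simps)
  also have "(\<Sum>i\<le>2 * L. cis ((real i - real L) * t)) = of_real (dirichlet L t)"
    using Suc by simp
  finally have "(\<Sum>i\<le>2 * Suc L. cis ((real i - real (Suc L)) * t))
    = cis (- (real (Suc L) * t)) + of_real (dirichlet L t) + cis (real (Suc L) * t)" by simp
  also have "\<dots> = of_real (dirichlet (Suc L) t)"
    by (simp add: dirichlet_def complex_eq_iff)
  finally show ?case by simp
qed

text \<open>All frequencies up to \<open>L\<close> occur in the kernel with coefficient 1, so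
  orthogonality returns every Fourier coefficient of \<open>H\<close> unchanged.\<close>

lemma dirichlet_reproduces:
  assumes "trigp n H" "n \<le> L"
  shows "((\<lambda>s. H s * of_real (dirichlet L (t - s))) has_integral (2 * of_real pi * H t)) {-pi..pi}"
proof -
  obtain c where c: "\<And>t. H t = (\<Sum>i\<le>2 * L. c i * cis ((real i - real L) * t))"
    using trigp_coeffs[OF trigp_mono[OF assms]] by blast
  have "((\<lambda>s. \<Sum>j\<le>2 * L. (H s * cis (- ((real j - real L) * s))) * cis ((real j - real L) * t))
     has_integral (\<Sum>j\<le>2 * L. (2 * of_real pi * c j) * cis ((real j - real L) * t))) {-pi..pi}"
    by (intro has_integral_sum has_integral_mult_left trigp_coeff_integral[OF c]) auto
  moreover have "(\<Sum>j\<le>2 * L. (H s * cis (- ((real j - real L) * s))) * cis ((real j - real L) * t))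
     = H s * of_real (dirichlet L (t - s))" for s
    unfolding dirichlet_cis sum_distrib_left
    by (intro sum.cong refl) (simp add: cis_mult mult.assoc algebra_simps)
  moreover have "(\<Sum>j\<le>2 * L. (2 * of_real pi * c j) * cis ((real j - real L) * t)) = 2 * of_real pi * H t"
    unfolding c sum_distrib_left by (simp add: mult.assoc)
  ultimately show ?thesis by simp
qed

text \<open>The Chebyshev polynomials, by their three-term recurrence. They turn the kernels into
  polynomials in \<open>cos t\<close>, the form needed for convolution of algebraic
  polynomials.\<close>

lemma cos_multiple_poly: "\<exists>P::real poly. degree P \<le> k \<and> (\<forall>t. cos (real k * t) = poly P (cos t))"
proof (induction k rule: less_induct)
  case (less k)
  consider "k = 0" | "k = 1" | j where "k = Suc (Suc j)"
    by (cases k; cases "k - 1") auto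
  then show ?case
  proof cases
    case 1 then show ?thesis by (intro exI[of _ 1]) simp
  next
    case 2 then show ?thesis by (intro exI[of _ "[:0, 1:]"]) simp
  next
    case 3
    obtain P where P: "degree P \<le> Suc j" "\<And>t. cos (real (Suc j) * t) = poly P (cos t)"
      using less[of "Suc j"] 3 by blast
    obtain Q where Q: "degree Q \<le> j" "\<And>t. cos (real j * t) = poly Q (cos t)"
      using less[of j] 3 by auto
    have "degree ([:0, 2:] * P - Q) \<le> k"
    proof (rule degree_diff_le)
      show "degree ([:0, 2:] * P) \<le> k"
        using degree_mult_le[of "[:0,2::real:]" P] P(1) 3 by simp
    qed (use Q(1) 3 in simp)
    moreover have "cos (real k * t) = poly ([:0, 2:] * P - Q) (cos t)" for t
    proof -
      have "cos (real k * t) + cos (real j * t) = 2 * cos (real (Suc j) * t) * cos t"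
        using cos_add[of "real (Suc j) * t" t] cos_diff[of "real (Suc j) * t" t] 3
        by (simp add: algebra_simps)
      then show ?thesis using P(2)[of t] Q(2)[of t] by (simp add: algebra_simps)
    qed
    ultimately show ?thesis by blast
  qed
qed

text \<open>
  The square of the normalised Dirichlet-type sum, that is, the Fejer kernel scaled to have value 1 at the origin.
\<close>

definition fejer :: "nat \<Rightarrow> real \<Rightarrow> real" where
  "fejer m t = (norm (\<Sum>j<m. cis (real j * t)) / real m)\<^sup>2"

lemma fejer_cos_sum: "fejer m t = (\<Sum>i<m. \<Sum>j<m. cos ((real i - real j) * t)) / (real m)\<^sup>2"
proof -
  let ?A = "\<Sum>j<m. cis (real j * t)"
  have "of_real ((norm ?A)\<^sup>2) = ?A * cnj ?A"
    by (rule complex_norm_square)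
  also have "\<dots> = (\<Sum>i<m. \<Sum>j<m. cis (real i * t) * cis (- (real j * t)))"
    by (simp add: sum_product cis_cnj)
  also have "\<dots> = (\<Sum>i<m. \<Sum>j<m. cis ((real i - real j) * t))"
    by (simp add: cis_mult algebra_simps)
  finally have "Re (of_real ((norm ?A)\<^sup>2)) = Re (\<Sum>i<m. \<Sum>j<m. cis ((real i - real j) * t))"
    by simp
  then show ?thesis unfolding fejer_def by (simp add: power_divide)
qed

lemma fejer_poly: "\<exists>P::real poly. degree P \<le> m - 1 \<and> (\<forall>t. fejer m t = poly P (cos t))"
proof -
  obtain Q :: "nat \<Rightarrow> real poly" where Q: "\<And>k. degree (Q k) \<le> k" "\<And>k t. cos (real k * t) = poly (Q k) (cos t)"
    using cos_multiple_poly by metis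
  let ?k = "\<lambda>i j::nat. nat \<bar>int i - int j\<bar>"
  have 1: "cos ((real i - real j) * t) = poly (Q (?k i j)) (cos t)" for i j t
  proof (cases "i \<ge> j")
    case True then show ?thesis using Q(2)[of "i - j" t] by (simp add: of_nat_diff nat_diff_distrib)
  next
    case False
    have "cos ((real i - real j) * t) = cos ((real j - real i) * t)"
      by (metis cos_minus minus_diff_eq mult_minus_left)
    then show ?thesis using False Q(2)[of "j - i" t] by (simp add: of_nat_diff nat_diff_distrib)
  qed
  let ?P = "smult (1 / (real m)\<^sup>2) (\<Sum>i<m. \<Sum>j<m. Q (?k i j))"
  have "degree (\<Sum>i<m. \<Sum>j<m. Q (?k i j)) \<le> m - 1"
    by (intro degree_sum_le) (auto intro!: order_trans[OF Q(1)])
  then have "degree ?P \<le> m - 1" using degree_smult_le order_trans by blast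
  moreover have "fejer m t = poly ?P (cos t)" for t
    unfolding fejer_cos_sum by (simp add: poly_sum 1)
  ultimately show ?thesis by blast
qed

lemma fejer_nonneg: "0 \<le> fejer m t" by (simp add: fejer_def)

lemma fejer_0: "m \<ge> 1 \<Longrightarrow> fejer m 0 = 1" by (simp add: fejer_def)

lemma norm_one_minus_cis: "norm (1 - cis t) = 2 * \<bar>sin (t / 2)\<bar>"
proof -
  have "(norm (1 - cis t))\<^sup>2 = (1 - cos t)\<^sup>2 + (sin t)\<^sup>2"
    by (simp add: cmod_power2)
  also have "\<dots> = 2 - 2 * cos t"
    using sin_cos_squared_add[of t] by (simp add: power2_eq_square algebra_simps)
  also have "\<dots> = (2 * \<bar>sin (t / 2)\<bar>)\<^sup>2"
    using cos_double_sin[of "t/2"] by (simp add: power_mult_distrib)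
  finally show ?thesis using power2_eq_imp_eq by fastforce
qed

text \<open>The trivial bound \<open>m\<close> for the exponential sum and the bound 1 for its
  product with \<open>\<bar>sin (t / 2)\<bar>\<close>, from the geometric series, are added; this
  gives one estimate valid both near \<open>t = 0\<close> and away from it.\<close>

lemma fejer_le:
  assumes "m \<ge> 1" shows "fejer m t \<le> (2 / (1 + real m * \<bar>sin (t / 2)\<bar>))\<^sup>2"
proof -
  let ?A = "\<Sum>j<m. cis (real j * t)"
  have 1: "norm ?A \<le> real m"
    by (rule order_trans[OF norm_sum]) simp
  have "?A * (1 - cis t) = 1 - cis (real m * t)"
  proof -
    have "?A = (\<Sum>j<m. cis t ^ j)" by (simp add: Complex.DeMoivre)
    moreover have "cis (real m * t) = cis t ^ m" by (simp add: Complex.DeMoivre)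
    ultimately show ?thesis using one_diff_power_eq[of "cis t" m]
      by (simp only: mult.commute)
  qed
  then have "norm ?A * norm (1 - cis t) = norm (1 - cis (real m * t))"
    by (simp only: norm_mult[symmetric])
  also have "\<dots> \<le> 2"
    using norm_triangle_ineq4[of 1 "cis (real m * t)"] by simp
  finally have "norm ?A * norm (1 - cis t) \<le> 2" .
  then have 2: "norm ?A * \<bar>sin (t / 2)\<bar> \<le> 1"
    unfolding norm_one_minus_cis by simp
  have "norm ?A / real m * (1 + real m * \<bar>sin (t / 2)\<bar>) = norm ?A / real m + norm ?A * \<bar>sin (t/2)\<bar>"
    using assms by (simp add: field_simps)
  also have "\<dots> \<le> 1 + 1" by (intro add_mono) (use 1 2 assms in auto)
  finally have "norm ?A / real m * (1 + real m * \<bar>sin (t / 2)\<bar>) \<le> 2" by simp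
  then have "norm ?A / real m \<le> 2 / (1 + real m * \<bar>sin (t / 2)\<bar>)"
    by (subst pos_le_divide_eq) (auto intro: add_pos_nonneg)
  then show ?thesis unfolding fejer_def by (intro power_mono) auto
qed

lemma fejer_le_1: "m \<ge> 1 \<Longrightarrow> fejer m t \<le> 1"
proof -
  assume m: "m \<ge> 1"
  have "norm (\<Sum>j<m. cis (real j * t)) \<le> real m"
    by (rule order_trans[OF norm_sum]) simp
  then have "norm (\<Sum>j<m. cis (real j * t)) / real m \<le> 1" using m by simp
  then show ?thesis unfolding fejer_def by (simp add: power_le_one)
qed

lemma trigp_fejer_power: "trigp (M * (m - 1)) (\<lambda>t. of_real (fejer m t ^ M))"
proof -
  obtain P :: "real poly" where "degree P \<le> m - 1" "\<And>t. fejer m t = poly P (cos t)"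
    using fejer_poly by blast
  then have "trigp (m - 1) (\<lambda>t. of_real (fejer m t))" using trigp_poly_cos by simp
  then show ?thesis using trigp_power by force
qed

section \<open>Localised sup-norm estimates\<close>

text \<open>Half the chord between \<open>cis s\<close> and \<open>cis t\<close>: a
  \<open>2 * pi\<close>-periodic distance with an exact triangle inequality, comparable to
  \<open>\<bar>s - t\<bar>\<close> as long as that is at most \<open>pi\<close>.\<close>

definition sdist :: "real \<Rightarrow> real \<Rightarrow> real" where
  "sdist s t = \<bar>sin ((s - t) / 2)\<bar>"

definition loc :: "real \<Rightarrow> nat \<Rightarrow> real \<Rightarrow> real \<Rightarrow> real" where
  "loc a n s t = (1 + real n * sdist s t) powr (- a)"

text \<open>The Jacobian \<open>sin s\<close> of \<open>x = cos s\<close>, raised by the resolution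
  \<open>1 / n\<close> of degree \<open>n\<close> so that it no longer degenerates at the
  endpoints.\<close>

definition wt :: "nat \<Rightarrow> real \<Rightarrow> real" where
  "wt n s = sin s + 1 / real n"

definition rtrig :: "nat \<Rightarrow> (real \<Rightarrow> real) \<Rightarrow> bool" where
  "rtrig n G \<longleftrightarrow> trigp n (\<lambda>t. of_real (G t))"

lemma sdist_nonneg: "0 \<le> sdist s t" by (simp add: sdist_def)

lemma sdist_le_1: "sdist s t \<le> 1" by (simp add: sdist_def)

lemma sdist_commute: "sdist s t = sdist t s"
  unfolding sdist_def by (metis abs_minus_cancel minus_diff_eq minus_divide_left sin_minus)

lemma sdist_triangle: "sdist a c \<le> sdist a b + sdist b c"
proof -
  have e: "(a - c) / 2 = (a - b) / 2 + (b - c) / 2" by (simp add: field_simps)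
  have "sin ((a - c) / 2) = sin ((a - b) / 2) * cos ((b - c) / 2) + cos ((a - b) / 2) * sin ((b - c) / 2)"
    unfolding e by (rule sin_add)
  also have "\<bar>\<dots>\<bar> \<le> \<bar>sin ((a - b) / 2)\<bar> * \<bar>cos ((b - c) / 2)\<bar> + \<bar>cos ((a - b) / 2)\<bar> * \<bar>sin ((b - c) / 2)\<bar>"
    by (metis abs_triangle_ineq abs_mult)
  also have "\<dots> \<le> \<bar>sin ((a - b) / 2)\<bar> * 1 + 1 * \<bar>sin ((b - c) / 2)\<bar>"
    by (intro add_mono mult_mono) auto
  finally show ?thesis by (simp add: sdist_def)
qed

text \<open>This submultiplicativity lets the centre of \<open>loc\<close> be moved at the cost of a
  power of the distance moved.\<close>

lemma sdist_submult:
  "1 + real n * sdist a c \<le> (1 + real n * sdist a b) * (1 + real n * sdist b c)"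
proof -
  have "real n * sdist a c \<le> real n * sdist a b + real n * sdist b c"
    using mult_left_mono[OF sdist_triangle[of a c b], of "real n"] by (simp add: distrib_left)
  moreover have "0 \<le> (real n * sdist a b) * (real n * sdist b c)"
    by (simp add: sdist_nonneg)
  ultimately show ?thesis by (simp add: algebra_simps)
qed

lemma one_plus_sdist_ge1: "1 \<le> 1 + real n * sdist s t"
  by (simp add: sdist_nonneg)

lemma sin_diff_le_sdist: "sin s - sin t \<le> 2 * sdist s t"
proof -
  have "sin s - sin t = 2 * sin ((s - t) / 2) * cos ((s + t) / 2)"
    by (rule sin_diff_sin)
  also have "\<dots> \<le> \<bar>2 * sin ((s - t) / 2) * cos ((s + t) / 2)\<bar>" by simp
  also have "\<dots> = 2 * sdist s t * \<bar>cos ((s + t) / 2)\<bar>" by (simp add: sdist_def abs_mult)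
  also have "\<dots> \<le> 2 * sdist s t * 1" by (intro mult_left_mono) (auto simp: sdist_nonneg)
  finally show ?thesis by simp
qed

lemma wt_ge: assumes "n \<ge> 1" "t \<in> {0..pi}" shows "1 / real n \<le> wt n t" "sin t \<le> wt n t" "0 < wt n t"
  using assms sin_ge_zero[of t] unfolding wt_def by (auto intro: add_nonneg_pos)

text \<open>\<open>sin\<close> is Lipschitz with constant 2 for \<open>sdist\<close>, and
  \<open>wt n t \<ge> 1 / n\<close> converts the increment \<open>2 * sdist s t\<close> into a
  multiple of \<open>wt n t\<close>.\<close>

lemma wt_compare:
  assumes "n \<ge> 1" "t \<in> {0..pi}"
  shows "wt n s \<le> 2 * wt n t * (1 + real n * sdist s t)"
proof -
  have "wt n s \<le> wt n t + 2 * sdist s t" using sin_diff_le_sdist[of s t] by (simp add: wt_def)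
  moreover have "2 * sdist s t \<le> (real n * wt n t) * (2 * sdist s t)"
    using wt_ge(1)[OF assms] assms(1) mult_right_mono[of 1 "real n * wt n t" "2 * sdist s t"]
    by (simp add: sdist_nonneg field_simps)
  moreover have "0 < wt n t" by (rule wt_ge(3)[OF assms])
  ultimately show ?thesis by (simp add: algebra_simps)
qed

text \<open>The squares differ by \<open>sin s * sin t\<close>, which is nonnegative on
  \<open>[0, pi]\<close>. Hence a kernel decreasing in \<open>sdist\<close> is no larger at the
  mirror point \<open>- t\<close> than at \<open>t\<close>, and integrals over
  \<open>[-pi, pi]\<close> fold onto \<open>[0, pi]\<close>.\<close>

lemma sdist_fold:
  assumes "s \<in> {0..pi}" "t \<in> {0..pi}" shows "sdist s t \<le> sdist s (- t)"
proof -
  have "(sin ((s + t) / 2))\<^sup>2 - (sin ((s - t) / 2))\<^sup>2 = sin s * sin t"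
  proof -
    have "sin ((s + t) / 2) = sin (s/2) * cos (t/2) + cos (s/2) * sin (t/2)"
      "sin ((s - t) / 2) = sin (s/2) * cos (t/2) - cos (s/2) * sin (t/2)"
      by (simp_all only: add_divide_distrib diff_divide_distrib sin_add sin_diff)
    moreover have "sin s = 2 * sin (s/2) * cos (s/2)" "sin t = 2 * sin (t/2) * cos (t/2)"
      using sin_double[of "s/2"] sin_double[of "t/2"] by auto
    ultimately show ?thesis by (simp only: power2_eq_square) (simp add: algebra_simps)
  qed
  moreover have "0 \<le> sin s * sin t" using assms by (intro mult_nonneg_nonneg sin_ge_zero) auto
  ultimately have "\<bar>sin ((s - t) / 2)\<bar> \<le> \<bar>sin ((s + t) / 2)\<bar>"
    by (simp add: abs_le_square_iff)
  then show ?thesis by (simp add: sdist_def)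
qed

lemma sin_ge_jordan:
  assumes "0 \<le> x" "x \<le> pi / 2" shows "2 * x / pi \<le> sin x"
proof -
  have "convex_on {0..pi/2} (\<lambda>x. - sin x)"
    by (rule f''_ge0_imp_convex[where f' = "\<lambda>x. - cos x" and f'' = sin])
      (auto intro!: derivative_eq_intros sin_ge_zero)
  then have "- sin x \<le> (- sin (pi/2) - - sin 0) / (pi/2 - 0) * (x - 0) + - sin 0"
    by (rule convex_onD_Icc') (use assms in auto)
  then show ?thesis by (simp add: field_simps)
qed

lemma sdist_ge: assumes "\<bar>s - t\<bar> \<le> pi" shows "\<bar>s - t\<bar> / pi \<le> sdist s t"
proof -
  have "2 * (\<bar>s - t\<bar> / 2) / pi \<le> sin (\<bar>s - t\<bar> / 2)"
    by (rule sin_ge_jordan) (use assms in auto)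
  also have "\<dots> \<le> \<bar>sin ((s - t) / 2)\<bar>"
  proof (cases "s \<ge> t")
    case False
    then have "\<bar>s - t\<bar> = - (s - t)" by simp
    then have "\<bar>s - t\<bar> / 2 = - ((s - t) / 2)" by (simp only: minus_divide_left)
    then show ?thesis by (simp only: sin_minus)
  qed simp
  finally show ?thesis by (simp add: sdist_def)
qed

lemma sdist_le: "sdist s t \<le> \<bar>s - t\<bar> / 2"
  using abs_sin_x_le_abs_x[of "(s-t)/2"] by (simp add: sdist_def)

lemma loc_nonneg: "0 \<le> loc a n s t" by (simp add: loc_def)

lemma loc_commute: "loc a n s t = loc a n t s"
  by (simp add: loc_def sdist_commute)

lemma continuous_on_sdist [continuous_intros]:
  fixes f g :: "'a::t2_space \<Rightarrow> real"
  shows "continuous_on S f \<Longrightarrow> continuous_on S g \<Longrightarrow> continuous_on S (\<lambda>x. sdist (f x) (g x))"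
  unfolding sdist_def by (intro continuous_intros) auto

lemma continuous_on_loc [continuous_intros]:
  fixes f g :: "'a::t2_space \<Rightarrow> real"
  shows "continuous_on S f \<Longrightarrow> continuous_on S g \<Longrightarrow> continuous_on S (\<lambda>x. loc a n (f x) (g x))"
  unfolding loc_def
  by (intro continuous_on_powr continuous_intros) (auto simp: add_nonneg_eq_0_iff sdist_nonneg)

lemma continuous_on_wt [continuous_intros]:
  fixes f :: "'a::t2_space \<Rightarrow> real"
  shows "continuous_on S f \<Longrightarrow> continuous_on S (\<lambda>x. wt n (f x))"
  unfolding wt_def by (intro continuous_intros) auto

lemma continuous_on_powr_pos:
  fixes f :: "real \<Rightarrow> real"
  assumes "continuous_on S f" "\<And>x. x \<in> S \<Longrightarrow> 0 \<le> f x" "0 < p"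
  shows "continuous_on S (\<lambda>x. f x powr p)"
  by (rule continuous_on_powr') (use assms in auto)

lemma continuous_on_abs_powr:
  fixes f :: "real \<Rightarrow> real"
  assumes "continuous_on S f" "0 < p"
  shows "continuous_on S (\<lambda>x. \<bar>f x\<bar> powr p)"
  by (rule continuous_on_powr_pos) (use assms in \<open>auto intro: continuous_intros\<close>)

section \<open>Integrals against the localising factor\<close>

text \<open>Jordan's inequality replaces \<open>sdist\<close> by
  \<open>\<bar>\<sigma> - s\<bar> / pi\<close>, after which the majorant has an explicit
  antiderivative on either side of \<open>\<sigma>\<close>. Each side contributes at most
  \<open>pi / n\<close>, and \<open>2 * pi < 7\<close>.\<close>

lemma integral_loc_le:
  assumes "n \<ge> 1" "a \<ge> 2" "\<sigma> \<in> {0..pi}"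
  shows "integral {0..pi} (\<lambda>s. loc a n \<sigma> s) \<le> 7 / real n"
proof -
  let ?f = "\<lambda>s. loc a n \<sigma> s"
  have b: "?f s \<le> 1 / (1 + real n * \<bar>\<sigma> - s\<bar> / pi)\<^sup>2" if "s \<in> {0..pi}" for s
  proof -
    have le: "1 + real n * \<bar>\<sigma> - s\<bar> / pi \<le> 1 + real n * sdist \<sigma> s"
      using mult_left_mono[OF sdist_ge[of \<sigma> s], of "real n"] that assms(3) by (simp add: abs_le_iff)
    have pos: "0 < 1 + real n * \<bar>\<sigma> - s\<bar> / pi" by (intro add_pos_nonneg) auto
    have "?f s \<le> (1 + real n * sdist \<sigma> s) powr (-2)"
      unfolding loc_def using assms(2) one_plus_sdist_ge1[of n \<sigma> s] by (intro powr_mono) (auto simp: sdist_nonneg)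
    also have "\<dots> \<le> (1 + real n * \<bar>\<sigma> - s\<bar> / pi) powr (-2)"
      using le pos by (intro powr_mono2') auto
    also have "\<dots> = 1 / (1 + real n * \<bar>\<sigma> - s\<bar> / pi)\<^sup>2"
      using pos by (simp add: powr_minus_divide)
    finally show ?thesis .
  qed
  have cont: "continuous_on T ?f" for T by (intro continuous_intros)
  have n: "real n > 0" using assms(1) by simp
  let ?P = "\<lambda>s. (pi / real n) / (1 + real n * (\<sigma> - s) / pi)"
  let ?Q = "\<lambda>s. - (pi / real n) / (1 + real n * (s - \<sigma>) / pi)"
  have p1: "1 + real n * (\<sigma> - x) / pi > 0" if "x \<le> \<sigma>" for x
    using that n by (intro add_pos_nonneg) auto
  have q1: "1 + real n * (x - \<sigma>) / pi > 0" if "\<sigma> \<le> x" for x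
    using that n by (intro add_pos_nonneg) auto
  have 1: "((\<lambda>s. 1 / (1 + real n * \<bar>\<sigma> - s\<bar> / pi)\<^sup>2) has_integral (?P \<sigma> - ?P 0)) {0..\<sigma>}"
  proof (rule fundamental_theorem_of_calculus)
    fix x assume x: "x \<in> {0..\<sigma>}"
    have "(?P has_real_derivative (1 / (1 + real n * \<bar>\<sigma> - x\<bar> / pi)\<^sup>2)) (at x within {0..\<sigma>})"
      using x p1[of x] n by (auto intro!: derivative_eq_intros simp: power2_eq_square)
    then show "(?P has_vector_derivative (1 / (1 + real n * \<bar>\<sigma> - x\<bar> / pi)\<^sup>2)) (at x within {0..\<sigma>})"
      by (simp add: has_real_derivative_iff_has_vector_derivative)
  qed (use assms in auto)
  have 2: "((\<lambda>s. 1 / (1 + real n * \<bar>\<sigma> - s\<bar> / pi)\<^sup>2) has_integral (?Q pi - ?Q \<sigma>)) {\<sigma>..pi}"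
  proof (rule fundamental_theorem_of_calculus)
    fix x assume x: "x \<in> {\<sigma>..pi}"
    have "(?Q has_real_derivative (1 / (1 + real n * \<bar>\<sigma> - x\<bar> / pi)\<^sup>2)) (at x within {\<sigma>..pi})"
      using x q1[of x] n by (auto intro!: derivative_eq_intros simp: power2_eq_square)
    then show "(?Q has_vector_derivative (1 / (1 + real n * \<bar>\<sigma> - x\<bar> / pi)\<^sup>2)) (at x within {\<sigma>..pi})"
      by (simp add: has_real_derivative_iff_has_vector_derivative)
  qed (use assms in auto)
  have "integral {0..pi} ?f = integral {0..\<sigma>} ?f + integral {\<sigma>..pi} ?f"
    by (rule Henstock_Kurzweil_Integration.integral_combine[symmetric]) (use assms cont in \<open>auto intro!: integrable_continuous_real\<close>)
  also have "\<dots> \<le> (?P \<sigma> - ?P 0) + (?Q pi - ?Q \<sigma>)"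
    by (intro add_mono has_integral_le[OF integrable_integral[OF integrable_continuous_real[OF cont]] 1]
        has_integral_le[OF integrable_integral[OF integrable_continuous_real[OF cont]] 2] b)
      (use assms in auto)
  also have "\<dots> \<le> pi / real n + pi / real n"
  proof (rule add_mono)
    have "0 \<le> ?P 0" using p1[of 0] assms n by (intro divide_nonneg_pos) auto
    then show "?P \<sigma> - ?P 0 \<le> pi / real n" by simp
    have "?Q pi \<le> 0" using q1[of pi] assms n by (intro divide_nonpos_pos) auto
    then show "?Q pi - ?Q \<sigma> \<le> pi / real n" by simp
  qed
  also have "\<dots> \<le> 7 / real n"
    using pi_less_4 pi_approx n by (simp add: field_simps)
  finally show ?thesis .
qed

text \<open>By Fubini the integration over the centre falls on \<open>loc\<close> alone: averaging a
  localised bound over its centre gives up the localisation and gains \<open>1 / n\<close>.\<close>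

lemma integral_loc_swap_le:
  fixes h :: "real \<Rightarrow> real"
  assumes "n \<ge> 1" "a \<ge> 2" "continuous_on {0..pi} h" "\<And>s. s \<in> {0..pi} \<Longrightarrow> 0 \<le> h s"
  shows "integral {0..pi} (\<lambda>\<sigma>. integral {0..pi} (\<lambda>s. h s * loc a n \<sigma> s)) \<le> 7 / real n * integral {0..pi} h"
proof -
  have c: "continuous_on (cbox (0,0) (pi,pi)) (\<lambda>(\<sigma>, s). h s * loc a n \<sigma> s)"
    unfolding case_prod_unfold
    by (intro continuous_on_mult continuous_on_loc continuous_on_fst continuous_on_snd continuous_on_id continuous_on_compose2[OF assms(3)]) (auto simp: cbox_Pair_eq)
  have "integral {0..pi} (\<lambda>\<sigma>. integral {0..pi} (\<lambda>s. h s * loc a n \<sigma> s))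
     = integral {0..pi} (\<lambda>s. integral {0..pi} (\<lambda>\<sigma>. h s * loc a n \<sigma> s))"
    using integral_swap_continuous[OF c] by (simp add: box_real)
  also have "\<dots> = integral {0..pi} (\<lambda>s. h s * integral {0..pi} (\<lambda>\<sigma>. loc a n \<sigma> s))"
    by simp
  also have "\<dots> \<le> integral {0..pi} (\<lambda>s. h s * (7 / real n))"
  proof (rule integral_le)
    have "continuous_on {0..pi} (\<lambda>s. integral (cbox 0 pi) (\<lambda>\<sigma>. loc a n \<sigma> s))"
      by (rule integral_continuous_on_param) (auto simp: case_prod_unfold intro!: continuous_intros)
    then show "(\<lambda>s. h s * integral {0..pi} (\<lambda>\<sigma>. loc a n \<sigma> s)) integrable_on {0..pi}"
      by (intro integrable_continuous_real continuous_on_mult assms(3)) (simp add: box_real)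
    show "(\<lambda>s. h s * (7 / real n)) integrable_on {0..pi}"
      by (intro integrable_continuous_real continuous_on_mult continuous_on_const assms(3))
    fix s assume s: "s \<in> {0..pi}"
    show "h s * integral {0..pi} (\<lambda>\<sigma>. loc a n \<sigma> s) \<le> h s * (7 / real n)"
      using integral_loc_le[OF assms(1,2) s] assms(4)[OF s]
      by (intro mult_left_mono) (auto simp: loc_commute[of a n _ s])
  qed
  finally show ?thesis by (simp add: mult.commute)
qed

text \<open>
  This replaces Hoelder's inequality, which is not available for \<open>p < 1\<close>: a pointwise bound of \<open>h\<close> by its own
  integral lets one pay for \<open>h\<close> with \<open>h powr p\<close>.
\<close>

lemma integral_powr_trick:
  fixes h :: "real \<Rightarrow> real"
  assumes "continuous_on {a..b} h" "\<And>x. x \<in> {a..b} \<Longrightarrow> 0 \<le> h x"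
    "\<And>x. x \<in> {a..b} \<Longrightarrow> h x \<le> K * integral {a..b} h" "0 < K" "0 < p" "p < 1"
  shows "integral {a..b} h powr p \<le> K powr (1 - p) * integral {a..b} (\<lambda>x. h x powr p)"
proof (cases "integral {a..b} h = 0")
  case True
  have "0 \<le> integral {a..b} (\<lambda>x. h x powr p)"
    by (rule Henstock_Kurzweil_Integration.integral_nonneg)
      (use assms in \<open>auto intro!: integrable_continuous_real continuous_on_powr_pos\<close>)
  then show ?thesis using True by simp
next
  case False
  define I where "I = integral {a..b} h"
  have I: "I > 0"
    using False Henstock_Kurzweil_Integration.integral_nonneg[of h "{a..b}"] assms(1,2)
    unfolding I_def by (auto intro!: integrable_continuous_real simp: less_le)
  have "I \<le> integral {a..b} (\<lambda>x. (K * I) powr (1 - p) * h x powr p)"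
    unfolding I_def[symmetric]
  proof (subst I_def, rule integral_le)
    show "h integrable_on {a..b}" using assms(1) by (rule integrable_continuous_real)
    show "(\<lambda>x. (K * I) powr (1 - p) * h x powr p) integrable_on {a..b}"
      using assms by (auto intro!: integrable_continuous_real continuous_on_mult continuous_on_const continuous_on_powr_pos)
    fix x assume x: "x \<in> {a..b}"
    have "h x = h x powr (1 - p) * h x powr p"
      using assms(2)[OF x] by (cases "h x = 0") (auto simp: powr_add[symmetric])
    also have "\<dots> \<le> (K * I) powr (1 - p) * h x powr p"
      using assms(2,3)[OF x] assms(6) I_def by (intro mult_right_mono powr_mono2) auto
    finally show "h x \<le> (K * I) powr (1 - p) * h x powr p" .
  qed
  also have "\<dots> = K powr (1 - p) * I powr (1 - p) * integral {a..b} (\<lambda>x. h x powr p)"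
    using I assms(4) by (simp add: powr_mult)
  finally have "I * I powr (p - 1) \<le> K powr (1 - p) * I powr (1 - p) * integral {a..b} (\<lambda>x. h x powr p) * I powr (p - 1)"
    by (rule mult_right_mono) simp
  moreover have "I * I powr (p - 1) = I powr p"
    using I powr_add[of I 1 "p - 1"] by simp
  moreover have "K powr (1 - p) * I powr (1 - p) * integral {a..b} (\<lambda>x. h x powr p) * I powr (p - 1)
     = K powr (1 - p) * integral {a..b} (\<lambda>x. h x powr p) * (I powr (1 - p) * I powr (p - 1))"
    by simp
  moreover have "I powr (1 - p) * I powr (p - 1) = 1"
    using I powr_add[of I "1 - p" "p - 1"] by simp
  ultimately have "I powr p \<le> K powr (1 - p) * integral {a..b} (\<lambda>x. h x powr p)"
    by (metis mult.right_neutral)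
  then show ?thesis by (simp add: I_def)
qed

lemma rtrig_mult: "rtrig n G \<Longrightarrow> rtrig m K \<Longrightarrow> rtrig (n + m) (\<lambda>t. G t * K t)"
  unfolding rtrig_def using trigp_mult[of n _ m] by fastforce

lemma rtrig_mono: "rtrig n G \<Longrightarrow> n \<le> m \<Longrightarrow> rtrig m G"
  unfolding rtrig_def by (rule trigp_mono)

lemma rtrig_sin_power: "rtrig k (\<lambda>t. sin t ^ k)"
  using trigp_power[OF trigp_sin1, of k] by (simp add: rtrig_def)

lemma rtrig_poly_cos: "degree P \<le> n \<Longrightarrow> rtrig n (\<lambda>t. poly P (cos t))"
  unfolding rtrig_def by (rule trigp_poly_cos)

lemma rtrig_shift: "rtrig n G \<Longrightarrow> rtrig n (\<lambda>t. G (t - a))"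
  unfolding rtrig_def by (rule trigp_shift)

lemma rtrig_continuous: "rtrig n G \<Longrightarrow> continuous_on S G"
  unfolding rtrig_def using trigp_continuous[of n "\<lambda>t. of_real (G t)" S] continuous_on_Re by fastforce

lemma rtrig_deriv:
  assumes "rtrig n G"
  shows "\<exists>D. (G has_real_derivative D) (at t) \<and>
    \<bar>D\<bar> \<le> real n * real (2 * n + 1) * (integral {-pi..pi} (\<lambda>s. \<bar>G s\<bar>) / (2 * pi))"
proof -
  obtain D where D: "((\<lambda>t. complex_of_real (G t)) has_vector_derivative D) (at t)"
    "norm D \<le> real n * real (2 * n + 1) * (integral {-pi..pi} (\<lambda>s. norm (complex_of_real (G s))) / (2 * pi))"
    using trigp_deriv_bound assms unfolding rtrig_def by blast
  have "((\<lambda>t. Re (complex_of_real (G t))) has_vector_derivative Re D) (at t)"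
    using bounded_linear.has_vector_derivative[OF bounded_linear_Re D(1)] .
  then have "(G has_real_derivative Re D) (at t)"
    by (simp add: has_real_derivative_iff_has_vector_derivative)
  moreover have "\<bar>Re D\<bar> \<le> norm D" by (rule abs_Re_le_cmod)
  ultimately show ?thesis using D(2) by (intro exI[of _ "Re D"]) auto
qed

lemma rtrig_sup:
  assumes "rtrig n G"
  shows "\<bar>G t\<bar> \<le> real (2 * n + 1) * (integral {-pi..pi} (\<lambda>s. \<bar>G s\<bar>) / (2 * pi))"
  using trigp_sup_bound[OF assms[unfolded rtrig_def], of t] by simp

lemma rtrig_fejer_power: "rtrig (M * (m - 1)) (\<lambda>t. fejer m t ^ M)"
  using trigp_fejer_power unfolding rtrig_def by simp

lemma wt_nonneg: "s \<in> {0..pi} \<Longrightarrow> 0 \<le> wt n s"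
  using sin_ge_zero[of s] by (auto simp: wt_def)

lemma fejer_powr_le:
  assumes "n \<ge> 1" "0 < p" "a \<le> 2 * real M * p"
  shows "(fejer n t ^ M) powr p \<le> 2 powr (2 * real M * p) * (1 + real n * \<bar>sin (t / 2)\<bar>) powr (- a)"
proof -
  let ?u = "1 + real n * \<bar>sin (t / 2)\<bar>"
  have u: "?u \<ge> 1" by simp
  have "(fejer n t ^ M) powr p \<le> (((2 / ?u)\<^sup>2) ^ M) powr p"
    using fejer_le[OF assms(1), of t] fejer_nonneg[of n t] assms(2) by (intro powr_mono2 power_mono) auto
  also have "((2 / ?u)\<^sup>2) ^ M = (2 / ?u) powr (2 * real M)"
  proof -
    have "0 < 2 / ?u" using u by (intro divide_pos_pos) linarith+
    from powr_realpow[OF this, of "2 * M"] show ?thesis by (simp add: power_mult)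
  qed
  also have "((2 / ?u) powr (2 * real M)) powr p = 2 powr (2 * real M * p) * ?u powr (- (2 * real M * p))"
    using u by (simp add: powr_powr powr_divide powr_minus_divide)
  also have "\<dots> \<le> 2 powr (2 * real M * p) * ?u powr (- a)"
    using assms u by (intro mult_left_mono powr_mono) auto
  finally show ?thesis .
qed

lemma integral_even_le:
  fixes f g :: "real \<Rightarrow> real"
  assumes "continuous_on {-pi..pi} f" "continuous_on {0..pi} g"
    "\<And>s. s \<in> {0..pi} \<Longrightarrow> f s \<le> g s" "\<And>s. s \<in> {0..pi} \<Longrightarrow> f (- s) \<le> g s"
  shows "integral {-pi..pi} f \<le> 2 * integral {0..pi} g"
proof -
  have "integral {-pi..pi} f = integral {-pi..0} f + integral {0..pi} f"
    by (rule Henstock_Kurzweil_Integration.integral_combine[symmetric])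
      (use assms in \<open>auto intro!: integrable_continuous_real\<close>)
  also have "integral {-pi..0} f = integral {0..pi} (\<lambda>s. f (- s))"
    using Henstock_Kurzweil_Integration.integral_reflect_real[of pi 0 "\<lambda>s. f (- s)"] by simp
  also have "\<dots> \<le> integral {0..pi} g"
    by (intro integral_le integrable_continuous_real assms(2,4) continuous_on_compose2[OF assms(1)] continuous_intros) auto
  also have "integral {0..pi} f \<le> integral {0..pi} g"
    by (intro integral_le integrable_continuous_real assms(2,3) continuous_on_subset[OF assms(1)]) auto
  finally show ?thesis by simp
qed

text \<open>
  Multiplying \<open>G\<close> by a power of the Fejer kernel centred at \<open>\<sigma>\<close> does not change the value at \<open>\<sigma>\<close> (nor the
  derivative, since the kernel is maximal there) and localises the integral, at the cost of a fixed multiple of the degree.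
\<close>

lemma local_nikolskii_aux:
  fixes p a :: real
  assumes p: "0 < p" "p < 1" and a: "0 \<le> a" and M: "a \<le> 2 * real M * p" and n: "n \<ge> 1"
    and G: "rtrig n G" and ev: "\<And>s. \<bar>G (- s)\<bar> = \<bar>G s\<bar>" and \<sigma>: "\<sigma> \<in> {0..pi}"
  defines "X \<equiv> 2 * (2 powr (2 * real M * p) * integral {0..pi} (\<lambda>s. \<bar>G s\<bar> powr p * loc a n \<sigma> s))"
    and "D \<equiv> (M + 1) * n"
  shows "\<bar>G \<sigma>\<bar> powr p \<le> real D * X"
    and "\<exists>E. (G has_real_derivative E) (at \<sigma>) \<and> \<bar>E\<bar> powr p \<le> real D powr (p + 1) * X"
proof -
  define H where "H = (\<lambda>s. G s * fejer n (s - \<sigma>) ^ M)"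
  have H: "rtrig D H"
  proof -
    have "rtrig (n + M * (n - 1)) H"
      unfolding H_def by (intro rtrig_mult G rtrig_shift[OF rtrig_fejer_power])
    moreover have "M * (n - 1) \<le> M * n" by (intro mult_le_mono2) simp
    then have "n + M * (n - 1) \<le> D" unfolding D_def by simp
    ultimately show ?thesis by (rule rtrig_mono)
  qed
  have D: "D \<ge> 1" using n unfolding D_def by (simp add: Suc_le_eq)
  define I where "I = integral {-pi..pi} (\<lambda>s. \<bar>H s\<bar>)"
  have contH: "continuous_on S H" for S by (rule rtrig_continuous[OF H])
  have I: "I \<ge> 0" unfolding I_def
    by (rule Henstock_Kurzweil_Integration.integral_nonneg) (use contH in \<open>auto intro!: integrable_continuous_real continuous_intros\<close>)
  \<comment> \<open>The numerical constants disappear in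
    \<open>2 * D + 1 \<le> 3 * D \<le> 2 * pi * D\<close>; what remains is the pointwise bound with
    \<open>K = D\<close> that \<open>integral_powr_trick\<close> asks for.\<close>
  have q: "real (2 * D + 1) * (I / (2 * pi)) \<le> real D * I"
  proof -
    have "real (2 * D + 1) \<le> 3 * real D" using D by simp
    also have "\<dots> \<le> (2 * pi) * real D" using pi_gt3 D by (intro mult_right_mono) auto
    finally have "real (2 * D + 1) / (2 * pi) \<le> real D" by (simp add: field_simps)
    then show ?thesis using mult_right_mono[OF _ I] by fastforce
  qed
  have sup: "\<bar>H t\<bar> \<le> real D * I" for t
    using rtrig_sup[OF H, of t] q unfolding I_def by linarith
  let ?X = "integral {-pi..pi} (\<lambda>s. \<bar>H s\<bar> powr p)"
  have tr: "I powr p \<le> real D powr (1 - p) * ?X"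
    unfolding I_def
    by (rule integral_powr_trick) (use sup p D in \<open>auto intro!: continuous_intros contH simp: I_def\<close>)
  have X: "?X \<le> X"
  proof -
    \<comment> \<open>Used with \<open>t = s\<close> and with \<open>t = - s\<close>; in the second
      case the condition on \<open>sdist\<close> is \<open>sdist_fold\<close>.\<close>
    have b: "\<bar>H t\<bar> powr p \<le> 2 powr (2 * real M * p) * (\<bar>G s\<bar> powr p * loc a n \<sigma> s)"
      if "\<bar>G t\<bar> = \<bar>G s\<bar>" "sdist \<sigma> s \<le> sdist \<sigma> t" for s t
    proof -
      have "\<bar>H t\<bar> powr p = \<bar>G t\<bar> powr p * (fejer n (t - \<sigma>) ^ M) powr p"
        unfolding H_def abs_mult using fejer_nonneg by (simp add: powr_mult)
      also have "\<dots> \<le> \<bar>G t\<bar> powr p * (2 powr (2 * real M * p) * (1 + real n * \<bar>sin ((t - \<sigma>) / 2)\<bar>) powr (- a))"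
        by (intro mult_left_mono fejer_powr_le n p M) auto
      also have "(1 + real n * \<bar>sin ((t - \<sigma>) / 2)\<bar>) powr (- a) = loc a n \<sigma> t"
        using loc_commute[of a n \<sigma> t] unfolding loc_def sdist_def by simp
      also have "\<bar>G t\<bar> powr p * (2 powr (2 * real M * p) * loc a n \<sigma> t)
         \<le> \<bar>G t\<bar> powr p * (2 powr (2 * real M * p) * loc a n \<sigma> s)"
        unfolding loc_def using that(2) a one_plus_sdist_ge1[of n \<sigma> s]
        by (intro mult_left_mono powr_mono2' add_left_mono) auto
      finally show ?thesis using that(1) by (simp add: mult_ac)
    qed
    have cg: "continuous_on S G" for S by (rule rtrig_continuous[OF G])
    have "?X \<le> 2 * integral {0..pi} (\<lambda>s. 2 powr (2 * real M * p) * (\<bar>G s\<bar> powr p * loc a n \<sigma> s))"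
      by (rule integral_even_le)
        (auto intro!: b continuous_on_abs_powr contH p continuous_on_mult continuous_on_const continuous_on_loc
          continuous_on_id cg simp: ev sdist_fold[OF \<sigma>])
    then show ?thesis by (simp add: X_def)
  qed
  have Hs: "H \<sigma> = G \<sigma>" unfolding H_def using fejer_0[OF n] by simp
  have "\<bar>G \<sigma>\<bar> powr p \<le> (real D * I) powr p"
    using sup[of \<sigma>] Hs p by (intro powr_mono2) auto
  also have "\<dots> = real D powr p * I powr p" using I by (simp add: powr_mult)
  also have "\<dots> \<le> real D powr p * (real D powr (1 - p) * X)"
    using tr X by (intro mult_left_mono) (auto intro: order_trans[OF _ mult_left_mono])
  also have "\<dots> = real D * X" using D by (simp add: powr_add[symmetric] mult.assoc[symmetric])
  finally show "\<bar>G \<sigma>\<bar> powr p \<le> real D * X" .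
  obtain E where E: "(H has_real_derivative E) (at \<sigma>)"
    "\<bar>E\<bar> \<le> real D * real (2 * D + 1) * (integral {-pi..pi} (\<lambda>s. \<bar>H s\<bar>) / (2 * pi))"
    using rtrig_deriv[OF H, of \<sigma>] by blast
  obtain E1 where E1: "(G has_real_derivative E1) (at \<sigma>)"
    using rtrig_deriv[OF G, of \<sigma>] by blast
  obtain E2 where E2: "((\<lambda>s. fejer n (s - \<sigma>) ^ M) has_real_derivative E2) (at \<sigma>)"
    using rtrig_deriv[OF rtrig_shift[OF rtrig_fejer_power], of n \<sigma> M \<sigma>] by blast
  have "E2 = 0"
    using E2 by (rule DERIV_local_max[where d = 1])
      (use fejer_0[OF n] fejer_le_1[OF n] fejer_nonneg in \<open>auto intro!: power_le_one\<close>)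
  then have "(H has_real_derivative E1) (at \<sigma>)"
    unfolding H_def using DERIV_mult[OF E1 E2] fejer_0[OF n] by simp
  then have "E = E1" using E(1) DERIV_unique by blast
  have "\<bar>E\<bar> \<le> real D * (real D * I)"
    using E(2) mult_left_mono[OF q, of "real D"] unfolding I_def by (simp add: mult.assoc)
  then have "\<bar>E\<bar> powr p \<le> (real D * (real D * I)) powr p"
    using p by (intro powr_mono2) auto
  also have "\<dots> = real D powr p * (real D powr p * I powr p)" using I by (simp add: powr_mult)
  also have "\<dots> \<le> real D powr p * (real D powr p * (real D powr (1 - p) * X))"
    using tr X by (intro mult_left_mono) (auto intro: order_trans[OF _ mult_left_mono])
  also have "\<dots> = real D powr (p + 1) * X"
    using D by (simp add: powr_add mult_ac) (simp add: powr_add[symmetric] mult.assoc[symmetric])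
  finally show "\<exists>E. (G has_real_derivative E) (at \<sigma>) \<and> \<bar>E\<bar> powr p \<le> real D powr (p + 1) * X"
    using E1 \<open>E = E1\<close> by blast
qed

text \<open>Brings the weight \<open>wt n\<close> into the local estimates. Value and derivative are
  controlled by the same localised average, the derivative with the additional factor
  \<open>real n powr p\<close>.\<close>

lemma local_nikolskii:
  fixes p a :: real
  assumes p: "0 < p" "p < 1" and a: "0 \<le> a"
  shows "\<exists>C>0. \<forall>n\<ge>1. \<forall>G. rtrig n G \<longrightarrow> (\<forall>s. \<bar>G (- s)\<bar> = \<bar>G s\<bar>) \<longrightarrow> (\<forall>\<sigma>\<in>{0..pi}.
    \<bar>G \<sigma>\<bar> powr p * wt n \<sigma> \<le> C * real n * integral {0..pi} (\<lambda>s. \<bar>G s\<bar> powr p * wt n s * loc a n \<sigma> s) \<and>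
    (\<exists>E. (G has_real_derivative E) (at \<sigma>) \<and>
      \<bar>E\<bar> powr p * wt n \<sigma> \<le> C * real n powr (p + 1) * integral {0..pi} (\<lambda>s. \<bar>G s\<bar> powr p * wt n s * loc a n \<sigma> s)))"
proof -
  \<comment> \<open>\<open>wt_compare\<close> moves the weight from \<open>\<sigma>\<close> to
    \<open>s\<close> at the cost of one factor \<open>1 + n * sdist \<sigma> s\<close>, hence one
    more power of decay. \<open>M\<close> is chosen so that the \<open>p\<close>-th power of the
    kernel decays that fast.\<close>
  define b where "b = a + 1"
  define M where "M = nat \<lceil>b / (2 * p)\<rceil>"
  have "b / (2 * p) \<le> real M" unfolding M_def by linarith
  then have M: "b \<le> 2 * real M * p" using p by (simp add: field_simps)
  define c where "c = 4 * 2 powr (2 * real M * p)"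
  define C where "C = real (M + 1) powr (p + 1) * c"
  have c: "c > 0" unfolding c_def by simp
  have C: "C > 0" unfolding C_def c_def by (intro mult_pos_pos) auto
  have C1: "real (M + 1) * c \<le> C"
    unfolding C_def using p powr_mono[of 1 "p + 1" "real (M + 1)"] c by (intro mult_right_mono) auto
  show ?thesis
  proof (rule exI[of _ C], intro conjI C allI impI ballI)
    fix n :: nat and G and \<sigma> assume n: "1 \<le> n" and G: "rtrig n G" "\<forall>s. \<bar>G (- s)\<bar> = \<bar>G s\<bar>"
      and \<sigma>: "\<sigma> \<in> {0..pi}"
    let ?X = "2 * (2 powr (2 * real M * p) * integral {0..pi} (\<lambda>s. \<bar>G s\<bar> powr p * loc b n \<sigma> s))"
    let ?Y = "integral {0..pi} (\<lambda>s. \<bar>G s\<bar> powr p * wt n s * loc a n \<sigma> s)"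
    have cg: "continuous_on S G" for S by (rule rtrig_continuous[OF G(1)])
    have "integral {0..pi} (\<lambda>s. (\<bar>G s\<bar> powr p * loc b n \<sigma> s) * wt n \<sigma>)
      \<le> integral {0..pi} (\<lambda>s. 2 * (\<bar>G s\<bar> powr p * wt n s * loc a n \<sigma> s))"
    proof (rule integral_le)
      fix s assume s: "s \<in> {0..pi}"
      have e: "loc b n \<sigma> s * (1 + real n * sdist \<sigma> s) = loc a n \<sigma> s"
        unfolding loc_def b_def using one_plus_sdist_ge1[of n \<sigma> s]
        powr_add[of "1 + real n * sdist \<sigma> s" "- (a + 1)" 1] by simp
      have "(\<bar>G s\<bar> powr p * loc b n \<sigma> s) * wt n \<sigma> \<le> (\<bar>G s\<bar> powr p * loc b n \<sigma> s) * (2 * wt n s * (1 + real n * sdist \<sigma> s))"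
        by (intro mult_left_mono wt_compare n s) (auto simp: loc_nonneg)
      also have "\<dots> = 2 * (\<bar>G s\<bar> powr p * wt n s * (loc b n \<sigma> s * (1 + real n * sdist \<sigma> s)))"
        by (simp add: mult_ac)
      finally show "(\<bar>G s\<bar> powr p * loc b n \<sigma> s) * wt n \<sigma> \<le> 2 * (\<bar>G s\<bar> powr p * wt n s * loc a n \<sigma> s)"
        unfolding e .
    qed (auto intro!: integrable_continuous_real continuous_on_abs_powr cg p continuous_on_mult
        continuous_on_const continuous_on_loc continuous_on_id continuous_on_wt)
    then have 1: "?X * wt n \<sigma> \<le> c * ?Y" unfolding c_def by (simp add: mult_ac)
    have w: "wt n \<sigma> \<ge> 0" using wt_ge(3)[OF n \<sigma>] by simp
    have Y: "?Y \<ge> 0"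
      by (rule Henstock_Kurzweil_Integration.integral_nonneg)
        (use wt_nonneg loc_nonneg in \<open>auto intro!: integrable_continuous_real continuous_on_abs_powr cg p continuous_on_mult
        continuous_on_const continuous_on_loc continuous_on_id continuous_on_wt mult_nonneg_nonneg\<close>)
    have D: "real ((M + 1) * n) = real (M + 1) * real n" by (rule of_nat_mult)
    note aux = local_nikolskii_aux[OF p _ M n G(1) _ \<sigma>]
    have "\<bar>G \<sigma>\<bar> powr p * wt n \<sigma> \<le> (real ((M + 1) * n) * ?X) * wt n \<sigma>"
      using aux(1) G(2) w a b_def by (intro mult_right_mono) auto
    also have "\<dots> \<le> real ((M + 1) * n) * (c * ?Y)"
      using mult_left_mono[OF 1, of "real ((M + 1) * n)"] by (simp add: mult.assoc)
    also have "\<dots> = (real (M + 1) * c) * (real n * ?Y)" unfolding D by (simp add: mult_ac)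
    also have "\<dots> \<le> C * (real n * ?Y)" using C1 Y by (intro mult_right_mono) auto
    finally show "\<bar>G \<sigma>\<bar> powr p * wt n \<sigma> \<le> C * real n * ?Y" by (simp add: mult_ac)
    obtain E where E: "(G has_real_derivative E) (at \<sigma>)" "\<bar>E\<bar> powr p \<le> real ((M + 1) * n) powr (p + 1) * ?X"
      using aux(2) G(2) a b_def by auto
    have "\<bar>E\<bar> powr p * wt n \<sigma> \<le> (real ((M + 1) * n) powr (p + 1) * ?X) * wt n \<sigma>"
      using E(2) w by (intro mult_right_mono) auto
    also have "\<dots> \<le> real ((M + 1) * n) powr (p + 1) * (c * ?Y)"
      using mult_left_mono[OF 1, of "real ((M + 1) * n) powr (p + 1)"] by (simp add: mult.assoc)
    also have "real ((M + 1) * n) powr (p + 1) = real (M + 1) powr (p + 1) * real n powr (p + 1)"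
      unfolding D by (simp add: powr_mult)
    finally show "\<exists>E. (G has_real_derivative E) (at \<sigma>) \<and> \<bar>E\<bar> powr p * wt n \<sigma> \<le> C * real n powr (p + 1) * ?Y"
      using E(1) unfolding C_def by (auto simp: mult_ac)
  qed
qed

section \<open>Bernstein and Nikolskii inequalities\<close>

text \<open>
  Only the absolute value is required to be even, because \<open>sin s ^ k\<close> has the parity of \<open>k\<close>.
  Under \<open>x = cos s\<close> the integral of \<open>\<bar>F x\<bar> powr p\<close> over \<open>[-1,1]\<close> becomes \<open>sint\<close>; \<open>wint\<close> replaces its degenerate
  weight by the doubling weight \<open>wt n\<close>, which costs only a constant for polynomials of degree \<open>n\<close>.
\<close>

definition etrig :: "nat \<Rightarrow> (real \<Rightarrow> real) \<Rightarrow> bool" where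
  "etrig n G \<longleftrightarrow> rtrig n G \<and> (\<forall>s. \<bar>G (- s)\<bar> = \<bar>G s\<bar>)"

definition wint :: "nat \<Rightarrow> real \<Rightarrow> (real \<Rightarrow> real) \<Rightarrow> real" where
  "wint n p G = integral {0..pi} (\<lambda>s. \<bar>G s\<bar> powr p * wt n s)"

definition sint :: "real \<Rightarrow> (real \<Rightarrow> real) \<Rightarrow> real" where
  "sint p G = integral {0..pi} (\<lambda>s. \<bar>G s\<bar> powr p * sin s)"

lemma etrig_continuous: "etrig n G \<Longrightarrow> continuous_on S G"
  unfolding etrig_def using rtrig_continuous by blast

lemma etrig_sin_poly:
  assumes "P = 0 \<or> k + degree P \<le> n"
  shows "etrig n (\<lambda>s. sin s ^ k * poly P (cos s))"
proof -
  have "rtrig n (\<lambda>s. sin s ^ k * poly P (cos s))"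
  proof (cases "P = 0")
    case True
    then show ?thesis by (simp add: rtrig_def trigp_const[of n 0, simplified])
  next
    case False
    then show ?thesis
      using assms rtrig_mono[OF rtrig_mult[OF rtrig_sin_power[of k] rtrig_poly_cos[of P "degree P"]]] by auto
  qed
  then show ?thesis unfolding etrig_def by (auto simp: abs_mult power_abs)
qed

lemma integrable_powr_wt:
  assumes "continuous_on {0..pi} G" "0 < p" "0 \<le> a" "b \<le> pi"
  shows "(\<lambda>s. \<bar>G s\<bar> powr p * wt n s) integrable_on {a..b}"
  by (intro integrable_continuous_real continuous_on_mult continuous_on_abs_powr continuous_on_wt continuous_on_id
      continuous_on_subset[OF assms(1)] assms(2)) (use assms in auto)

lemma integrable_powr_sin:
  assumes "continuous_on {0..pi} G" "0 < p" "0 \<le> a" "b \<le> pi"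
  shows "(\<lambda>s. \<bar>G s\<bar> powr p * sin s) integrable_on {a..b}"
  by (intro integrable_continuous_real continuous_on_mult continuous_on_abs_powr continuous_on_sin continuous_on_id
      continuous_on_subset[OF assms(1)] assms(2)) (use assms in auto)

lemma wint_nonneg: assumes "continuous_on {0..pi} G" "0 < p" shows "0 \<le> wint n p G"
  unfolding wint_def
  by (rule Henstock_Kurzweil_Integration.integral_nonneg)
    (auto intro!: mult_nonneg_nonneg wt_nonneg integrable_powr_wt assms)

lemma sint_nonneg: assumes "continuous_on {0..pi} G" "0 < p" shows "0 \<le> sint p G"
  unfolding sint_def
  by (rule Henstock_Kurzweil_Integration.integral_nonneg)
    (auto intro!: mult_nonneg_nonneg sin_ge_zero integrable_powr_sin assms)

lemma sint_le_wint: assumes "continuous_on {0..pi} G" "0 < p" shows "sint p G \<le> wint n p G"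
  unfolding sint_def wint_def
  by (intro integral_le integrable_powr_sin integrable_powr_wt assms) (auto intro!: mult_left_mono simp: wt_def)

text \<open>With exponent 0 the factor \<open>loc\<close> is identically 1, and the local estimate
  turns into a global supremum bound.\<close>

lemma sup_bound_wint:
  fixes p :: real
  assumes p: "0 < p" "p < 1"
  shows "\<exists>C>0. \<forall>n\<ge>1. \<forall>G. etrig n G \<longrightarrow> (\<forall>\<sigma>\<in>{0..pi}.
    \<bar>G \<sigma>\<bar> powr p * wt n \<sigma> \<le> C * real n * wint n p G)"
proof -
  obtain C where C: "C > 0" "\<forall>n\<ge>1. \<forall>G. rtrig n G \<longrightarrow> (\<forall>s. \<bar>G (- s)\<bar> = \<bar>G s\<bar>) \<longrightarrow> (\<forall>\<sigma>\<in>{0..pi}.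
    \<bar>G \<sigma>\<bar> powr p * wt n \<sigma> \<le> C * real n * integral {0..pi} (\<lambda>s. \<bar>G s\<bar> powr p * wt n s * loc 0 n \<sigma> s))"
    using local_nikolskii[OF p, of 0] by auto
  have l: "loc 0 n \<sigma> s = 1" for n \<sigma> s
    using one_plus_sdist_ge1[of n \<sigma> s] by (simp add: loc_def)
  show ?thesis
    using C unfolding l wint_def etrig_def by (intro exI[of _ C]) auto
qed

lemma sin_ge_mid:
  assumes "0 \<le> d" "d \<le> s" "s \<le> pi - d" shows "2 * d / pi \<le> sin s"
proof (cases "s \<le> pi / 2")
  case True
  have "2 * d / pi \<le> 2 * s / pi" using assms by (intro divide_right_mono) auto
  also have "\<dots> \<le> sin s" by (rule sin_ge_jordan) (use assms True in auto)
  finally show ?thesis .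
next
  case False
  have "2 * d / pi \<le> 2 * (pi - s) / pi" using assms by (intro divide_right_mono) auto
  also have "\<dots> \<le> sin (pi - s)" by (rule sin_ge_jordan) (use assms False in auto)
  finally show ?thesis by simp
qed

text \<open>The supremum bound caps the weighted integrand by \<open>C * n * wint n p G\<close>. An
  end interval of length \<open>\<delta> / n\<close> therefore carries at most the share
  \<open>\<delta> * C \<le> 1 / 4\<close> of the whole, and the middle keeps at least one
  half.\<close>

lemma wint_le_middle:
  fixes p :: real
  assumes p: "0 < p" "p < 1"
  shows "\<exists>\<delta>>0. \<delta> \<le> 1 \<and> (\<forall>n\<ge>1. \<forall>G. etrig n G \<longrightarrow>
    wint n p G \<le> 2 * integral {\<delta> / real n..pi - \<delta> / real n} (\<lambda>s. \<bar>G s\<bar> powr p * wt n s))"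
proof -
  obtain C where C: "C > 0" "\<And>n G \<sigma>. n \<ge> 1 \<Longrightarrow> etrig n G \<Longrightarrow> \<sigma> \<in> {0..pi} \<Longrightarrow>
    \<bar>G \<sigma>\<bar> powr p * wt n \<sigma> \<le> C * real n * wint n p G"
    using sup_bound_wint[OF p] by blast
  define \<delta> where "\<delta> = min 1 (1 / (4 * C))"
  have d: "\<delta> > 0" "\<delta> \<le> 1" "\<delta> * C \<le> 1 / 4" unfolding \<delta>_def using C(1) by (auto simp: min_def field_simps)
  show ?thesis
  proof (intro exI[of _ \<delta>] conjI d allI impI)
    fix n :: nat and G assume n: "1 \<le> n" and G: "etrig n G"
    let ?f = "\<lambda>s. \<bar>G s\<bar> powr p * wt n s"
    let ?d = "\<delta> / real n"
    have dn: "0 \<le> ?d" "?d \<le> 1" using d n by (auto simp: field_simps)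
    note cg = etrig_continuous[OF G, of "{0..pi}"]
    have int: "?f integrable_on {a..b}" if "0 \<le> a" "b \<le> pi" for a b
      by (rule integrable_powr_wt) (use that p cg in auto)
    have end_le: "integral {a..b} ?f \<le> wint n p G / 4" if "0 \<le> a" "b \<le> pi" "b - a = ?d" for a b
    proof -
      have "integral {a..b} ?f \<le> integral {a..b} (\<lambda>s. C * real n * wint n p G)"
        by (rule integral_le) (use that int C(2)[OF n G] in auto)
      also have "\<dots> = ?d * (C * real n * wint n p G)" using that dn by simp
      also have "\<dots> = (\<delta> * C) * wint n p G" using n by simp
      also have "\<dots> \<le> 1 / 4 * wint n p G"
        by (intro mult_right_mono d(3) wint_nonneg cg p)
      finally show ?thesis by simp
    qed
    have le: "?d \<le> pi - ?d" using dn pi_gt3 by linarith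
    have "wint n p G = integral {0..?d} ?f + (integral {?d..pi - ?d} ?f + integral {pi - ?d..pi} ?f)"
      unfolding wint_def
      by (subst Henstock_Kurzweil_Integration.integral_combine, (use le dn in simp), (use le dn in simp), rule int, (use dn in simp), simp,
          subst Henstock_Kurzweil_Integration.integral_combine, (use le dn in simp), (use le dn in simp), rule int) auto
    moreover have "integral {0..?d} ?f \<le> wint n p G / 4" by (rule end_le) (use le dn in auto)
    moreover have "integral {pi - ?d..pi} ?f \<le> wint n p G / 4" by (rule end_le) (use le dn in auto)
    ultimately show "wint n p G \<le> 2 * integral {?d..pi - ?d} ?f" by linarith
  qed
qed

lemma wint_le_compare:
  fixes p :: real
  assumes p: "0 < p" "p < 1" and "\<delta> > 0" "\<delta> \<le> 1" "n \<ge> 1" "etrig n H" "continuous_on {0..pi} G" "K \<ge> 0"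
    and mid: "wint n p H \<le> 2 * integral {\<delta> / real n..pi - \<delta> / real n} (\<lambda>s. \<bar>H s\<bar> powr p * wt n s)"
    and le: "\<And>s. s \<in> {\<delta> / real n..pi - \<delta> / real n} \<Longrightarrow> \<bar>H s\<bar> powr p * wt n s \<le> K * (\<bar>G s\<bar> powr p * sin s)"
  shows "wint n p H \<le> 2 * K * sint p G"
proof -
  let ?d = "\<delta> / real n"
  have dn: "0 \<le> ?d" using assms by simp
  note cH = etrig_continuous[OF assms(6), of "{0..pi}"]
  have "integral {?d..pi - ?d} (\<lambda>s. \<bar>H s\<bar> powr p * wt n s) \<le> integral {?d..pi - ?d} (\<lambda>s. K * (\<bar>G s\<bar> powr p * sin s))"
    by (intro integral_le integrable_powr_wt cH integrable_on_mult_right integrable_powr_sin assms le) (use dn in auto)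
  also have "\<dots> \<le> integral {0..pi} (\<lambda>s. K * (\<bar>G s\<bar> powr p * sin s))"
    by (intro integral_subset_le integrable_on_mult_right integrable_powr_sin assms)
      (use dn \<open>K \<ge> 0\<close> in \<open>auto intro!: mult_nonneg_nonneg sin_ge_zero\<close>)
  also have "\<dots> = K * sint p G" by (simp add: sint_def)
  finally show ?thesis using mid by simp
qed

text \<open>The way back from the doubling weight: on the middle part \<open>sin s\<close> is at
  least a constant times \<open>1 / n\<close> and so dominates \<open>wt n s\<close>, while the rest
  has been discarded by \<open>wint_le_middle\<close>.\<close>

lemma wint_le_sint:
  fixes p :: real
  assumes p: "0 < p" "p < 1"
  shows "\<exists>C>0. \<forall>n\<ge>1. \<forall>G. etrig n G \<longrightarrow> wint n p G \<le> C * sint p G"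
proof -
  obtain \<delta> where d: "\<delta> > 0" "\<delta> \<le> 1" and m: "\<And>n G. n \<ge> 1 \<Longrightarrow> etrig n G \<Longrightarrow>
    wint n p G \<le> 2 * integral {\<delta> / real n..pi - \<delta> / real n} (\<lambda>s. \<bar>G s\<bar> powr p * wt n s)"
    using wint_le_middle[OF p] by blast
  define K where "K = 1 + pi / (2 * \<delta>)"
  have K: "K > 0" unfolding K_def using d by (intro add_pos_pos) auto
  show ?thesis
  proof (intro exI[of _ "2 * K"] conjI allI impI)
    fix n :: nat and G assume n: "1 \<le> n" and G: "etrig n G"
    show "wint n p G \<le> 2 * K * sint p G"
    proof (rule wint_le_compare[OF p d n G etrig_continuous[OF G] _ m[OF n G]])
      fix s assume s: "s \<in> {\<delta> / real n..pi - \<delta> / real n}"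
      have "2 * (\<delta> / real n) / pi \<le> sin s" by (rule sin_ge_mid) (use s d in auto)
      then have "1 / real n \<le> pi / (2 * \<delta>) * sin s" using d n by (simp add: field_simps)
      then have "wt n s \<le> K * sin s" by (simp add: wt_def K_def algebra_simps)
      then have "\<bar>G s\<bar> powr p * wt n s \<le> \<bar>G s\<bar> powr p * (K * sin s)" by (intro mult_left_mono) auto
      then show "\<bar>G s\<bar> powr p * wt n s \<le> K * (\<bar>G s\<bar> powr p * sin s)" by (simp add: mult_ac)
    qed (use K in auto)
  qed (use K in auto)
qed

text \<open>On the middle part \<open>n * sin s\<close> is bounded below, so a division by
  \<open>sin s\<close> costs \<open>real n powr p\<close>. This serves the term of Bernstein's
  inequality in which differentiation has consumed one factor \<open>sin\<close>.\<close>

lemma wint_div_sin_le: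
  fixes p :: real
  assumes p: "0 < p" "p < 1"
  shows "\<exists>C>0. \<forall>n\<ge>1. \<forall>H. etrig n H \<longrightarrow> wint n p H \<le> C * real n powr p * sint p (\<lambda>s. sin s * H s)"
proof -
  obtain \<delta> where d: "\<delta> > 0" "\<delta> \<le> 1" and m: "\<And>n G. n \<ge> 1 \<Longrightarrow> etrig n G \<Longrightarrow>
    wint n p G \<le> 2 * integral {\<delta> / real n..pi - \<delta> / real n} (\<lambda>s. \<bar>G s\<bar> powr p * wt n s)"
    using wint_le_middle[OF p] by blast
  define K where "K = 1 + pi / (2 * \<delta>)"
  have K: "K > 0" unfolding K_def using d by (intro add_pos_pos) auto
  define L where "L = (pi / (2 * \<delta>)) powr p * K"
  have L: "L > 0" unfolding L_def using K d by simp
  show ?thesis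
  proof (intro exI[of _ "2 * L"] conjI allI impI)
    fix n :: nat and G assume n: "1 \<le> n" and G: "etrig n G"
    have "wint n p G \<le> 2 * (L * real n powr p) * sint p (\<lambda>s. sin s * G s)"
    proof (rule wint_le_compare[OF p d n G _ _ m[OF n G]])
      show "continuous_on {0..pi} (\<lambda>s. sin s * G s)" by (intro continuous_intros etrig_continuous[OF G])
      fix s assume s: "s \<in> {\<delta> / real n..pi - \<delta> / real n}"
      have g: "2 * (\<delta> / real n) / pi \<le> sin s" by (rule sin_ge_mid) (use s d in auto)
      have "0 < 2 * (\<delta> / real n) / pi" using d n by simp
      then have sp: "sin s > 0" using g by linarith
      have 1: "1 / real n \<le> pi / (2 * \<delta>) * sin s" using d n g by (simp add: field_simps)
      then have w: "wt n s \<le> K * sin s" by (simp add: wt_def K_def algebra_simps)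
      have "1 \<le> pi / (2 * \<delta>) * real n * sin s" using 1 n by (simp add: field_simps)
      then have "\<bar>G s\<bar> * 1 \<le> \<bar>G s\<bar> * (pi / (2 * \<delta>) * real n * sin s)" by (intro mult_left_mono) auto
      also have "\<dots> = pi / (2 * \<delta>) * real n * \<bar>sin s * G s\<bar>" using sp by (simp add: abs_mult mult_ac)
      finally have "\<bar>G s\<bar> powr p \<le> (pi / (2 * \<delta>) * real n * \<bar>sin s * G s\<bar>) powr p"
        using p by (intro powr_mono2) auto
      also have "\<dots> = (pi / (2 * \<delta>)) powr p * real n powr p * \<bar>sin s * G s\<bar> powr p"
        using d by (simp only: powr_mult)
      finally have "\<bar>G s\<bar> powr p * wt n s \<le> ((pi / (2 * \<delta>)) powr p * real n powr p * \<bar>sin s * G s\<bar> powr p) * (K * sin s)"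
      proof (intro mult_mono w wt_nonneg)
        have "0 \<le> \<delta> / real n" using d by simp
        then show "s \<in> {0..pi}" using s by auto
      qed auto
      then show "\<bar>G s\<bar> powr p * wt n s \<le> L * real n powr p * (\<bar>sin s * G s\<bar> powr p * sin s)"
        by (simp add: L_def mult_ac)
    qed (use L in auto)
    then show "wint n p G \<le> 2 * L * real n powr p * sint p (\<lambda>s. sin s * G s)" by (simp add: mult_ac)
  qed (use L in auto)
qed

text \<open>
  The image of \<open>\<phi> ^ j * R\<close> under \<open>x = cos s\<close>.
\<close>

definition gtrig :: "nat \<Rightarrow> real poly \<Rightarrow> real \<Rightarrow> real" where
  "gtrig j R s = sin s ^ j * poly R (cos s)"

text \<open>The zero polynomial is a separate alternative because its degree is 0 by convention,
  which would break the inequality once \<open>j\<close> exceeds the degree of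
  \<open>P\<close>.\<close>

lemma degree_higher_pderiv: "(pderiv ^^ j) P = 0 \<or> j + degree ((pderiv ^^ j) P) \<le> degree (P :: real poly)"
proof (induction j)
  case 0 then show ?case by simp
next
  case (Suc j)
  show ?case
  proof (cases "(pderiv ^^ j) P = 0 \<or> degree ((pderiv ^^ j) P) = 0")
    case True
    then have "pderiv ((pderiv ^^ j) P) = 0" by (auto simp: pderiv_eq_0_iff)
    then show ?thesis by simp
  next
    case False
    then show ?thesis using Suc by (auto simp: degree_pderiv)
  qed
qed

lemma etrig_gtrig_pderiv: "degree Q \<le> n \<Longrightarrow> etrig n (gtrig j ((pderiv ^^ j) Q))"
  unfolding gtrig_def using degree_higher_pderiv[of j Q] by (intro etrig_sin_poly) auto

text \<open>After division by \<open>x + y\<close> this is \<open>u \<le> u powr p\<close> on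
  \<open>[0, 1]\<close>. It takes the place of the triangle inequality, which is why
  \<open>sint\<close> is estimated rather than its root.\<close>

lemma powr_abs_add_le:
  fixes a b p :: real
  assumes "0 < p" "p \<le> 1" shows "\<bar>a + b\<bar> powr p \<le> \<bar>a\<bar> powr p + \<bar>b\<bar> powr p"
proof -
  have sub: "(x + y) powr p \<le> x powr p + y powr p" if "0 \<le> x" "0 \<le> y" for x y :: real
  proof (cases "x + y = 0")
    case True then show ?thesis using that by simp
  next
    case False
    then have s: "x + y > 0" using that by linarith
    have k: "u / (x + y) \<le> (u / (x + y)) powr p" if "0 \<le> u" "u \<le> x + y" for u
      using powr_mono'[of p 1 "u / (x + y)"] that assms s by auto
    have "(x + y) powr p = (x / (x + y) + y / (x + y)) * (x + y) powr p"
      using s by (simp add: add_divide_distrib[symmetric])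
    also have "\<dots> \<le> ((x / (x + y)) powr p + (y / (x + y)) powr p) * (x + y) powr p"
      using that k by (intro mult_right_mono add_mono) auto
    also have "\<dots> = x powr p + y powr p"
      using s that by (simp add: powr_divide distrib_right)
    finally show ?thesis .
  qed
  have "\<bar>a + b\<bar> powr p \<le> (\<bar>a\<bar> + \<bar>b\<bar>) powr p" using assms by (intro powr_mono2) auto
  also have "\<dots> \<le> \<bar>a\<bar> powr p + \<bar>b\<bar> powr p" by (rule sub) auto
  finally show ?thesis .
qed

text \<open>For \<open>j = 0\<close> the truncated \<open>j - 1\<close> is harmless, since the
  factor \<open>real j\<close> annihilates that term.\<close>

lemma gtrig_deriv:
  "(gtrig j R has_real_derivative (real j * cos s * gtrig (j - 1) R s - gtrig (Suc j) (pderiv R) s)) (at s)"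
proof -
  have "((\<lambda>s. sin s ^ j * poly R (cos s)) has_real_derivative
    (real j * cos s * (sin s ^ (j - 1) * poly R (cos s)) - sin s ^ Suc j * poly (pderiv R) (cos s))) (at s)"
    by (auto intro!: derivative_eq_intros simp: algebra_simps)
  then show ?thesis by (simp add: gtrig_def[abs_def])
qed

text \<open>The derivative \<open>E\<close> of \<open>G = gtrig j R\<close> is
  \<open>j * cos s * H\<close> minus the function wanted, where \<open>H\<close> is \<open>G\<close>
  divided by \<open>sin\<close> if \<open>j > 0\<close>. The quotient is paid for by
  \<open>wint_div_sin_le\<close>. \<open>E\<close> is bounded at every point by the local estimate,
  and the bound is averaged over the point with Fubini. Either way the cost is one factor
  \<open>real n powr p\<close>.\<close>

lemma bernstein_step:
  fixes p :: real
  assumes p: "0 < p" "p < 1"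
  shows "\<exists>C>0. \<forall>n\<ge>1. \<forall>Q. degree Q \<le> n \<longrightarrow>
    sint p (gtrig (Suc j) ((pderiv ^^ Suc j) Q)) \<le> C * real n powr p * sint p (gtrig j ((pderiv ^^ j) Q))"
proof -
  obtain C1 where C1: "C1 > 0" "\<And>n G. n \<ge> 1 \<Longrightarrow> etrig n G \<Longrightarrow> wint n p G \<le> C1 * sint p G"
    using wint_le_sint[OF p] by blast
  obtain C2 where C2: "C2 > 0" "\<And>n H. n \<ge> 1 \<Longrightarrow> etrig n H \<Longrightarrow> wint n p H \<le> C2 * real n powr p * sint p (\<lambda>s. sin s * H s)"
    using wint_div_sin_le[OF p] by blast
  obtain C3 where C3: "C3 > 0" "\<And>n G \<sigma>. n \<ge> 1 \<Longrightarrow> etrig n G \<Longrightarrow> \<sigma> \<in> {0..pi} \<Longrightarrow>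
      \<exists>E. (G has_real_derivative E) (at \<sigma>) \<and>
      \<bar>E\<bar> powr p * wt n \<sigma> \<le> C3 * real n powr (p + 1) * integral {0..pi} (\<lambda>s. \<bar>G s\<bar> powr p * wt n s * loc 2 n \<sigma> s)"
    using local_nikolskii[OF p, of 2] unfolding etrig_def by auto
  define C where "C = real j powr p * C2 + 7 * C3 * C1"
  have C: "C > 0" unfolding C_def using C1 C2 C3 by (intro add_nonneg_pos) auto
  show ?thesis
  proof (intro exI[of _ C] conjI C allI impI)
    fix n :: nat and Q :: "real poly" assume n: "1 \<le> n" and Q: "degree Q \<le> n"
    define R where "R = (pderiv ^^ j) Q"
    define G where "G = gtrig j R"
    define H where "H = gtrig (j - 1) R"
    define E where "E = (\<lambda>s. real j * cos s * H s - gtrig (Suc j) (pderiv R) s)"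
    have G: "etrig n G" unfolding G_def R_def by (rule etrig_gtrig_pderiv[OF Q])
    have H: "etrig n H" unfolding H_def gtrig_def R_def using degree_higher_pderiv[of j Q] Q by (intro etrig_sin_poly) auto
    have G2: "etrig n (gtrig (Suc j) (pderiv R))" using etrig_gtrig_pderiv[OF Q, of "Suc j"] by (simp add: R_def)
    note c = etrig_continuous[OF G] etrig_continuous[OF H] etrig_continuous[OF G2]
    have cE: "continuous_on S E" for S unfolding E_def by (intro continuous_intros c)
    have dE: "(G has_real_derivative E s) (at s)" for s unfolding G_def E_def H_def by (rule gtrig_deriv)
    have "sint p (gtrig (Suc j) (pderiv R)) \<le> wint n p (gtrig (Suc j) (pderiv R))"
      by (rule sint_le_wint[OF c(3) p(1)])
    also have "\<dots> \<le> real j powr p * wint n p H + wint n p E"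
    proof -
      have "wint n p (gtrig (Suc j) (pderiv R)) \<le> integral {0..pi} (\<lambda>s. real j powr p * (\<bar>H s\<bar> powr p * wt n s) + \<bar>E s\<bar> powr p * wt n s)"
        unfolding wint_def
      proof (intro integral_le integrable_powr_wt Henstock_Kurzweil_Integration.integrable_add integrable_on_mult_right c cE p)
        fix s assume s: "s \<in> {0..pi}"
        have "\<bar>gtrig (Suc j) (pderiv R) s\<bar> = \<bar>real j * cos s * H s + (- E s)\<bar>" by (simp add: E_def)
        also have "\<dots> powr p \<le> \<bar>real j * cos s * H s\<bar> powr p + \<bar>- E s\<bar> powr p"
          by (rule powr_abs_add_le) (use p in auto)
        also have "\<bar>real j * cos s * H s\<bar> powr p \<le> (real j * 1 * \<bar>H s\<bar>) powr p"
          unfolding abs_mult using p by (intro powr_mono2 mult_right_mono mult_mono) auto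
        also have "\<dots> = real j powr p * \<bar>H s\<bar> powr p" by (simp add: powr_mult)
        finally have "\<bar>gtrig (Suc j) (pderiv R) s\<bar> powr p \<le> real j powr p * \<bar>H s\<bar> powr p + \<bar>E s\<bar> powr p" by simp
        from mult_right_mono[OF this wt_nonneg[OF s]]
        show "\<bar>gtrig (Suc j) (pderiv R) s\<bar> powr p * wt n s \<le> real j powr p * (\<bar>H s\<bar> powr p * wt n s) + \<bar>E s\<bar> powr p * wt n s"
          by (simp add: algebra_simps)
      qed auto
      also have "\<dots> = real j powr p * wint n p H + wint n p E"
        unfolding wint_def
        by (subst Henstock_Kurzweil_Integration.integral_add) (auto intro!: integrable_powr_wt integrable_on_mult_right c cE p)
      finally show ?thesis .
    qed
    also have "real j powr p * wint n p H \<le> real j powr p * C2 * real n powr p * sint p G"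
    proof (cases "j = 0")
      case False
      then have "(\<lambda>s. sin s * H s) = G" unfolding H_def G_def gtrig_def
        by (auto simp: fun_eq_iff mult.assoc[symmetric] power_Suc[symmetric] simp del: power_Suc)
      then have "wint n p H \<le> C2 * real n powr p * sint p G" using C2(2)[OF n H] by simp
      then have "real j powr p * wint n p H \<le> real j powr p * (C2 * real n powr p * sint p G)" by (intro mult_left_mono) auto
      then show ?thesis by (simp only: mult.assoc)
    qed simp
    also have "wint n p E \<le> 7 * C3 * C1 * real n powr p * sint p G"
    proof -
      have ci: "continuous_on {0..pi} (\<lambda>\<sigma>. integral {0..pi} (\<lambda>s. \<bar>G s\<bar> powr p * wt n s * loc 2 n \<sigma> s))"
      proof -
        have "continuous_on {0..pi} (\<lambda>\<sigma>. integral (cbox 0 pi) (\<lambda>s. \<bar>G s\<bar> powr p * wt n s * loc 2 n \<sigma> s))"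
          by (rule integral_continuous_on_param)
            (auto simp: case_prod_unfold intro!: continuous_on_mult continuous_on_loc continuous_on_wt continuous_on_fst continuous_on_snd
              continuous_on_id continuous_on_compose2[OF continuous_on_abs_powr[OF c(1)[of UNIV] p(1)]])
        then show ?thesis by (simp add: box_real)
      qed
      have "wint n p E \<le> integral {0..pi} (\<lambda>\<sigma>. C3 * real n powr (p + 1) * integral {0..pi} (\<lambda>s. \<bar>G s\<bar> powr p * wt n s * loc 2 n \<sigma> s))"
        unfolding wint_def
      proof (intro integral_le integrable_powr_wt cE p integrable_on_mult_right integrable_continuous_real ci)
        fix \<sigma> assume s: "\<sigma> \<in> {0..pi}"
        obtain E' where "(G has_real_derivative E') (at \<sigma>)"
          "\<bar>E'\<bar> powr p * wt n \<sigma> \<le> C3 * real n powr (p + 1) * integral {0..pi} (\<lambda>s. \<bar>G s\<bar> powr p * wt n s * loc 2 n \<sigma> s)"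
          using C3(2)[OF n G s] by blast
        moreover have "E' = E \<sigma>" using calculation(1) dE DERIV_unique by blast
        ultimately show "\<bar>E \<sigma>\<bar> powr p * wt n \<sigma> \<le> C3 * real n powr (p + 1) * integral {0..pi} (\<lambda>s. \<bar>G s\<bar> powr p * wt n s * loc 2 n \<sigma> s)"
          by simp
      qed auto
      also have "\<dots> = C3 * real n powr (p + 1) * integral {0..pi} (\<lambda>\<sigma>. integral {0..pi} (\<lambda>s. \<bar>G s\<bar> powr p * wt n s * loc 2 n \<sigma> s))"
        by simp
      also have "\<dots> \<le> C3 * real n powr (p + 1) * (7 / real n * wint n p G)"
        unfolding wint_def
        by (intro mult_left_mono integral_loc_swap_le n)
          (use C3(1) in \<open>auto intro!: continuous_on_mult continuous_on_abs_powr c p continuous_on_wt continuous_on_id mult_nonneg_nonneg wt_nonneg\<close>)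
      also have "\<dots> = 7 * C3 * real n powr p * wint n p G"
        using n by (simp add: powr_add)
      also have "\<dots> \<le> 7 * C3 * real n powr p * (C1 * sint p G)"
        using C3(1) by (intro mult_left_mono C1(2) n G) auto
      finally show ?thesis by (simp add: mult_ac)
    qed
    finally have "sint p (gtrig (Suc j) (pderiv R)) \<le> C * real n powr p * sint p G"
      unfolding C_def by (simp add: algebra_simps)
    then show "sint p (gtrig (Suc j) ((pderiv ^^ Suc j) Q)) \<le> C * real n powr p * sint p (gtrig j ((pderiv ^^ j) Q))"
      by (simp add: R_def G_def)
  qed
qed

lemma bernstein_sint:
  fixes p :: real
  assumes p: "0 < p" "p < 1"
  shows "\<exists>C>0. \<forall>n\<ge>1. \<forall>Q. degree Q \<le> n \<longrightarrow>
    sint p (gtrig r ((pderiv ^^ r) Q)) \<le> C * real n powr (real r * p) * sint p (gtrig 0 Q)"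
proof (induction r)
  case 0
  show ?case by (intro exI[of _ 1]) auto
next
  case (Suc r)
  obtain C where C: "C > 0" "\<And>n Q. n \<ge> 1 \<Longrightarrow> degree Q \<le> n \<Longrightarrow>
    sint p (gtrig r ((pderiv ^^ r) Q)) \<le> C * real n powr (real r * p) * sint p (gtrig 0 Q)"
    using Suc by blast
  obtain D where D: "D > 0" "\<And>n Q. n \<ge> 1 \<Longrightarrow> degree Q \<le> n \<Longrightarrow>
    sint p (gtrig (Suc r) ((pderiv ^^ Suc r) Q)) \<le> D * real n powr p * sint p (gtrig r ((pderiv ^^ r) Q))"
    using bernstein_step[OF p, of r] by blast
  show ?case
  proof (intro exI[of _ "C * D"] conjI allI impI)
    fix n :: nat and Q :: "real poly" assume n: "1 \<le> n" and Q: "degree Q \<le> n"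
    have "sint p (gtrig (Suc r) ((pderiv ^^ Suc r) Q)) \<le> D * real n powr p * sint p (gtrig r ((pderiv ^^ r) Q))"
      by (rule D(2)[OF n Q])
    also have "\<dots> \<le> D * real n powr p * (C * real n powr (real r * p) * sint p (gtrig 0 Q))"
      using D(1) by (intro mult_left_mono C(2) n Q) auto
    also have "\<dots> = C * D * (real n powr p * real n powr (real r * p)) * sint p (gtrig 0 Q)" by (simp add: mult_ac)
    also have "real n powr p * real n powr (real r * p) = real n powr (real (Suc r) * p)"
      by (simp add: powr_add[symmetric] algebra_simps)
    finally show "sint p (gtrig (Suc r) ((pderiv ^^ Suc r) Q)) \<le> C * D * real n powr (real (Suc r) * p) * sint p (gtrig 0 Q)" .
  qed (use C D in auto)
qed

text \<open>In \<open>\<bar>G\<bar> = \<bar>G\<bar> powr (1 - p) * \<bar>G\<bar> powr p\<close> the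
  first factor is bounded by the supremum. Since \<open>wt n\<close> can be as small as
  \<open>1 / n\<close>, the supremum of \<open>\<bar>G\<bar> powr p\<close> costs
  \<open>n ^ 2\<close> and not \<open>n\<close>; raised to \<open>(1 - p) / p\<close> this is the
  stated power.\<close>

lemma nikolskii_sint:
  fixes p :: real
  assumes p: "0 < p" "p < 1"
  shows "\<exists>C>0. \<forall>n\<ge>1. \<forall>G. etrig n G \<longrightarrow>
    sint 1 G \<le> C * real n powr (2 / p - 2) * sint p G powr (1 / p)"
proof -
  obtain C1 where C1: "C1 > 0" "\<And>n G. n \<ge> 1 \<Longrightarrow> etrig n G \<Longrightarrow> wint n p G \<le> C1 * sint p G"
    using wint_le_sint[OF p] by blast
  obtain C2 where C2: "C2 > 0" "\<And>n G \<sigma>. n \<ge> 1 \<Longrightarrow> etrig n G \<Longrightarrow> \<sigma> \<in> {0..pi} \<Longrightarrow>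
    \<bar>G \<sigma>\<bar> powr p * wt n \<sigma> \<le> C2 * real n * wint n p G"
    using sup_bound_wint[OF p] by blast
  define C where "C = (C2 * C1) powr ((1 - p) / p)"
  show ?thesis
  proof (intro exI[of _ C] conjI allI impI)
    show "C > 0" unfolding C_def using C1 C2 by simp
    fix n :: nat and G assume n: "1 \<le> n" and G: "etrig n G"
    note c = etrig_continuous[OF G]
    let ?Z = "sint p G"
    have Z: "?Z \<ge> 0" by (rule sint_nonneg[OF c p(1)])
    let ?B = "C2 * C1 * real n ^ 2 * ?Z"
    have B: "\<bar>G s\<bar> powr p \<le> ?B" if s: "s \<in> {0..pi}" for s
    proof -
      have "\<bar>G s\<bar> powr p = \<bar>G s\<bar> powr p * (1 / real n) * real n" using n by simp
      also have "\<dots> \<le> \<bar>G s\<bar> powr p * wt n s * real n"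
        using wt_ge(1)[OF n s] by (intro mult_right_mono mult_left_mono) auto
      also have "\<dots> \<le> C2 * real n * wint n p G * real n"
        using C2(2)[OF n G s] by (intro mult_right_mono) auto
      also have "\<dots> \<le> C2 * real n * (C1 * ?Z) * real n"
        using C2(1) by (intro mult_right_mono mult_left_mono C1(2) n G) auto
      finally show ?thesis by (simp add: power2_eq_square mult_ac)
    qed
    have B': "\<bar>G s\<bar> powr (1 - p) \<le> ?B powr ((1 - p) / p)" if s: "s \<in> {0..pi}" for s
    proof -
      have "\<bar>G s\<bar> powr (1 - p) = (\<bar>G s\<bar> powr p) powr ((1 - p) / p)" using p by (simp add: powr_powr)
      also have "\<dots> \<le> ?B powr ((1 - p) / p)" using B[OF s] p by (intro powr_mono2) auto
      finally show ?thesis .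
    qed
    have "sint 1 G = integral {0..pi} (\<lambda>s. \<bar>G s\<bar> powr 1 * sin s)" by (rule sint_def)
    also have "\<dots> \<le> integral {0..pi} (\<lambda>s. ?B powr ((1 - p) / p) * (\<bar>G s\<bar> powr p * sin s))"
    proof (rule integral_le)
      show "(\<lambda>s. \<bar>G s\<bar> powr 1 * sin s) integrable_on {0..pi}"
        by (rule integrable_powr_sin) (use c in auto)
      fix s assume s: "s \<in> {0..pi}"
      have "\<bar>G s\<bar> powr 1 * sin s = \<bar>G s\<bar> powr (1 - p) * (\<bar>G s\<bar> powr p * sin s)"
        by (simp add: powr_add[symmetric] mult.assoc[symmetric] del: powr_one_eq_one)
      also have "\<dots> \<le> ?B powr ((1 - p) / p) * (\<bar>G s\<bar> powr p * sin s)"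
        using s B'[OF s] by (intro mult_right_mono mult_nonneg_nonneg sin_ge_zero) auto
      finally show "\<bar>G s\<bar> powr 1 * sin s \<le> ?B powr ((1 - p) / p) * (\<bar>G s\<bar> powr p * sin s)" by simp
    qed (use c p in \<open>auto intro!: integrable_powr_sin integrable_on_mult_right\<close>)
    also have "\<dots> = ?B powr ((1 - p) / p) * ?Z" by (simp add: sint_def)
    also have "?B powr ((1 - p) / p) = C * (real n ^ 2) powr ((1 - p) / p) * ?Z powr ((1 - p) / p)"
      unfolding C_def using C1 C2 Z by (simp add: powr_mult)
    also have "(real n ^ 2) powr ((1 - p) / p) = real n powr (2 / p - 2)"
    proof -
      have "(real n ^ 2) powr ((1 - p) / p) = (real n powr 2) powr ((1 - p) / p)" using n by simp
      also have "\<dots> = real n powr (2 / p - 2)" using p by (simp only: powr_powr) (simp add: field_simps)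
      finally show ?thesis .
    qed
    also have "C * real n powr (2 / p - 2) * ?Z powr ((1 - p) / p) * ?Z = C * real n powr (2 / p - 2) * ?Z powr (1 / p)"
    proof -
      have "?Z powr ((1 - p) / p) * ?Z = ?Z powr (1 / p)"
      proof (cases "?Z = 0")
        case False
        then show ?thesis using Z p powr_add[of ?Z "(1 - p) / p" 1] by (simp add: diff_divide_distrib)
      qed simp
      then show ?thesis by (simp only: mult.assoc)
    qed
    finally show "sint 1 G \<le> C * real n powr (2 / p - 2) * ?Z powr (1 / p)" .
  qed
qed

section \<open>Jackson-type approximation by convolution\<close>

definition taylor :: "nat \<Rightarrow> real \<Rightarrow> real poly \<Rightarrow> real \<Rightarrow> real" where
  "taylor r y S t = (\<Sum>i<r. (t - y) ^ i / fact i * poly ((pderiv ^^ i) S) y)"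

lemma taylor_remainder_ge:
  assumes "r \<ge> 1" "y \<le> t"
  shows "\<bar>poly S t - taylor r y S t\<bar> \<le> integral {y..t} (\<lambda>u. \<bar>t - u\<bar> ^ (r - 1) * \<bar>poly ((pderiv ^^ r) S) u\<bar>)"
proof -
  let ?i = "\<lambda>x. ((t - x) ^ (r - 1) / fact (r - 1)) *\<^sub>R poly ((pderiv ^^ r) S) x"
  have "poly S t = (\<Sum>i<r. ((t - y) ^ i / fact i) *\<^sub>R poly ((pderiv ^^ i) S) y) + integral {y..t} ?i"
  proof (rule Taylor_integral)
    fix m x
    show "((\<lambda>x. poly ((pderiv ^^ m) S) x) has_vector_derivative poly ((pderiv ^^ Suc m) S) x) (at x within {y..t})"
      by (auto simp: has_real_derivative_iff_has_vector_derivative[symmetric] intro!: derivative_eq_intros)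
  qed (use assms in auto)
  then have "poly S t - taylor r y S t = integral {y..t} ?i" by (simp add: taylor_def)
  also have "\<bar>\<dots>\<bar> \<le> integral {y..t} (\<lambda>u. \<bar>t - u\<bar> ^ (r - 1) * \<bar>poly ((pderiv ^^ r) S) u\<bar>)"
    unfolding real_norm_def[symmetric]
  proof (rule integral_norm_bound_integral)
    fix x assume "x \<in> {y..t}"
    have "\<bar>t - x\<bar> ^ (r - 1) / fact (r - 1) \<le> \<bar>t - x\<bar> ^ (r - 1)"
      using divide_left_mono[of 1 "fact (r - 1)" "\<bar>t - x\<bar> ^ (r - 1)"] by (simp add: fact_ge_1)
    from mult_right_mono[OF this, of "\<bar>poly ((pderiv ^^ r) S) x\<bar>"]
    show "norm (?i x) \<le> norm (t - x) ^ (r - 1) * norm (poly ((pderiv ^^ r) S) x)"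
      by (simp add: abs_mult power_abs)
  qed (auto intro!: integrable_continuous_real continuous_intros)
  finally show ?thesis .
qed

lemma higher_pderiv_reflect:
  "poly ((pderiv ^^ i) (pcompose S [:0, -1::real:])) x = (-1) ^ i * poly ((pderiv ^^ i) S) (- x)"
proof -
  have "(pderiv ^^ i) (pcompose S [:0, -1::real:]) = smult ((-1) ^ i) (pcompose ((pderiv ^^ i) S) [:0, -1:])"
  proof (induction i)
    case (Suc i)
    have "pderiv [:0, -1::real:] = [:-1:]" by (simp add: pderiv_pCons)
    then show ?case using Suc by (simp add: pderiv_smult pderiv_pcompose)
  qed simp
  then show ?thesis by (simp add: poly_pcompose)
qed

text \<open>The case \<open>t < y\<close> is the case \<open>y \<le> t\<close> for the reflected
  polynomial \<open>S (- x)\<close>; the signs \<open>(-1) ^ i\<close> of its derivatives cancel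
  those of the powers of the increment.\<close>

lemma taylor_remainder:
  assumes "r \<ge> 1"
  shows "\<bar>poly S t - taylor r y S t\<bar> \<le> integral {min y t..max y t} (\<lambda>u. \<bar>t - u\<bar> ^ (r - 1) * \<bar>poly ((pderiv ^^ r) S) u\<bar>)"
proof (cases "y \<le> t")
  case True
  then show ?thesis using taylor_remainder_ge[OF assms True] by simp
next
  case False
  let ?S = "pcompose S [:0, -1::real:]"
  have e: "poly ?S (- t) - taylor r (- y) ?S (- t) = poly S t - taylor r y S t"
  proof -
    have "(- t - - y) ^ i / fact i * poly ((pderiv ^^ i) ?S) (- y) = (t - y) ^ i / fact i * poly ((pderiv ^^ i) S) y" for i
    proof -
      have "(- t - - y) ^ i * (-1) ^ i = (t - y) ^ i"
        by (simp add: power_mult_distrib[symmetric])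
      then show ?thesis by (simp add: higher_pderiv_reflect field_simps)
    qed
    then show ?thesis by (simp only: taylor_def) (simp add: poly_pcompose)
  qed
  have "\<bar>poly ?S (- t) - taylor r (- y) ?S (- t)\<bar>
     \<le> integral {- y..- t} (\<lambda>u. \<bar>- t - u\<bar> ^ (r - 1) * \<bar>poly ((pderiv ^^ r) ?S) u\<bar>)"
    by (rule taylor_remainder_ge) (use False assms in auto)
  also have "\<dots> = integral {- y..- t} (\<lambda>u. (\<lambda>v. \<bar>t - v\<bar> ^ (r - 1) * \<bar>poly ((pderiv ^^ r) S) v\<bar>) (- u))"
    by (intro Henstock_Kurzweil_Integration.integral_cong)
      (simp add: higher_pderiv_reflect abs_mult power_abs abs_minus_commute add.commute)
  also have "\<dots> = integral {t..y} (\<lambda>v. \<bar>t - v\<bar> ^ (r - 1) * \<bar>poly ((pderiv ^^ r) S) v\<bar>)"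
    by (rule Henstock_Kurzweil_Integration.integral_reflect_real)
  finally show ?thesis using False by (simp add: e)
qed

lemma integral_cos_subst:
  fixes F :: "real \<Rightarrow> real"
  assumes "0 \<le> \<alpha>" "\<alpha> \<le> \<beta>" "\<beta> \<le> pi" "continuous_on {-1..1} F"
  shows "integral {cos \<beta>..cos \<alpha>} F = integral {\<alpha>..\<beta>} (\<lambda>s. F (cos s) * sin s)"
proof -
  have le: "cos \<beta> \<le> cos \<alpha>" using assms by (simp add: cos_monotone_0_pi_le)
  have "((\<lambda>x. (- sin x) *\<^sub>R F (cos x)) has_integral (integral {cos \<alpha>..cos \<beta>} F - integral {cos \<beta>..cos \<alpha>} F)) {\<alpha>..\<beta>}"
    by (rule has_integral_substitution_general[where s = "{}" and c = "-1" and d = 1])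
      (use assms in \<open>auto intro!: continuous_intros derivative_eq_intros\<close>)
  moreover have "integral {cos \<alpha>..cos \<beta>} F = 0"
  proof (cases "cos \<alpha> = cos \<beta>")
    case False
    then have "{cos \<alpha>..cos \<beta>} = {}" using le by auto
    then show ?thesis by simp
  qed simp
  ultimately have "((\<lambda>x. - ((- sin x) *\<^sub>R F (cos x))) has_integral - (0 - integral {cos \<beta>..cos \<alpha>} F)) {\<alpha>..\<beta>}"
    by (intro has_integral_neg) simp
  then show ?thesis by (intro integral_unique[symmetric]) (simp add: mult.commute)
qed

lemma sdist_between:
  assumes "\<tau> \<in> {0..pi}" "\<eta> \<in> {0..pi}" "min \<tau> \<eta> \<le> \<sigma>" "\<sigma> \<le> max \<tau> \<eta>"
  shows "sdist \<tau> \<sigma> \<le> sdist \<eta> \<tau>" "sdist \<eta> \<sigma> \<le> sdist \<eta> \<tau>"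
proof -
  have m: "sdist a b \<le> sdist c d" if "\<bar>a - b\<bar> \<le> \<bar>c - d\<bar>" "\<bar>c - d\<bar> \<le> pi" for a b c d
  proof -
    have e: "sdist x y = sin (\<bar>x - y\<bar> / 2)" if "\<bar>x - y\<bar> \<le> pi" for x y
    proof -
      have "sdist x y = \<bar>sin (\<bar>x - y\<bar> / 2)\<bar>"
      proof (cases "x \<ge> y")
        case False
        then have "\<bar>x - y\<bar> / 2 = - ((x - y) / 2)" by (simp add: field_simps)
        then show ?thesis unfolding sdist_def by (simp only: sin_minus abs_minus_cancel)
      qed (simp add: sdist_def)
      then show ?thesis using that sin_ge_zero[of "\<bar>x - y\<bar> / 2"] by simp
    qed
    show ?thesis using that by (simp add: e sin_monotone_2pi_le)
  qed
  show "sdist \<tau> \<sigma> \<le> sdist \<eta> \<tau>" "sdist \<eta> \<sigma> \<le> sdist \<eta> \<tau>"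
    by (rule m; use assms in \<open>auto simp: min_def max_def abs_if split: if_splits\<close>)+
qed

text \<open>On the way from \<open>\<sigma>\<close> down to \<open>\<tau>\<close> the factor
  \<open>sin (x / 2)\<close> decreases, so only \<open>cos (x / 2)\<close> can grow, by at most
  \<open>sdist \<tau> \<sigma>\<close>. Hypothesis \<open>m\<close> keeps \<open>\<eta>\<close>, and
  with it \<open>\<sigma>\<close>, away from \<open>pi\<close>: \<open>cos (\<sigma> / 2)\<close> is
  at least \<open>1 / (4 * m)\<close>, which makes the growth a relative one.\<close>

lemma cos_diff_bound_aux:
  assumes "0 \<le> \<tau>" "\<tau> \<le> \<sigma>" "\<sigma> \<le> \<eta>" "\<eta> \<le> pi" and m: "real m * cos (\<eta> / 2) \<ge> 1 / 4"
  shows "sin ((\<tau> + \<sigma>) / 2) \<le> sin \<sigma> * (1 + 2 * real m * sdist \<tau> \<sigma>)"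
    and "sin \<tau> \<le> sin \<sigma> * (1 + 4 * real m * sdist \<tau> \<sigma>)"
proof -
  let ?d = "sdist \<tau> \<sigma>"
  have d: "sin ((\<sigma> - \<tau>) / 2) \<le> ?d" using sdist_commute[of \<tau> \<sigma>] by (simp add: sdist_def)
  have s: "0 \<le> sin (\<sigma> / 2)" "sin (\<sigma> / 2) \<le> 1" "0 \<le> cos (\<sigma> / 2)" "0 \<le> cos (\<tau> / 2)" "0 \<le> sin (\<tau> / 2)"
    using assms by (auto intro!: sin_ge_zero cos_ge_zero)
  have st: "sin (\<tau> / 2) \<le> sin (\<sigma> / 2)" using assms by (intro sin_monotone_2pi_le) auto
  have ce: "cos (\<eta> / 2) \<le> cos (\<sigma> / 2)" using assms by (intro cos_monotone_0_pi_le) auto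
  have sd0: "0 \<le> sin ((\<sigma> - \<tau>) / 2)" using assms by (intro sin_ge_zero) auto
  have "\<tau> / 2 = \<sigma> / 2 - (\<sigma> - \<tau>) / 2" by (simp add: field_simps)
  then have "cos (\<tau> / 2) = cos (\<sigma> / 2) * cos ((\<sigma> - \<tau>) / 2) + sin (\<sigma> / 2) * sin ((\<sigma> - \<tau>) / 2)"
    by (simp only: cos_diff)
  also have "\<dots> \<le> cos (\<sigma> / 2) * 1 + 1 * ?d"
    using s d sd0 assms by (intro add_mono mult_mono) (auto intro!: cos_ge_zero)
  also have "?d \<le> ?d * (4 * (real m * cos (\<sigma> / 2)))"
  proof -
    have "1 / 4 \<le> real m * cos (\<sigma> / 2)" using m ce by (meson mult_left_mono of_nat_0_le_iff order_trans)
    then have "?d * 1 \<le> ?d * (4 * (real m * cos (\<sigma> / 2)))" by (intro mult_left_mono) (auto simp: sdist_nonneg)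
    then show ?thesis by simp
  qed
  finally have c: "cos (\<tau> / 2) \<le> cos (\<sigma> / 2) * (1 + 4 * real m * ?d)" by (simp add: algebra_simps)
  have ss: "sin \<sigma> = 2 * sin (\<sigma> / 2) * cos (\<sigma> / 2)" using sin_double[of "\<sigma>/2"] by simp
  have "(\<tau> + \<sigma>) / 2 = \<tau> / 2 + \<sigma> / 2" by (simp add: field_simps)
  then have "sin ((\<tau> + \<sigma>) / 2) = sin (\<tau> / 2) * cos (\<sigma> / 2) + cos (\<tau> / 2) * sin (\<sigma> / 2)"
    by (simp only: sin_add)
  also have "\<dots> \<le> sin (\<sigma> / 2) * cos (\<sigma> / 2) + cos (\<sigma> / 2) * (1 + 4 * real m * ?d) * sin (\<sigma> / 2)"
    using s st c by (intro add_mono mult_right_mono) auto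
  also have "\<dots> = sin \<sigma> * (1 + 2 * real m * ?d)" by (simp add: ss algebra_simps)
  finally show "sin ((\<tau> + \<sigma>) / 2) \<le> sin \<sigma> * (1 + 2 * real m * sdist \<tau> \<sigma>)" .
  have "sin \<tau> = 2 * (sin (\<tau> / 2) * cos (\<tau> / 2))" using sin_double[of "\<tau>/2"] by simp
  also have "\<dots> \<le> 2 * (sin (\<sigma> / 2) * (cos (\<sigma> / 2) * (1 + 4 * real m * ?d)))"
    using s st c by (intro mult_left_mono mult_mono) auto
  also have "\<dots> = sin \<sigma> * (1 + 4 * real m * ?d)" by (simp add: ss algebra_simps)
  finally show "sin \<tau> \<le> sin \<sigma> * (1 + 4 * real m * sdist \<tau> \<sigma>)" .
qed

text \<open>The case \<open>\<eta> < \<tau>\<close> follows by reflection at \<open>pi / 2\<close>.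
  The factor \<open>sin \<sigma>\<close> on the right is essential: it turns the kernel
  \<open>\<bar>cos \<tau> - cos \<sigma>\<bar> ^ (r - 1)\<close> of the Taylor remainder into powers
  of \<open>sin \<sigma>\<close>, that is, of the weight \<open>phi\<close>.\<close>

lemma cos_diff_bound:
  assumes "m \<ge> 1" "\<tau> \<in> {0..pi}" "\<eta> \<in> {0..pi}" "min \<tau> \<eta> \<le> \<sigma>" "\<sigma> \<le> max \<tau> \<eta>"
    and m: "real m * cos (\<eta> / 2) \<ge> 1 / 4" "real m * sin (\<eta> / 2) \<ge> 1 / 4"
  shows "\<bar>cos \<tau> - cos \<sigma>\<bar> \<le> 4 / real m * (1 + real m * sdist \<eta> \<tau>)\<^sup>2 * sin \<sigma>"
    and "sin \<tau> \<le> 4 * (1 + real m * sdist \<eta> \<tau>) * sin \<sigma>"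
proof -
  have s: "sin ((\<tau> + \<sigma>) / 2) \<le> sin \<sigma> * (1 + 2 * real m * sdist \<tau> \<sigma>) \<and>
     sin \<tau> \<le> sin \<sigma> * (1 + 4 * real m * sdist \<tau> \<sigma>)"
  proof (cases "\<tau> \<le> \<eta>")
    case True
    then show ?thesis using cos_diff_bound_aux[of \<tau> \<sigma> \<eta> m] assms by (auto simp: min_def max_def)
  next
    case False
    have e: "sin ((pi - \<tau> + (pi - \<sigma>)) / 2) = sin ((\<tau> + \<sigma>) / 2)"
    proof -
      have "(pi - \<tau> + (pi - \<sigma>)) / 2 = pi - (\<tau> + \<sigma>) / 2" by (simp add: field_simps)
      then show ?thesis by (simp only: sin_pi_minus)
    qed
    have e2: "sdist (pi - \<tau>) (pi - \<sigma>) = sdist \<tau> \<sigma>"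
      using sdist_commute[of \<tau> \<sigma>] by (simp add: sdist_def)
    have e3: "cos ((pi - \<eta>) / 2) = sin (\<eta> / 2)"
      by (simp add: diff_divide_distrib cos_diff)
    show ?thesis using cos_diff_bound_aux[of "pi - \<tau>" "pi - \<sigma>" "pi - \<eta>" m] assms False
      unfolding e e2 e3 by (auto simp: min_def max_def)
  qed
  let ?d = "sdist \<eta> \<tau>"
  note bt = sdist_between[OF assms(2-5)]
  have sg: "\<sigma> \<in> {0..pi}" using assms by (auto simp: min_def max_def split: if_splits)
  then have s0: "0 \<le> sin \<sigma>" by (auto intro: sin_ge_zero)
  have mp: "real m > 0" using assms by simp
  have sp: "0 \<le> sin ((\<tau> + \<sigma>) / 2)" using sg assms by (intro sin_ge_zero) auto
  have "cos \<tau> - cos \<sigma> = 2 * sin ((\<tau> + \<sigma>) / 2) * sin ((\<sigma> - \<tau>) / 2)"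
    by (simp add: cos_diff_cos)
  then have "\<bar>cos \<tau> - cos \<sigma>\<bar> = 2 * \<bar>sin ((\<tau> + \<sigma>) / 2)\<bar> * sdist \<tau> \<sigma>"
    using sdist_commute[of \<tau> \<sigma>] by (simp add: sdist_def abs_mult)
  also have "\<bar>sin ((\<tau> + \<sigma>) / 2)\<bar> = sin ((\<tau> + \<sigma>) / 2)"
    using sp by simp
  also have "2 * sin ((\<tau> + \<sigma>) / 2) * sdist \<tau> \<sigma> \<le> 2 * (sin \<sigma> * (1 + 2 * real m * ?d)) * ?d"
  proof (intro mult_mono mult_left_mono)
    have "sin \<sigma> * (1 + 2 * real m * sdist \<tau> \<sigma>) \<le> sin \<sigma> * (1 + 2 * real m * ?d)"
      using bt s0 by (intro mult_left_mono add_left_mono) auto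
    then show "sin ((\<tau> + \<sigma>) / 2) \<le> sin \<sigma> * (1 + 2 * real m * ?d)" using s by linarith
  qed (use bt s0 sp sdist_nonneg in \<open>auto intro!: mult_nonneg_nonneg add_nonneg_nonneg\<close>)
  also have "\<dots> = 4 / real m * ((1 / 2 + real m * ?d) * (real m * ?d)) * sin \<sigma>"
    using mp by (simp add: field_simps)
  also have "\<dots> \<le> 4 / real m * (1 + real m * ?d)\<^sup>2 * sin \<sigma>"
    unfolding power2_eq_square using s0 mp sdist_nonneg[of \<eta> \<tau>]
    by (intro mult_right_mono mult_left_mono mult_mono) auto
  finally show "\<bar>cos \<tau> - cos \<sigma>\<bar> \<le> 4 / real m * (1 + real m * sdist \<eta> \<tau>)\<^sup>2 * sin \<sigma>" .
  have "sin \<tau> \<le> sin \<sigma> * (1 + 4 * real m * sdist \<tau> \<sigma>)" using s by simp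
  also have "\<dots> \<le> sin \<sigma> * (4 + 4 * real m * ?d)"
    using bt s0 by (intro mult_left_mono add_mono) auto
  finally show "sin \<tau> \<le> 4 * (1 + real m * sdist \<eta> \<tau>) * sin \<sigma>" by (simp add: algebra_simps)
qed

text \<open>The remainder kernel supplies \<open>r - 1\<close> factors \<open>sin\<close> and the
  substitution \<open>x = cos s\<close> one more, together the weight in \<open>gtrig r\<close>.
  There remains an integral of \<open>\<bar>G\<bar>\<close> between \<open>\<tau>\<close> and
  \<open>\<eta>\<close>; the local Nikolskii inequality at scale \<open>N\<close> converts it to
  \<open>p\<close>-th powers, and this produces \<open>real N powr (1 - p)\<close>. The localisation
  is kept at the coarser scale \<open>m\<close>, and a distant \<open>\<tau>\<close> costs powers of
  \<open>1 + m * sdist \<eta> \<tau>\<close>.\<close>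

lemma taylor_estimate:
  fixes p a :: real
  assumes p: "0 < p" "p < 1" and a: "0 \<le> a" and r: "r \<ge> 1"
  shows "\<exists>C>0. \<forall>m N S \<eta> \<tau>. 1 \<le> m \<longrightarrow> m \<le> N \<longrightarrow> degree S \<le> N \<longrightarrow> \<eta> \<in> {0..pi} \<longrightarrow> \<tau> \<in> {0..pi} \<longrightarrow>
     real m * cos (\<eta> / 2) \<ge> 1 / 4 \<longrightarrow> real m * sin (\<eta> / 2) \<ge> 1 / 4 \<longrightarrow>
     \<bar>poly S (cos \<tau>) - taylor r (cos \<eta>) S (cos \<tau>)\<bar> powr p \<le>
       C * real m powr (- (real (r - 1) * p)) * real N powr (1 - p)
       * integral {0..pi} (\<lambda>s. \<bar>gtrig r ((pderiv ^^ r) S) s\<bar> powr p * wt N s * loc a m \<eta> s)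
       * (1 + real m * sdist \<eta> \<tau>) powr (a + 1 + 2 * real (r - 1) * p) / wt N \<tau>"
proof -
  obtain C0 where C0: "C0 > 0" "\<And>n G \<sigma>. n \<ge> 1 \<Longrightarrow> etrig n G \<Longrightarrow> \<sigma> \<in> {0..pi} \<Longrightarrow>
      \<bar>G \<sigma>\<bar> powr p * wt n \<sigma> \<le> C0 * real n * integral {0..pi} (\<lambda>s. \<bar>G s\<bar> powr p * wt n s * loc a n \<sigma> s)"
    using local_nikolskii[OF p a] unfolding etrig_def by auto
  define C where "C = 4 powr (real (r - 1) * p) * C0 powr (1 - p) * 4"
  show ?thesis
  proof (intro exI[of _ C] conjI allI impI)
    show "C > 0" unfolding C_def using C0 by simp
    fix m N :: nat and S :: "real poly" and \<eta> \<tau> :: real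
    assume m: "1 \<le> m" and mN: "m \<le> N" and S: "degree S \<le> N" and \<eta>: "\<eta> \<in> {0..pi}" and \<tau>: "\<tau> \<in> {0..pi}"
      and c: "real m * cos (\<eta> / 2) \<ge> 1 / 4" "real m * sin (\<eta> / 2) \<ge> 1 / 4"
    define G where "G = gtrig r ((pderiv ^^ r) S)"
    define u where "u = 1 + real m * sdist \<eta> \<tau>"
    define Z where "Z = integral {0..pi} (\<lambda>s. \<bar>G s\<bar> powr p * wt N s * loc a m \<eta> s)"
    \<comment> \<open>A common bound for \<open>(1 + m * sdist \<eta> s) powr a / wt N s\<close>
      over all \<open>s\<close> between \<open>\<tau>\<close> and \<open>\<eta>\<close>: the
      numerator is at most \<open>u powr a\<close>, and replacing \<open>wt N s\<close> by
      \<open>wt N \<tau>\<close> costs \<open>4 * u\<close>.\<close>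
    define X where "X = 4 * u powr (a + 1) / wt N \<tau>"
    define \<alpha> where "\<alpha> = min \<tau> \<eta>"
    define \<beta> where "\<beta> = max \<tau> \<eta>"
    have ab: "0 \<le> \<alpha>" "\<alpha> \<le> \<beta>" "\<beta> \<le> pi" using \<eta> \<tau> by (auto simp: \<alpha>_def \<beta>_def)
    have N: "N \<ge> 1" using m mN by simp
    have G: "etrig N G" unfolding G_def by (rule etrig_gtrig_pderiv[OF S])
    note cG = etrig_continuous[OF G]
    have u: "u \<ge> 1" unfolding u_def by (rule one_plus_sdist_ge1)
    have wN: "wt N s > 0" if "s \<in> {0..pi}" for s by (rule wt_ge(3)[OF N that])
    have X: "X > 0" unfolding X_def using u wN[OF \<tau>] by simp
    have in_I: "s \<in> {0..pi}" "min \<tau> \<eta> \<le> s" "s \<le> max \<tau> \<eta>" if "s \<in> {\<alpha>..\<beta>}" for s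
      using that ab by (auto simp: \<alpha>_def \<beta>_def)
    have intg: "(\<lambda>s. \<bar>G s\<bar> powr p * wt N s * loc b k x s) integrable_on {c..d}" for b k x c d
      by (intro integrable_continuous_real continuous_on_mult continuous_on_abs_powr cG p continuous_on_wt
          continuous_on_loc continuous_on_const continuous_on_id)
    have Z: "Z \<ge> 0" unfolding Z_def
      by (rule Henstock_Kurzweil_Integration.integral_nonneg)
        (auto intro!: intg mult_nonneg_nonneg wt_nonneg loc_nonneg)
    have wX: "(1 + real m * sdist \<eta> s) powr a / wt N s \<le> X" if s: "s \<in> {\<alpha>..\<beta>}" for s
    proof -
      have "(1 + real m * sdist \<eta> s) powr a \<le> u powr a"
        unfolding u_def using sdist_between(2)[OF \<tau> \<eta> in_I(2,3)[OF s]] a one_plus_sdist_ge1[of m \<eta> s]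
        by (intro powr_mono2 add_left_mono mult_left_mono) (auto simp: add_nonneg_nonneg sdist_nonneg)
      moreover have "wt N \<tau> \<le> 4 * u * wt N s"
      proof -
        have "sin \<tau> \<le> 4 * u * sin s"
          unfolding u_def by (rule cos_diff_bound(2)[OF m \<tau> \<eta> in_I(2,3)[OF s] c])
        moreover have "1 / real N \<le> 4 * u * (1 / real N)" using u N by (simp add: field_simps)
        ultimately show ?thesis by (simp add: wt_def distrib_left)
      qed
      then have "1 / wt N s \<le> 4 * u / wt N \<tau>"
        using wN[OF \<tau>] wN[OF in_I(1)[OF s]] by (simp add: field_simps)
      ultimately have "(1 + real m * sdist \<eta> s) powr a * (1 / wt N s) \<le> u powr a * (4 * u / wt N \<tau>)"
        using wN[OF in_I(1)[OF s]] by (intro mult_mono) auto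
      also have "\<dots> = X" unfolding X_def using u by (simp add: powr_add)
      finally show ?thesis by simp
    qed
    \<comment> \<open>The local estimate is centred at \<open>s\<close> with scale \<open>N\<close>.
      Submultiplicativity and \<open>m \<le> N\<close> recentre it at \<open>\<eta>\<close> with
      scale \<open>m\<close>, so that one number \<open>Z\<close> serves all
      \<open>s\<close>.\<close>
    have pw: "\<bar>G s\<bar> powr p \<le> C0 * real N * Z * X" if s: "s \<in> {\<alpha>..\<beta>}" for s
    proof -
      have "\<bar>G s\<bar> powr p * wt N s \<le> C0 * real N * integral {0..pi} (\<lambda>t. \<bar>G t\<bar> powr p * wt N t * loc a N s t)"
        by (rule C0(2)[OF N G in_I(1)[OF s]])
      also have "\<dots> \<le> C0 * real N * integral {0..pi} (\<lambda>t. (1 + real m * sdist \<eta> s) powr a * (\<bar>G t\<bar> powr p * wt N t * loc a m \<eta> t))"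
      proof (intro mult_left_mono integral_le intg integrable_on_mult_right)
        fix t assume t: "t \<in> {0..pi}"
        have "1 + real m * sdist \<eta> t \<le> (1 + real m * sdist \<eta> s) * (1 + real m * sdist s t)"
          by (rule sdist_submult)
        also have "\<dots> \<le> (1 + real m * sdist \<eta> s) * (1 + real N * sdist s t)"
          using mN by (intro mult_left_mono add_left_mono mult_right_mono) (auto simp: sdist_nonneg)
        finally have "((1 + real m * sdist \<eta> s) * (1 + real N * sdist s t)) powr (- a) \<le> (1 + real m * sdist \<eta> t) powr (- a)"
          using a one_plus_sdist_ge1[of m \<eta> t] by (intro powr_mono2') auto
        then have "(1 + real m * sdist \<eta> s) powr (- a) * loc a N s t \<le> loc a m \<eta> t"
          unfolding loc_def using one_plus_sdist_ge1[of m \<eta> s] one_plus_sdist_ge1[of N s t] by (simp add: powr_mult)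
        from mult_left_mono[OF this, of "(1 + real m * sdist \<eta> s) powr a"]
        have "loc a N s t \<le> (1 + real m * sdist \<eta> s) powr a * loc a m \<eta> t"
          using one_plus_sdist_ge1[of m \<eta> s] by (simp add: mult.assoc[symmetric] powr_add[symmetric])
        from mult_left_mono[OF this, of "\<bar>G t\<bar> powr p * wt N t"] wt_nonneg[OF t, of N]
        show "\<bar>G t\<bar> powr p * wt N t * loc a N s t \<le> (1 + real m * sdist \<eta> s) powr a * (\<bar>G t\<bar> powr p * wt N t * loc a m \<eta> t)"
          by (simp add: mult_ac)
      qed (use C0 in auto)
      also have "\<dots> = C0 * real N * ((1 + real m * sdist \<eta> s) powr a * Z)" by (simp add: Z_def)
      also have "\<dots> = C0 * real N * Z * (1 + real m * sdist \<eta> s) powr a" by (simp add: mult_ac)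
      finally have "\<bar>G s\<bar> powr p \<le> C0 * real N * Z * ((1 + real m * sdist \<eta> s) powr a / wt N s)"
        using wN[OF in_I(1)[OF s]] by (simp add: field_simps)
      also have "\<dots> \<le> C0 * real N * Z * X"
        using wX[OF s] C0 Z by (intro mult_left_mono) auto
      finally show ?thesis .
    qed
    let ?B = "C0 * real N * Z * X"
    have B: "?B \<ge> 0" using C0 Z X by (intro mult_nonneg_nonneg) auto
    have IG: "integral {\<alpha>..\<beta>} (\<lambda>s. \<bar>G s\<bar>) \<le> ?B powr ((1 - p) / p) * (X * Z)"
    proof -
      have "integral {\<alpha>..\<beta>} (\<lambda>s. \<bar>G s\<bar>) \<le> integral {\<alpha>..\<beta>} (\<lambda>s. ?B powr ((1 - p) / p) * (X * (\<bar>G s\<bar> powr p * wt N s * loc a m \<eta> s)))"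
      proof (intro integral_le intg integrable_on_mult_right)
        show "(\<lambda>s. \<bar>G s\<bar>) integrable_on {\<alpha>..\<beta>}" by (intro integrable_continuous_real continuous_intros cG)
        fix s assume s: "s \<in> {\<alpha>..\<beta>}"
        have "\<bar>G s\<bar> = \<bar>G s\<bar> powr (1 - p) * \<bar>G s\<bar> powr p"
          by (simp add: powr_add[symmetric])
        also have "\<bar>G s\<bar> powr (1 - p) = (\<bar>G s\<bar> powr p) powr ((1 - p) / p)" using p by (simp add: powr_powr)
        also have "(\<bar>G s\<bar> powr p) powr ((1 - p) / p) * \<bar>G s\<bar> powr p \<le> ?B powr ((1 - p) / p) * (X * (\<bar>G s\<bar> powr p * wt N s * loc a m \<eta> s))"
        proof (intro mult_mono powr_mono2 pw s)
          \<comment> \<open>The constant 1 is factored so that the weight and the localisation of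
            \<open>Z\<close> appear under the integral; the price is \<open>X\<close>.\<close>
          have "1 = ((1 + real m * sdist \<eta> s) powr a / wt N s) * (wt N s * loc a m \<eta> s)"
            unfolding loc_def using one_plus_sdist_ge1[of m \<eta> s] wN[OF in_I(1)[OF s]]
            by (simp add: powr_minus field_simps)
          also have "\<dots> \<le> X * (wt N s * loc a m \<eta> s)"
            using wX[OF s] wt_nonneg[OF in_I(1)[OF s]] by (intro mult_right_mono mult_nonneg_nonneg loc_nonneg)
          finally have "\<bar>G s\<bar> powr p * 1 \<le> \<bar>G s\<bar> powr p * (X * (wt N s * loc a m \<eta> s))" by (intro mult_left_mono) auto
          then show "\<bar>G s\<bar> powr p \<le> X * (\<bar>G s\<bar> powr p * wt N s * loc a m \<eta> s)" by (simp add: mult_ac)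
        qed (use p in auto)
        finally show "\<bar>G s\<bar> \<le> ?B powr ((1 - p) / p) * (X * (\<bar>G s\<bar> powr p * wt N s * loc a m \<eta> s))" .
      qed
      also have "\<dots> \<le> integral {0..pi} (\<lambda>s. ?B powr ((1 - p) / p) * (X * (\<bar>G s\<bar> powr p * wt N s * loc a m \<eta> s)))"
        by (intro integral_subset_le intg integrable_on_mult_right)
          (use ab X in \<open>auto intro!: mult_nonneg_nonneg wt_nonneg loc_nonneg less_imp_le[OF X]\<close>)
      also have "\<dots> = ?B powr ((1 - p) / p) * (X * Z)" by (simp add: Z_def)
      finally show ?thesis .
    qed
    \<comment> \<open>\<open>K * sin s\<close> bounds \<open>\<bar>cos \<tau> - cos s\<bar>\<close>.
      The power \<open>r - 1\<close> of \<open>K\<close> is the source of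
      \<open>real m powr (- (real (r - 1) * p))\<close> and of the part
      \<open>2 * real (r - 1) * p\<close> of the growth exponent.\<close>
    define K where "K = 4 / real m * u\<^sup>2"
    have K: "K \<ge> 0" unfolding K_def by simp
    have "\<bar>poly S (cos \<tau>) - taylor r (cos \<eta>) S (cos \<tau>)\<bar> \<le>
      integral {min (cos \<eta>) (cos \<tau>)..max (cos \<eta>) (cos \<tau>)} (\<lambda>u. \<bar>cos \<tau> - u\<bar> ^ (r - 1) * \<bar>poly ((pderiv ^^ r) S) u\<bar>)"
      by (rule taylor_remainder[OF r])
    also have "min (cos \<eta>) (cos \<tau>) = cos \<beta>"
      using \<eta> \<tau> unfolding \<beta>_def by (cases "\<tau> \<le> \<eta>") (auto simp: min_def max_def cos_mono_le_eq)
    also have "max (cos \<eta>) (cos \<tau>) = cos \<alpha>"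
      using \<eta> \<tau> unfolding \<alpha>_def by (cases "\<tau> \<le> \<eta>") (auto simp: min_def max_def cos_mono_le_eq)
    also have "integral {cos \<beta>..cos \<alpha>} (\<lambda>u. \<bar>cos \<tau> - u\<bar> ^ (r - 1) * \<bar>poly ((pderiv ^^ r) S) u\<bar>)
       = integral {\<alpha>..\<beta>} (\<lambda>s. \<bar>cos \<tau> - cos s\<bar> ^ (r - 1) * \<bar>poly ((pderiv ^^ r) S) (cos s)\<bar> * sin s)"
      by (rule integral_cos_subst[OF ab]) (intro continuous_intros)
    also have "\<dots> \<le> integral {\<alpha>..\<beta>} (\<lambda>s. K ^ (r - 1) * \<bar>G s\<bar>)"
    proof (intro integral_le)
      fix s assume s: "s \<in> {\<alpha>..\<beta>}"
      have s0: "sin s \<ge> 0" using in_I(1)[OF s] by (auto intro: sin_ge_zero)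
      have "\<bar>cos \<tau> - cos s\<bar> \<le> K * sin s"
        unfolding K_def u_def by (rule cos_diff_bound(1)[OF m \<tau> \<eta> in_I(2,3)[OF s] c])
      then have "\<bar>cos \<tau> - cos s\<bar> ^ (r - 1) * \<bar>poly ((pderiv ^^ r) S) (cos s)\<bar> * sin s \<le> (K * sin s) ^ (r - 1) * \<bar>poly ((pderiv ^^ r) S) (cos s)\<bar> * sin s"
        using s0 by (intro mult_right_mono power_mono) auto
      also have "\<dots> = K ^ (r - 1) * (sin s ^ Suc (r - 1) * \<bar>poly ((pderiv ^^ r) S) (cos s)\<bar>)"
        by (simp add: power_mult_distrib mult_ac)
      also have "sin s ^ Suc (r - 1) * \<bar>poly ((pderiv ^^ r) S) (cos s)\<bar> = \<bar>G s\<bar>"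
        using r s0 by (simp add: G_def gtrig_def abs_mult)
      finally show "\<bar>cos \<tau> - cos s\<bar> ^ (r - 1) * \<bar>poly ((pderiv ^^ r) S) (cos s)\<bar> * sin s \<le> K ^ (r - 1) * \<bar>G s\<bar>" .
    qed (intro integrable_continuous_real continuous_intros cG)+
    also have "\<dots> = K ^ (r - 1) * integral {\<alpha>..\<beta>} (\<lambda>s. \<bar>G s\<bar>)" by simp
    also have "\<dots> \<le> K ^ (r - 1) * (?B powr ((1 - p) / p) * (X * Z))"
      using IG K by (intro mult_left_mono) auto
    finally have "\<bar>poly S (cos \<tau>) - taylor r (cos \<eta>) S (cos \<tau>)\<bar> powr p \<le> (K ^ (r - 1) * (?B powr ((1 - p) / p) * (X * Z))) powr p"
      using p by (intro powr_mono2) auto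
    also have "\<dots> = (K ^ (r - 1)) powr p * ((?B powr ((1 - p) / p)) powr p * (X * Z) powr p)"
      using K Z X B by (simp add: powr_mult)
    also have "(?B powr ((1 - p) / p)) powr p = (C0 * real N) powr (1 - p) * (X * Z) powr (1 - p)"
      using p Z X C0 by (simp add: powr_powr powr_mult mult_ac)
    also have "(C0 * real N) powr (1 - p) * (X * Z) powr (1 - p) * (X * Z) powr p = (C0 * real N) powr (1 - p) * (X * Z)"
      using Z X by (simp add: powr_add[symmetric] mult.assoc)
    also have "(K ^ (r - 1)) powr p = 4 powr (real (r - 1) * p) * real m powr (- (real (r - 1) * p)) * u powr (2 * real (r - 1) * p)"
    proof -
      have "K > 0" unfolding K_def using m u by simp
      then have "(K ^ (r - 1)) powr p = K powr (real (r - 1) * p)"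
        by (simp add: powr_realpow[symmetric] powr_powr)
      also have "\<dots> = (4 * real m powr (-1) * u powr 2) powr (real (r - 1) * p)"
        unfolding K_def using m u by (simp add: powr_minus_divide)
      also have "\<dots> = 4 powr (real (r - 1) * p) * real m powr (- (real (r - 1) * p)) * u powr (2 * real (r - 1) * p)"
        by (simp only: powr_mult powr_powr) (simp add: mult_ac)
      finally show ?thesis .
    qed
    finally have "\<bar>poly S (cos \<tau>) - taylor r (cos \<eta>) S (cos \<tau>)\<bar> powr p \<le>
       4 powr (real (r - 1) * p) * real m powr (- (real (r - 1) * p)) * u powr (2 * real (r - 1) * p) * ((C0 * real N) powr (1 - p) * (X * Z))" .
    also have "\<dots> = C * real m powr (- (real (r - 1) * p)) * real N powr (1 - p) * Z * (u powr (a + 1) * u powr (2 * real (r - 1) * p)) / wt N \<tau>"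
      unfolding C_def X_def using C0 by (simp add: powr_mult mult_ac)
    also have "u powr (a + 1) * u powr (2 * real (r - 1) * p) = u powr (a + 1 + 2 * real (r - 1) * p)"
      by (simp add: powr_add)
    finally show "\<bar>poly S (cos \<tau>) - taylor r (cos \<eta>) S (cos \<tau>)\<bar> powr p \<le>
       C * real m powr (- (real (r - 1) * p)) * real N powr (1 - p)
       * integral {0..pi} (\<lambda>s. \<bar>gtrig r ((pderiv ^^ r) S) s\<bar> powr p * wt N s * loc a m \<eta> s)
       * (1 + real m * sdist \<eta> \<tau>) powr (a + 1 + 2 * real (r - 1) * p) / wt N \<tau>"
      unfolding Z_def G_def u_def .
  qed
qed

section \<open>Convolution operators on algebraic polynomials\<close>

lemma integral_odd_zero:
  fixes f :: "real \<Rightarrow> real"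
  assumes "\<And>x. f (- x) = - f x" shows "integral {-a..a} f = 0"
proof -
  have "integral {-a..a} f = integral {-a..a} (\<lambda>x. f (- x))"
    using Henstock_Kurzweil_Integration.integral_reflect_real[of a "-a" f] by simp
  also have "\<dots> = - integral {-a..a} f" unfolding assms by simp
  finally show ?thesis by simp
qed

text \<open>In the binomial expansion of \<open>cos (\<theta> - \<tau>) ^ k\<close> an odd power of
  \<open>sin \<theta>\<close> comes with the same odd power of \<open>sin \<tau>\<close>, whose
  integral against an even function vanishes; even powers of \<open>sin \<theta>\<close> are
  polynomials in \<open>cos \<theta>\<close>.\<close>

lemma cos_convolution_monom:
  fixes S :: "real poly"
  shows "\<exists>T::real poly. degree T \<le> k \<and> (\<forall>\<theta>. poly T (cos \<theta>) = integral {-pi..pi} (\<lambda>\<tau>. poly S (cos \<tau>) * cos (\<theta> - \<tau>) ^ k))"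
proof -
  define c where "c i = integral {-pi..pi} (\<lambda>\<tau>. poly S (cos \<tau>) * (cos \<tau> ^ i * sin \<tau> ^ (k - i)))" for i
  define T where "T = (\<Sum>i\<le>k. smult (real (k choose i) * c i) ([:0, 1:] ^ i * [:1, 0, -1:] ^ ((k - i) div 2)))"
  have "degree T \<le> k"
    unfolding T_def
  proof (rule degree_sum_le)
    fix i assume i: "i \<in> {..k}"
    have "degree ([:0, 1::real:] ^ i * [:1, 0, -1:] ^ ((k - i) div 2)) \<le> i + 2 * ((k - i) div 2)"
      using degree_mult_le[of "[:0, 1::real:] ^ i" "[:1, 0, -1:] ^ ((k - i) div 2)"]
        degree_power_le[of "[:0, 1::real:]" i] degree_power_le[of "[:1, 0, -1::real:]" "(k - i) div 2"] by simp
    also have "\<dots> \<le> k" using i by simp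
    finally show "degree (smult (real (k choose i) * c i) ([:0, 1:] ^ i * [:1, 0, -1:] ^ ((k - i) div 2))) \<le> k"
      using degree_smult_le order_trans by blast
  qed simp
  moreover have "poly T (cos \<theta>) = integral {-pi..pi} (\<lambda>\<tau>. poly S (cos \<tau>) * cos (\<theta> - \<tau>) ^ k)" for \<theta>
  proof -
    have "integral {-pi..pi} (\<lambda>\<tau>. poly S (cos \<tau>) * cos (\<theta> - \<tau>) ^ k)
      = integral {-pi..pi} (\<lambda>\<tau>. \<Sum>i\<le>k. (real (k choose i) * cos \<theta> ^ i * sin \<theta> ^ (k - i)) * (poly S (cos \<tau>) * (cos \<tau> ^ i * sin \<tau> ^ (k - i))))"
      by (simp add: cos_diff binomial_ring sum_distrib_left power_mult_distrib mult_ac)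
    also have "\<dots> = (\<Sum>i\<le>k. (real (k choose i) * cos \<theta> ^ i * sin \<theta> ^ (k - i)) * c i)"
      unfolding c_def
      by (subst Henstock_Kurzweil_Integration.integral_sum) (auto intro!: integrable_continuous_real continuous_intros)
    also have "\<dots> = (\<Sum>i\<le>k. (real (k choose i) * c i) * (cos \<theta> ^ i * (1 - (cos \<theta>)\<^sup>2) ^ ((k - i) div 2)))"
    proof (rule sum.cong[OF refl])
      fix i assume "i \<in> {..k}"
      show "(real (k choose i) * cos \<theta> ^ i * sin \<theta> ^ (k - i)) * c i = (real (k choose i) * c i) * (cos \<theta> ^ i * (1 - (cos \<theta>)\<^sup>2) ^ ((k - i) div 2))"
      proof (cases "even (k - i)")
        case True
        then have "sin \<theta> ^ (k - i) = ((sin \<theta>)\<^sup>2) ^ ((k - i) div 2)" by (simp add: power_mult[symmetric])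
        then show ?thesis by (simp add: sin_squared_eq)
      next
        case False
        have "c i = 0" unfolding c_def by (rule integral_odd_zero) (use False in simp)
        then show ?thesis by simp
      qed
    qed
    also have "\<dots> = poly T (cos \<theta>)"
      unfolding T_def by (simp add: poly_sum power2_eq_square algebra_simps)
    finally show ?thesis by simp
  qed
  ultimately show ?thesis by blast
qed

lemma cos_convolution_poly:
  fixes S V :: "real poly"
  shows "\<exists>T::real poly. degree T \<le> degree V \<and> (\<forall>\<theta>. poly T (cos \<theta>) = integral {-pi..pi} (\<lambda>\<tau>. poly S (cos \<tau>) * poly V (cos (\<theta> - \<tau>))))"
proof -
  obtain T where T: "\<And>k. degree (T k :: real poly) \<le> k" "\<And>k \<theta>. poly (T k) (cos \<theta>) = integral {-pi..pi} (\<lambda>\<tau>. poly S (cos \<tau>) * cos (\<theta> - \<tau>) ^ k)"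
    using cos_convolution_monom[of _ S] by metis
  let ?T = "\<Sum>k\<le>degree V. smult (coeff V k) (T k)"
  have "degree ?T \<le> degree V"
    by (rule degree_sum_le) (auto intro: order_trans[OF degree_smult_le] order_trans[OF T(1)])
  moreover have "poly ?T (cos \<theta>) = integral {-pi..pi} (\<lambda>\<tau>. poly S (cos \<tau>) * poly V (cos (\<theta> - \<tau>)))" for \<theta>
  proof -
    have "integral {-pi..pi} (\<lambda>\<tau>. poly S (cos \<tau>) * poly V (cos (\<theta> - \<tau>)))
      = integral {-pi..pi} (\<lambda>\<tau>. \<Sum>k\<le>degree V. coeff V k * (poly S (cos \<tau>) * cos (\<theta> - \<tau>) ^ k))"
      by (simp add: poly_altdef[of V] sum_distrib_left mult_ac)
    also have "\<dots> = (\<Sum>k\<le>degree V. coeff V k * poly (T k) (cos \<theta>))"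
      unfolding T(2)
      by (subst Henstock_Kurzweil_Integration.integral_sum) (auto intro!: integrable_continuous_real continuous_intros)
    finally show ?thesis by (simp add: poly_sum)
  qed
  ultimately show ?thesis by blast
qed

lemma dirichlet_poly: "\<exists>P::real poly. degree P \<le> L \<and> (\<forall>t. dirichlet L t = poly P (cos t))"
proof -
  obtain Q :: "nat \<Rightarrow> real poly" where Q: "\<And>k. degree (Q k) \<le> k" "\<And>k t. cos (real k * t) = poly (Q k) (cos t)"
    using cos_multiple_poly by metis
  let ?P = "1 + smult 2 (\<Sum>k=1..L. Q k)"
  have "degree (\<Sum>k=1..L. Q k) \<le> L"
    by (rule degree_sum_le) (auto intro: order_trans[OF Q(1)])
  then have "degree (smult 2 (\<Sum>k=1..L. Q k)) \<le> L" using degree_smult_le order_trans by blast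
  then have "degree ?P \<le> L" by (intro degree_add_le) auto
  moreover have "dirichlet L t = poly ?P (cos t)" for t
    by (simp add: dirichlet_def poly_sum Q(2))
  ultimately show ?thesis by blast
qed

lemma fejer_even: "fejer m (- t) = fejer m t"
proof -
  obtain P :: "real poly" where "\<And>t. fejer m t = poly P (cos t)" using fejer_poly by blast
  then show ?thesis by simp
qed

text \<open>
  Convolution with (a power of the Fejer kernel) times (a Dirichlet kernel of larger degree): the Dirichlet
  factor makes it reproduce every \<open>W\<close> of small degree exactly, the Fejer factor makes it local.
\<close>

lemma jackson_operator:
  fixes S :: "real poly" and M :: nat
  assumes m: "m \<ge> 1" and r: "r \<ge> 1"
  defines "L \<equiv> M * (m - 1) + (r - 1)"
  shows "\<exists>T::real poly. degree T \<le> 2 * (M * (m - 1)) + (r - 1) \<and>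
    (\<forall>W \<theta>. degree W \<le> r - 1 \<longrightarrow> \<theta> \<in> {0..pi} \<longrightarrow>
      \<bar>poly T (cos \<theta>) - poly W (cos \<theta>)\<bar> \<le> real (2 * L + 1) * 2 powr (2 * real M) *
        integral {0..pi} (\<lambda>\<tau>. \<bar>poly S (cos \<tau>) - poly W (cos \<tau>)\<bar> * loc (2 * real M) m \<theta> \<tau>))"
proof -
  obtain J :: "real poly" where J: "degree J \<le> m - 1" "\<And>t. fejer m t = poly J (cos t)"
    using fejer_poly by blast
  obtain D :: "real poly" where D: "degree D \<le> L" "\<And>t. dirichlet L t = poly D (cos t)"
    using dirichlet_poly by blast
  define V where "V = J ^ M * D"
  have "degree (J ^ M) \<le> M * (m - 1)"
    using order_trans[OF degree_power_le[of J M] mult_le_mono1[OF J(1), of M]] by (simp only: mult.commute)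
  then have V: "degree V \<le> 2 * (M * (m - 1)) + (r - 1)"
    unfolding V_def using degree_mult_le[of "J ^ M" D] D(1) unfolding L_def by linarith
  have Vt: "poly V (cos t) = fejer m t ^ M * dirichlet L t" for t
    unfolding V_def J(2) D(2) by simp
  obtain T0 :: "real poly" where T0: "degree T0 \<le> degree V"
    "\<And>\<theta>. poly T0 (cos \<theta>) = integral {-pi..pi} (\<lambda>\<tau>. poly S (cos \<tau>) * poly V (cos (\<theta> - \<tau>)))"
    using cos_convolution_poly[of V S] by blast
  define T where "T = smult (1 / (2 * pi)) T0"
  show ?thesis
  proof (intro exI[of _ T] conjI allI impI)
    show "degree T \<le> 2 * (M * (m - 1)) + (r - 1)"
      unfolding T_def using degree_smult_le[of "1 / (2 * pi)" T0] T0(1) V by linarith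
    fix W :: "real poly" and \<theta> :: real assume W: "degree W \<le> r - 1" and \<theta>: "\<theta> \<in> {0..pi}"
    \<comment> \<open>\<open>W\<close> times the Fejer factor centred at \<open>\<theta>\<close> has
      degree at most \<open>L\<close>, so the Dirichlet factor evaluates this product at
      \<open>\<theta>\<close>, where the Fejer factor is 1.\<close>
    have rep: "integral {-pi..pi} (\<lambda>\<tau>. poly W (cos \<tau>) * poly V (cos (\<theta> - \<tau>))) = 2 * pi * poly W (cos \<theta>)"
    proof -
      define H where "H = (\<lambda>\<tau>. complex_of_real (poly W (cos \<tau>)) * of_real (fejer m (\<tau> - \<theta>) ^ M))"
      have "trigp (r - 1 + M * (m - 1)) H"
        unfolding H_def by (intro trigp_mult trigp_poly_cos W trigp_shift[OF trigp_fejer_power])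
      then have "((\<lambda>s. H s * of_real (dirichlet L (\<theta> - s))) has_integral (2 * of_real pi * H \<theta>)) {-pi..pi}"
        by (rule dirichlet_reproduces) (simp add: L_def)
      moreover have "H s * of_real (dirichlet L (\<theta> - s)) = of_real (poly W (cos s) * poly V (cos (\<theta> - s)))" for s
        using fejer_even[of m "\<theta> - s"] by (simp add: H_def Vt)
      moreover have "2 * of_real pi * H \<theta> = of_real (2 * pi * poly W (cos \<theta>))"
        using fejer_0[OF m] by (simp add: H_def)
      ultimately have "((\<lambda>s. complex_of_real (poly W (cos s) * poly V (cos (\<theta> - s)))) has_integral of_real (2 * pi * poly W (cos \<theta>))) {-pi..pi}"
        by simp
      then have "((\<lambda>s. Re (complex_of_real (poly W (cos s) * poly V (cos (\<theta> - s))))) has_integral Re (of_real (2 * pi * poly W (cos \<theta>)))) {-pi..pi}"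
        by (rule has_integral_Re)
      then show ?thesis by (simp add: integral_unique)
    qed
    let ?R = "\<lambda>\<tau>. poly S (cos \<tau>) - poly W (cos \<tau>)"
    have "2 * pi * (poly T (cos \<theta>) - poly W (cos \<theta>)) = integral {-pi..pi} (\<lambda>\<tau>. poly S (cos \<tau>) * poly V (cos (\<theta> - \<tau>)))
       - integral {-pi..pi} (\<lambda>\<tau>. poly W (cos \<tau>) * poly V (cos (\<theta> - \<tau>)))"
      unfolding rep by (simp add: T_def T0(2) right_diff_distrib)
    also have "\<dots> = integral {-pi..pi} (\<lambda>\<tau>. ?R \<tau> * poly V (cos (\<theta> - \<tau>)))"
      by (subst Henstock_Kurzweil_Integration.integral_diff[symmetric])
        (auto intro!: integrable_continuous_real continuous_intros simp: left_diff_distrib)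
    finally have e: "2 * pi * (poly T (cos \<theta>) - poly W (cos \<theta>)) = integral {-pi..pi} (\<lambda>\<tau>. ?R \<tau> * poly V (cos (\<theta> - \<tau>)))" .
    let ?K = "real (2 * L + 1) * 2 powr (2 * real M)"
    let ?g = "\<lambda>\<tau>. ?K * (\<bar>?R \<tau>\<bar> * loc (2 * real M) m \<theta> \<tau>)"
    \<comment> \<open>All decay comes from the Fejer factor; the Dirichlet factor is estimated by
      its maximum \<open>2 * L + 1\<close>.\<close>
    have V_le: "\<bar>poly V (cos (\<theta> - t))\<bar> \<le> ?K * loc (2 * real M) m \<theta> \<tau>" if "sdist \<theta> \<tau> \<le> sdist \<theta> t" for t \<tau>
    proof -
      have "fejer m (\<theta> - t) ^ M \<le> 2 powr (2 * real M) * loc (2 * real M) m \<theta> t"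
        using fejer_powr_le[OF m, of 1 "2 * real M" M "\<theta> - t"] fejer_nonneg[of m "\<theta> - t"] by (simp add: loc_def sdist_def)
      also have "\<dots> \<le> 2 powr (2 * real M) * loc (2 * real M) m \<theta> \<tau>"
        unfolding loc_def using that one_plus_sdist_ge1[of m \<theta> \<tau>]
        by (intro mult_left_mono powr_mono2' add_left_mono) auto
      finally have f: "fejer m (\<theta> - t) ^ M \<le> 2 powr (2 * real M) * loc (2 * real M) m \<theta> \<tau>" .
      have "\<bar>poly V (cos (\<theta> - t))\<bar> = fejer m (\<theta> - t) ^ M * \<bar>dirichlet L (\<theta> - t)\<bar>"
        unfolding Vt abs_mult using fejer_nonneg by (simp add: power_abs)
      also have "\<dots> \<le> (2 powr (2 * real M) * loc (2 * real M) m \<theta> \<tau>) * real (2 * L + 1)"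
        by (intro mult_mono f dirichlet_abs_le) (auto simp: loc_nonneg)
      finally show ?thesis by (simp add: mult_ac)
    qed
    have "\<bar>2 * pi * (poly T (cos \<theta>) - poly W (cos \<theta>))\<bar> \<le> integral {-pi..pi} (\<lambda>\<tau>. \<bar>?R \<tau> * poly V (cos (\<theta> - \<tau>))\<bar>)"
      unfolding e real_norm_def[symmetric]
      by (rule integral_norm_bound_integral) (auto intro!: integrable_continuous_real continuous_intros)
    also have "\<dots> \<le> 2 * integral {0..pi} ?g"
    proof (rule integral_even_le)
      fix s assume s: "s \<in> {0..pi}"
      have "\<bar>?R s\<bar> * \<bar>poly V (cos (\<theta> - s))\<bar> \<le> \<bar>?R s\<bar> * (?K * loc (2 * real M) m \<theta> s)"
        by (intro mult_left_mono V_le) auto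
      then show "\<bar>?R s * poly V (cos (\<theta> - s))\<bar> \<le> ?g s" by (simp add: abs_mult mult_ac)
      have "\<bar>?R s\<bar> * \<bar>poly V (cos (\<theta> - (- s)))\<bar> \<le> \<bar>?R s\<bar> * (?K * loc (2 * real M) m \<theta> s)"
        by (intro mult_left_mono V_le sdist_fold \<theta> s) auto
      then show "\<bar>?R (- s) * poly V (cos (\<theta> - (- s)))\<bar> \<le> ?g s" by (simp add: abs_mult mult_ac)
    qed (intro continuous_intros)+
    finally have "2 * pi * \<bar>poly T (cos \<theta>) - poly W (cos \<theta>)\<bar> \<le> 2 * integral {0..pi} ?g"
      by (simp add: abs_mult)
    moreover have "2 * \<bar>poly T (cos \<theta>) - poly W (cos \<theta>)\<bar> \<le> 2 * pi * \<bar>poly T (cos \<theta>) - poly W (cos \<theta>)\<bar>"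
      using pi_gt3 by (intro mult_right_mono) auto
    ultimately have "2 * \<bar>poly T (cos \<theta>) - poly W (cos \<theta>)\<bar> \<le> 2 * integral {0..pi} ?g" by (rule order_trans[rotated])
    then have "\<bar>poly T (cos \<theta>) - poly W (cos \<theta>)\<bar> \<le> integral {0..pi} ?g"
      by (simp only: mult_le_cancel_left_pos zero_less_numeral)
    then show "\<bar>poly T (cos \<theta>) - poly W (cos \<theta>)\<bar> \<le> ?K * integral {0..pi} (\<lambda>\<tau>. \<bar>?R \<tau>\<bar> * loc (2 * real M) m \<theta> \<tau>)"
      by simp
  qed
qed

section \<open>The Jackson inequality for polynomials\<close>

text \<open>Jordan's inequality bounds \<open>wt N\<close> from below by a linear function on each
  half of the interval. For \<open>q > 1\<close> the integral of the negative power is governed by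
  the endpoint, where \<open>wt N\<close> equals \<open>1 / N\<close>.\<close>

lemma integral_wt_powr_le:
  fixes q :: real
  assumes q: "q > 1" and N: "N \<ge> 1"
  shows "integral {0..pi} (\<lambda>s. wt N s powr (- q)) \<le> pi / (q - 1) * real N powr (q - 1)"
proof -
  let ?c = "2 / pi"
  let ?f = "\<lambda>s. (?c * s + 1 / real N) powr (- q)"
  let ?g = "\<lambda>s. (?c * (pi - s) + 1 / real N) powr (- q)"
  have Np: "real N > 0" using N by simp
  have pos: "?c * s + 1 / real N > 0" if "s \<ge> 0" for s using that Np by (intro add_nonneg_pos) auto
  have nz: "?c * s + 1 / real N \<noteq> 0" "?c * (pi - s) + 1 / real N \<noteq> 0" if "s \<in> {0..pi}" for s
    using pos[of s] pos[of "pi - s"] that by (metis atLeastAtMost_iff less_irrefl diff_ge_0_iff_ge)+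
  have cf: "continuous_on {0..pi} ?f" "continuous_on {0..pi} ?g"
    by (intro continuous_on_powr continuous_on_add continuous_on_mult continuous_on_diff continuous_on_const continuous_on_id ballI nz; assumption)+
  have If: "(?f has_integral ((?c * pi + 1 / real N) powr (1 - q) / (?c * (1 - q)) - (?c * 0 + 1 / real N) powr (1 - q) / (?c * (1 - q)))) {0..pi}"
  proof (rule fundamental_theorem_of_calculus)
    fix x :: real assume x: "x \<in> {0..pi}"
    have "((\<lambda>s. (?c * s + 1 / real N) powr (1 - q) / (?c * (1 - q))) has_real_derivative ?f x) (at x within {0..pi})"
    proof -
      have "((\<lambda>s. ?c * s + 1 / real N) has_real_derivative ?c) (at x)"
        by (auto intro!: derivative_eq_intros)
      then have "((\<lambda>s. (?c * s + 1 / real N) powr (1 - q)) has_real_derivative ((1 - q) * (?c * x + 1 / real N) powr (1 - q - of_nat 1) * ?c)) (at x)"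
        by (rule DERIV_fun_powr) (use pos[of x] x in simp)
      then have d: "((\<lambda>s. (?c * s + 1 / real N) powr (1 - q)) has_real_derivative ((1 - q) * ?f x * ?c)) (at x)"
        by simp
      have e: "((1 - q) * Y * ?c) / (?c * (1 - q)) = Y" for Y :: real
        using q by (simp add: field_simps)
      from DERIV_cdivide[OF d, of "?c * (1 - q)"]
      have "((\<lambda>s. (?c * s + 1 / real N) powr (1 - q) / (?c * (1 - q))) has_real_derivative ?f x) (at x)"
        by (simp only: e)
      then show ?thesis by (rule has_field_derivative_at_within)
    qed
    then show "((\<lambda>s. (?c * s + 1 / real N) powr (1 - q) / (?c * (1 - q))) has_vector_derivative ?f x) (at x within {0..pi})"
      by (simp add: has_real_derivative_iff_has_vector_derivative)
  qed simp
  have le1: "integral {0..pi} ?f \<le> pi / (2 * (q - 1)) * real N powr (q - 1)"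
  proof -
    have "integral {0..pi} ?f = (?c * pi + 1 / real N) powr (1 - q) / (?c * (1 - q)) - (1 / real N) powr (1 - q) / (?c * (1 - q))"
      using integral_unique[OF If] by simp
    also have "\<dots> \<le> (1 / real N) powr (1 - q) / (?c * (q - 1))"
    proof -
      have e: "?c * (1 - q) = - (?c * (q - 1))" by (simp only: right_diff_distrib)
      have "0 \<le> (?c * pi + 1 / real N) powr (1 - q) / (?c * (q - 1))" using q by simp
      then show ?thesis unfolding e by simp
    qed
    also have "(1 / real N) powr (1 - q) = real N powr (q - 1)"
      using Np by (simp add: powr_divide powr_minus_divide[symmetric])
    finally show ?thesis by (simp add: mult_ac)
  qed
  have fg: "integral {0..pi} ?g = integral {0..pi} ?f"
  proof -
    have "integral {0..pi} ?g = integral {-pi..0} (\<lambda>s. ?f (s + pi))"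
      using Henstock_Kurzweil_Integration.integral_reflect_real[of pi 0 ?g] by (simp add: add.commute)
    also have "\<dots> = integral {0..pi} ?f"
      using integral_shift_real_ivl[of 0 pi pi ?f] by simp
    finally show ?thesis .
  qed
  have "integral {0..pi} (\<lambda>s. wt N s powr (- q)) \<le> integral {0..pi} (\<lambda>s. ?f s + ?g s)"
  proof (rule integral_le)
    show "(\<lambda>s. wt N s powr (- q)) integrable_on {0..pi}"
      by (intro integrable_continuous_real continuous_on_powr continuous_on_wt continuous_on_id continuous_on_const) (use wt_ge(3)[OF N] in force)
    show "(\<lambda>s. ?f s + ?g s) integrable_on {0..pi}"
      by (intro integrable_continuous_real continuous_on_add cf)
    fix s assume s: "s \<in> {0..pi}"
    show "wt N s powr (- q) \<le> ?f s + ?g s"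
    proof (cases "s \<le> pi / 2")
      case True
      have "?c * s \<le> sin s" using sin_ge_jordan[of s] True s by simp
      then have "wt N s powr (- q) \<le> ?f s"
        using pos[of s] s q by (intro powr_mono2') (auto simp: wt_def)
      then show ?thesis by (smt (verit) powr_ge_zero)
    next
      case False
      have "?c * (pi - s) \<le> sin s" using sin_ge_jordan[of "pi - s"] False s by simp
      then have "wt N s powr (- q) \<le> ?g s"
        using pos[of "pi - s"] s q by (intro powr_mono2') (auto simp: wt_def)
      then show ?thesis by (smt (verit) powr_ge_zero)
    qed
  qed
  also have "\<dots> = integral {0..pi} ?f + integral {0..pi} ?g"
    by (rule Henstock_Kurzweil_Integration.integral_add) (intro integrable_continuous_real cf)+
  also have "\<dots> \<le> 2 * (pi / (2 * (q - 1)) * real N powr (q - 1))" unfolding fg using le1 by linarith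
  also have "\<dots> = pi / (q - 1) * real N powr (q - 1)" using q by (simp add: field_simps)
  finally show ?thesis .
qed

lemma one_plus_powr_le:
  fixes x q :: real assumes "0 \<le> x" "0 \<le> q" shows "(1 + x) powr q \<le> 2 powr q * (1 + x powr q)"
proof (cases "x \<le> 1")
  case True
  have "(1 + x) powr q \<le> 2 powr q" using assms True by (intro powr_mono2) auto
  also have "\<dots> \<le> 2 powr q * (1 + x powr q)" by (simp add: distrib_left)
  finally show ?thesis .
next
  case False
  have "(1 + x) powr q \<le> (2 * x) powr q" using assms False by (intro powr_mono2) auto
  also have "\<dots> = 2 powr q * x powr q" using assms by (simp add: powr_mult)
  also have "\<dots> \<le> 2 powr q * (1 + x powr q)" by (simp add: distrib_left)
  finally show ?thesis .
qed

text \<open>\<open>wt N \<tau>\<close> is compared with \<open>wt m \<theta>\<close> in two moves.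
  Changing the point at scale \<open>m\<close> costs powers of
  \<open>1 + m * sdist \<theta> \<tau>\<close>, absorbed by the decay \<open>e\<close>. Refining the
  scale costs \<open>1 + 1 / (m * wt N \<tau>)\<close>, which is large only near the endpoints and
  integrates to \<open>(N / m) powr (q - 1)\<close>.\<close>

lemma integral_loc_wt_le:
  fixes q e :: real
  assumes q: "q > 1" and e: "e \<ge> q + 2" and m: "m \<ge> 1" "m \<le> N" and \<theta>: "\<theta> \<in> {0..pi}"
  shows "real m * integral {0..pi} (\<lambda>\<tau>. loc e m \<theta> \<tau> * wt N \<tau> powr (- q)) \<le>
    4 powr q * (7 + pi / (q - 1)) * (real N / real m) powr (q - 1) * wt m \<theta> powr (- q)"
proof -
  have N: "N \<ge> 1" using m by simp
  have mp: "real m > 0" using m by simp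
  let ?A = "4 powr q * wt m \<theta> powr (- q)"
  have A: "?A \<ge> 0" by simp
  let ?g = "\<lambda>\<tau>. ?A * (loc 2 m \<theta> \<tau> + real m powr (- q) * wt N \<tau> powr (- q))"
  have cw: "continuous_on {0..pi} (\<lambda>\<tau>. wt N \<tau> powr (- q))"
    by (intro continuous_on_powr continuous_on_wt continuous_on_id continuous_on_const) (use wt_ge(3)[OF N] in force)
  have cl: "continuous_on {0..pi} (\<lambda>\<tau>. loc b m \<theta> \<tau>)" for b by (intro continuous_intros)
  have "integral {0..pi} (\<lambda>\<tau>. loc e m \<theta> \<tau> * wt N \<tau> powr (- q)) \<le> integral {0..pi} ?g"
  proof (rule integral_le)
    show "(\<lambda>\<tau>. loc e m \<theta> \<tau> * wt N \<tau> powr (- q)) integrable_on {0..pi}" "?g integrable_on {0..pi}"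
      by (intro integrable_continuous_real continuous_on_mult continuous_on_add continuous_on_const cw cl)+
    fix \<tau> assume \<tau>: "\<tau> \<in> {0..pi}"
    define u where "u = 1 + real m * sdist \<theta> \<tau>"
    have u: "u \<ge> 1" unfolding u_def by (rule one_plus_sdist_ge1)
    have w: "wt N \<tau> > 0" "wt m \<tau> > 0" "wt m \<theta> > 0" using wt_ge(3) N m(1) \<tau> \<theta> by auto
    have 1: "wt m \<theta> \<le> 2 * wt m \<tau> * u" unfolding u_def by (rule wt_compare[OF m(1) \<tau>])
    have "wt m \<tau> \<le> wt N \<tau> + 1 / real m" by (simp add: wt_def)
    also have "\<dots> = wt N \<tau> * (1 + 1 / (real m * wt N \<tau>))" using w mp by (simp add: field_simps)
    finally have 2: "wt m \<tau> \<le> wt N \<tau> * (1 + 1 / (real m * wt N \<tau>))" .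
    have "wt m \<theta> \<le> 2 * (wt N \<tau> * (1 + 1 / (real m * wt N \<tau>))) * u"
      by (rule order_trans[OF 1]) (use 2 u in \<open>intro mult_right_mono mult_left_mono, auto\<close>)
    then have "1 / wt N \<tau> \<le> 2 * (u * (1 / wt m \<theta>)) * (1 + 1 / (real m * wt N \<tau>))"
      using w by (simp add: field_simps)
    then have "(1 / wt N \<tau>) powr q \<le> (2 * (u * (1 / wt m \<theta>)) * (1 + 1 / (real m * wt N \<tau>))) powr q"
      using w q by (intro powr_mono2) auto
    also have "\<dots> = 2 powr q * (u powr q * (1 / wt m \<theta>) powr q) * (1 + 1 / (real m * wt N \<tau>)) powr q"
      using w u by (simp only: powr_mult)
    also have "\<dots> \<le> 2 powr q * (u powr q * (1 / wt m \<theta>) powr q) * (2 powr q * (1 + (1 / (real m * wt N \<tau>)) powr q))"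
      using w q mp by (intro mult_left_mono one_plus_powr_le) auto
    also have "\<dots> = (2 powr q * 2 powr q) * (1 / wt m \<theta>) powr q * (u powr q * (1 + (1 / (real m * wt N \<tau>)) powr q))"
      by (simp add: mult_ac)
    also have "2 powr q * 2 powr q = (4::real) powr q" by (simp add: powr_mult[symmetric])
    also have "(1 / wt m \<theta>) powr q = wt m \<theta> powr (- q)" by (simp add: powr_minus_divide powr_divide)
    also have "(1 / (real m * wt N \<tau>)) powr q = real m powr (- q) * wt N \<tau> powr (- q)"
      using mp w by (simp add: powr_minus_divide powr_divide powr_mult)
    also have "(1 / wt N \<tau>) powr q = wt N \<tau> powr (- q)" by (simp add: powr_minus_divide powr_divide)
    finally have "loc e m \<theta> \<tau> * wt N \<tau> powr (- q) \<le> loc e m \<theta> \<tau> * (?A * (u powr q * (1 + real m powr (- q) * wt N \<tau> powr (- q))))"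
      by (intro mult_left_mono loc_nonneg)
    also have "\<dots> = ?A * (loc e m \<theta> \<tau> * u powr q * (1 + real m powr (- q) * wt N \<tau> powr (- q)))" by (simp add: mult_ac)
    also have "loc e m \<theta> \<tau> * u powr q = u powr (q - e)"
      unfolding loc_def u_def[symmetric] by (simp add: powr_add[symmetric])
    also have "?A * (u powr (q - e) * (1 + real m powr (- q) * wt N \<tau> powr (- q))) \<le> ?g \<tau>"
    proof (intro mult_left_mono A)
      have "u powr (q - e) \<le> loc 2 m \<theta> \<tau>" unfolding loc_def u_def[symmetric] using u e by (intro powr_mono) auto
      moreover have "u powr (q - e) \<le> 1" using u e powr_mono[of "q - e" 0 u] by simp
      then have "u powr (q - e) * (real m powr (- q) * wt N \<tau> powr (- q)) \<le> real m powr (- q) * wt N \<tau> powr (- q)"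
        by (intro mult_left_le_one_le) auto
      ultimately show "u powr (q - e) * (1 + real m powr (- q) * wt N \<tau> powr (- q)) \<le> loc 2 m \<theta> \<tau> + real m powr (- q) * wt N \<tau> powr (- q)"
        by (simp add: distrib_left)
    qed
    finally show "loc e m \<theta> \<tau> * wt N \<tau> powr (- q) \<le> ?g \<tau>" .
  qed
  also have "integral {0..pi} ?g = ?A * (integral {0..pi} (\<lambda>\<tau>. loc 2 m \<theta> \<tau>) + real m powr (- q) * integral {0..pi} (\<lambda>\<tau>. wt N \<tau> powr (- q)))"
    by (simp, subst Henstock_Kurzweil_Integration.integral_add) (auto intro!: integrable_continuous_real cw cl continuous_on_mult continuous_on_const)
  also have "\<dots> \<le> ?A * (7 / real m + real m powr (- q) * (pi / (q - 1) * real N powr (q - 1)))"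
    by (intro mult_left_mono add_mono A integral_loc_le m(1) \<theta> integral_wt_powr_le q N) auto
  finally have "real m * integral {0..pi} (\<lambda>\<tau>. loc e m \<theta> \<tau> * wt N \<tau> powr (- q)) \<le>
      real m * (?A * (7 / real m + real m powr (- q) * (pi / (q - 1) * real N powr (q - 1))))"
    by (intro mult_left_mono) auto
  also have "\<dots> = ?A * (7 + (real m * real m powr (- q)) * (pi / (q - 1) * real N powr (q - 1)))"
    using mp by (simp add: field_simps)
  also have "real m * real m powr (- q) = real m powr (- (q - 1))"
    using mp powr_add[of "real m" 1 "- q"] by simp
  also have "real m powr (- (q - 1)) * (pi / (q - 1) * real N powr (q - 1))
    = pi / (q - 1) * (real N / real m) powr (q - 1)"
    by (simp add: powr_divide powr_minus_divide del: minus_diff_eq)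
  also have "?A * (7 + pi / (q - 1) * (real N / real m) powr (q - 1)) \<le> ?A * (7 * (real N / real m) powr (q - 1) + pi / (q - 1) * (real N / real m) powr (q - 1))"
  proof (intro mult_left_mono add_right_mono A)
    have "1 \<le> (real N / real m) powr (q - 1)" using m q by (intro ge_one_powr_ge_zero) auto
    then show "7 \<le> 7 * (real N / real m) powr (q - 1)" by simp
  qed
  also have "\<dots> = 4 powr q * (7 + pi / (q - 1)) * (real N / real m) powr (q - 1) * wt m \<theta> powr (- q)"
    by (simp add: algebra_simps)
  finally show ?thesis .
qed

lemma taylor_poly: "\<exists>W::real poly. degree W \<le> r - 1 \<and> (\<forall>t. poly W t = taylor r y S t)"
proof -
  let ?W = "\<Sum>i<r. smult (poly ((pderiv ^^ i) S) y / fact i) ([:- y, 1:] ^ i)"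
  have "degree ?W \<le> r - 1"
  proof (rule degree_sum_le)
    fix i assume i: "i \<in> {..<r}"
    have "degree ([:- y, 1:] ^ i) \<le> i" using degree_power_le[of "[:- y, 1:]" i] by simp
    then show "degree (smult (poly ((pderiv ^^ i) S) y / fact i) ([:- y, 1:] ^ i)) \<le> r - 1"
      using i degree_smult_le[of "poly ((pderiv ^^ i) S) y / fact i" "[:- y, 1:] ^ i"] by simp
  qed simp
  moreover have "poly ?W t = taylor r y S t" for t
    by (simp add: taylor_def poly_sum mult.commute)
  ultimately show ?thesis by blast
qed

lemma sint_add_le:
  assumes "0 < p" "p \<le> 1" "continuous_on {0..pi} F" "continuous_on {0..pi} G"
  shows "sint p (\<lambda>s. F s + G s) \<le> sint p F + sint p G"
proof -
  have "sint p (\<lambda>s. F s + G s) \<le> integral {0..pi} (\<lambda>s. \<bar>F s\<bar> powr p * sin s + \<bar>G s\<bar> powr p * sin s)"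
    unfolding sint_def
  proof (intro integral_le integrable_powr_sin Henstock_Kurzweil_Integration.integrable_add continuous_on_add assms)
    fix s assume s: "s \<in> {0..pi}"
    have "\<bar>F s + G s\<bar> powr p * sin s \<le> (\<bar>F s\<bar> powr p + \<bar>G s\<bar> powr p) * sin s"
      using s assms by (intro mult_right_mono powr_abs_add_le sin_ge_zero) auto
    then show "\<bar>F s + G s\<bar> powr p * sin s \<le> \<bar>F s\<bar> powr p * sin s + \<bar>G s\<bar> powr p * sin s"
      by (simp add: distrib_right)
  qed auto
  also have "\<dots> = sint p F + sint p G"
    unfolding sint_def
    by (rule Henstock_Kurzweil_Integration.integral_add) (auto intro!: integrable_powr_sin assms)
  finally show ?thesis .
qed

text \<open>\<open>taylor_estimate\<close> needs a centre that is not nearer than about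
  \<open>1 / m\<close> to an endpoint. Clamping \<open>\<theta>\<close> to
  \<open>[1 / m, pi - 1 / m]\<close> provides one and moves \<open>\<theta>\<close> by at most
  \<open>1 / m\<close>, so decay factors at scale \<open>m\<close> change by bounded factors
  only.\<close>

lemma clamp_angle:
  assumes m: "m \<ge> 1" and \<theta>: "\<theta> \<in> {0..pi}"
  shows "\<exists>\<eta>\<in>{0..pi}. real m * cos (\<eta> / 2) \<ge> 1 / 4 \<and> real m * sin (\<eta> / 2) \<ge> 1 / 4 \<and>
    1 + real m * sdist \<theta> \<eta> \<le> 2"
proof -
  let ?h = "1 / real m"
  define \<eta> where "\<eta> = max ?h (min \<theta> (pi - ?h))"
  have h: "0 < ?h" "?h \<le> 1" using m by auto
  have h2: "2 / real m \<le> pi" using h pi_gt3 by linarith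
  have \<eta>: "?h \<le> \<eta>" "\<eta> \<le> pi - ?h" "\<bar>\<theta> - \<eta>\<bar> \<le> ?h"
    using h h2 pi_gt3 \<theta> unfolding \<eta>_def by (auto simp: min_def max_def abs_if)
  have s: "real m * sin (x / 2) \<ge> 1 / 4" if "?h \<le> x" "x \<le> pi" for x
  proof -
    have "2 * (x / 2) / pi \<le> sin (x / 2)" using that order_trans[OF less_imp_le[OF h(1)] that(1)] by (intro sin_ge_jordan) auto
    moreover have "?h / 4 \<le> 2 * (x / 2) / pi"
    proof -
      have "?h / 4 \<le> x / 4" using that by simp
      also have "\<dots> \<le> x / pi" using that h pi_less_4 order_trans[OF less_imp_le[OF h(1)] that(1)] by (intro divide_left_mono) auto
      finally show ?thesis by simp
    qed
    ultimately have "?h / 4 \<le> sin (x / 2)" by linarith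
    then have "real m * (?h / 4) \<le> real m * sin (x / 2)" by (intro mult_left_mono) auto
    then show ?thesis using m by simp
  qed
  have "cos (\<eta> / 2) = sin ((pi - \<eta>) / 2)" by (simp add: diff_divide_distrib sin_diff)
  then have "real m * cos (\<eta> / 2) \<ge> 1 / 4" using s[of "pi - \<eta>"] \<eta> h by simp
  moreover have "real m * sin (\<eta> / 2) \<ge> 1 / 4" using s[of \<eta>] \<eta> h by simp
  moreover have "1 + real m * sdist \<theta> \<eta> \<le> 2"
  proof -
    have "\<bar>\<theta> - \<eta>\<bar> / 2 \<le> \<bar>\<theta> - \<eta>\<bar>" by simp
    then have "sdist \<theta> \<eta> \<le> ?h" using order_trans[OF sdist_le[of \<theta> \<eta>]] \<eta>(3) order_trans by blast
    then have "real m * sdist \<theta> \<eta> \<le> real m * ?h" by (intro mult_left_mono) auto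
    then show ?thesis using m by simp
  qed
  moreover have "\<eta> \<in> {0..pi}" using \<eta> h by auto
  ultimately show ?thesis by blast
qed

lemma powr_le_imp_le:
  fixes x B p :: real
  assumes "0 \<le> x" "0 < p" "x powr p \<le> B" shows "x \<le> B powr (1 / p)"
proof -
  have "x = (x powr p) powr (1 / p)" using assms by (simp add: powr_powr)
  also have "\<dots> \<le> B powr (1 / p)" using assms by (intro powr_mono2) auto
  finally show ?thesis .
qed

text \<open>\<open>T\<close> does not depend on \<open>\<theta>\<close>, but at each
  \<open>\<theta>\<close> it is compared with a \<open>W\<close> of its own: the Taylor polynomial
  of \<open>S\<close> at the clamped angle, which the operator reproduces because its degree is at
  most \<open>r - 1\<close>. Both \<open>S - W\<close> and \<open>T - W\<close> are then controlled
  by \<open>taylor_estimate\<close>, the former directly and the latter under the integral of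
  \<open>jackson_operator\<close>.\<close>

lemma jackson_pointwise:
  fixes p :: real
  assumes p: "0 < p" "p < 1" and r: "r \<ge> 1"
  shows "\<exists>C>0. \<exists>M\<ge>1. \<forall>m N S. 1 \<le> m \<longrightarrow> m \<le> N \<longrightarrow> degree S \<le> N \<longrightarrow>
    (\<exists>T. degree T \<le> 2 * (M * (m - 1)) + (r - 1) \<and>
      (\<forall>\<theta>\<in>{0..pi}. \<bar>poly S (cos \<theta>) - poly T (cos \<theta>)\<bar> powr p * sin \<theta> \<le>
        C * real m powr (- (real (r - 1) * p)) * real N powr (1 - p) * (real N / real m) powr (1 - p) *
        integral {0..pi} (\<lambda>s. \<bar>gtrig r ((pderiv ^^ r) S) s\<bar> powr p * wt N s * loc 2 m \<theta> s)))"
proof -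
  define b where "b = 2 + 1 + 2 * real (r - 1) * p"
  have b: "b \<ge> 3" unfolding b_def using p by simp
  obtain C1 where C1: "C1 > 0" "\<And>m N S \<eta> \<tau>. 1 \<le> m \<Longrightarrow> m \<le> N \<Longrightarrow> degree S \<le> N \<Longrightarrow> \<eta> \<in> {0..pi} \<Longrightarrow> \<tau> \<in> {0..pi} \<Longrightarrow>
     real m * cos (\<eta> / 2) \<ge> 1 / 4 \<Longrightarrow> real m * sin (\<eta> / 2) \<ge> 1 / 4 \<Longrightarrow>
     \<bar>poly S (cos \<tau>) - taylor r (cos \<eta>) S (cos \<tau>)\<bar> powr p \<le>
       C1 * real m powr (- (real (r - 1) * p)) * real N powr (1 - p)
       * integral {0..pi} (\<lambda>s. \<bar>gtrig r ((pderiv ^^ r) S) s\<bar> powr p * wt N s * loc 2 m \<eta> s)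
       * (1 + real m * sdist \<eta> \<tau>) powr b / wt N \<tau>"
    using taylor_estimate[OF p _ r, of 2] unfolding b_def by auto
  define q where "q = 1 / p"
  have q: "q > 1" unfolding q_def using p by simp
  \<comment> \<open>Under the operator the Taylor error grows with exponent \<open>b * q\<close> and
    carries \<open>wt N powr (- q)\<close>. The decay \<open>2 * M\<close> of the kernel must absorb
    this growth and leave the exponent \<open>q + 2\<close> that \<open>integral_loc_wt_le\<close>
    requires.\<close>
  define M where "M = Suc (nat \<lceil>b * q + q + 2\<rceil>)"
  have M: "M \<ge> 1" "b * q + q + 2 \<le> 2 * real M" unfolding M_def by (auto, linarith)
  define C2 where "C2 = 4 powr q * (7 + pi / (q - 1))"
  have C2: "C2 > 0" unfolding C2_def using q by (intro mult_pos_pos add_pos_pos) auto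
  define K where "K = 2 * real (M + r) * 2 powr (2 * real M) * C2"
  have K: "K > 0" unfolding K_def using M C2 by simp
  define C where "C = 4 * C1 * 2 powr b * (1 + K powr p)"
  have Cpos: "C > 0" unfolding C_def using C1 K by (intro mult_pos_pos add_pos_nonneg) auto
  show ?thesis
  proof (rule exI[of _ C], rule conjI[OF Cpos], rule exI[of _ M], rule conjI[OF M(1)], intro allI impI)
    fix m N :: nat and S :: "real poly" assume m: "1 \<le> m" and mN: "m \<le> N" and S: "degree S \<le> N"
    have N: "N \<ge> 1" using m mN by simp
    define L where "L = M * (m - 1) + (r - 1)"
    obtain T where T: "degree T \<le> 2 * (M * (m - 1)) + (r - 1)" "\<And>W \<theta>. degree W \<le> r - 1 \<Longrightarrow> \<theta> \<in> {0..pi} \<Longrightarrow>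
      \<bar>poly T (cos \<theta>) - poly W (cos \<theta>)\<bar> \<le> real (2 * L + 1) * 2 powr (2 * real M) *
        integral {0..pi} (\<lambda>\<tau>. \<bar>poly S (cos \<tau>) - poly W (cos \<tau>)\<bar> * loc (2 * real M) m \<theta> \<tau>)"
      using jackson_operator[OF m r, of M S] unfolding L_def by blast
    define G where "G = gtrig r ((pderiv ^^ r) S)"
    note cG = etrig_continuous[OF etrig_gtrig_pderiv[OF S, of r], folded G_def]
    define Z where "Z \<theta> = integral {0..pi} (\<lambda>s. \<bar>G s\<bar> powr p * wt N s * loc 2 m \<theta> s)" for \<theta>
    have intg: "(\<lambda>s. \<bar>G s\<bar> powr p * wt N s * loc 2 m x s) integrable_on {0..pi}" for x
      by (intro integrable_continuous_real continuous_on_mult continuous_on_abs_powr cG p continuous_on_wt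
          continuous_on_loc continuous_on_const continuous_on_id)
    have Z0: "Z \<theta> \<ge> 0" for \<theta> unfolding Z_def
      by (rule Henstock_Kurzweil_Integration.integral_nonneg)
        (auto intro!: intg mult_nonneg_nonneg wt_nonneg loc_nonneg)
    define Y where "Y = C1 * real m powr (- (real (r - 1) * p)) * real N powr (1 - p)"
    have Y: "Y \<ge> 0" unfolding Y_def using C1 by simp
    show "\<exists>T. degree T \<le> 2 * (M * (m - 1)) + (r - 1) \<and>
      (\<forall>\<theta>\<in>{0..pi}. \<bar>poly S (cos \<theta>) - poly T (cos \<theta>)\<bar> powr p * sin \<theta> \<le>
        C * real m powr (- (real (r - 1) * p)) * real N powr (1 - p) * (real N / real m) powr (1 - p) *
        integral {0..pi} (\<lambda>s. \<bar>gtrig r ((pderiv ^^ r) S) s\<bar> powr p * wt N s * loc 2 m \<theta> s))"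
    proof (intro exI[of _ T] conjI T(1) ballI)
      fix \<theta> assume \<theta>: "\<theta> \<in> {0..pi}"
      obtain \<eta> where \<eta>: "\<eta> \<in> {0..pi}" "real m * cos (\<eta> / 2) \<ge> 1 / 4" "real m * sin (\<eta> / 2) \<ge> 1 / 4"
        "1 + real m * sdist \<theta> \<eta> \<le> 2"
        using clamp_angle[OF m \<theta>] by blast
      obtain W where W: "degree W \<le> r - 1" "\<And>t. poly W t = taylor r (cos \<eta>) S t" using taylor_poly by blast
      let ?R = "\<lambda>\<tau>. poly S (cos \<tau>) - poly W (cos \<tau>)"
      \<comment> \<open>The factor \<open>2 powr b\<close> pays for measuring the growth from
        \<open>\<theta>\<close> instead of \<open>\<eta>\<close>.\<close>
      define B where "B = Y * Z \<eta> * 2 powr b"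
      have B: "B \<ge> 0" unfolding B_def using Y Z0 by (intro mult_nonneg_nonneg) auto
      have om: "1 + real m * sdist \<eta> \<tau> \<le> 2 * (1 + real m * sdist \<theta> \<tau>)" for \<tau>
      proof -
        have "1 + real m * sdist \<eta> \<tau> \<le> (1 + real m * sdist \<eta> \<theta>) * (1 + real m * sdist \<theta> \<tau>)"
          by (rule sdist_submult)
        also have "\<dots> \<le> 2 * (1 + real m * sdist \<theta> \<tau>)"
          using \<eta>(4) one_plus_sdist_ge1[of m \<theta> \<tau>] by (intro mult_right_mono) (auto simp: sdist_commute)
        finally show ?thesis .
      qed
      have om2: "1 + real m * sdist \<theta> \<tau> \<le> 2 * (1 + real m * sdist \<eta> \<tau>)" for \<tau>
      proof -
        have "1 + real m * sdist \<theta> \<tau> \<le> (1 + real m * sdist \<theta> \<eta>) * (1 + real m * sdist \<eta> \<tau>)"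
          by (rule sdist_submult)
        also have "\<dots> \<le> 2 * (1 + real m * sdist \<eta> \<tau>)"
          using \<eta>(4) one_plus_sdist_ge1[of m \<eta> \<tau>] by (intro mult_right_mono) auto
        finally show ?thesis .
      qed
      have R: "\<bar>?R \<tau>\<bar> powr p \<le> B * (1 + real m * sdist \<theta> \<tau>) powr b / wt N \<tau>" if \<tau>: "\<tau> \<in> {0..pi}" for \<tau>
      proof -
        have "\<bar>?R \<tau>\<bar> powr p \<le> Y * Z \<eta> * (1 + real m * sdist \<eta> \<tau>) powr b / wt N \<tau>"
          unfolding W(2) Y_def Z_def G_def by (rule C1(2)[OF m mN S \<eta>(1) \<tau> \<eta>(2,3)])
        also have "\<dots> \<le> Y * Z \<eta> * (2 * (1 + real m * sdist \<theta> \<tau>)) powr b / wt N \<tau>"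
          using om[of \<tau>] one_plus_sdist_ge1[of m \<eta> \<tau>] b wt_nonneg[OF \<tau>, of N] Y Z0[of \<eta>]
          by (intro divide_right_mono mult_left_mono powr_mono2 mult_nonneg_nonneg) auto
        also have "\<dots> = B * (1 + real m * sdist \<theta> \<tau>) powr b / wt N \<tau>"
          unfolding B_def by (simp only: powr_mult mult.assoc)
        finally show ?thesis .
      qed
      have R': "\<bar>?R \<tau>\<bar> * loc (2 * real M) m \<theta> \<tau> \<le> B powr q * (loc (2 * real M - b * q) m \<theta> \<tau> * wt N \<tau> powr (- q))"
        if \<tau>: "\<tau> \<in> {0..pi}" for \<tau>
      proof -
        have u: "0 < 1 + real m * sdist \<theta> \<tau>" using one_plus_sdist_ge1[of m \<theta> \<tau>] by linarith
        have "\<bar>?R \<tau>\<bar> \<le> (B * (1 + real m * sdist \<theta> \<tau>) powr b / wt N \<tau>) powr q"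
          unfolding q_def by (rule powr_le_imp_le) (use R[OF \<tau>] p in auto)
        also have "\<dots> = B powr q * (1 + real m * sdist \<theta> \<tau>) powr (b * q) * wt N \<tau> powr (- q)"
          by (simp add: powr_mult powr_divide powr_powr powr_minus_divide)
        finally have "\<bar>?R \<tau>\<bar> * loc (2 * real M) m \<theta> \<tau> \<le> B powr q * (1 + real m * sdist \<theta> \<tau>) powr (b * q) * wt N \<tau> powr (- q) * loc (2 * real M) m \<theta> \<tau>"
          by (intro mult_right_mono loc_nonneg)
        also have "\<dots> = B powr q * (((1 + real m * sdist \<theta> \<tau>) powr (b * q) * loc (2 * real M) m \<theta> \<tau>) * wt N \<tau> powr (- q))"
          by (simp only: mult_ac)
        also have "(1 + real m * sdist \<theta> \<tau>) powr (b * q) * loc (2 * real M) m \<theta> \<tau> = loc (2 * real M - b * q) m \<theta> \<tau>"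
          unfolding loc_def by (simp add: powr_add[symmetric])
        finally show ?thesis .
      qed
      have cw: "continuous_on {0..pi} (\<lambda>\<tau>. wt N \<tau> powr (- q))"
        by (intro continuous_on_powr continuous_on_wt continuous_on_id continuous_on_const) (use wt_ge(3)[OF N] in force)
      have "\<bar>poly T (cos \<theta>) - poly W (cos \<theta>)\<bar> \<le> real (2 * L + 1) * 2 powr (2 * real M) *
        integral {0..pi} (\<lambda>\<tau>. \<bar>?R \<tau>\<bar> * loc (2 * real M) m \<theta> \<tau>)"
        by (rule T(2)[OF W(1) \<theta>])
      also have "\<dots> \<le> real (2 * L + 1) * 2 powr (2 * real M) *
        integral {0..pi} (\<lambda>\<tau>. B powr q * (loc (2 * real M - b * q) m \<theta> \<tau> * wt N \<tau> powr (- q)))"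
        by (intro mult_left_mono integral_le R' integrable_continuous_real continuous_on_mult continuous_on_const cw)
          (auto intro!: continuous_intros)
      also have "\<dots> = real (2 * L + 1) * 2 powr (2 * real M) * B powr q *
        integral {0..pi} (\<lambda>\<tau>. loc (2 * real M - b * q) m \<theta> \<tau> * wt N \<tau> powr (- q))" by simp
      also have "\<dots> \<le> (2 * real (M + r) * real m) * 2 powr (2 * real M) * B powr q *
        integral {0..pi} (\<lambda>\<tau>. loc (2 * real M - b * q) m \<theta> \<tau> * wt N \<tau> powr (- q))"
      proof (intro mult_right_mono)
        have "2 * L + 1 \<le> 2 * ((M + r) * m)"
        proof -
          have "M * (m - 1) \<le> M * m" by (rule mult_le_mono2) simp
          moreover have "r \<le> r * m" using m by simp
          ultimately have "L + 1 \<le> (M + r) * m" unfolding L_def add_mult_distrib using r by linarith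
          then show ?thesis by linarith
        qed
        then have "real (2 * L + 1) \<le> real (2 * ((M + r) * m))" by (simp only: of_nat_le_iff)
        then show "real (2 * L + 1) \<le> 2 * real (M + r) * real m" by (simp only: of_nat_mult of_nat_numeral mult.assoc)
        show "0 \<le> integral {0..pi} (\<lambda>\<tau>. loc (2 * real M - b * q) m \<theta> \<tau> * wt N \<tau> powr (- q))"
          by (rule Henstock_Kurzweil_Integration.integral_nonneg)
            (auto intro!: integrable_continuous_real continuous_on_mult cw continuous_on_loc continuous_on_const continuous_on_id mult_nonneg_nonneg loc_nonneg)
      qed auto
      also have "\<dots> = 2 * real (M + r) * 2 powr (2 * real M) * B powr q *
        (real m * integral {0..pi} (\<lambda>\<tau>. loc (2 * real M - b * q) m \<theta> \<tau> * wt N \<tau> powr (- q)))" by (simp only: mult_ac)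
      also have "\<dots> \<le> 2 * real (M + r) * 2 powr (2 * real M) * B powr q *
        (C2 * (real N / real m) powr (q - 1) * wt m \<theta> powr (- q))"
        unfolding C2_def using M(2) by (intro mult_left_mono integral_loc_wt_le q m mN \<theta>) auto
      also have "\<dots> = K * B powr q * (real N / real m) powr (q - 1) * wt m \<theta> powr (- q)"
        unfolding K_def by (simp only: mult_ac)
      \<comment> \<open>Back to \<open>p\<close>-th powers: since \<open>q * p = 1\<close> and
        \<open>(q - 1) * p = 1 - p\<close>, both \<open>B\<close> and
        \<open>1 / wt m \<theta>\<close> return to the first power, and the loss
        \<open>(N / m) powr (1 - p)\<close> remains.\<close>
      finally have "\<bar>poly T (cos \<theta>) - poly W (cos \<theta>)\<bar> powr p \<le> (K * B powr q * (real N / real m) powr (q - 1) * wt m \<theta> powr (- q)) powr p"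
        using p by (intro powr_mono2) auto
      also have "\<dots> = K powr p * B powr (q * p) * (real N / real m) powr ((q - 1) * p) * wt m \<theta> powr (- (q * p))"
        by (simp only: powr_mult powr_powr) simp
      also have "q * p = 1" unfolding q_def using p by simp
      also have "(q - 1) * p = 1 - p" unfolding q_def using p by (simp add: field_simps)
      finally have TW: "\<bar>poly T (cos \<theta>) - poly W (cos \<theta>)\<bar> powr p \<le> K powr p * B * (real N / real m) powr (1 - p) / wt m \<theta>"
        using B wt_ge(3)[OF m \<theta>] by (simp add: powr_minus_divide)
      have SW: "\<bar>?R \<theta>\<bar> powr p \<le> B / wt N \<theta>" using R[OF \<theta>] by (simp add: sdist_def)
      have s0: "sin \<theta> \<ge> 0" using \<theta> by (auto intro: sin_ge_zero)
      have "\<bar>poly S (cos \<theta>) - poly T (cos \<theta>)\<bar> powr p = \<bar>?R \<theta> + (poly W (cos \<theta>) - poly T (cos \<theta>))\<bar> powr p" by simp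
      also have "\<dots> \<le> \<bar>?R \<theta>\<bar> powr p + \<bar>poly W (cos \<theta>) - poly T (cos \<theta>)\<bar> powr p"
        by (rule powr_abs_add_le) (use p in auto)
      also have "\<dots> \<le> B / wt N \<theta> + K powr p * B * (real N / real m) powr (1 - p) / wt m \<theta>"
        using SW TW by (simp only: abs_minus_commute[of "poly W (cos \<theta>)"] add_mono)
      finally have "\<bar>poly S (cos \<theta>) - poly T (cos \<theta>)\<bar> powr p * sin \<theta> \<le> (B / wt N \<theta> + K powr p * B * (real N / real m) powr (1 - p) / wt m \<theta>) * sin \<theta>"
        by (intro mult_right_mono s0)
      also have "\<dots> = B * (sin \<theta> / wt N \<theta>) + K powr p * B * (real N / real m) powr (1 - p) * (sin \<theta> / wt m \<theta>)"
        by (simp add: distrib_right)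
      also have "\<dots> \<le> B * 1 + K powr p * B * (real N / real m) powr (1 - p) * 1"
        using wt_ge(2,3)[OF m \<theta>] wt_ge(2,3)[OF N \<theta>] B by (intro add_mono mult_left_mono) auto
      also have "\<dots> \<le> B * (real N / real m) powr (1 - p) + K powr p * B * (real N / real m) powr (1 - p)"
      proof -
        have "1 \<le> (real N / real m) powr (1 - p)" using m mN p by (intro ge_one_powr_ge_zero) auto
        then have "B * 1 \<le> B * (real N / real m) powr (1 - p)" using B by (intro mult_left_mono) auto
        then show ?thesis by simp
      qed
      also have "\<dots> = (1 + K powr p) * 2 powr b * Y * (real N / real m) powr (1 - p) * Z \<eta>"
        unfolding B_def by (simp add: algebra_simps)
      \<comment> \<open>The centre returns from \<open>\<eta>\<close> to \<open>\<theta>\<close>;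
        the quantities \<open>1 + m * sdist\<close> differ by a factor of at most 2, so
        \<open>loc 2\<close> changes by at most 4.\<close>
      also have "\<dots> \<le> (1 + K powr p) * 2 powr b * Y * (real N / real m) powr (1 - p) * (4 * Z \<theta>)"
      proof (intro mult_left_mono)
        have "Z \<eta> \<le> integral {0..pi} (\<lambda>s. 4 * (\<bar>G s\<bar> powr p * wt N s * loc 2 m \<theta> s))"
          unfolding Z_def
        proof (intro integral_le intg integrable_on_mult_right)
          fix s assume s: "s \<in> {0..pi}"
          have "(2 * (1 + real m * sdist \<eta> s)) powr (-2) \<le> (1 + real m * sdist \<theta> s) powr (-2)"
            using om2[of s] one_plus_sdist_ge1[of m \<theta> s] by (intro powr_mono2') auto
          moreover have "(2 * (1 + real m * sdist \<eta> s)) powr (-2) = loc 2 m \<eta> s / 4"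
            unfolding loc_def by (simp only: powr_mult) (simp add: powr_minus_divide)
          ultimately have "loc 2 m \<eta> s \<le> 4 * loc 2 m \<theta> s"
            by (simp add: loc_def)
          then have "\<bar>G s\<bar> powr p * wt N s * loc 2 m \<eta> s \<le> \<bar>G s\<bar> powr p * wt N s * (4 * loc 2 m \<theta> s)"
            using s by (intro mult_left_mono mult_nonneg_nonneg wt_nonneg) auto
          then show "\<bar>G s\<bar> powr p * wt N s * loc 2 m \<eta> s \<le> 4 * (\<bar>G s\<bar> powr p * wt N s * loc 2 m \<theta> s)"
            by (simp only: mult_ac)
        qed
        then show "Z \<eta> \<le> 4 * Z \<theta>" by (simp add: Z_def)
      qed (use Y in auto)
      also have "\<dots> = C * real m powr (- (real (r - 1) * p)) * real N powr (1 - p) * (real N / real m) powr (1 - p) * Z \<theta>"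
        unfolding C_def Y_def by (simp only: mult_ac)
      finally show "\<bar>poly S (cos \<theta>) - poly T (cos \<theta>)\<bar> powr p * sin \<theta> \<le>
        C * real m powr (- (real (r - 1) * p)) * real N powr (1 - p) * (real N / real m) powr (1 - p) *
        integral {0..pi} (\<lambda>s. \<bar>gtrig r ((pderiv ^^ r) S) s\<bar> powr p * wt N s * loc 2 m \<theta> s)"
        unfolding Z_def G_def .
    qed
  qed
qed

text \<open>Integration over \<open>\<theta>\<close> removes the localisation and gains
  \<open>1 / m\<close>. Then \<open>1 / m\<close> and the factors of the pointwise estimate combine
  to \<open>real m powr (- (real r * p))\<close> times \<open>(N / m) powr (2 - 2 * p)\<close>, and
  \<open>m\<close> is comparable with \<open>n\<close>.\<close>

lemma jackson_sint:
  fixes p :: real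
  assumes p: "0 < p" "p < 1" and r: "r \<ge> 1"
  shows "\<exists>C>0. \<forall>n N S. r \<le> n \<longrightarrow> n \<le> N \<longrightarrow> degree S \<le> N \<longrightarrow>
    (\<exists>T. degree T \<le> n \<and> sint p (gtrig 0 (S - T)) \<le>
        C * real n powr (- (real r * p)) * (real N / real n) powr (2 - 2 * p) * sint p (gtrig r ((pderiv ^^ r) S)))"
proof -
  obtain C1 M where C1: "C1 > 0" and M: "M \<ge> 1" and J: "\<And>m N S. 1 \<le> m \<Longrightarrow> m \<le> N \<Longrightarrow> degree S \<le> N \<Longrightarrow>
    (\<exists>T. degree T \<le> 2 * (M * (m - 1)) + (r - 1) \<and>
      (\<forall>\<theta>\<in>{0..pi}. \<bar>poly S (cos \<theta>) - poly T (cos \<theta>)\<bar> powr p * sin \<theta> \<le>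
        C1 * real m powr (- (real (r - 1) * p)) * real N powr (1 - p) * (real N / real m) powr (1 - p) *
        integral {0..pi} (\<lambda>s. \<bar>gtrig r ((pderiv ^^ r) S) s\<bar> powr p * wt N s * loc 2 m \<theta> s)))"
    using jackson_pointwise[OF p r] by blast
  obtain C2 where C2: "C2 > 0" "\<And>n G. n \<ge> 1 \<Longrightarrow> etrig n G \<Longrightarrow> wint n p G \<le> C2 * sint p G"
    using wint_le_sint[OF p] by blast
  define \<kappa> where "\<kappa> = 2 * M + r"
  have kap: "\<kappa> \<ge> 1" unfolding \<kappa>_def using r by simp
  define C where "C = 7 * C1 * C2 * real \<kappa> powr (real r * p) * real \<kappa> powr (2 - 2 * p)"
  have Cpos: "C > 0" unfolding C_def using C1 C2 kap by simp
  show ?thesis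
  proof (rule exI[of _ C], rule conjI[OF Cpos], intro allI impI)
    fix n N :: nat and S :: "real poly" assume n: "r \<le> n" and nN: "n \<le> N" and S: "degree S \<le> N"
    \<comment> \<open>The largest \<open>m\<close> for which the degree bound of the operator,
      \<open>2 * (M * (m - 1)) + (r - 1)\<close>, does not exceed \<open>n\<close>; its maximality
      gives \<open>n \<le> \<kappa> * m\<close>.\<close>
    define m where "m = (n - (r - 1)) div (2 * M) + 1"
    have m1: "m \<ge> 1" unfolding m_def by simp
    have deg: "2 * (M * (m - 1)) + (r - 1) \<le> n"
    proof -
      have "(2 * M) * ((n - (r - 1)) div (2 * M)) \<le> n - (r - 1)" by (rule times_div_less_eq_dividend)
      moreover have "m - 1 = (n - (r - 1)) div (2 * M)" unfolding m_def by simp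
      ultimately have "2 * (M * (m - 1)) \<le> n - (r - 1)" by (simp only: mult.assoc)
      then show ?thesis using n by linarith
    qed
    have mn: "m \<le> n"
    proof -
      have "(n - (r - 1)) div (2 * M) \<le> n div 2"
        using M by (intro order_trans[OF div_le_mono2[of 2 "2 * M"] div_le_mono]) auto
      then show ?thesis unfolding m_def using n r by linarith
    qed
    have nm: "n \<le> \<kappa> * m"
    proof -
      have "n - (r - 1) < (2 * M) * m"
        unfolding m_def using M dividend_less_times_div[of "2 * M" "n - (r - 1)"] by simp
      moreover have "r - 1 \<le> r * m" using m1 by (metis diff_le_self le_trans mult.right_neutral mult_le_mono2)
      ultimately show ?thesis unfolding \<kappa>_def add_mult_distrib using n by linarith
    qed
    have mN: "m \<le> N" using mn nN by simp
    have N: "N \<ge> 1" using m1 mN by simp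
    define G where "G = gtrig r ((pderiv ^^ r) S)"
    have G: "etrig N G" unfolding G_def by (rule etrig_gtrig_pderiv[OF S])
    note cG = etrig_continuous[OF G]
    have sG: "0 \<le> sint p G" by (rule sint_nonneg[OF cG p(1)])
    obtain T where T: "degree T \<le> 2 * (M * (m - 1)) + (r - 1)"
      "\<And>\<theta>. \<theta> \<in> {0..pi} \<Longrightarrow> \<bar>poly S (cos \<theta>) - poly T (cos \<theta>)\<bar> powr p * sin \<theta> \<le>
        C1 * real m powr (- (real (r - 1) * p)) * real N powr (1 - p) * (real N / real m) powr (1 - p) *
        integral {0..pi} (\<lambda>s. \<bar>G s\<bar> powr p * wt N s * loc 2 m \<theta> s)"
      using J[OF m1 mN S] unfolding G_def by blast
    let ?Y = "C1 * real m powr (- (real (r - 1) * p)) * real N powr (1 - p) * (real N / real m) powr (1 - p)"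
    have Y: "?Y \<ge> 0" using C1 by simp
    have ci: "continuous_on {0..pi} (\<lambda>\<sigma>. integral {0..pi} (\<lambda>s. \<bar>G s\<bar> powr p * wt N s * loc 2 m \<sigma> s))"
    proof -
      have "continuous_on {0..pi} (\<lambda>\<sigma>. integral (cbox 0 pi) (\<lambda>s. \<bar>G s\<bar> powr p * wt N s * loc 2 m \<sigma> s))"
        by (rule integral_continuous_on_param)
          (auto simp: case_prod_unfold intro!: continuous_on_mult continuous_on_loc continuous_on_wt continuous_on_fst continuous_on_snd
            continuous_on_id continuous_on_compose2[OF continuous_on_abs_powr[OF cG[of UNIV] p(1)]])
      then show ?thesis by (simp add: box_real)
    qed
    have "sint p (gtrig 0 (S - T)) \<le> integral {0..pi} (\<lambda>\<theta>. ?Y * integral {0..pi} (\<lambda>s. \<bar>G s\<bar> powr p * wt N s * loc 2 m \<theta> s))"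
      unfolding sint_def
    proof (intro integral_le integrable_powr_sin p integrable_continuous_real continuous_on_mult continuous_on_const ci)
      show "continuous_on {0..pi} (gtrig 0 (S - T))" unfolding gtrig_def by (intro continuous_intros)
      fix \<theta> assume "\<theta> \<in> {0..pi}"
      from T(2)[OF this] show "\<bar>gtrig 0 (S - T) \<theta>\<bar> powr p * sin \<theta> \<le> ?Y * integral {0..pi} (\<lambda>s. \<bar>G s\<bar> powr p * wt N s * loc 2 m \<theta> s)"
        by (simp add: gtrig_def)
    qed auto
    also have "\<dots> = ?Y * integral {0..pi} (\<lambda>\<theta>. integral {0..pi} (\<lambda>s. \<bar>G s\<bar> powr p * wt N s * loc 2 m \<theta> s))" by simp
    also have "\<dots> \<le> ?Y * (7 / real m * wint N p G)"
      unfolding wint_def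
      by (intro mult_left_mono integral_loc_swap_le m1 Y)
        (auto intro!: continuous_on_mult continuous_on_abs_powr cG p continuous_on_wt continuous_on_id mult_nonneg_nonneg wt_nonneg)
    also have "\<dots> \<le> ?Y * (7 / real m * (C2 * sint p G))"
      using Y by (intro mult_left_mono C2(2) N G) auto
    also have "\<dots> = 7 * C1 * C2 * (real m powr (- (real (r - 1) * p)) * (1 / real m) * (real N powr (1 - p) * (real N / real m) powr (1 - p))) * sint p G"
      by simp
    also have "real m powr (- (real (r - 1) * p)) * (1 / real m) * (real N powr (1 - p) * (real N / real m) powr (1 - p))
       = real m powr (- (real r * p)) * (real N / real m) powr (2 - 2 * p)"
    proof -
      have mp: "real m > 0" using m1 by simp
      have "real m powr (- (real (r - 1) * p)) * (1 / real m) = real m powr (- (real (r - 1) * p) - 1)"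
        using mp by (simp add: powr_diff)
      also have "- (real (r - 1) * p) - 1 = - (real r * p) + (p - 1)" using r by (simp add: of_nat_diff algebra_simps)
      also have "real m powr (- (real r * p) + (p - 1)) = real m powr (- (real r * p)) * real m powr (- (1 - p))"
        by (simp only: powr_add minus_diff_eq)
      also have "real m powr (- (1 - p)) = 1 / real m powr (1 - p)" by (simp only: powr_minus_divide)
      finally have 1: "real m powr (- (real (r - 1) * p)) * (1 / real m) = real m powr (- (real r * p)) * (1 / real m powr (1 - p))" .
      have "1 / real m powr (1 - p) * real N powr (1 - p) = (real N / real m) powr (1 - p)" by (simp add: powr_divide)
      moreover have "(real N / real m) powr (1 - p) * (real N / real m) powr (1 - p) = (real N / real m) powr (2 - 2 * p)"
        by (simp add: powr_add[symmetric])
      moreover have "a * i * (v * w) = a * ((i * v) * w)" for a i v w :: real by (simp only: mult_ac)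
      ultimately show ?thesis unfolding 1 by (simp only:)
    qed
    also have "7 * C1 * C2 * (real m powr (- (real r * p)) * (real N / real m) powr (2 - 2 * p)) * sint p G
      \<le> 7 * C1 * C2 * ((real \<kappa> powr (real r * p) * real n powr (- (real r * p))) * (real \<kappa> powr (2 - 2 * p) * (real N / real n) powr (2 - 2 * p))) * sint p G"
    proof (intro mult_right_mono mult_left_mono mult_mono sG)
      have nr: "real n \<le> real \<kappa> * real m" using nm by (metis of_nat_le_iff of_nat_mult)
      have mp: "real m > 0" "real n > 0" "real \<kappa> > 0" using m1 mn kap by auto
      have "real n / real \<kappa> \<le> real m" using nr mp by (simp add: field_simps)
      then have "real m powr (- (real r * p)) \<le> (real n / real \<kappa>) powr (- (real r * p))"
        using mp p by (intro powr_mono2') auto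
      also have "\<dots> = real \<kappa> powr (real r * p) * real n powr (- (real r * p))"
        by (simp add: powr_divide powr_minus_divide)
      finally show "real m powr (- (real r * p)) \<le> real \<kappa> powr (real r * p) * real n powr (- (real r * p))" .
      have "real N / real m \<le> real \<kappa> * (real N / real n)" using nr mp by (simp add: field_simps mult_mono)
      then have "(real N / real m) powr (2 - 2 * p) \<le> (real \<kappa> * (real N / real n)) powr (2 - 2 * p)"
        using p by (intro powr_mono2) auto
      then show "(real N / real m) powr (2 - 2 * p) \<le> real \<kappa> powr (2 - 2 * p) * (real N / real n) powr (2 - 2 * p)"
        by (simp only: powr_mult)
    qed (use C1 C2 in auto)
    also have "\<dots> = C * real n powr (- (real r * p)) * (real N / real n) powr (2 - 2 * p) * sint p G"
      unfolding C_def by (simp only: mult_ac)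
    finally show "\<exists>T. degree T \<le> n \<and> sint p (gtrig 0 (S - T)) \<le>
        C * real n powr (- (real r * p)) * (real N / real n) powr (2 - 2 * p) * sint p (gtrig r ((pderiv ^^ r) S))"
      using T(1) deg unfolding G_def by (intro exI[of _ T]) auto
  qed
qed

text \<open>This is \<open>taylor_estimate\<close> with \<open>m = 1\<close>, without localisation,
  and with centre \<open>pi / 2\<close>, that is \<open>x = 0\<close>, where the Taylor polynomial
  vanishes by hypothesis. The estimate obtained has \<open>real N powr (1 - p)\<close>; it is
  relaxed to the power that the dyadic sums are made for.\<close>

lemma zero_taylor_sint:
  fixes p :: real
  assumes p: "0 < p" "p < 1" and r: "r \<ge> 1"
  shows "\<exists>C>0. \<forall>N\<ge>1. \<forall>S. degree S \<le> N \<longrightarrow> (\<forall>i<r. poly ((pderiv ^^ i) S) 0 = 0) \<longrightarrow>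
    sint p (gtrig 0 S) \<le> C * real N powr (2 - 2 * p) * sint p (gtrig r ((pderiv ^^ r) S))"
proof -
  define b where "b = 0 + 1 + 2 * real (r - 1) * p"
  have b: "b \<ge> 0" unfolding b_def using p by simp
  obtain C1 where C1: "C1 > 0" "\<And>m N S \<eta> \<tau>. 1 \<le> m \<Longrightarrow> m \<le> N \<Longrightarrow> degree S \<le> N \<Longrightarrow> \<eta> \<in> {0..pi} \<Longrightarrow> \<tau> \<in> {0..pi} \<Longrightarrow>
     real m * cos (\<eta> / 2) \<ge> 1 / 4 \<Longrightarrow> real m * sin (\<eta> / 2) \<ge> 1 / 4 \<Longrightarrow>
     \<bar>poly S (cos \<tau>) - taylor r (cos \<eta>) S (cos \<tau>)\<bar> powr p \<le>
       C1 * real m powr (- (real (r - 1) * p)) * real N powr (1 - p)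
       * integral {0..pi} (\<lambda>s. \<bar>gtrig r ((pderiv ^^ r) S) s\<bar> powr p * wt N s * loc 0 m \<eta> s)
       * (1 + real m * sdist \<eta> \<tau>) powr b / wt N \<tau>"
    using taylor_estimate[OF p _ r, of 0] unfolding b_def by auto
  obtain C2 where C2: "C2 > 0" "\<And>n G. n \<ge> 1 \<Longrightarrow> etrig n G \<Longrightarrow> wint n p G \<le> C2 * sint p G"
    using wint_le_sint[OF p] by blast
  define C where "C = C1 * 2 powr b * C2 * pi"
  have Cpos: "C > 0" unfolding C_def using C1 C2 by simp
  show ?thesis
  proof (rule exI[of _ C], rule conjI[OF Cpos], intro allI impI)
    fix N :: nat and S :: "real poly" assume N: "1 \<le> N" and S: "degree S \<le> N" and z: "\<forall>i<r. poly ((pderiv ^^ i) S) 0 = 0"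
    define G where "G = gtrig r ((pderiv ^^ r) S)"
    have G: "etrig N G" unfolding G_def by (rule etrig_gtrig_pderiv[OF S])
    note cG = etrig_continuous[OF G]
    have w: "integral {0..pi} (\<lambda>s. \<bar>G s\<bar> powr p * wt N s * loc 0 1 (pi / 2) s) = wint N p G"
      unfolding wint_def
      by (rule Henstock_Kurzweil_Integration.integral_cong) (auto simp: loc_def add_nonneg_eq_0_iff sdist_nonneg)
    let ?B = "C1 * real N powr (1 - p) * (C2 * sint p G) * 2 powr b"
    have sG: "0 \<le> sint p G" by (rule sint_nonneg[OF cG p(1)])
    have wG: "0 \<le> wint N p G" by (rule wint_nonneg[OF cG p(1)])
    have "sint p (gtrig 0 S) \<le> integral {0..pi} (\<lambda>s. ?B)"
      unfolding sint_def[of p "gtrig 0 S"]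
    proof (intro integral_le integrable_powr_sin p integrable_continuous_real continuous_on_const)
      show "continuous_on {0..pi} (gtrig 0 S)" unfolding gtrig_def by (intro continuous_intros)
      fix \<tau> assume \<tau>: "\<tau> \<in> {0..pi}"
      have "1 \<le> sqrt 2" by simp
      then have "1 \<le> sqrt 2 * 2" by linarith
      then have "\<bar>poly S (cos \<tau>) - taylor r (cos (pi / 2)) S (cos \<tau>)\<bar> powr p \<le>
        C1 * real 1 powr (- (real (r - 1) * p)) * real N powr (1 - p)
       * integral {0..pi} (\<lambda>s. \<bar>gtrig r ((pderiv ^^ r) S) s\<bar> powr p * wt N s * loc 0 1 (pi / 2) s)
       * (1 + real 1 * sdist (pi / 2) \<tau>) powr b / wt N \<tau>"
        by (intro C1(2) N S \<tau>) (auto simp: cos_45 sin_45)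
      moreover have "taylor r (cos (pi / 2)) S (cos \<tau>) = 0"
        using z by (simp add: taylor_def)
      ultimately have "\<bar>poly S (cos \<tau>)\<bar> powr p \<le> C1 * real N powr (1 - p) * wint N p G * (1 + sdist (pi / 2) \<tau>) powr b / wt N \<tau>"
        unfolding G_def[symmetric] w by simp
      also have "\<dots> \<le> ?B / wt N \<tau>"
      proof (intro divide_right_mono mult_mono mult_left_mono C2(2) N G powr_mono2)
        show "0 \<le> wt N \<tau>" by (rule wt_nonneg[OF \<tau>])
      qed (use C1(1) C2(1) sG wG b p sdist_nonneg sdist_le_1[of "pi/2" \<tau>] in auto)
      finally have "\<bar>poly S (cos \<tau>)\<bar> powr p * sin \<tau> \<le> ?B / wt N \<tau> * sin \<tau>"
        using \<tau> by (intro mult_right_mono sin_ge_zero) auto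
      also have "\<dots> = ?B * (sin \<tau> / wt N \<tau>)" by simp
      also have "\<dots> \<le> ?B * 1"
        using wt_ge(2,3)[OF N \<tau>] C1 C2 sG by (intro mult_left_mono) auto
      finally show "\<bar>gtrig 0 S \<tau>\<bar> powr p * sin \<tau> \<le> ?B" by (simp add: gtrig_def)
    qed auto
    also have "\<dots> = C * real N powr (1 - p) * sint p G" unfolding C_def by simp
    also have "\<dots> \<le> C * real N powr (2 - 2 * p) * sint p G"
      using Cpos N p sG by (intro mult_right_mono mult_left_mono powr_mono) auto
    finally show "sint p (gtrig 0 S) \<le> C * real N powr (2 - 2 * p) * sint p (gtrig r ((pderiv ^^ r) S))"
      unfolding G_def .
  qed
qed

section \<open>Simultaneous approximation of a polynomial and its derivative\<close>

lemma gtrig_add: "gtrig j (P + Q) = (\<lambda>s. gtrig j P s + gtrig j Q s)"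
  by (simp add: gtrig_def fun_eq_iff algebra_simps)

lemma gtrig_diff: "gtrig j (P - Q) = (\<lambda>s. gtrig j P s - gtrig j Q s)"
  by (simp add: gtrig_def fun_eq_iff algebra_simps)

lemma continuous_gtrig: "continuous_on A (gtrig j P)"
  unfolding gtrig_def by (intro continuous_intros)

lemma sint_gtrig_add_le:
  assumes "0 < p" "p \<le> 1"
  shows "sint p (gtrig j (P + Q)) \<le> sint p (gtrig j P) + sint p (gtrig j Q)"
  unfolding gtrig_add by (rule sint_add_le) (use assms continuous_gtrig in auto)

lemma sint_gtrig_minus: "sint p (gtrig j (P - Q)) = sint p (gtrig j (Q - P))"
  unfolding gtrig_diff sint_def by (simp add: abs_minus_commute)

lemma sint_gtrig_diff_le:
  assumes "0 < p" "p \<le> 1"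
  shows "sint p (gtrig j (P - Q)) \<le> sint p (gtrig j (P - R)) + sint p (gtrig j (Q - R))"
  using sint_gtrig_add_le[OF assms, of j "P - R" "R - Q"] sint_gtrig_minus[of p j R Q] by simp

lemma sint_gtrig_nonneg: "0 < p \<Longrightarrow> 0 \<le> sint p (gtrig j P)"
  by (rule sint_nonneg) (auto intro: continuous_gtrig)

lemma higher_pderiv_minus: "(pderiv ^^ r) (P - Q :: real poly) = (pderiv ^^ r) P - (pderiv ^^ r) Q"
  by (induction r) (auto simp: pderiv_diff)

text \<open>
  The approximants to \<open>S\<close> of degrees \<open>2 ^ j * n\<close> are telescoped down to degree \<open>n\<close>, and Bernstein's inequality is
  applied to the differences of consecutive ones. Because \<open>p < 1\<close> the approximated function must be a polynomial;
  the factor \<open>(2 powr (2 - 2 * p)) ^ k\<close> is the price of its degree.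
\<close>

lemma simultaneous_sint:
  fixes p :: real
  assumes p: "0 < p" "p < 1" and r: "r \<ge> 1"
  shows "\<exists>C>0. \<forall>n k S. r \<le> n \<longrightarrow> degree S \<le> 2 ^ k * n \<longrightarrow>
    (\<exists>T. degree T \<le> n \<and>
      sint p (gtrig 0 (S - T)) \<le> C * real n powr (- (real r * p)) * (2 powr (2 - 2 * p)) ^ k * sint p (gtrig r ((pderiv ^^ r) S)) \<and>
      sint p (gtrig r ((pderiv ^^ r) T)) \<le> C * (2 powr (2 - 2 * p)) ^ k * sint p (gtrig r ((pderiv ^^ r) S)))"
proof -
  obtain C1 where C1: "C1 > 0" "\<And>n N S. r \<le> n \<Longrightarrow> n \<le> N \<Longrightarrow> degree S \<le> N \<Longrightarrow>
    (\<exists>T. degree T \<le> n \<and> sint p (gtrig 0 (S - T)) \<le>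
        C1 * real n powr (- (real r * p)) * (real N / real n) powr (2 - 2 * p) * sint p (gtrig r ((pderiv ^^ r) S)))"
    using jackson_sint[OF p r] by blast
  obtain C2 where C2: "C2 > 0" "\<And>n Q. n \<ge> 1 \<Longrightarrow> degree Q \<le> n \<Longrightarrow>
    sint p (gtrig r ((pderiv ^^ r) Q)) \<le> C2 * real n powr (real r * p) * sint p (gtrig 0 Q)"
    using bernstein_sint[OF p, of r] by blast
  define q where "q = 2 powr (2 - 2 * p)"
  have q: "q > 1" unfolding q_def using p powr_less_mono[of 0 "2 - 2 * p" 2] by simp
  \<comment> \<open>Bernstein times Jackson for a difference of consecutive approximants. The
    summand 1 belongs to the one of larger degree; \<open>2 powr (real r * p)\<close> belongs to the
    one of half that degree, whose Jackson factor is larger by this amount.\<close>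
  define C' where "C' = C2 * C1 * (2 powr (real r * p) + 1)"
  have C': "C' > 0" unfolding C'_def using C1 C2 by (intro mult_pos_pos add_pos_pos) auto
  \<comment> \<open>Chosen so that \<open>K + C' * q \<le> K * q\<close>: the bound
    \<open>K * q ^ i * X\<close> then reproduces itself at each step down, and \<open>1 + C'\<close>
    covers the start.\<close>
  define K where "K = 1 + C' + C' * q / (q - 1)"
  have K: "K > 0" "1 + C' \<le> K" unfolding K_def using C' q by (auto intro!: add_pos_pos divide_pos_pos)
  have Kq: "K * q ^ i + C' * q ^ Suc i \<le> K * q ^ Suc i" for i
  proof -
    have "C' * q / (q - 1) * (q - 1) \<le> K * (q - 1)" using q C' unfolding K_def by (intro mult_right_mono) auto
    then have "C' * q \<le> K * (q - 1)" using q by simp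
    then have "q ^ i * (C' * q) \<le> q ^ i * (K * (q - 1))" using q by (intro mult_left_mono) auto
    then show ?thesis by (simp add: algebra_simps)
  qed
  define C where "C = K + C1"
  have Cpos: "C > 0" unfolding C_def using K C1 by simp
  show ?thesis
  proof (rule exI[of _ C], rule conjI[OF Cpos], intro allI impI)
    fix n k :: nat and S :: "real poly" assume n: "r \<le> n" and S: "degree S \<le> 2 ^ k * n"
    define X where "X = sint p (gtrig r ((pderiv ^^ r) S))"
    have X: "X \<ge> 0" unfolding X_def by (rule sint_gtrig_nonneg[OF p(1)])
    have n1: "n \<ge> 1" using n r by simp
    have "\<exists>T. degree T \<le> 2 ^ j * n \<and> sint p (gtrig 0 (S - T)) \<le>
        C1 * real (2 ^ j * n) powr (- (real r * p)) * q ^ (k - j) * X" if j: "j \<le> k" for j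
    proof -
      have "r \<le> 2 ^ j * n" using n by (rule order_trans) simp
      moreover have "2 ^ j * n \<le> 2 ^ k * n" using j by (intro mult_le_mono1 power_increasing) auto
      moreover have "(real (2 ^ k * n) / real (2 ^ j * n)) powr (2 - 2 * p) = q ^ (k - j)"
      proof -
        have "real (2 ^ k * n) / real (2 ^ j * n) = 2 ^ (k - j)" using n1 j by (simp add: power_diff)
        then have "(real (2 ^ k * n) / real (2 ^ j * n)) powr (2 - 2 * p) = (2 ^ (k - j)) powr (2 - 2 * p)" by simp
        also have "\<dots> = q ^ (k - j)"
          unfolding q_def by (simp add: powr_realpow[symmetric] powr_powr mult.commute)
        finally show ?thesis .
      qed
      ultimately show ?thesis using C1(2)[of "2 ^ j * n" "2 ^ k * n" S] S unfolding X_def by auto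
    qed
    then obtain T where T: "\<And>j. j \<le> k \<Longrightarrow> degree (T j) \<le> 2 ^ j * n"
      "\<And>j. j \<le> k \<Longrightarrow> sint p (gtrig 0 (S - T j)) \<le> C1 * real (2 ^ j * n) powr (- (real r * p)) * q ^ (k - j) * X"
      by metis
    let ?a = "\<lambda>j. sint p (gtrig r ((pderiv ^^ r) (T j)))"
    have scale: "real (2 ^ j * n) powr (real r * p) * real (2 ^ j * n) powr (- (real r * p)) = 1" for j
      using n1 by (simp add: powr_add[symmetric])
    \<comment> \<open>\<open>S\<close> itself has degree at most \<open>2 ^ k * n\<close>, so
      Bernstein's inequality applies to \<open>S - T k\<close>, and its power of the degree cancels
      the one from Jackson.\<close>
    have top: "?a k \<le> (1 + C') * X"
    proof -
      have "sint p (gtrig r ((pderiv ^^ r) (S - T k))) \<le> C2 * real (2 ^ k * n) powr (real r * p) * sint p (gtrig 0 (S - T k))"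
        using n1 S T(1)[of k] by (intro C2(2) degree_diff_le) (auto simp: Suc_le_eq)
      also have "\<dots> \<le> C2 * real (2 ^ k * n) powr (real r * p) * (C1 * real (2 ^ k * n) powr (- (real r * p)) * q ^ (k - k) * X)"
        using C2(1) by (intro mult_left_mono T(2)) auto
      also have "\<dots> = C2 * C1 * (real (2 ^ k * n) powr (real r * p) * real (2 ^ k * n) powr (- (real r * p))) * X"
        by (simp only: mult_ac diff_self_eq_0 power_0 mult_1_right mult_1_left)
      also have "\<dots> \<le> C' * X" unfolding scale C'_def using C1 C2 X by (intro mult_right_mono) auto
      finally have "sint p (gtrig r ((pderiv ^^ r) (T k) - (pderiv ^^ r) S)) \<le> C' * X"
        unfolding higher_pderiv_minus by (subst sint_gtrig_minus)
      then show ?thesis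
        using sint_gtrig_add_le[OF p(1) less_imp_le[OF p(2)], of r "(pderiv ^^ r) (T k) - (pderiv ^^ r) S" "(pderiv ^^ r) S"]
        by (simp add: X_def algebra_simps)
    qed
    have step: "?a j \<le> ?a (Suc j) + C' * q ^ (k - j) * X" if j: "j < k" for j
    proof -
      let ?D = "T (Suc j) - T j"
      let ?N = "2 ^ Suc j * n"
      have "degree (T j) \<le> ?N" using T(1)[of j] j by simp
      then have "sint p (gtrig r ((pderiv ^^ r) ?D)) \<le> C2 * real ?N powr (real r * p) * sint p (gtrig 0 ?D)"
        using n1 T(1)[of "Suc j"] j by (intro C2(2) degree_diff_le) (auto simp: Suc_le_eq)
      also have "\<dots> \<le> C2 * real ?N powr (real r * p) * (C1 * real ?N powr (- (real r * p)) * q ^ (k - Suc j) * X + C1 * real (2 ^ j * n) powr (- (real r * p)) * q ^ (k - j) * X)"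
      proof (intro mult_left_mono)
        have "sint p (gtrig 0 ?D) \<le> sint p (gtrig 0 (T (Suc j) - S)) + sint p (gtrig 0 (T j - S))"
          by (rule sint_gtrig_diff_le[OF p(1) less_imp_le[OF p(2)]])
        then show "sint p (gtrig 0 ?D) \<le> C1 * real ?N powr (- (real r * p)) * q ^ (k - Suc j) * X + C1 * real (2 ^ j * n) powr (- (real r * p)) * q ^ (k - j) * X"
          using T(2)[of "Suc j"] T(2)[of j] j unfolding sint_gtrig_minus[of p 0 _ S] by linarith
      qed (use C2 in auto)
      also have "\<dots> = C2 * C1 * (q ^ (k - Suc j) * (real ?N powr (real r * p) * real ?N powr (- (real r * p)))
          + q ^ (k - j) * (real ?N powr (real r * p) * real (2 ^ j * n) powr (- (real r * p)))) * X"
        by (simp only: distrib_left distrib_right mult_ac)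
      also have "real ?N powr (real r * p) * real (2 ^ j * n) powr (- (real r * p)) = 2 powr (real r * p)"
      proof -
        have "real ?N powr (real r * p) = 2 powr (real r * p) * real (2 ^ j * n) powr (real r * p)"
          by (simp only: powr_mult[symmetric]) (simp add: mult_ac)
        then show ?thesis using scale[of j] by (simp add: mult.assoc)
      qed
      also have "C2 * C1 * (q ^ (k - Suc j) * (real ?N powr (real r * p) * real ?N powr (- (real r * p))) + q ^ (k - j) * 2 powr (real r * p)) * X
        \<le> C2 * C1 * (q ^ (k - j) * 1 + q ^ (k - j) * 2 powr (real r * p)) * X"
        unfolding scale using q C1 C2 X by (intro mult_right_mono mult_left_mono add_mono power_increasing) auto
      also have "\<dots> = C' * q ^ (k - j) * X" unfolding C'_def by (simp add: algebra_simps)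
      finally have "sint p (gtrig r ((pderiv ^^ r) (T j) - (pderiv ^^ r) (T (Suc j)))) \<le> C' * q ^ (k - j) * X"
        unfolding higher_pderiv_minus by (subst sint_gtrig_minus)
      then show ?thesis
        using sint_gtrig_add_le[OF p(1) less_imp_le[OF p(2)], of r "(pderiv ^^ r) (T j) - (pderiv ^^ r) (T (Suc j))" "(pderiv ^^ r) (T (Suc j))"]
        by simp
    qed
    have ind: "i \<le> k \<Longrightarrow> ?a (k - i) \<le> K * q ^ i * X" for i
    proof (induction i)
      case 0
      have "(1 + C') * X \<le> K * X" using K X by (intro mult_right_mono) auto
      then show ?case using top by simp
    next
      case (Suc i)
      have e: "Suc (k - Suc i) = k - i" "k - (k - Suc i) = Suc i" using Suc.prems by auto
      have "?a (k - Suc i) \<le> ?a (k - i) + C' * q ^ Suc i * X"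
        using step[of "k - Suc i"] Suc.prems unfolding e by simp
      also have "\<dots> \<le> K * q ^ i * X + C' * q ^ Suc i * X" using Suc by simp
      also have "\<dots> = (K * q ^ i + C' * q ^ Suc i) * X" by (simp only: distrib_right)
      also have "\<dots> \<le> K * q ^ Suc i * X" by (intro mult_right_mono Kq X)
      finally show ?case .
    qed
    have a0: "?a 0 \<le> K * q ^ k * X" using ind[of k] by simp
    show "\<exists>T. degree T \<le> n \<and>
      sint p (gtrig 0 (S - T)) \<le> C * real n powr (- (real r * p)) * (2 powr (2 - 2 * p)) ^ k * sint p (gtrig r ((pderiv ^^ r) S)) \<and>
      sint p (gtrig r ((pderiv ^^ r) T)) \<le> C * (2 powr (2 - 2 * p)) ^ k * sint p (gtrig r ((pderiv ^^ r) S))"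
      unfolding X_def[symmetric] q_def[symmetric]
    proof (intro exI[of _ "T 0"] conjI)
      show "degree (T 0) \<le> n" using T(1)[of 0] by simp
      have "sint p (gtrig 0 (S - T 0)) \<le> C1 * real n powr (- (real r * p)) * q ^ k * X" using T(2)[of 0] by simp
      also have "\<dots> \<le> C * real n powr (- (real r * p)) * q ^ k * X"
        unfolding C_def using K q X by (intro mult_right_mono) auto
      finally show "sint p (gtrig 0 (S - T 0)) \<le> C * real n powr (- (real r * p)) * q ^ k * X" .
      have "K * q ^ k * X \<le> C * q ^ k * X" unfolding C_def using C1 q X by (intro mult_right_mono) auto
      then show "?a 0 \<le> C * q ^ k * X" using a0 by linarith
    qed
  qed
qed

section \<open>The fundamental theorem of calculus for absolutely continuous functions\<close>

lemma AC_delta: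
  assumes "abs_continuous_on_Icc l u f" "\<epsilon> > 0"
  shows "\<exists>\<delta>>0. \<forall>(m::nat) a b. (\<forall>i<m. l \<le> a i \<and> a i \<le> b i \<and> b i \<le> u) \<longrightarrow>
    (\<forall>i<m. \<forall>j<m. i \<noteq> j \<longrightarrow> {a i<..<b i} \<inter> {a j<..<b j} = {}) \<longrightarrow> (\<Sum>i<m. b i - a i) < \<delta> \<longrightarrow>
    (\<Sum>i<m. \<bar>f (b i) - f (a i)\<bar>) < \<epsilon>"
  using assms(1)[unfolded abs_continuous_on_Icc_def, THEN spec[of _ \<epsilon>], THEN mp, OF assms(2)]
  by (simp only: conj_assoc imp_conjL)

text \<open>The definition numbers the intervals by an initial segment of the naturals, while Vitali
  families and divisions come as sets; an enumeration links the two. The index type differs between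
  the uses, hence the type variable.\<close>

lemma AC_finite:
  fixes f :: "real \<Rightarrow> real"
  assumes "abs_continuous_on_Icc l u f" "\<epsilon> > 0"
  shows "\<exists>\<delta>>0. \<forall>(I :: 'i set) a b. finite I \<longrightarrow> (\<forall>i\<in>I. l \<le> a i \<and> a i \<le> b i \<and> b i \<le> u) \<longrightarrow>
    (\<forall>i\<in>I. \<forall>j\<in>I. i \<noteq> j \<longrightarrow> {a i<..<b i} \<inter> {a j<..<b j} = {}) \<longrightarrow> (\<Sum>i\<in>I. b i - a i) < \<delta> \<longrightarrow>
    (\<Sum>i\<in>I. \<bar>f (b i) - f (a i)\<bar>) < \<epsilon>"
proof -
  obtain \<delta> where d: "\<delta> > 0" and D: "\<forall>(m::nat) a b. (\<forall>i<m. l \<le> a i \<and> a i \<le> b i \<and> b i \<le> u) \<longrightarrow>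
    (\<forall>i<m. \<forall>j<m. i \<noteq> j \<longrightarrow> {a i<..<b i} \<inter> {a j<..<b j} = {}) \<longrightarrow> (\<Sum>i<m. b i - a i) < \<delta> \<longrightarrow>
    (\<Sum>i<m. \<bar>f (b i) - f (a i)\<bar>) < \<epsilon>"
    using AC_delta[OF assms] by (elim exE conjE)
  note D' = D[THEN spec, THEN spec, THEN spec, THEN mp, THEN mp, THEN mp]
  show ?thesis
  proof (rule exI[of _ \<delta>], rule conjI[OF d], intro allI impI)
    fix I :: "'i set" and a b :: "'i \<Rightarrow> real"
    assume I: "finite I" and 1: "\<forall>i\<in>I. l \<le> a i \<and> a i \<le> b i \<and> b i \<le> u"
      and 2: "\<forall>i\<in>I. \<forall>j\<in>I. i \<noteq> j \<longrightarrow> {a i<..<b i} \<inter> {a j<..<b j} = {}" and 3: "(\<Sum>i\<in>I. b i - a i) < \<delta>"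
    obtain e where e: "bij_betw e {0..<card I} I" using ex_bij_betw_nat_finite[OF I] by blast
    then have e': "bij_betw e {..<card I} I" by (simp add: atLeast0LessThan)
    have eI: "e i \<in> I" if "i < card I" for i using e' that bij_betwE by blast
    have inj: "e i \<noteq> e j" if "i < card I" "j < card I" "i \<noteq> j" for i j
      using e' that unfolding bij_betw_def inj_on_def by auto
    have s: "(\<Sum>i\<in>I. F i) = (\<Sum>i<card I. F (e i))" for F :: "'i \<Rightarrow> real"
      by (rule sum.reindex_bij_betw[OF e', symmetric])
    show "(\<Sum>i\<in>I. \<bar>f (b i) - f (a i)\<bar>) < \<epsilon>"
      unfolding s by (rule D') (use 1 2 3 eI inj s in auto)
  qed
qed

lemma AC_subinterval:
  assumes "abs_continuous_on_Icc l u f" "l \<le> c" "d \<le> u" shows "abs_continuous_on_Icc c d f"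
  unfolding abs_continuous_on_Icc_def
proof (intro allI impI)
  fix \<epsilon> :: real assume "\<epsilon> > 0"
  then obtain \<delta> where d: "\<delta> > 0" and D: "\<forall>(m::nat) a b. (\<forall>i<m. l \<le> a i \<and> a i \<le> b i \<and> b i \<le> u) \<longrightarrow>
    (\<forall>i<m. \<forall>j<m. i \<noteq> j \<longrightarrow> {a i<..<b i} \<inter> {a j<..<b j} = {}) \<longrightarrow> (\<Sum>i<m. b i - a i) < \<delta> \<longrightarrow>
    (\<Sum>i<m. \<bar>f (b i) - f (a i)\<bar>) < \<epsilon>"
    using AC_delta[OF assms(1)] by blast
  note D' = D[THEN spec, THEN spec, THEN spec, THEN mp, THEN mp, THEN mp]
  show "\<exists>\<delta>>0. \<forall>(m::nat) a b.
        (\<forall>i<m. c \<le> a i \<and> a i \<le> b i \<and> b i \<le> d) \<and>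
        (\<forall>i<m. \<forall>j<m. i \<noteq> j \<longrightarrow> {a i<..<b i} \<inter> {a j<..<b j} = {}) \<and>
        (\<Sum>i<m. b i - a i) < \<delta>
        \<longrightarrow> (\<Sum>i<m. \<bar>f (b i) - f (a i)\<bar>) < \<epsilon>"
  proof (intro exI[of _ \<delta>] conjI d allI impI, elim conjE)
    fix m :: nat and a b
    assume "\<forall>i<m. c \<le> a i \<and> a i \<le> b i \<and> b i \<le> d"
      "\<forall>i<m. \<forall>j<m. i \<noteq> j \<longrightarrow> {a i<..<b i} \<inter> {a j<..<b j} = {}" "(\<Sum>i<m. b i - a i) < \<delta>"
    then show "(\<Sum>i<m. \<bar>f (b i) - f (a i)\<bar>) < \<epsilon>"
      using assms(2,3) by (intro D') force+
  qed
qed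

section \<open>Differentiability almost everywhere by Vitali coverings\<close>

text \<open>The sets in question are not known to be measurable, so the infimum over measurable
  supersets, the outer measure, takes the place of a measure. It is positive as soon as the set is
  not negligible, and it is approached by open sets inside \<open>V\<close>.\<close>

lemma outer_measure_cases:
  fixes S :: "real set"
  assumes "\<not> negligible S" "S \<subseteq> V" "open V" "V \<in> lmeasurable"
  shows "\<exists>s>0. (\<forall>M\<in>lmeasurable. S \<subseteq> M \<longrightarrow> s \<le> measure lebesgue M) \<and>
    (\<forall>e>0. \<exists>T. open T \<and> T \<in> lmeasurable \<and> S \<subseteq> T \<and> T \<subseteq> V \<and> measure lebesgue T < s + e)"
proof -
  let ?X = "measure lebesgue ` {M \<in> lmeasurable. S \<subseteq> M}"
  define s where "s = Inf ?X"
  have ne: "?X \<noteq> {}" using assms by auto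
  have bdd: "bdd_below ?X" by (rule bdd_belowI[of _ 0]) auto
  have le: "s \<le> measure lebesgue M" if "M \<in> lmeasurable" "S \<subseteq> M" for M
    unfolding s_def by (rule cInf_lower[OF _ bdd]) (use that in auto)
  have ex: "\<exists>M\<in>lmeasurable. S \<subseteq> M \<and> measure lebesgue M < s + e" if "e > 0" for e
  proof -
    have "Inf ?X < s + e" using that unfolding s_def by simp
    then obtain y where "y \<in> ?X" "y < s + e" using cInf_lessD[OF ne, of "s + e"] by blast
    then show ?thesis by auto
  qed
  have "s > 0"
  proof (rule ccontr)
    assume "\<not> s > 0"
    have "negligible S"
      unfolding negligible_outer
    proof (intro allI impI)
      fix e :: real assume "e > 0"
      then obtain M where "M \<in> lmeasurable" "S \<subseteq> M" "measure lebesgue M < s + e" using ex by blast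
      then show "\<exists>T. S \<subseteq> T \<and> T \<in> lmeasurable \<and> measure lebesgue T < e"
        using \<open>\<not> s > 0\<close> by (intro exI[of _ M]) auto
    qed
    then show False using assms by simp
  qed
  moreover have "\<exists>T. open T \<and> T \<in> lmeasurable \<and> S \<subseteq> T \<and> T \<subseteq> V \<and> measure lebesgue T < s + e" if e: "e > 0" for e
  proof -
    obtain M where M: "M \<in> lmeasurable" "S \<subseteq> M" "measure lebesgue M < s + e / 2"
      using ex[of "e / 2"] e by auto
    obtain T where T: "open T" "M \<subseteq> T" "T - M \<in> lmeasurable" "emeasure lebesgue (T - M) < ennreal (e / 2)"
      using sets_lebesgue_outer_open[of M "e / 2"] M(1) e by auto
    have TM: "measure lebesgue (T - M) < e / 2"
    proof -
      have "ennreal (measure lebesgue (T - M)) < ennreal (e / 2)"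
        using T(3,4) by (simp add: emeasure_eq_measure2)
      then show ?thesis by (simp add: ennreal_less_iff)
    qed
    have Tm: "T \<in> lmeasurable"
      using fmeasurable.Un[OF M(1) T(3)] T(2) by (simp add: Un_absorb1)
    have "measure lebesgue T \<le> measure lebesgue M + measure lebesgue (T - M)"
      using measure_Un_le[of M lebesgue "T - M"] M(1) T(2,3) by (simp add: Un_absorb1 fmeasurableD)
    then have "measure lebesgue T < s + e" using M(3) TM by linarith
    moreover have "measure lebesgue (T \<inter> V) \<le> measure lebesgue T"
      by (rule measure_mono_fmeasurable) (use Tm assms in auto)
    ultimately show ?thesis
      using T(1,2) M(2) Tm assms by (intro exI[of _ "T \<inter> V"]) (auto intro: fmeasurable.Int)
  qed
  ultimately show ?thesis using le by blast
qed

lemma outer_measure_pos: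
  fixes S :: "real set"
  assumes "\<not> negligible S" "S \<subseteq> V" "open V" "V \<in> lmeasurable"
  shows "\<exists>s>0. \<forall>M\<in>lmeasurable. S \<subseteq> M \<longrightarrow> s \<le> measure lebesgue M"
  by (meson outer_measure_cases[OF assms])

lemma cball_real: "cball ((a + b) / 2) ((b - a) / 2) = {a..b::real}"
  by (auto simp: cball_eq_atLeastAtMost field_simps)

lemma vitali_finite:
  fixes S T :: "real set"
  assumes T: "open T" "T \<in> lmeasurable" "S \<subseteq> T"
    and s: "\<And>M. M \<in> lmeasurable \<Longrightarrow> S \<subseteq> M \<Longrightarrow> s \<le> measure lebesgue M"
    and cov: "\<And>x d. x \<in> S \<Longrightarrow> d > 0 \<Longrightarrow> \<exists>a b. a < b \<and> x \<in> {a..b} \<and> b - a < d \<and> P a b"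
    and e: "e > 0"
  obtains \<D> where "finite \<D>" "\<forall>K\<in>\<D>. \<exists>a b. K = {a..b} \<and> a < b \<and> P a b \<and> K \<subseteq> T"
    "pairwise disjnt \<D>" "s - e < (\<Sum>K\<in>\<D>. Sup K - Inf K)" "(\<Sum>K\<in>\<D>. Sup K - Inf K) \<le> measure lebesgue T"
proof -
  define K where "K = {(a, b). a < b \<and> P a b \<and> {a..b} \<subseteq> T}"
  let ?c = "\<lambda>i::real \<times> real. (fst i + snd i) / 2" and ?r = "\<lambda>i::real \<times> real. (snd i - fst i) / 2"
  have cb: "cball (?c i) (?r i) = {fst i..snd i}" for i by (rule cball_real)
  obtain C where C: "countable C" "C \<subseteq> K"
    "pairwise (\<lambda>i j. disjnt (cball (?c i) (?r i)) (cball (?c j) (?r j))) C"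
    "negligible (S - (\<Union>i\<in>C. cball (?c i) (?r i)))"
  proof (rule Vitali_covering_theorem_cballs[of K ?r S ?c])
    show "0 < ?r i" if "i \<in> K" for i using that unfolding K_def by auto
    fix x d :: real assume x: "x \<in> S" and d: "0 < d"
    obtain \<epsilon> where \<epsilon>: "\<epsilon> > 0" "ball x \<epsilon> \<subseteq> T" using T(1,3) x open_contains_ball by blast
    obtain a b where ab: "a < b" "x \<in> {a..b}" "b - a < min d \<epsilon>" "P a b"
      using cov[OF x, of "min d \<epsilon>"] d \<epsilon> by auto
    have "{a..b} \<subseteq> ball x \<epsilon>" using ab by (auto simp: dist_real_def)
    then show "\<exists>i. i \<in> K \<and> x \<in> cball (?c i) (?r i) \<and> ?r i < d"
      using ab \<epsilon> unfolding cb K_def by (intro exI[of _ "(a, b)"]) auto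
  qed
  define \<C> where "\<C> = (\<lambda>i. {fst i..snd i}) ` C"
  have UC: "(\<Union>i\<in>C. cball (?c i) (?r i)) = \<Union>\<C>" unfolding cb \<C>_def by simp
  have \<C>: "\<exists>a b. K = {a..b} \<and> a < b \<and> P a b \<and> K \<subseteq> T" if "K \<in> \<C>" for K
    using that C(2) unfolding \<C>_def K_def by force
  have disj: "pairwise disjnt \<C>"
  proof (rule pairwiseI)
    fix K L assume "K \<in> \<C>" "L \<in> \<C>" "K \<noteq> L"
    then obtain i j where ij: "i \<in> C" "j \<in> C" "K = {fst i..snd i}" "L = {fst j..snd j}" "i \<noteq> j"
      unfolding \<C>_def by auto
    then show "disjnt K L" using pairwiseD[OF C(3) ij(1,2,5)] unfolding cb by simp
  qed
  have meas: "K \<in> lmeasurable" if "K \<in> \<C>" for K using \<C>[OF that] by auto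
  have sub: "\<Union>\<C> \<subseteq> T" using \<C> by blast
  have cC: "countable \<C>" unfolding \<C>_def using C(1) by simp
  have UCm: "\<Union>\<C> \<in> lmeasurable"
  proof (rule fmeasurableI2[OF T(2) sub])
    show "\<Union>\<C> \<in> sets lebesgue" by (rule sets.countable_Union[OF cC]) (use meas in \<open>auto simp: fmeasurableD\<close>)
  qed
  have sU: "s \<le> measure lebesgue (\<Union>\<C>)"
  proof -
    have N: "negligible (S - \<Union>\<C>)" using C(4) unfolding UC .
    have "\<Union>\<C> \<union> (S - \<Union>\<C>) \<in> lmeasurable"
      by (rule fmeasurable.Un[OF UCm negligible_imp_measurable[OF N]])
    then have "s \<le> measure lebesgue (\<Union>\<C> \<union> (S - \<Union>\<C>))"
      by (rule s) blast
    also have "\<dots> \<le> measure lebesgue (\<Union>\<C>) + measure lebesgue (S - \<Union>\<C>)"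
      by (rule measure_Un_le) (use UCm negligible_imp_measurable[OF N] in \<open>auto simp: fmeasurableD\<close>)
    also have "measure lebesgue (S - \<Union>\<C>) = 0" by (rule negligible_imp_measure0[OF N])
    finally show ?thesis by simp
  qed
  obtain \<D> where D: "\<D> \<subseteq> \<C>" "finite \<D>" "measure lebesgue (\<Union>\<C>) - e < measure lebesgue (\<Union>\<D>)"
  proof (rule measure_countable_Union_approachable[OF cC e meas, where B = "measure lebesgue T"])
    fix D' assume "D' \<subseteq> \<C>" "finite D'"
    then have "\<Union>D' \<in> sets lebesgue" by (intro sets.finite_Union) (use meas fmeasurableD in blast)+
    then show "measure lebesgue (\<Union>D') \<le> measure lebesgue T"
      using sub \<open>D' \<subseteq> \<C>\<close> by (intro measure_mono_fmeasurable T) auto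
  qed auto
  have len: "measure lebesgue K = Sup K - Inf K" if "K \<in> \<C>" for K using \<C>[OF that] by auto
  have "measure lebesgue (\<Union>\<D>) = (\<Sum>K\<in>\<D>. measure lebesgue K)"
    by (rule measure_Union') (use D meas pairwise_subset[OF disj D(1)] in auto)
  also have "\<dots> = (\<Sum>K\<in>\<D>. Sup K - Inf K)" by (rule sum.cong) (use D(1) len in auto)
  finally have m: "measure lebesgue (\<Union>\<D>) = (\<Sum>K\<in>\<D>. Sup K - Inf K)" .
  have "\<Union>\<D> \<in> sets lebesgue" by (intro sets.finite_Union D(2)) (use D(1) meas fmeasurableD in blast)
  then have "measure lebesgue (\<Union>\<D>) \<le> measure lebesgue T"
    using sub D(1) by (intro measure_mono_fmeasurable T) auto
  then show ?thesis
    using D sU m \<C> pairwise_subset[OF disj D(1)] by (intro that[of \<D>]) (auto 0 4)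
qed

lemma division_telescope:
  fixes h :: "real \<Rightarrow> real"
  assumes "q division_of {a..b}" "a \<le> b"
  shows "(\<Sum>K\<in>q. h (Sup K) - h (Inf K)) = h b - h a"
proof -
  have fin: "finite q" using assms(1) by blast
  have K: "K \<noteq> {}" "\<exists>c d. K = cbox c d" "K \<subseteq> {a..b}" if "K \<in> q" for K
    using division_ofD[OF assms(1)] that by blast+
  have Inf: "Inf K \<in> K" if "K \<in> q" for K using K[OF that] by (auto simp: box_real)
  have td: "(\<lambda>K. (Inf K, K)) ` q tagged_division_of {a..b}"
  proof (rule tagged_division_ofI)
    fix x1 K1 x2 K2 assume "(x1, K1) \<in> (\<lambda>K. (Inf K, K)) ` q" "(x2, K2) \<in> (\<lambda>K. (Inf K, K)) ` q" "(x1, K1) \<noteq> (x2, K2)"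
    then have "K1 \<in> q" "K2 \<in> q" "K1 \<noteq> K2" by auto
    then show "interior K1 \<inter> interior K2 = {}" by (rule division_ofD(5)[OF assms(1)])
  next
    have "{K. \<exists>x. (x, K) \<in> (\<lambda>K. (Inf K, K)) ` q} = q" by auto
    then show "\<Union>{K. \<exists>x. (x, K) \<in> (\<lambda>K. (Inf K, K)) ` q} = {a..b}"
      using division_ofD(6)[OF assms(1)] by simp
  qed (use K Inf fin in auto)
  have "(\<Sum>(x,K)\<in>(\<lambda>K. (Inf K, K)) ` q. h (Sup K) - h (Inf K)) = h b - h a"
    by (rule additive_tagged_division_1[OF assms(2) td])
  then show ?thesis by (subst (asm) sum.reindex) (auto simp: inj_on_def)
qed

text \<open>
  If the set had outer measure \<open>s > 0\<close>, Vitali's theorem would give disjoint intervals of slope at most \<open>\<alpha>\<close>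
  and, inside them, disjoint intervals of slope at least \<open>\<beta>\<close>, both of total length nearly \<open>s\<close>. The gaps between the two
  families are short, so \<open>h\<close> varies little on them by absolute continuity: a contradiction.
\<close>

lemma AC_two_slopes_negligible:
  fixes h :: "real \<Rightarrow> real"
  assumes AC: "abs_continuous_on_Icc l u h" and S: "S \<subseteq> {l<..<u}" and ab: "\<alpha> < \<beta>"
    and lo: "\<And>x d. x \<in> S \<Longrightarrow> d > 0 \<Longrightarrow> \<exists>a b. a < b \<and> x \<in> {a..b} \<and> b - a < d \<and> h b - h a \<le> \<alpha> * (b - a)"
    and hi: "\<And>x d. x \<in> S \<Longrightarrow> d > 0 \<Longrightarrow> \<exists>a b. a < b \<and> x \<in> {a..b} \<and> b - a < d \<and> \<beta> * (b - a) \<le> h b - h a"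
  shows "negligible S"
proof (rule ccontr)
  assume "\<not> negligible S"
  then obtain s where s: "s > 0" "\<And>M. M \<in> lmeasurable \<Longrightarrow> S \<subseteq> M \<Longrightarrow> s \<le> measure lebesgue M"
    "\<And>e. e > 0 \<Longrightarrow> \<exists>T. open T \<and> T \<in> lmeasurable \<and> S \<subseteq> T \<and> T \<subseteq> {l<..<u} \<and> measure lebesgue T < s + e"
    using outer_measure_cases[of S "{l<..<u}"] S by (metis lmeasurable_interval(2) box_real(1) open_greaterThanLessThan lmeasurable_box)
  \<comment> \<open>The slopes differ by \<open>\<beta> - \<alpha>\<close> over a length of at least
    \<open>s / 2\<close>, a gain of \<open>4 * \<epsilon>\<close>. The gaps will account for less
    than \<open>\<epsilon>\<close> and the mismatch of the two lengths for at most
    \<open>\<epsilon> / 2\<close>.\<close>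
  define \<epsilon> where "\<epsilon> = (\<beta> - \<alpha>) * s / 8"
  have \<epsilon>: "\<epsilon> > 0" unfolding \<epsilon>_def using s(1) ab by simp
  obtain \<delta> where \<delta>: "\<delta> > 0" "\<And>(I :: (real set \<times> real set) set) a b. finite I \<Longrightarrow> (\<forall>i\<in>I. l \<le> a i \<and> a i \<le> b i \<and> b i \<le> u) \<Longrightarrow>
    (\<forall>i\<in>I. \<forall>j\<in>I. i \<noteq> j \<longrightarrow> {a i<..<b i} \<inter> {a j<..<b j} = {}) \<Longrightarrow> (\<Sum>i\<in>I. b i - a i) < \<delta> \<Longrightarrow>
    (\<Sum>i\<in>I. \<bar>h (b i) - h (a i)\<bar>) < \<epsilon>"
    using AC_finite[OF AC \<epsilon>, where 'i = "real set \<times> real set"] by blast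
  define A where "A = \<bar>\<alpha>\<bar> + 1"
  have A: "A > 0" "\<alpha> \<le> A" "-\<alpha> \<le> A" unfolding A_def by auto
  \<comment> \<open>The total length of the gaps will be at most \<open>4 * \<eta>\<close>. The
    three bounds make it shorter than \<open>\<delta>\<close>, leave more than \<open>s / 2\<close>
    for the steep family, and keep \<open>\<bar>\<alpha>\<bar>\<close> times the mismatch
    small.\<close>
  define \<eta> where "\<eta> = min (min (\<delta> / 8) (s / 8)) (\<epsilon> / (8 * A))"
  have "\<eta> \<le> \<epsilon> / (8 * A)" unfolding \<eta>_def by simp
  then have "A * \<eta> \<le> A * (\<epsilon> / (8 * A))" using A by (intro mult_left_mono) auto
  then have \<eta>: "\<eta> > 0" "\<eta> \<le> \<delta> / 8" "\<eta> \<le> s / 8" "A * \<eta> \<le> \<epsilon> / 8"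
    using \<delta>(1) s(1) \<epsilon> A by (auto simp: \<eta>_def)
  obtain T where T: "open T" "T \<in> lmeasurable" "S \<subseteq> T" "T \<subseteq> {l<..<u}" "measure lebesgue T < s + \<eta>"
    using s(3)[OF \<eta>(1)] by blast
  obtain \<A> where \<A>: "finite \<A>" "\<And>K. K \<in> \<A> \<Longrightarrow> \<exists>a b. K = {a..b} \<and> a < b \<and> h b - h a \<le> \<alpha> * (b - a) \<and> K \<subseteq> T"
    "pairwise disjnt \<A>" "s - \<eta> < (\<Sum>K\<in>\<A>. Sup K - Inf K)" "(\<Sum>K\<in>\<A>. Sup K - Inf K) \<le> measure lebesgue T"
    by (rule vitali_finite[OF T(1-3) s(2) lo \<eta>(1)]) (assumption | rule that | blast)+
  define V where "V = (\<Union>K\<in>\<A>. interior K)"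
  have V: "open V" unfolding V_def by auto
  have Vm: "V \<in> lmeasurable"
    unfolding V_def by (intro fmeasurable.finite_UN \<A>(1)) (use \<A>(2) in \<open>force simp: interior_atLeastAtMost_real\<close>)
  have VT: "V \<subseteq> T" unfolding V_def using \<A>(2) interior_subset by blast
  have mV: "measure lebesgue V = (\<Sum>K\<in>\<A>. Sup K - Inf K)"
  proof -
    have "measure lebesgue V = (\<Sum>K\<in>\<A>. measure lebesgue (interior K))"
      unfolding V_def
    proof (rule measure_UNION'[OF \<A>(1)])
      show "interior K \<in> lmeasurable" if "K \<in> \<A>" for K using \<A>(2)[OF that] by (auto simp: interior_atLeastAtMost_real)
      show "pairwise (\<lambda>K L. disjnt (interior K) (interior L)) \<A>"
        using \<A>(3) unfolding pairwise_def disjnt_def using interior_subset by blast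
    qed
    also have "\<dots> = (\<Sum>K\<in>\<A>. Sup K - Inf K)"
    proof (rule sum.cong[OF refl])
      fix K assume "K \<in> \<A>"
      then obtain a b where "K = {a..b}" "a < b" using \<A>(2) by blast
      then show "measure lebesgue (interior K) = Sup K - Inf K" by (simp add: interior_atLeastAtMost_real)
    qed
    finally show ?thesis .
  qed
  \<comment> \<open>\<open>T - V\<close> has measure below \<open>2 * \<eta>\<close>, so
    \<open>S \<inter> V\<close> keeps almost the full outer measure and Vitali's theorem can be
    applied once more, now inside \<open>V\<close>.\<close>
  have sV: "s - 2 * \<eta> \<le> measure lebesgue M" if M: "M \<in> lmeasurable" "S \<inter> V \<subseteq> M" for M
  proof -
    have "s \<le> measure lebesgue (M \<union> (T - V))"
      by (rule s(2)) (use M T Vm in \<open>auto intro!: fmeasurable.Un fmeasurable_Diff\<close>)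
    also have "\<dots> \<le> measure lebesgue M + measure lebesgue (T - V)"
      by (rule measure_Un_le) (use M T Vm in \<open>auto intro!: fmeasurableD\<close>)
    also have "measure lebesgue (T - V) = measure lebesgue T - measure lebesgue V"
      by (rule measurable_measure_Diff) (use T Vm VT in \<open>auto simp: fmeasurableD\<close>)
    finally show ?thesis using mV \<A>(4) T(5) by linarith
  qed
  have hi': "\<exists>a b. a < b \<and> x \<in> {a..b} \<and> b - a < d \<and> \<beta> * (b - a) \<le> h b - h a" if "x \<in> S \<inter> V" "d > 0" for x d
    using hi[of x d] that by simp
  obtain \<B> where \<B>: "finite \<B>" "\<And>K. K \<in> \<B> \<Longrightarrow> \<exists>a b. K = {a..b} \<and> a < b \<and> \<beta> * (b - a) \<le> h b - h a \<and> K \<subseteq> V"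
    "pairwise disjnt \<B>" "s - 2 * \<eta> - \<eta> < (\<Sum>K\<in>\<B>. Sup K - Inf K)" "(\<Sum>K\<in>\<B>. Sup K - Inf K) \<le> measure lebesgue V"
    by (rule vitali_finite[where S = "S \<inter> V", OF V Vm _ sV hi' \<eta>(1)]) (assumption | rule that | blast)+
  \<comment> \<open>\<open>V\<close> is a disjoint union of open intervals, and a connected subset
    of it lies in one of them.\<close>
  have nest: "\<exists>K\<in>\<A>. J \<subseteq> interior K" if J: "J \<in> \<B>" for J
  proof -
    obtain a b where J': "J = {a..b}" "a < b" "J \<subseteq> V" using \<B>(2)[OF J] by blast
    have "a \<in> V" using J' by auto
    then obtain K where K: "K \<in> \<A>" "a \<in> interior K" unfolding V_def by blast
    have "connected J" using J' by simp
    have "J \<subseteq> interior K"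
    proof (rule ccontr)
      assume n: "\<not> J \<subseteq> interior K"
      define W where "W = (\<Union>L\<in>\<A> - {K}. interior L)"
      have "open W" "open (interior K)" unfolding W_def by auto
      moreover have "J \<subseteq> interior K \<union> W" using J'(3) unfolding V_def W_def by blast
      moreover have "interior K \<inter> W \<inter> J = {}"
        using \<A>(3) K(1) interior_subset unfolding W_def pairwise_def disjnt_def by blast
      moreover have "interior K \<inter> J \<noteq> {}" using K(2) J' by auto
      moreover have "W \<inter> J \<noteq> {}" using n calculation(3) by blast
      ultimately show False using \<open>connected J\<close> unfolding connected_def by blast
    qed
    then show ?thesis using K by blast
  qed
  define BK where "BK K = {J \<in> \<B>. J \<subseteq> interior K}" for K
  have finB: "finite (BK K)" for K unfolding BK_def using \<B>(1) by simp
  \<comment> \<open>Completing the steep intervals inside \<open>K\<close> to a division of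
    \<open>K\<close> exhibits the gaps as the finite family \<open>q K - BK K\<close>, over which
    increments telescope.\<close>
  have "\<exists>q. BK K \<subseteq> q \<and> q division_of K" if K: "K \<in> \<A>" for K
  proof -
    obtain a b where ab: "K = {a..b}" "a < b" using \<A>(2)[OF K] by blast
    have "BK K division_of \<Union>(BK K)"
    proof (rule division_ofI)
      fix J assume J: "J \<in> BK K"
      then obtain c d where cd: "J = {c..d}" "c < d" using \<B>(2) unfolding BK_def by blast
      then have "J = cbox c d" by (simp add: box_real)
      then show "\<exists>a b. J = cbox a b" by blast
      show "J \<noteq> {}" using cd by simp
    next
      fix J J' assume "J \<in> BK K" "J' \<in> BK K" "J \<noteq> J'"
      then have "J \<inter> J' = {}" using \<B>(3) unfolding BK_def pairwise_def disjnt_def by blast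
      then show "interior J \<inter> interior J' = {}" using interior_subset by blast
    qed (use finB in auto)
    moreover have "\<Union>(BK K) \<subseteq> cbox a b" using interior_subset ab unfolding BK_def by (auto simp: box_real)
    ultimately show ?thesis using partial_division_extend_interval[of "BK K" a b] ab by (metis box_real(2))
  qed
  then obtain q where q: "\<And>K. K \<in> \<A> \<Longrightarrow> BK K \<subseteq> q K" "\<And>K. K \<in> \<A> \<Longrightarrow> q K division_of K" by metis
  have finq: "finite (q K)" if "K \<in> \<A>" for K using q(2)[OF that] by blast
  have tele: "(\<Sum>J\<in>q K - BK K. g (Sup J) - g (Inf J)) = (g (Sup K) - g (Inf K)) - (\<Sum>J\<in>BK K. g (Sup J) - g (Inf J))"
    if K: "K \<in> \<A>" for K and g :: "real \<Rightarrow> real"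
  proof -
    obtain a b where ab: "K = {a..b}" "a < b" using \<A>(2)[OF K] by blast
    have "(\<Sum>J\<in>q K. g (Sup J) - g (Inf J)) = g (Sup K) - g (Inf K)"
      using division_telescope[of "q K" a b g] q(2)[OF K] ab by simp
    then show ?thesis using sum_diff[OF finq[OF K] q(1)[OF K], of "\<lambda>J. g (Sup J) - g (Inf J)"] by simp
  qed
  have sumB: "(\<Sum>K\<in>\<A>. \<Sum>J\<in>BK K. F J) = (\<Sum>J\<in>\<B>. F J)" for F :: "real set \<Rightarrow> real"
  proof -
    have "\<B> = (\<Union>K\<in>\<A>. BK K)" using nest unfolding BK_def by blast
    moreover have "BK K \<inter> BK K' = {}" if "K \<in> \<A>" "K' \<in> \<A>" "K \<noteq> K'" for K K'
    proof (rule ccontr)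
      assume "BK K \<inter> BK K' \<noteq> {}"
      then obtain J where J: "J \<in> \<B>" "J \<subseteq> interior K" "J \<subseteq> interior K'" unfolding BK_def by blast
      have "K \<inter> K' = {}" using \<A>(3) that unfolding pairwise_def disjnt_def by blast
      moreover have "J \<noteq> {}" using \<B>(2)[OF J(1)] by auto
      ultimately show False using J interior_subset by blast
    qed
    ultimately show ?thesis using sum.UNION_disjoint[of \<A> BK F] \<A>(1) finB by auto
  qed
  let ?I = "Sigma \<A> (\<lambda>K. q K - BK K)"
  have sumI: "(\<Sum>i\<in>?I. g (Sup (snd i)) - g (Inf (snd i))) = (\<Sum>K\<in>\<A>. g (Sup K) - g (Inf K)) - (\<Sum>J\<in>\<B>. g (Sup J) - g (Inf J))"
    for g :: "real \<Rightarrow> real"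
  proof -
    have "(\<Sum>i\<in>?I. g (Sup (snd i)) - g (Inf (snd i))) = (\<Sum>K\<in>\<A>. \<Sum>J\<in>q K - BK K. g (Sup J) - g (Inf J))"
      by (subst sum.Sigma) (use \<A>(1) finq in \<open>auto simp: case_prod_unfold\<close>)
    also have "\<dots> = (\<Sum>K\<in>\<A>. (g (Sup K) - g (Inf K)) - (\<Sum>J\<in>BK K. g (Sup J) - g (Inf J)))"
      by (rule sum.cong[OF refl]) (rule tele)
    also have "\<dots> = (\<Sum>K\<in>\<A>. g (Sup K) - g (Inf K)) - (\<Sum>J\<in>\<B>. g (Sup J) - g (Inf J))"
      unfolding sum_subtractf sumB by simp
    finally show ?thesis .
  qed
  have qK: "\<exists>c d. J = {c..d} \<and> c \<le> d \<and> J \<subseteq> K" if "K \<in> \<A>" "J \<in> q K" for K J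
  proof -
    have "J \<noteq> {}" "\<exists>c d. J = cbox c d" "J \<subseteq> K" using division_ofD[OF q(2)[OF that(1)]] that(2) by blast+
    then show ?thesis by (auto simp: box_real)
  qed
  have gap: "(\<Sum>i\<in>?I. \<bar>h (Sup (snd i)) - h (Inf (snd i))\<bar>) < \<epsilon>"
  proof (rule \<delta>(2))
    show "finite ?I" using \<A>(1) finq by auto
    show "\<forall>i\<in>?I. l \<le> Inf (snd i) \<and> Inf (snd i) \<le> Sup (snd i) \<and> Sup (snd i) \<le> u"
    proof
      fix i assume "i \<in> ?I"
      then have i: "fst i \<in> \<A>" "snd i \<in> q (fst i)" by auto
      obtain c d where cd: "snd i = {c..d}" "c \<le> d" "snd i \<subseteq> fst i" using qK[OF i] by blast
      have "fst i \<subseteq> {l<..<u}" using \<A>(2)[OF i(1)] T(4) by blast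
      moreover have "c \<in> snd i" "d \<in> snd i" using cd by auto
      ultimately have "c \<in> {l<..<u}" "d \<in> {l<..<u}" using cd(3) by blast+
      then show "l \<le> Inf (snd i) \<and> Inf (snd i) \<le> Sup (snd i) \<and> Sup (snd i) \<le> u" using cd by auto
    qed
    show "\<forall>i\<in>?I. \<forall>j\<in>?I. i \<noteq> j \<longrightarrow> {Inf (snd i)<..<Sup (snd i)} \<inter> {Inf (snd j)<..<Sup (snd j)} = {}"
    proof (intro ballI impI)
      fix i j assume i: "i \<in> ?I" and j: "j \<in> ?I" and ne: "i \<noteq> j"
      have e: "{Inf (snd i)<..<Sup (snd i)} = interior (snd i)" if "i \<in> ?I" for i
        using that qK[of "fst i" "snd i"] by (auto simp: interior_atLeastAtMost_real)
      have "interior (snd i) \<inter> interior (snd j) = {}"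
      proof (cases "fst i = fst j")
        case True
        then have "snd i \<noteq> snd j" using ne by (simp add: prod_eq_iff)
        moreover have "fst i \<in> \<A>" "snd i \<in> q (fst i)" "snd j \<in> q (fst i)" using i j True by auto
        ultimately show ?thesis using division_ofD(5)[OF q(2)[of "fst i"]] by blast
      next
        case False
        moreover have mem: "fst i \<in> \<A>" "snd i \<in> q (fst i)" "fst j \<in> \<A>" "snd j \<in> q (fst j)" using i j by auto
        ultimately have "fst i \<inter> fst j = {}" using \<A>(3) unfolding pairwise_def disjnt_def by blast
        moreover have "snd i \<subseteq> fst i" "snd j \<subseteq> fst j" using qK[OF mem(1,2)] qK[OF mem(3,4)] by blast+
        ultimately show ?thesis using interior_subset by blast
      qed
      then show "{Inf (snd i)<..<Sup (snd i)} \<inter> {Inf (snd j)<..<Sup (snd j)} = {}" using e[OF i] e[OF j] by simp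
    qed
    have "(\<Sum>i\<in>?I. Sup (snd i) - Inf (snd i)) = (\<Sum>K\<in>\<A>. Sup K - Inf K) - (\<Sum>J\<in>\<B>. Sup J - Inf J)"
      using sumI[of "\<lambda>x. x"] by simp
    also have "\<dots> < \<delta>" using \<A>(5) \<B>(4) T(5) \<eta> by linarith
    finally show "(\<Sum>i\<in>?I. Sup (snd i) - Inf (snd i)) < \<delta>" .
  qed
  let ?a = "\<Sum>K\<in>\<A>. Sup K - Inf K" and ?b = "\<Sum>J\<in>\<B>. Sup J - Inf J"
  have "(\<Sum>K\<in>\<A>. h (Sup K) - h (Inf K)) \<le> (\<Sum>K\<in>\<A>. \<alpha> * (Sup K - Inf K))"
    by (rule sum_mono) (use \<A>(2) in force)
  moreover have "(\<Sum>J\<in>\<B>. \<beta> * (Sup J - Inf J)) \<le> (\<Sum>J\<in>\<B>. h (Sup J) - h (Inf J))"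
    by (rule sum_mono) (use \<B>(2) in force)
  moreover have "\<bar>\<Sum>i\<in>?I. h (Sup (snd i)) - h (Inf (snd i))\<bar> < \<epsilon>"
    using gap sum_abs[of "\<lambda>i. h (Sup (snd i)) - h (Inf (snd i))" ?I] by linarith
  \<comment> \<open>The increments of \<open>h\<close> over \<open>\<A>\<close> minus those over
    \<open>\<B>\<close> are its increments over the gaps, whose absolute values sum to less than
    \<open>\<epsilon>\<close>.\<close>
  ultimately have "\<beta> * ?b - \<alpha> * ?a < \<epsilon>"
    unfolding sumI sum_distrib_left[symmetric] by linarith
  moreover have "\<beta> * ?b - \<alpha> * ?a = (\<beta> - \<alpha>) * ?b - \<alpha> * (?a - ?b)" by (simp add: algebra_simps)
  moreover have "\<alpha> * (?a - ?b) \<le> A * (4 * \<eta>)"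
  proof -
    have "0 \<le> ?a - ?b" "?a - ?b \<le> 4 * \<eta>" using \<A>(5) \<B>(4,5) T(5) mV by linarith+
    then have "\<alpha> * (?a - ?b) \<le> A * (?a - ?b)" using A by (intro mult_right_mono) auto
    also have "\<dots> \<le> A * (4 * \<eta>)" using A \<open>?a - ?b \<le> 4 * \<eta>\<close> by (intro mult_left_mono) auto
    finally show ?thesis .
  qed
  moreover have "(\<beta> - \<alpha>) * (s / 2) \<le> (\<beta> - \<alpha>) * ?b"
    using ab \<B>(4) \<eta>(3) s(1) by (intro mult_left_mono) linarith+
  moreover have "(\<beta> - \<alpha>) * (s / 2) = 4 * \<epsilon>" unfolding \<epsilon>_def by simp
  ultimately show False using \<eta>(4) \<epsilon> by linarith
qed

text \<open>Disjoint intervals in a window of length \<open>\<delta> / 2\<close> are short enough in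
  total for the increments of \<open>h\<close> to sum to less than 1. If the set had outer measure
  \<open>s > 0\<close> in the window, Vitali intervals of slope at least \<open>2 / s\<close> and
  total length above \<open>s / 2\<close> would produce more than 1.\<close>

lemma AC_steep_negligible:
  fixes h :: "real \<Rightarrow> real"
  assumes AC: "abs_continuous_on_Icc l u h" and S: "S \<subseteq> {l<..<u}"
    and steep: "\<And>x c d. x \<in> S \<Longrightarrow> d > 0 \<Longrightarrow> \<exists>a b. a < b \<and> x \<in> {a..b} \<and> b - a < d \<and> c * (b - a) \<le> \<bar>h b - h a\<bar>"
  shows "negligible S"
proof -
  obtain \<delta> where \<delta>: "\<delta> > 0" "\<And>(I :: real set set) a b. finite I \<Longrightarrow> (\<forall>i\<in>I. l \<le> a i \<and> a i \<le> b i \<and> b i \<le> u) \<Longrightarrow>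
    (\<forall>i\<in>I. \<forall>j\<in>I. i \<noteq> j \<longrightarrow> {a i<..<b i} \<inter> {a j<..<b j} = {}) \<Longrightarrow> (\<Sum>i\<in>I. b i - a i) < \<delta> \<Longrightarrow>
    (\<Sum>i\<in>I. \<bar>h (b i) - h (a i)\<bar>) < 1"
    using AC_finite[OF AC, of 1, where 'i = "real set"] by auto
  have local: "negligible (S \<inter> ball x (\<delta> / 4))" for x
  proof (rule ccontr)
    let ?S = "S \<inter> ball x (\<delta> / 4)"
    let ?T = "ball x (\<delta> / 4) \<inter> {l<..<u}"
    have T: "open ?T" "?T \<in> lmeasurable" "?S \<subseteq> ?T" using S by (auto intro!: fmeasurable.Int)
    assume nn: "\<not> negligible ?S"
    obtain s where s0: "s > 0" "\<forall>M\<in>lmeasurable. ?S \<subseteq> M \<longrightarrow> s \<le> measure lebesgue M"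
      using outer_measure_pos[OF nn T(3,1,2)] by (elim exE conjE)
    have s: "s > 0" "\<And>M. M \<in> lmeasurable \<Longrightarrow> ?S \<subseteq> M \<Longrightarrow> s \<le> measure lebesgue M"
      using s0(1) s0(2)[rule_format] by simp_all
    have cv: "\<exists>a b. a < b \<and> y \<in> {a..b} \<and> b - a < d \<and> 2 / s * (b - a) \<le> \<bar>h b - h a\<bar>"
      if "y \<in> ?S" "d > 0" for y d using steep[of y d "2 / s"] that by auto
    obtain \<A> where \<A>: "finite \<A>" "\<And>K. K \<in> \<A> \<Longrightarrow> \<exists>a b. K = {a..b} \<and> a < b \<and> 2 / s * (b - a) \<le> \<bar>h b - h a\<bar> \<and> K \<subseteq> ?T"
      "pairwise disjnt \<A>" "s - s / 2 < (\<Sum>K\<in>\<A>. Sup K - Inf K)" "(\<Sum>K\<in>\<A>. Sup K - Inf K) \<le> measure lebesgue ?T"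
      by (rule vitali_finite[OF T s(2) cv half_gt_zero[OF s(1)]]) (assumption | rule that | blast)+
    have "(\<Sum>K\<in>\<A>. \<bar>h (Sup K) - h (Inf K)\<bar>) < 1"
    proof (rule \<delta>(2)[OF \<A>(1)])
      show "\<forall>K\<in>\<A>. l \<le> Inf K \<and> Inf K \<le> Sup K \<and> Sup K \<le> u"
      proof
        fix K assume "K \<in> \<A>"
        then obtain a b where ab: "K = {a..b}" "a < b" "K \<subseteq> ?T" using \<A>(2) by blast
        then have "a \<in> K" "b \<in> K" by auto
        then have "a \<in> {l<..<u}" "b \<in> {l<..<u}" using ab(3) by blast+
        then show "l \<le> Inf K \<and> Inf K \<le> Sup K \<and> Sup K \<le> u" using ab by auto
      qed
      show "\<forall>i\<in>\<A>. \<forall>j\<in>\<A>. i \<noteq> j \<longrightarrow> {Inf i<..<Sup i} \<inter> {Inf j<..<Sup j} = {}"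
      proof (intro ballI impI)
        fix i j assume ij: "i \<in> \<A>" "j \<in> \<A>" "i \<noteq> j"
        have "{Inf K<..<Sup K} \<subseteq> K" if "K \<in> \<A>" for K using \<A>(2)[OF that] by auto
        moreover have "i \<inter> j = {}" using ij \<A>(3) unfolding pairwise_def disjnt_def by blast
        ultimately show "{Inf i<..<Sup i} \<inter> {Inf j<..<Sup j} = {}" using ij by blast
      qed
      have "measure lebesgue ?T \<le> measure lebesgue (ball x (\<delta> / 4))"
        by (rule measure_mono_fmeasurable) (use T in \<open>auto simp: fmeasurableD\<close>)
      also have "\<dots> = \<delta> / 2" using \<delta>(1) by (simp add: ball_eq_greaterThanLessThan)
      finally show "(\<Sum>K\<in>\<A>. Sup K - Inf K) < \<delta>" using \<A>(5) \<delta>(1) by linarith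
    qed
    moreover have "(\<Sum>K\<in>\<A>. 2 / s * (Sup K - Inf K)) \<le> (\<Sum>K\<in>\<A>. \<bar>h (Sup K) - h (Inf K)\<bar>)"
      by (rule sum_mono) (use \<A>(2) in force)
    moreover have "1 < 2 / s * (\<Sum>K\<in>\<A>. Sup K - Inf K)"
    proof -
      have "2 / s * (s - s / 2) < 2 / s * (\<Sum>K\<in>\<A>. Sup K - Inf K)"
        using s(1) \<A>(4) by (intro mult_strict_left_mono) auto
      then show ?thesis using s(1) by simp
    qed
    ultimately show False unfolding sum_distrib_left[symmetric] by linarith
  qed
  show ?thesis
    unfolding locally_negligible_alt[of S]
  proof
    fix x assume "x \<in> S"
    then show "\<exists>U. openin (top_of_set S) U \<and> x \<in> U \<and> negligible U"
      using \<delta>(1) local[of x]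
      by (intro exI[of _ "S \<inter> ball x (\<delta> / 4)"]) (auto intro: openin_open_Int)
  qed
qed

text \<open>Outside one null set for each pair of rational slopes, and the null set where slopes are
  unbounded, the lower and upper limits of the difference quotient agree and are finite. A
  difference quotient at \<open>x\<close> is the slope over an interval with endpoint
  \<open>x\<close>, which the covering hypotheses admit.\<close>

lemma AC_differentiable_ae:
  fixes h :: "real \<Rightarrow> real"
  assumes AC: "abs_continuous_on_Icc l u h"
  shows "negligible {x \<in> {l<..<u}. \<not> (\<exists>D. (h has_real_derivative D) (at x))}"
proof -
  define lo where "lo \<alpha> x \<longleftrightarrow> (\<forall>d>0. \<exists>a b. a < b \<and> x \<in> {a..b} \<and> b - a < d \<and> h b - h a \<le> \<alpha> * (b - a))" for \<alpha> x :: real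
  define hi where "hi \<beta> x \<longleftrightarrow> (\<forall>d>0. \<exists>a b. a < b \<and> x \<in> {a..b} \<and> b - a < d \<and> \<beta> * (b - a) \<le> h b - h a)" for \<beta> x :: real
  define E where "E = (\<lambda>(\<alpha>, \<beta>). {x \<in> {l<..<u}. \<alpha> < \<beta> \<and> lo \<alpha> x \<and> hi \<beta> x})"
  define F where "F = {x \<in> {l<..<u}. \<forall>c. \<forall>d>0. \<exists>a b. a < b \<and> x \<in> {a..b} \<and> b - a < d \<and> c * (b - a) \<le> \<bar>h b - h a\<bar>}"
  have nE: "negligible (E p)" for p
  proof (cases p)
    case (Pair \<alpha> \<beta>)
    show ?thesis
    proof (cases "\<alpha> < \<beta>")
      case True
      show ?thesis
        unfolding Pair by (rule AC_two_slopes_negligible[OF AC _ True]) (auto simp: E_def lo_def hi_def)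
    next
      case False
      then have "E p = {}" by (auto simp: E_def Pair)
      then show ?thesis by simp
    qed
  qed
  have nF: "negligible F" by (rule AC_steep_negligible[OF AC]) (auto simp: F_def)
  let ?R = "(\<lambda>(a, b). (real_of_rat a, real_of_rat b)) ` UNIV"
  have "countable (E ` ?R)" by (intro countable_image) auto
  then have "negligible (\<Union>(E ` ?R))" by (rule negligible_countable_Union) (use nE in auto)
  then have n: "negligible (F \<union> \<Union>(E ` ?R))" using nF by (rule negligible_Un[rotated])
  show ?thesis
  proof (rule negligible_subset[OF n], rule subsetI, rule ccontr)
    fix x assume x: "x \<in> {x \<in> {l<..<u}. \<not> (\<exists>D. (h has_real_derivative D) (at x))}" and nx: "x \<notin> F \<union> \<Union>(E ` ?R)"
    define q where "q y = (h y - h x) / (y - x)" for y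
    have iv: "\<exists>a b. a < b \<and> x \<in> {a..b} \<and> b - a = \<bar>y - x\<bar> \<and> h b - h a = q y * (b - a)" if "y \<noteq> x" for y
    proof (cases "x < y")
      case True
      then show ?thesis by (intro exI[of _ x] exI[of _ y]) (auto simp: q_def)
    next
      case False
      then show ?thesis using that by (intro exI[of _ y] exI[of _ x]) (auto simp: q_def field_simps)
    qed
    have fr: "\<exists>a b. a < b \<and> x \<in> {a..b} \<and> b - a < d \<and> Q ((h b - h a) / (b - a))"
      if "frequently (\<lambda>y. Q (q y)) (at x)" "d > 0" for Q d
    proof -
      have "\<exists>y. y \<noteq> x \<and> dist y x < d \<and> Q (q y)"
      proof (rule ccontr)
        assume "\<not> ?thesis"
        then have "eventually (\<lambda>y. \<not> Q (q y)) (at x)"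
          unfolding eventually_at using that(2) by (intro exI[of _ d]) auto
        then show False using that(1) by (simp add: frequently_def)
      qed
      then obtain y where y: "y \<noteq> x" "dist y x < d" "Q (q y)" by blast
      obtain a b where "a < b" "x \<in> {a..b}" "b - a = \<bar>y - x\<bar>" "h b - h a = q y * (b - a)" using iv[OF y(1)] by blast
      then show ?thesis using y by (intro exI[of _ a] exI[of _ b]) (auto simp: dist_real_def)
    qed
    let ?q = "\<lambda>y. ereal (q y)"
    have steep: "x \<in> F" if st: "\<And>c. frequently (\<lambda>y. c \<le> \<bar>q y\<bar>) (at x)"
      unfolding F_def
    proof (safe)
      show "x \<in> {l<..<u}" using x by simp
      fix c d :: real assume d: "d > 0"
      obtain a b where ab: "a < b" "x \<in> {a..b}" "b - a < d" "c \<le> \<bar>(h b - h a) / (b - a)\<bar>"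
        using fr[OF st[of c] d] by blast
      have "c * (b - a) \<le> \<bar>(h b - h a) / (b - a)\<bar> * (b - a)" using ab by (intro mult_right_mono) auto
      also have "\<dots> = \<bar>h b - h a\<bar>" using ab(1) by (simp add: abs_divide)
      finally show "\<exists>a b. a < b \<and> x \<in> {a..b} \<and> b - a < d \<and> c * (b - a) \<le> \<bar>h b - h a\<bar>" using ab by blast
    qed
    have "Liminf (at x) ?q = Limsup (at x) ?q"
    proof (rule ccontr)
      assume "Liminf (at x) ?q \<noteq> Limsup (at x) ?q"
      then have lt: "Liminf (at x) ?q < Limsup (at x) ?q"
        using Liminf_le_Limsup[of "at x" ?q] by (simp add: less_le trivial_limit_at)
      obtain r1 where r1: "Liminf (at x) ?q < real_of_rat r1" "real_of_rat r1 < Limsup (at x) ?q"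
        using ereal_dense3[OF lt] by blast
      obtain r2 where r2: "ereal (real_of_rat r1) < real_of_rat r2" "real_of_rat r2 < Limsup (at x) ?q"
        using ereal_dense3[OF r1(2)] by blast
      let ?a = "real_of_rat r1" and ?b = "real_of_rat r2"
      have "frequently (\<lambda>y. q y \<le> ?a) (at x)"
      proof (rule ccontr)
        assume "\<not> ?thesis"
        then have "eventually (\<lambda>y. ereal ?a \<le> ?q y) (at x)"
          unfolding not_frequently by (rule eventually_mono) auto
        then show False using Liminf_bounded[of "ereal ?a" ?q "at x"] r1(1) by simp
      qed
      then have "lo ?a x"
        unfolding lo_def using fr[of "\<lambda>z. z \<le> ?a"] by (metis diff_gt_0_iff_gt pos_divide_le_eq)
      moreover have "frequently (\<lambda>y. ?b \<le> q y) (at x)"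
      proof (rule ccontr)
        assume "\<not> ?thesis"
        then have "eventually (\<lambda>y. ?q y \<le> ereal ?b) (at x)"
          unfolding not_frequently by (rule eventually_mono) auto
        then show False using Limsup_bounded[of ?q "ereal ?b" "at x"] r2(2) by simp
      qed
      then have "hi ?b x"
        unfolding hi_def using fr[of "\<lambda>z. ?b \<le> z"] by (metis diff_gt_0_iff_gt pos_le_divide_eq)
      ultimately have "x \<in> E (?a, ?b)" using x r2(1) by (simp add: E_def)
      then show False using nx by blast
    qed
    then have lim: "(?q \<longlongrightarrow> Limsup (at x) ?q) (at x)"
      by (subst tendsto_iff_Liminf_eq_Limsup) (auto simp: trivial_limit_at)
    show False
    proof (cases "Limsup (at x) ?q")
      case (real D)
      then have "(q \<longlongrightarrow> D) (at x)" using lim by simp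
      then have "(h has_real_derivative D) (at x)" by (simp add: has_field_derivative_iff q_def[abs_def])
      then show False using x by blast
    next
      case PInf
      have "frequently (\<lambda>y. c \<le> \<bar>q y\<bar>) (at x)" for c
      proof -
        have "eventually (\<lambda>y. ereal c < ?q y) (at x)" using lim PInf by (simp add: tendsto_PInfty)
        then have "eventually (\<lambda>y. c \<le> \<bar>q y\<bar>) (at x)" by (rule eventually_mono) auto
        then show ?thesis by (rule eventually_frequently[rotated]) (simp add: trivial_limit_at)
      qed
      then show False using steep nx by blast
    next
      case MInf
      have "frequently (\<lambda>y. c \<le> \<bar>q y\<bar>) (at x)" for c
      proof -
        have "eventually (\<lambda>y. ?q y < ereal (- c)) (at x)" using lim MInf by (simp only: tendsto_MInfty)
        then have "eventually (\<lambda>y. c \<le> \<bar>q y\<bar>) (at x)" by (rule eventually_mono) auto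
        then show ?thesis by (rule eventually_frequently[rotated]) (simp add: trivial_limit_at)
      qed
      then show False using steep nx by blast
    qed
  qed
qed

text \<open>A direct gauge argument, in which integrability of the derivative is part of the
  conclusion. Tags in the exceptional null set \<open>N\<close> receive intervals inside an open set
  of measure below \<open>\<delta>\<close>, where absolute continuity makes the increments of
  \<open>h\<close> small; at the other tags differentiability bounds the error by
  \<open>\<epsilon>'\<close> times the length.\<close>

lemma AC_has_integral:
  fixes h :: "real \<Rightarrow> real"
  assumes AC: "abs_continuous_on_Icc l u h" and lcdu: "l \<le> c" "c \<le> d" "d \<le> u"
  shows "((\<lambda>x. vector_derivative h (at x within {l..u})) has_integral (h d - h c)) {c..d}"
proof -
  define D where "D = {x \<in> {c<..<d}. \<exists>D. (h has_real_derivative D) (at x)}"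
  \<comment> \<open>With the value 0 off \<open>D\<close>, a tag in \<open>N\<close> contributes
    nothing but the increment of \<open>h\<close>.\<close>
  define k where "k x = (if x \<in> D then (SOME D. (h has_real_derivative D) (at x)) else 0)" for x
  have kd: "(h has_real_derivative k x) (at x)" if "x \<in> D" for x
    using that someI_ex[of "\<lambda>D. (h has_real_derivative D) (at x)"] unfolding k_def D_def by auto
  define N where "N = {c..d} - D"
  have ACcd: "abs_continuous_on_Icc c d h" by (rule AC_subinterval[OF AC lcdu(1,3)])
  have N: "negligible N"
  proof (rule negligible_subset)
    show "negligible ({x \<in> {c<..<d}. \<not> (\<exists>D. (h has_real_derivative D) (at x))} \<union> {c, d})"
      by (intro negligible_Un AC_differentiable_ae ACcd negligible_finite) auto
    show "N \<subseteq> {x \<in> {c<..<d}. \<not> (\<exists>D. (h has_real_derivative D) (at x))} \<union> {c, d}"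
      by (auto simp: N_def D_def)
  qed
  have "(k has_integral (h d - h c)) {c..d}"
    unfolding has_integral_real
  proof (intro allI impI)
    fix \<epsilon> :: real assume \<epsilon>: "\<epsilon> > 0"
    obtain \<delta> where d: "\<delta> > 0" and H: "\<forall>(I :: (real \<times> real set) set) a b. finite I \<longrightarrow> (\<forall>i\<in>I. c \<le> a i \<and> a i \<le> b i \<and> b i \<le> d) \<longrightarrow>
      (\<forall>i\<in>I. \<forall>j\<in>I. i \<noteq> j \<longrightarrow> {a i<..<b i} \<inter> {a j<..<b j} = {}) \<longrightarrow> (\<Sum>i\<in>I. b i - a i) < \<delta> \<longrightarrow>
      (\<Sum>i\<in>I. \<bar>h (b i) - h (a i)\<bar>) < \<epsilon> / 2"
      using AC_finite[OF ACcd, of "\<epsilon> / 2", where 'i = "real \<times> real set"] \<epsilon> by auto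
    define \<epsilon>' where "\<epsilon>' = \<epsilon> / (2 * (d - c + 1))"
    have e': "\<epsilon>' > 0" "\<epsilon>' * (d - c) < \<epsilon> / 2" unfolding \<epsilon>'_def using \<epsilon> lcdu by (auto simp: field_simps)
    obtain T where T: "open T" "N \<subseteq> T" "T \<in> lmeasurable" "measure lebesgue T < \<delta>"
    proof -
      obtain T where T: "open T" "N \<subseteq> T" "T - N \<in> lmeasurable" "emeasure lebesgue (T - N) < ennreal \<delta>"
        using sets_lebesgue_outer_open[OF negligible_imp_sets[OF N] d] by blast
      have "T = N \<union> (T - N)" using T(2) by blast
      then have m: "T \<in> lmeasurable" using fmeasurable.Un[OF negligible_imp_measurable[OF N] T(3)] by simp
      have "ennreal (measure lebesgue (T - N)) < ennreal \<delta>" using T(3,4) by (simp add: emeasure_eq_measure2)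
      then have "measure lebesgue (T - N) < \<delta>" by (simp add: ennreal_less_iff)
      moreover have "measure lebesgue T \<le> measure lebesgue N + measure lebesgue (T - N)"
        using measure_Un_le[of N lebesgue "T - N"] T(2,3) negligible_imp_sets[OF N] by (simp add: Un_absorb1 fmeasurableD)
      ultimately have "measure lebesgue T < \<delta>" using negligible_imp_measure0[OF N] by simp
      then show ?thesis using that T m by blast
    qed
    have "\<exists>r>0. \<forall>y. \<bar>y - x\<bar> < r \<longrightarrow> \<bar>h y - h x - k x * (y - x)\<bar> \<le> \<epsilon>' * \<bar>y - x\<bar>" if "x \<in> D" for x
    proof -
      have "(h has_derivative (\<lambda>y. k x * y)) (at x)" using kd[OF that] by (simp add: has_field_derivative_def)
      then obtain r where "r > 0" "\<forall>y. norm (y - x) < r \<longrightarrow> norm (h y - h x - k x * (y - x)) \<le> \<epsilon>' * norm (y - x)"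
        using e'(1) unfolding has_derivative_at_alt by blast
      then show ?thesis by auto
    qed
    then obtain r where r: "\<And>x. x \<in> D \<Longrightarrow> r x > 0" "\<And>x y. x \<in> D \<Longrightarrow> \<bar>y - x\<bar> < r x \<Longrightarrow> \<bar>h y - h x - k x * (y - x)\<bar> \<le> \<epsilon>' * \<bar>y - x\<bar>"
      by metis
    define \<gamma> where "\<gamma> x = (if x \<in> N then T else if x \<in> D then ball x (r x) else ball x 1)" for x
    have g: "gauge \<gamma>" unfolding gauge_def \<gamma>_def using T r(1) by auto
    show "\<exists>\<gamma>. gauge \<gamma> \<and> (\<forall>p. p tagged_division_of {c..d} \<and> \<gamma> fine p \<longrightarrow>
        norm ((\<Sum>(x, K)\<in>p. measure lborel K *\<^sub>R k x) - (h d - h c)) < \<epsilon>)"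
    proof (rule exI[of _ \<gamma>], rule conjI[OF g], intro allI impI, elim conjE)
      fix p assume p: "p tagged_division_of {c..d}" and fine: "\<gamma> fine p"
      have finp: "finite p" using p by blast
      have K: "\<exists>a b. K = {a..b} \<and> a \<le> x \<and> x \<le> b \<and> c \<le> a \<and> b \<le> d" "x \<in> {c..d}" "K \<subseteq> \<gamma> x" if xKp: "(x, K) \<in> p" for x K
      proof -
        obtain a b where ab: "K = {a..b}" using tagged_division_ofD(4)[OF p xKp] by (auto simp: box_real)
        have xK: "x \<in> K" "K \<subseteq> {c..d}" using tagged_division_ofD(2,3)[OF p xKp] by auto
        then show "\<exists>a b. K = {a..b} \<and> a \<le> x \<and> x \<le> b \<and> c \<le> a \<and> b \<le> d" using ab by (intro exI[of _ a] exI[of _ b]) auto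
        show "x \<in> {c..d}" using xK by blast
        show "K \<subseteq> \<gamma> x" using fine xKp unfolding fine_def by blast
      qed
      let ?F = "\<lambda>(x, K). measure lborel K *\<^sub>R k x - (h (Sup K) - h (Inf K))"
      define p1 where "p1 = {i \<in> p. fst i \<in> N}"
      have p1: "p1 \<subseteq> p" "finite p1" unfolding p1_def using finp by auto
      have "(\<Sum>(x, K)\<in>p. measure lborel K *\<^sub>R k x) - (h d - h c) = (\<Sum>i\<in>p. ?F i)"
        using additive_tagged_division_1[OF lcdu(2) p, of h] by (simp add: sum_subtractf case_prod_unfold)
      also have "\<dots> = (\<Sum>i\<in>p - p1. ?F i) + (\<Sum>i\<in>p1. ?F i)"
        by (rule sum.subset_diff[OF p1(1) finp])
      finally have eq: "(\<Sum>(x, K)\<in>p. measure lborel K *\<^sub>R k x) - (h d - h c) = (\<Sum>i\<in>p - p1. ?F i) + (\<Sum>i\<in>p1. ?F i)" .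
      have "\<bar>\<Sum>i\<in>p - p1. ?F i\<bar> \<le> (\<Sum>(x, K)\<in>p - p1. \<epsilon>' * measure lborel K)"
      proof (rule order_trans[OF sum_abs], rule sum_mono)
        fix i assume i: "i \<in> p - p1"
        obtain x K' where iK: "i = (x, K')" by (cases i)
        have xp: "(x, K') \<in> p" "x \<notin> N" using i iK unfolding p1_def by auto
        then have xD: "x \<in> D" using K(2)[OF xp(1)] unfolding N_def by blast
        obtain a b where ab: "K' = {a..b}" "a \<le> x" "x \<le> b" using K(1)[OF xp(1)] by blast
        have "K' \<subseteq> ball x (r x)" using K(3)[OF xp(1)] xp(2) xD by (simp add: \<gamma>_def)
        moreover have "a \<in> K'" "b \<in> K'" using ab by auto
        ultimately have "a \<in> ball x (r x)" "b \<in> ball x (r x)" by blast+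
        then have "\<bar>a - x\<bar> < r x" "\<bar>b - x\<bar> < r x" by (auto simp: dist_real_def abs_minus_commute)
        then have "\<bar>h a - h x - k x * (a - x)\<bar> \<le> \<epsilon>' * \<bar>a - x\<bar>" "\<bar>h b - h x - k x * (b - x)\<bar> \<le> \<epsilon>' * \<bar>b - x\<bar>"
          using r(2)[OF xD] by auto
        then have "\<bar>h a - h x - k x * (a - x)\<bar> \<le> \<epsilon>' * (x - a)" "\<bar>h b - h x - k x * (b - x)\<bar> \<le> \<epsilon>' * (b - x)"
          using ab by auto
        then have "\<bar>(b - a) * k x - (h b - h a)\<bar> \<le> \<epsilon>' * (b - a)"
          by (simp add: algebra_simps abs_le_iff)
        then show "\<bar>?F i\<bar> \<le> (case i of (x, K) \<Rightarrow> \<epsilon>' * measure lborel K)" using ab by (simp add: iK)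
      qed
      also have "\<dots> \<le> (\<Sum>(x, K)\<in>p. \<epsilon>' * measure lborel K)"
        by (rule sum_mono2[OF finp]) (use e' in auto)
      also have "\<dots> = \<epsilon>' * (\<Sum>(x, K)\<in>p. measure lborel K)" by (simp add: sum_distrib_left case_prod_unfold)
      also have "(\<Sum>(x, K)\<in>p. measure lborel K) = d - c"
        using additive_content_tagged_division[of p c d] p lcdu by (simp add: box_real)
      finally have b2: "\<bar>\<Sum>i\<in>p - p1. ?F i\<bar> < \<epsilon> / 2" using e'(2) by linarith
      have "\<bar>\<Sum>i\<in>p1. ?F i\<bar> \<le> (\<Sum>i\<in>p1. \<bar>h (Sup (snd i)) - h (Inf (snd i))\<bar>)"
      proof (rule order_trans[OF sum_abs], rule sum_mono)
        fix i assume "i \<in> p1"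
        then have "k (fst i) = 0" unfolding p1_def N_def k_def by auto
        then show "\<bar>?F i\<bar> \<le> \<bar>h (Sup (snd i)) - h (Inf (snd i))\<bar>" by (simp add: case_prod_unfold)
      qed
      also have "\<dots> < \<epsilon> / 2"
      proof (rule H[THEN spec, THEN spec, THEN spec, THEN mp, THEN mp, THEN mp, THEN mp])
        show "finite p1" by (rule p1)
        have I: "\<exists>a b. snd i = {a..b} \<and> a \<le> b \<and> c \<le> a \<and> b \<le> d" if "i \<in> p1" for i
          using K(1)[of "fst i" "snd i"] that p1(1) by force
        show "\<forall>i\<in>p1. c \<le> Inf (snd i) \<and> Inf (snd i) \<le> Sup (snd i) \<and> Sup (snd i) \<le> d"
          using I by force
        have int: "{Inf (snd i)<..<Sup (snd i)} = interior (snd i)" if "i \<in> p1" for i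
          using I[OF that] by (auto simp: interior_atLeastAtMost_real)
        have dis: "interior (snd i) \<inter> interior (snd j) = {}" if "i \<in> p1" "j \<in> p1" "i \<noteq> j" for i j
          using tagged_division_ofD(5)[OF p, of "fst i" "snd i" "fst j" "snd j"] that p1(1) by auto
        show "\<forall>i\<in>p1. \<forall>j\<in>p1. i \<noteq> j \<longrightarrow> {Inf (snd i)<..<Sup (snd i)} \<inter> {Inf (snd j)<..<Sup (snd j)} = {}"
          using int dis by simp
        have im: "interior (snd i) \<in> lmeasurable" if "i \<in> p1" for i
          using I[OF that] by (auto simp: interior_atLeastAtMost_real)
        have "(\<Sum>i\<in>p1. Sup (snd i) - Inf (snd i)) = (\<Sum>i\<in>p1. measure lebesgue (interior (snd i)))"
        proof (rule sum.cong[OF refl])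
          fix i assume "i \<in> p1"
          then obtain a b where "snd i = {a..b}" "a \<le> b" using I by blast
          then show "Sup (snd i) - Inf (snd i) = measure lebesgue (interior (snd i))" by (simp add: interior_atLeastAtMost_real)
        qed
        also have "\<dots> = measure lebesgue (\<Union>i\<in>p1. interior (snd i))"
        proof (rule measure_UNION'[symmetric, OF p1(2)])
          fix i assume "i \<in> p1"
          then show "interior (snd i) \<in> lmeasurable" by (rule im)
        next
          show "pairwise (\<lambda>i j. disjnt (interior (snd i)) (interior (snd j))) p1"
            using dis unfolding pairwise_def disjnt_def by blast
        qed
        also have "\<dots> \<le> measure lebesgue T"
        proof (rule measure_mono_fmeasurable[OF _ _ T(3)])
          show "(\<Union>i\<in>p1. interior (snd i)) \<subseteq> T"
          proof (rule UN_least)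
            fix i assume i: "i \<in> p1"
            then have "snd i \<subseteq> T" using K(3)[of "fst i" "snd i"] p1(1) unfolding p1_def \<gamma>_def by auto
            then show "interior (snd i) \<subseteq> T" using interior_subset by blast
          qed
          show "(\<Union>i\<in>p1. interior (snd i)) \<in> sets lebesgue"
            by (intro fmeasurableD fmeasurable.finite_UN p1(2) im)
        qed
        finally show "(\<Sum>i\<in>p1. Sup (snd i) - Inf (snd i)) < \<delta>" using T(4) by linarith
      qed
      finally have b1: "\<bar>\<Sum>i\<in>p1. ?F i\<bar> < \<epsilon> / 2" .
      show "norm ((\<Sum>(x, K)\<in>p. measure lborel K *\<^sub>R k x) - (h d - h c)) < \<epsilon>"
        unfolding eq real_norm_def
        using b1 b2 abs_triangle_ineq[of "\<Sum>i\<in>p - p1. ?F i" "\<Sum>i\<in>p1. ?F i"] by linarith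
    qed
  qed
  then show ?thesis
  \<comment> \<open>On \<open>D\<close> the function \<open>k\<close> agrees with the derivative
    relative to \<open>{l..u}\<close>, the form in which \<open>iter_deriv\<close> expresses
    it.\<close>
  proof (rule has_integral_spike[OF N, rotated])
    fix x assume "x \<in> {c..d} - N"
    then have x: "x \<in> D" unfolding N_def by blast
    then have xlu: "x \<in> {l<..<u}" using lcdu unfolding D_def by auto
    have "(h has_vector_derivative k x) (at x within {l..u})"
      using kd[OF x] has_field_derivative_at_within by (simp add: has_real_derivative_iff_has_vector_derivative[symmetric])
    then show "vector_derivative h (at x within {l..u}) = k x"
      using xlu by (intro vector_derivative_within_cbox[of l u, unfolded box_real]) auto
  qed
qed

section \<open>Integrals of powers on the interval\<close>

text \<open>The \<open>p\<close>-th power of \<open>Lp_norm\<close> for the functions that occur, as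
  a gauge integral. Without the root it is subadditive for \<open>p < 1\<close>.\<close>

definition pint :: "real \<Rightarrow> (real \<Rightarrow> real) \<Rightarrow> real" where
  "pint p F = integral {-1..1} (\<lambda>x. \<bar>F x\<bar> powr p)"

lemma powr_absolutely_integrable:
  fixes F :: "real \<Rightarrow> real"
  assumes F: "F absolutely_integrable_on {-1..1}" and p: "0 < p" "p < 1"
  shows "(\<lambda>x. \<bar>F x\<bar> powr p) absolutely_integrable_on {-1..1}"
proof (rule measurable_bounded_by_integrable_imp_absolutely_integrable)
  have "F \<in> borel_measurable (lebesgue_on {-1..1})"
    by (rule absolutely_integrable_imp_borel_measurable[OF F]) simp
  then show "(\<lambda>x. \<bar>F x\<bar> powr p) \<in> borel_measurable (lebesgue_on {-1..1})" by measurable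
  show "(\<lambda>x. 1 + \<bar>F x\<bar>) integrable_on {-1..1}"
    using F by (intro Henstock_Kurzweil_Integration.integrable_add)
      (auto simp: absolutely_integrable_on_def)
  fix x
  show "norm (\<bar>F x\<bar> powr p) \<le> 1 + \<bar>F x\<bar>"
  proof (cases "\<bar>F x\<bar> \<le> 1")
    case True
    then have "\<bar>F x\<bar> powr p \<le> 1" using powr_mono2[of p "\<bar>F x\<bar>" 1] p by simp
    then show ?thesis by simp
  next
    case False
    then have "\<bar>F x\<bar> powr p \<le> \<bar>F x\<bar> powr 1" using p by (intro powr_mono) auto
    then show ?thesis by simp
  qed
qed simp

lemma pint_integrable:
  fixes F :: "real \<Rightarrow> real"
  assumes "F absolutely_integrable_on {-1..1}" "0 < p" "p < 1"
  shows "(\<lambda>x. \<bar>F x\<bar> powr p) integrable_on {-1..1}"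
  using powr_absolutely_integrable[OF assms] set_lebesgue_integral_eq_integral(1) by blast

lemma Lp_norm_pint:
  fixes F :: "real \<Rightarrow> real"
  assumes "F absolutely_integrable_on {-1..1}" "0 < p" "p < 1"
  shows "Lp_norm p F = pint p F powr (1 / p)"
  unfolding Lp_norm_def pint_def
  using set_lebesgue_integral_eq_integral(2)[OF powr_absolutely_integrable[OF assms]] by simp

lemma pint_nonneg: "0 \<le> pint p F"
  unfolding pint_def
  by (cases "(\<lambda>x. \<bar>F x\<bar> powr p) integrable_on {-1..1}")
    (auto intro: Henstock_Kurzweil_Integration.integral_nonneg simp: not_integrable_integral)

lemma pint_le_add:
  assumes F: "F absolutely_integrable_on {-1..1}" and G: "G absolutely_integrable_on {-1..1}"
    and H: "H absolutely_integrable_on {-1..1}" and p: "0 < p" "p < 1"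
    and le: "\<And>x. x \<in> {-1..1} \<Longrightarrow> H x = F x + G x"
  shows "pint p H \<le> pint p F + pint p G"
proof -
  have "pint p H \<le> integral {-1..1} (\<lambda>x. \<bar>F x\<bar> powr p + \<bar>G x\<bar> powr p)"
    unfolding pint_def
    by (intro integral_le pint_integrable Henstock_Kurzweil_Integration.integrable_add F G H p)
      (use le powr_abs_add_le p in auto)
  also have "\<dots> = pint p F + pint p G"
    unfolding pint_def by (intro Henstock_Kurzweil_Integration.integral_add pint_integrable F G p)
  finally show ?thesis .
qed

lemma pint_commute: "pint p (\<lambda>x. w x * (F x - G x)) = pint p (\<lambda>x. w x * (G x - F x))"
  unfolding pint_def by (simp add: abs_mult abs_minus_commute)

lemma continuous_phi: "continuous_on S phi"
  unfolding phi_def by (intro continuous_intros)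

lemma pint_poly:
  assumes "0 < p"
  shows "pint p (\<lambda>x. phi x ^ r * poly R x) = sint p (gtrig r R)"
proof -
  have "pint p (\<lambda>x. phi x ^ r * poly R x) = integral {cos pi..cos 0} (\<lambda>x. \<bar>phi x ^ r * poly R x\<bar> powr p)"
    unfolding pint_def by simp
  also have "\<dots> = integral {0..pi} (\<lambda>s. \<bar>phi (cos s) ^ r * poly R (cos s)\<bar> powr p * sin s)"
    by (rule integral_cos_subst) (auto intro!: continuous_on_abs_powr assms continuous_intros continuous_phi)
  also have "\<dots> = sint p (gtrig r R)"
    unfolding sint_def
  proof (rule Henstock_Kurzweil_Integration.integral_cong)
    fix s :: real assume "s \<in> {0..pi}"
    then have "phi (cos s) = sin s" unfolding phi_def using sin_ge_zero[of s] by (simp add: sin_squared_eq[symmetric])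
    then show "\<bar>phi (cos s) ^ r * poly R (cos s)\<bar> powr p * sin s = \<bar>gtrig r R s\<bar> powr p * sin s"
      by (simp add: gtrig_def)
  qed
  finally show ?thesis .
qed

lemma pint_poly_0: "0 < p \<Longrightarrow> pint p (poly R) = sint p (gtrig 0 R)"
  using pint_poly[of p 0 R] by simp

lemma integral_phi_poly: "integral {-1..1} (\<lambda>x. \<bar>phi x ^ r * poly R x\<bar>) = sint 1 (gtrig r R)"
  using pint_poly[of 1 r R] by (simp add: pint_def)

lemma absint_phi_poly: "(\<lambda>x. phi x ^ r * poly R x) absolutely_integrable_on {-1..1}"
  by (intro absolutely_integrable_continuous_real continuous_intros continuous_phi)

lemma absint_on_lebesgue:
  fixes F :: "real \<Rightarrow> real"
  shows "F absolutely_integrable_on {-1..1} \<longleftrightarrow> integrable (lebesgue_on {-1..1}) F"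
  by (simp add: set_integrable_def integrable_restrict_space)

text \<open>Fatou's lemma for gauge integrals. It carries bounds between polynomials over to a limit
  that is known only almost everywhere.\<close>

lemma fatou_integral_le:
  fixes u :: "nat \<Rightarrow> real \<Rightarrow> real" and v :: "real \<Rightarrow> real"
  assumes u: "\<And>i. u i absolutely_integrable_on {-1..1}" "\<And>i x. 0 \<le> u i x"
    and v: "v absolutely_integrable_on {-1..1}" "\<And>x. 0 \<le> v x"
    and lim: "AE x in lebesgue_on {-1..1}. (\<lambda>i. u i x) \<longlonglongrightarrow> v x"
    and le: "eventually (\<lambda>i. integral {-1..1} (u i) \<le> c) sequentially"
  shows "integral {-1..1} v \<le> c"
proof -
  let ?M = "lebesgue_on {-1..1::real}"
  have ui: "integrable ?M (u i)" and vi: "integrable ?M v" for i using u(1) v(1) by (auto simp: absint_on_lebesgue)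
  have eq: "(\<integral>\<^sup>+x. ennreal (F x) \<partial>?M) = ennreal (integral {-1..1} F)" if "integrable ?M F" "\<And>x. 0 \<le> F x" for F
    using nn_integral_eq_integral[OF that(1)] that lebesgue_integral_eq_integral[OF that(1)] by simp
  have "(\<integral>\<^sup>+x. ennreal (v x) \<partial>?M) = (\<integral>\<^sup>+x. liminf (\<lambda>i. ennreal (u i x)) \<partial>?M)"
  proof (rule nn_integral_cong_AE)
    show "AE x in ?M. ennreal (v x) = liminf (\<lambda>i. ennreal (u i x))"
      using lim
    proof eventually_elim
      case (elim x)
      then have "(\<lambda>i. ennreal (u i x)) \<longlonglongrightarrow> ennreal (v x)" by (rule tendsto_ennrealI)
      from lim_imp_Liminf[OF trivial_limit_sequentially this] show ?case by (rule sym)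
    qed
  qed
  also have "\<dots> \<le> liminf (\<lambda>i. \<integral>\<^sup>+x. ennreal (u i x) \<partial>?M)"
    by (rule nn_integral_liminf) (use ui in measurable)
  also have "\<dots> = liminf (\<lambda>i. ennreal (integral {-1..1} (u i)))" using eq[OF ui u(2)] by simp
  also have "\<dots> \<le> ennreal c"
  proof (rule Liminf_le)
    show "\<forall>\<^sub>F i in sequentially. ennreal (integral {-1..1} (u i)) \<le> ennreal c"
      using le by eventually_elim (rule ennreal_leI)
  qed simp
  finally have "ennreal (integral {-1..1} v) \<le> ennreal c" using eq[OF vi v(2)] by simp
  moreover have "0 \<le> c"
  proof -
    obtain i where "integral {-1..1} (u i) \<le> c" using le unfolding eventually_sequentially by blast
    moreover have "0 \<le> integral {-1..1} (u i)"
      using u by (intro Henstock_Kurzweil_Integration.integral_nonneg) (auto intro: set_lebesgue_integral_eq_integral(1))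
    ultimately show ?thesis by linarith
  qed
  ultimately show ?thesis by (simp add: ennreal_le_iff)
qed

text \<open>Bounded sums of integrals make the series of the \<open>v i\<close> converge almost
  everywhere, so the whole sequence tends to 0 and no subsequence has to be selected.\<close>

lemma AE_tendsto_zero:
  fixes v :: "nat \<Rightarrow> real \<Rightarrow> real"
  assumes v: "\<And>i. v i absolutely_integrable_on {-1..1}" "\<And>i x. 0 \<le> v i x"
    and B: "\<And>k. (\<Sum>i<k. integral {-1..1} (v i)) \<le> B"
  shows "AE x in lebesgue_on {-1..1}. (\<lambda>i. v i x) \<longlonglongrightarrow> 0"
proof -
  let ?M = "lebesgue_on {-1..1::real}"
  have vi: "integrable ?M (v i)" for i using v(1) by (auto simp: absint_on_lebesgue)
  have vm[measurable]: "v i \<in> borel_measurable ?M" for i using vi by measurable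
  have pos: "0 \<le> integral {-1..1} (v i)" for i
    using v by (intro Henstock_Kurzweil_Integration.integral_nonneg) (auto intro: set_lebesgue_integral_eq_integral(1))
  have eq: "(\<integral>\<^sup>+x. ennreal (v i x) \<partial>?M) = ennreal (integral {-1..1} (v i))" for i
    using nn_integral_eq_integral[OF vi] v(2) lebesgue_integral_eq_integral[OF vi] by simp
  have "(\<integral>\<^sup>+x. (\<Sum>i. ennreal (v i x)) \<partial>?M) = (\<Sum>i. ennreal (integral {-1..1} (v i)))"
    by (subst nn_integral_suminf) (auto simp: eq)
  also have "\<dots> \<le> ennreal B"
  proof (rule suminf_le_const)
    fix k
    show "(\<Sum>i<k. ennreal (integral {-1..1} (v i))) \<le> ennreal B"
      using B[of k] pos by (simp add: sum_ennreal ennreal_leI)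
  qed simp
  finally have "(\<integral>\<^sup>+x. (\<Sum>i. ennreal (v i x)) \<partial>?M) \<noteq> \<infinity>"
    by (metis ennreal_neq_top infinity_ennreal_def neq_top_trans)
  then have "AE x in ?M. (\<Sum>i. ennreal (v i x)) \<noteq> \<infinity>"
    by (intro nn_integral_PInf_AE) measurable
  then show ?thesis
  proof eventually_elim
    case (elim x)
    then have "summable (\<lambda>i. v i x)" using v(2) by (intro summable_suminf_not_top) auto
    then show ?case by (rule summable_LIMSEQ_zero)
  qed
qed

lemma AC_continuous:
  assumes "abs_continuous_on_Icc l u f" shows "continuous_on {l..u} f"
  unfolding continuous_on_iff
proof (intro ballI allI impI)
  fix x e :: real assume x: "x \<in> {l..u}" and e: "e > 0"
  obtain \<delta> where d: "\<delta> > 0" and H: "\<forall>(I :: unit set) a b. finite I \<longrightarrow> (\<forall>i\<in>I. l \<le> a i \<and> a i \<le> b i \<and> b i \<le> u) \<longrightarrow>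
      (\<forall>i\<in>I. \<forall>j\<in>I. i \<noteq> j \<longrightarrow> {a i<..<b i} \<inter> {a j<..<b j} = {}) \<longrightarrow> (\<Sum>i\<in>I. b i - a i) < \<delta> \<longrightarrow>
      (\<Sum>i\<in>I. \<bar>f (b i) - f (a i)\<bar>) < e"
    using AC_finite[OF assms e, where 'i = unit] by auto
  have le: "\<bar>f b - f a\<bar> < e" if "l \<le> a" "a \<le> b" "b \<le> u" "b - a < \<delta>" for a b
    using H[THEN spec[of _ "UNIV"], THEN spec[of _ "\<lambda>_. a"], THEN spec[of _ "\<lambda>_. b"]] that by simp
  show "\<exists>d>0. \<forall>x'\<in>{l..u}. dist x' x < d \<longrightarrow> dist (f x') (f x) < e"
  proof (intro exI[of _ \<delta>] conjI d ballI impI)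
    fix y assume y: "y \<in> {l..u}" "dist y x < \<delta>"
    show "dist (f y) (f x) < e"
    proof (cases "x \<le> y")
      case True then show ?thesis using le[of x y] x y by (auto simp: dist_real_def)
    next
      case False then show ?thesis using le[of y x] x y by (auto simp: dist_real_def abs_minus_commute)
    qed
  qed
qed

section \<open>Polynomial antiderivatives matched to the function at the origin\<close>

lemma poly_antideriv: "\<exists>A::real poly. pderiv A = S \<and> degree A \<le> Suc (degree S)"
proof -
  let ?A = "\<Sum>i\<le>degree S. monom (coeff S i / real (Suc i)) (Suc i)"
  have c: "coeff ?A (Suc n) = coeff S n / real (Suc n)" for n
    by (simp add: coeff_sum coeff_eq_0)
  have "pderiv ?A = S"
    by (rule poly_eqI) (simp only: coeff_pderiv c, simp)
  moreover have "degree ?A \<le> Suc (degree S)"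
    by (rule degree_sum_le) (auto intro: order_trans[OF degree_monom_le])
  ultimately show ?thesis by blast
qed

lemma poly_iterated_antideriv:
  "\<exists>S::real poly. (pderiv ^^ r) S = Q \<and> (\<forall>i<r. poly ((pderiv ^^ i) S) 0 = c i) \<and> degree S \<le> degree Q + r"
proof (induction r arbitrary: c)
  case 0 then show ?case by auto
next
  case (Suc r)
  obtain S' where S': "(pderiv ^^ r) S' = Q" "\<forall>i<r. poly ((pderiv ^^ i) S') 0 = c (Suc i)" "degree S' \<le> degree Q + r"
    using Suc[of "\<lambda>i. c (Suc i)"] by blast
  obtain A where A: "pderiv A = S'" "degree A \<le> Suc (degree S')" using poly_antideriv by blast
  define S where "S = A + [:c 0 - poly A 0:]"
  have pS: "pderiv S = S'" unfolding S_def by (simp add: pderiv_add A pderiv_pCons)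
  have "(pderiv ^^ Suc r) S = Q" using S'(1) pS by (simp add: funpow_Suc_right del: funpow.simps)
  moreover have "poly ((pderiv ^^ i) S) 0 = c i" if "i < Suc r" for i
  proof (cases i)
    case 0 then show ?thesis by (simp add: S_def)
  next
    case (Suc j) then show ?thesis using S'(2) pS that by (simp add: funpow_Suc_right del: funpow.simps)
  qed
  moreover have "degree S \<le> degree Q + Suc r"
    unfolding S_def using A(2) S'(3) by (intro degree_add_le) auto
  ultimately show ?case by blast
qed

lemma iter_deriv_has_derivative:
  assumes "deriv_in_AC r f" "k < r - 1" "x \<in> {-1..1}"
  shows "(iter_deriv k f has_real_derivative iter_deriv (Suc k) f x) (at x within {-1..1})"
  using assms vector_derivative_works[of "iter_deriv k f" "at x within {-1..1}"]
  unfolding deriv_in_AC_def by (simp add: has_real_derivative_iff_has_vector_derivative)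

lemma deriv_in_AC_continuous:
  assumes "deriv_in_AC r f" "r \<ge> 1" shows "continuous_on {-1..1} f"
proof (cases "r = 1")
  case True
  then show ?thesis using AC_continuous[of "-1" 1 f] assms unfolding deriv_in_AC_def by simp
next
  case False
  show ?thesis
    by (rule DERIV_continuous_on[where D = "iter_deriv 1 f"])
      (use iter_deriv_has_derivative[OF assms(1), of 0] False assms(2) in auto)
qed

text \<open>Closeness of the derivatives of order \<open>r - 1\<close> descends to lower orders by
  the mean value inequality: the Taylor data agree at 0, and since \<open>\<bar>x\<bar> < 1\<close>
  no factor is lost on the way.\<close>

lemma iter_deriv_close:
  assumes f: "deriv_in_AC r f" and a: "0 < a" "a < 1"
    and z: "\<And>i. i < r \<Longrightarrow> poly ((pderiv ^^ i) F) 0 = iter_deriv i f 0"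
    and top: "\<And>x. x \<in> {-a..a} \<Longrightarrow> \<bar>iter_deriv (r - 1) f x - poly ((pderiv ^^ (r - 1)) F) x\<bar> \<le> \<Delta>"
    and x: "x \<in> {-a..a}"
  shows "\<bar>f x - poly F x\<bar> \<le> \<Delta>"
proof -
  have D0: "\<Delta> \<ge> 0" using top[of 0] a by (smt (verit) atLeastAtMost_iff)
  have "j \<le> r - 1 \<Longrightarrow> \<forall>x\<in>{-a..a}. \<bar>iter_deriv (r - 1 - j) f x - poly ((pderiv ^^ (r - 1 - j)) F) x\<bar> \<le> \<Delta>" for j
  proof (induction j)
    case 0 then show ?case using top by simp
  next
    case (Suc j)
    let ?k = "r - 1 - Suc j"
    have k: "Suc ?k = r - 1 - j" "?k < r - 1" "?k < r" using Suc.prems by auto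
    define u where "u x = iter_deriv ?k f x - poly ((pderiv ^^ ?k) F) x" for x
    have du: "(u has_field_derivative (iter_deriv (Suc ?k) f y - poly ((pderiv ^^ Suc ?k) F) y)) (at y within {-a..a})"
      if "y \<in> {-a..a}" for y
    proof -
      have "(iter_deriv ?k f has_real_derivative iter_deriv (Suc ?k) f y) (at y within {-a..a})"
        by (rule DERIV_subset[OF iter_deriv_has_derivative[OF f k(2)]]) (use that a in auto)
      moreover have "(poly ((pderiv ^^ ?k) F) has_real_derivative poly ((pderiv ^^ Suc ?k) F) y) (at y within {-a..a})"
        by (auto intro!: derivative_eq_intros)
      ultimately show ?thesis unfolding u_def by (intro DERIV_diff)
    qed
    show ?case
    proof
      fix x assume x: "x \<in> {-a..a}"
      have "norm (u x - u 0) \<le> \<Delta> * norm (x - 0)"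
      proof (rule field_differentiable_bound[OF _ du])
        fix y assume "y \<in> {-a..a}"
        then show "norm (iter_deriv (Suc ?k) f y - poly ((pderiv ^^ Suc ?k) F) y) \<le> \<Delta>"
          using Suc.IH Suc.prems unfolding k(1) by simp
      qed (use x a in auto)
      moreover have "u 0 = 0" unfolding u_def using z[OF k(3)] by simp
      moreover have "\<Delta> * \<bar>x\<bar> \<le> \<Delta> * 1" using D0 x a by (intro mult_left_mono) auto
      ultimately show "\<bar>iter_deriv ?k f x - poly ((pderiv ^^ ?k) F) x\<bar> \<le> \<Delta>" unfolding u_def by simp
    qed
  qed
  from this[of "r - 1"] x show ?thesis by simp
qed

text \<open>On \<open>[-a, a]\<close> the weight is at least \<open>phi a ^ r\<close>, so the
  weighted \<open>L_1\<close> norm controls the plain one there; the fundamental theorem then bounds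
  the increment from 0, where both sides agree.\<close>

lemma iter_deriv_top_close:
  assumes f: "deriv_in_AC r f" and r: "r \<ge> 1" and a: "0 < a" "a < 1"
    and z: "poly ((pderiv ^^ (r - 1)) F) 0 = iter_deriv (r - 1) f 0"
    and int: "(\<lambda>x. phi x ^ r * (iter_deriv r f x - poly ((pderiv ^^ r) F) x)) absolutely_integrable_on {-1..1}"
    and x: "x \<in> {-a..a}"
  shows "\<bar>iter_deriv (r - 1) f x - poly ((pderiv ^^ (r - 1)) F) x\<bar> \<le>
    integral {-1..1} (\<lambda>x. \<bar>phi x ^ r * (iter_deriv r f x - poly ((pderiv ^^ r) F) x)\<bar>) / phi a ^ r"
proof -
  define h where "h = iter_deriv (r - 1) f"
  define P where "P = (pderiv ^^ (r - 1)) F"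
  have AC: "abs_continuous_on_Icc (-1) 1 h" using f unfolding deriv_in_AC_def h_def by simp
  have Sr: "r = Suc (r - 1)" using r by simp
  have g: "iter_deriv r f = (\<lambda>x. vector_derivative h (at x within {-1..1}))"
    unfolding h_def by (subst Sr) simp
  have Q: "(pderiv ^^ r) F = pderiv P" unfolding P_def by (subst Sr) simp
  have pa: "phi a > 0" unfolding phi_def using a by (simp add: abs_square_less_1)
  have pge: "phi a \<le> phi y" if "y \<in> {-a..a}" for y
  proof -
    have "\<bar>y\<bar> \<le> \<bar>a\<bar>" using that a by auto
    then have "y\<^sup>2 \<le> a\<^sup>2" by (simp only: abs_le_square_iff)
    then show ?thesis unfolding phi_def by simp
  qed
  let ?k = "\<lambda>y. \<bar>phi y ^ r * (iter_deriv r f y - poly ((pderiv ^^ r) F) y)\<bar>"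
  have ki: "?k integrable_on {-1..1}" using int unfolding absolutely_integrable_on_def by simp
  have main: "\<bar>(h d - h c) - (poly P d - poly P c)\<bar> \<le> integral {-1..1} ?k / phi a ^ r"
    if cd: "- a \<le> c" "c \<le> d" "d \<le> a" for c d
  proof -
    have i1: "(iter_deriv r f has_integral (h d - h c)) {c..d}"
      unfolding g by (rule AC_has_integral[OF AC]) (use cd a in auto)
    have i2: "(poly (pderiv P) has_integral (poly P d - poly P c)) {c..d}"
      by (rule fundamental_theorem_of_calculus)
        (use cd in \<open>auto simp: has_real_derivative_iff_has_vector_derivative[symmetric] intro!: derivative_eq_intros\<close>)
    have i3: "((\<lambda>y. iter_deriv r f y - poly ((pderiv ^^ r) F) y) has_integral ((h d - h c) - (poly P d - poly P c))) {c..d}"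
      unfolding Q by (rule has_integral_diff[OF i1 i2])
    have ksub: "?k integrable_on {c..d}"
      by (rule integrable_on_subinterval[OF ki]) (use cd a in auto)
    have "norm (integral {c..d} (\<lambda>y. iter_deriv r f y - poly ((pderiv ^^ r) F) y)) \<le> integral {c..d} (\<lambda>y. ?k y / phi a ^ r)"
    proof (rule integral_norm_bound_integral)
      show "(\<lambda>y. iter_deriv r f y - poly ((pderiv ^^ r) F) y) integrable_on {c..d}" using i3 by blast
      show "(\<lambda>y. ?k y / phi a ^ r) integrable_on {c..d}" using ksub by (simp add: integrable_on_divide)
      fix y assume y: "y \<in> {c..d}"
      have "phi a ^ r \<le> phi y ^ r" using pge[of y] pa y cd by (intro power_mono) auto
      then have "phi a ^ r * \<bar>iter_deriv r f y - poly ((pderiv ^^ r) F) y\<bar> \<le> ?k y"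
        using pge[of y] pa y cd unfolding abs_mult by (intro mult_right_mono) auto
      then show "norm (iter_deriv r f y - poly ((pderiv ^^ r) F) y) \<le> ?k y / phi a ^ r"
        using pa by (simp add: pos_le_divide_eq mult.commute)
    qed
    also have "\<dots> = integral {c..d} ?k / phi a ^ r" by simp
    also have "\<dots> \<le> integral {-1..1} ?k / phi a ^ r"
      by (intro divide_right_mono integral_subset_le ksub ki) (use cd a pa in auto)
    finally show ?thesis using integral_unique[OF i3] by simp
  qed
  have z': "h 0 = poly P 0" using z by (simp add: h_def P_def)
  show ?thesis
  proof (cases "0 \<le> x")
    case True
    then show ?thesis using main[of 0 x] x a z' by (simp add: h_def P_def)
  next
    case False
    then show ?thesis using main[of x 0] x a z' by (simp add: h_def P_def abs_minus_commute algebra_simps)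
  qed
qed

section \<open>Near-best approximants on dyadic degrees\<close>

lemma Lp_norm_nonneg: "0 \<le> Lp_norm p F"
  unfolding Lp_norm_def by simp

lemma Lp_norms_bdd_below: "bdd_below ((\<lambda>P. Lp_norm p (\<lambda>x. w x * (f x - poly P x))) ` A)"
  by (rule bdd_belowI[of _ 0]) (auto simp: Lp_norm_nonneg)

lemma best_approx_nonneg: "0 \<le> best_approx n p w f"
  unfolding best_approx_def
  by (rule cINF_greatest) (auto intro: exI[of _ 0] simp: Lp_norm_nonneg)

lemma best_approx_le:
  "degree P \<le> n \<Longrightarrow> best_approx n p w f \<le> Lp_norm p (\<lambda>x. w x * (f x - poly P x))"
  unfolding best_approx_def by (rule cINF_lower[OF Lp_norms_bdd_below]) simp

lemma best_approx_antimono: "m \<le> n \<Longrightarrow> best_approx n p w f \<le> best_approx m p w f"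
  unfolding best_approx_def
  by (rule cINF_superset_mono[OF _ Lp_norms_bdd_below]) (auto intro: exI[of _ 0])

lemma absint_phi_diff_poly:
  assumes "(\<lambda>x. phi x ^ r * g x) absolutely_integrable_on {-1..1}"
  shows "(\<lambda>x. phi x ^ r * (g x - poly Q x)) absolutely_integrable_on {-1..1}"
  using set_integral_diff(1)[OF assms absint_phi_poly[of r Q]] by (simp add: right_diff_distrib)

text \<open>The slack \<open>\<delta>\<close> replaces attainment of the infimum. It is placed on
  the \<open>p\<close>-th power so that it can be summed directly.\<close>

lemma near_best_approx:
  fixes p :: real
  assumes p: "0 < p" "p < 1" and d: "\<delta> > 0"
    and g: "(\<lambda>x. phi x ^ r * g x) absolutely_integrable_on {-1..1}"
  shows "\<exists>Q. degree Q \<le> m \<and>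
    pint p (\<lambda>x. phi x ^ r * (g x - poly Q x)) \<le> best_approx m p (\<lambda>x. phi x ^ r) g powr p + \<delta>"
proof -
  let ?E = "best_approx m p (\<lambda>x. phi x ^ r) g"
  let ?N = "\<lambda>Q. Lp_norm p (\<lambda>x. phi x ^ r * (g x - poly Q x))"
  have "?E < ?E + \<delta> powr (1 / p)" using d by simp
  then obtain Q where Q: "degree Q \<le> m" "?N Q < ?E + \<delta> powr (1 / p)"
    unfolding best_approx_def by (subst (asm) cINF_less_iff[OF _ Lp_norms_bdd_below]) (auto intro: exI[of _ 0])
  have "pint p (\<lambda>x. phi x ^ r * (g x - poly Q x)) = ?N Q powr p"
    using Lp_norm_pint[OF absint_phi_diff_poly[OF g] p, of Q] p by (simp add: powr_powr pint_nonneg)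
  also have "\<dots> \<le> (?E + \<delta> powr (1 / p)) powr p"
    using Q(2) p by (intro powr_mono2) (auto simp: Lp_norm_nonneg)
  also have "\<dots> \<le> ?E powr p + (\<delta> powr (1 / p)) powr p"
    using powr_abs_add_le[of p ?E "\<delta> powr (1 / p)"] p by (simp add: best_approx_nonneg)
  also have "(\<delta> powr (1 / p)) powr p = \<delta>" using p d by (simp add: powr_powr)
  finally show ?thesis using Q(1) by blast
qed

text \<open>By monotonicity the last term of \<open>a\<close> in a block is the smallest, and the
  weights over the block starting at \<open>2 ^ k * n\<close> sum to at least
  \<open>(2 ^ k * n) powr (2 - 2 * p) / 2\<close>. The constant 8 is this 2 times
  \<open>q \<le> 4\<close> for the shift from \<open>k\<close> to \<open>k + 1\<close>.\<close>

lemma dyadic_sum_le: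
  fixes a :: "nat \<Rightarrow> real" and p :: real
  assumes p: "0 < p" "p < 1" and n: "n \<ge> 1"
    and a: "\<And>\<nu>. 0 \<le> a \<nu>" "\<And>\<mu> \<nu>. \<mu> \<le> \<nu> \<Longrightarrow> a \<nu> \<le> a \<mu>"
    and s: "(\<lambda>\<nu>. real \<nu> powr (1 - 2 * p) * a \<nu>) summable_on {n + 1..}"
  shows "(\<Sum>k<K. (2 powr (2 - 2 * p)) ^ k * a (2 ^ k * n)) \<le>
    a n + 8 * real n powr (2 * p - 2) * (\<Sum>\<^sub>\<infinity>\<nu>\<in>{n + 1..}. real \<nu> powr (1 - 2 * p) * a \<nu>)"
proof -
  define q where "q = (2::real) powr (2 - 2 * p)"
  define t where "t \<nu> = real \<nu> powr (1 - 2 * p) * a \<nu>" for \<nu>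
  have t0: "0 \<le> t \<nu>" for \<nu> unfolding t_def using a(1) by simp
  have q: "0 < q" "q \<le> 4"
    unfolding q_def using powr_mono[of "2 - 2 * p" 2 2] p by (auto simp: powr_numeral)
  have qk: "q ^ k = (2 ^ k) powr (2 - 2 * p)" for k
    unfolding q_def by (simp add: powr_powr powr_realpow[symmetric] mult.commute)
  have block: "q ^ Suc k * a (2 ^ Suc k * n) \<le> 8 * real n powr (2 * p - 2) * sum t {2 ^ k * n<..2 ^ Suc k * n}" for k
  proof -
    let ?m = "2 ^ k * n" and ?M = "2 ^ Suc k * n"
    have m: "?m \<ge> 1" "real ?m > 0" using n by auto
    have "real ?m powr (2 - 2 * p) / 2 * a ?M = (\<Sum>\<nu>\<in>{?m<..?M}. real ?m powr (2 - 2 * p) / real ?M * a ?M)"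
      using m by (simp add: field_simps)
    also have "\<dots> \<le> sum t {?m<..?M}"
    proof (rule sum_mono)
      fix \<nu> assume v: "\<nu> \<in> {?m<..?M}"
      then have v0: "real \<nu> > 0" by auto
      have vm: "real ?m \<le> real \<nu>" "real \<nu> \<le> real ?M" using v by (auto simp only: of_nat_le_iff greaterThanAtMost_iff)
      \<comment> \<open>\<open>\<nu> powr (1 - 2 * p)\<close> may increase or decrease, depending on
        \<open>p\<close>. As a quotient of two increasing functions it is bounded below by the two
        ends of the block.\<close>
      have "real ?m powr (2 - 2 * p) / real ?M \<le> real \<nu> powr (2 - 2 * p) / real \<nu>"
        using vm v0 m p by (intro frac_le powr_mono2) auto
      also have "\<dots> = real \<nu> powr (1 - 2 * p)"
        using v0 powr_diff[of "real \<nu>" "2 - 2 * p" 1] by simp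
      finally show "real ?m powr (2 - 2 * p) / real ?M * a ?M \<le> t \<nu>"
        unfolding t_def using a v by (intro mult_mono) auto
    qed
    finally have "real ?m powr (2 - 2 * p) * a ?M \<le> 2 * sum t {?m<..?M}" by simp
    have "real ?m powr (2 - 2 * p) = q ^ k * real n powr (2 - 2 * p)"
      by (simp add: qk powr_mult)
    with \<open>real ?m powr (2 - 2 * p) * a ?M \<le> 2 * sum t {?m<..?M}\<close>
    have "real n powr (2 * p - 2) * (q ^ k * real n powr (2 - 2 * p) * a ?M) \<le> real n powr (2 * p - 2) * (2 * sum t {?m<..?M})"
      by (intro mult_left_mono) auto
    then have "(real n powr (2 * p - 2) * real n powr (2 - 2 * p)) * (q ^ k * a ?M) \<le> 2 * (real n powr (2 * p - 2) * sum t {?m<..?M})"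
      by (simp only: mult_ac)
    then have *: "q ^ k * a ?M \<le> 2 * (real n powr (2 * p - 2) * sum t {?m<..?M})"
      using n by (simp add: powr_add[symmetric])
    have "q ^ Suc k * a ?M \<le> 4 * (q ^ k * a ?M)"
      using q a by (auto intro!: mult_right_mono simp: mult.assoc)
    with * show ?thesis by simp
  qed
  have blocks: "(\<Sum>k<K. q ^ Suc k * a (2 ^ Suc k * n)) \<le> 8 * real n powr (2 * p - 2) * sum t {n<..2 ^ K * n}" for K
  proof (induction K)
    case (Suc K)
    have "sum t {n<..2 ^ Suc K * n} = sum t {n<..2 ^ K * n} + sum t {2 ^ K * n<..2 ^ Suc K * n}"
    proof (subst sum.union_disjoint[symmetric])
      have "n \<le> 2 ^ K * n" by simp
      then show "sum t {n<..2 ^ Suc K * n} = sum t ({n<..2 ^ K * n} \<union> {2 ^ K * n<..2 ^ Suc K * n})"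
        by (subst ivl_disj_un_two) auto
    qed auto
    then show ?case using Suc block[of K] by (simp add: distrib_left)
  qed simp
  have ts: "t summable_on {n + 1..}" unfolding t_def by (rule s)
  have inf: "8 * real n powr (2 * p - 2) * sum t {n<..2 ^ K * n} \<le> 8 * real n powr (2 * p - 2) * infsum t {n + 1..}" for K
    by (intro mult_left_mono finite_sum_le_infsum) (use ts t0 in auto)
  show ?thesis
  proof (cases K)
    case 0
    have "0 \<le> infsum t {n + 1..}" by (intro infsum_nonneg) (simp add: t0)
    then show ?thesis unfolding 0 using a(1)[of n] by (simp add: t_def[symmetric])
  next
    case (Suc K')
    have "(\<Sum>k<K. q ^ k * a (2 ^ k * n)) = a n + (\<Sum>k<K'. q ^ Suc k * a (2 ^ Suc k * n))"
      unfolding Suc sum.lessThan_Suc_shift by simp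
    with blocks[of K'] inf[of K'] show ?thesis unfolding q_def t_def by linarith
  qed
qed

lemma gtrig_0 [simp]: "gtrig j 0 = (\<lambda>s. 0)"
  by (simp add: gtrig_def fun_eq_iff)

lemma sint_zero [simp]: "sint p (\<lambda>s. 0) = 0"
  by (simp add: sint_def)

lemma sint_gtrig_sum_le:
  assumes "0 < p" "p \<le> 1"
  shows "sint p (gtrig j (\<Sum>k\<in>A. R k)) \<le> (\<Sum>k\<in>A. sint p (gtrig j (R k)))"
proof (induction A rule: infinite_finite_induct)
  case (insert k A)
  then show ?case using sint_gtrig_add_le[OF assms, of j "R k" "\<Sum>k\<in>A. R k"] by simp
qed simp_all

lemma sint_gtrig_telescope_le:
  assumes "0 < p" "p \<le> 1" "K \<le> L"
  shows "sint p (gtrig j (R L - R K)) \<le> (\<Sum>k=K..<L. sint p (gtrig j (R (Suc k) - R k)))"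
proof -
  have "R L - R K = (\<Sum>k=K..<L. R (Suc k) - R k)" using assms(3) by (simp add: sum_Suc_diff')
  then show ?thesis using sint_gtrig_sum_le[OF assms(1,2), of j "\<lambda>k. R (Suc k) - R k" "{K..<L}"] by simp
qed

section \<open>Convergence of the antiderivatives\<close>

lemma tendsto_zero_of_powr:
  fixes x :: "nat \<Rightarrow> real"
  assumes "(\<lambda>i. \<bar>x i\<bar> powr p) \<longlonglongrightarrow> 0" "0 < p"
  shows "x \<longlonglongrightarrow> 0"
proof -
  have "(\<lambda>i. (\<bar>x i\<bar> powr p) powr (1 / p)) \<longlonglongrightarrow> 0"
    by (rule tendsto_zero_powrI[OF assms(1) tendsto_const]) (use assms(2) in auto)
  then have "(\<lambda>i. \<bar>x i\<bar>) \<longlonglongrightarrow> 0" using assms(2) by (simp add: powr_powr)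
  then show ?thesis by (simp add: tendsto_rabs_zero_iff)
qed

lemma suminf_tail_tendsto_zero:
  fixes d :: "nat \<Rightarrow> real"
  assumes "summable d"
  shows "(\<lambda>K. suminf d - sum d {..<K}) \<longlonglongrightarrow> 0"
  using tendsto_diff[OF tendsto_const[of "suminf d"] summable_LIMSEQ[OF assms]] by simp

lemma sum_atLeastLessThan_le_tail:
  fixes d :: "nat \<Rightarrow> real"
  assumes "summable d" "\<And>k. 0 \<le> d k" "K \<le> L"
  shows "sum d {K..<L} \<le> suminf d - sum d {..<K}"
proof -
  have "sum d {..<L} = sum d {..<K} + sum d {K..<L}"
    using assms(3) by (metis atLeast0LessThan le0 sum.atLeastLessThan_concat)
  moreover have "sum d {..<L} \<le> suminf d" using assms by (intro sum_le_suminf) auto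
  ultimately show ?thesis by simp
qed

lemma AE_open_interval: "AE x in lebesgue_on {-1..1::real}. -1 < x \<and> x < 1"
proof (rule AE_I')
  show "{-1, 1} \<in> null_sets (lebesgue_on {-1..1::real})"
    by (simp add: null_sets_restrict_space negligible_iff_null_sets[symmetric])
qed auto

text \<open>For fixed \<open>x\<close> a number \<open>a\<close> between
  \<open>\<bar>x\<bar>\<close> and 1 bounds the weight from below on \<open>[-a, a]\<close>. The
  constant deteriorates as \<open>x\<close> approaches an endpoint, so the conclusion is pointwise
  on the open interval.\<close>

lemma antiderivative_L1_to_pointwise:
  fixes f :: "real \<Rightarrow> real"
  assumes f: "deriv_in_AC r f" and r: "r \<ge> 1"
    and g: "(\<lambda>x. phi x ^ r * iter_deriv r f x) absolutely_integrable_on {-1..1}"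
    and F: "\<And>k i. i < r \<Longrightarrow> poly ((pderiv ^^ i) (F k)) 0 = iter_deriv i f 0"
    and lim: "(\<lambda>k. integral {-1..1} (\<lambda>x. \<bar>phi x ^ r * (iter_deriv r f x - poly ((pderiv ^^ r) (F k)) x)\<bar>)) \<longlonglongrightarrow> 0"
    and x: "-1 < x" "x < 1"
  shows "(\<lambda>k. poly (F k) x) \<longlonglongrightarrow> f x"
proof -
  define I where "I k = integral {-1..1} (\<lambda>x. \<bar>phi x ^ r * (iter_deriv r f x - poly ((pderiv ^^ r) (F k)) x)\<bar>)" for k
  have "\<bar>x\<bar> < 1" using x by auto
  then obtain a where a: "\<bar>x\<bar> < a" "a < 1" using dense by blast
  have "\<bar>f x - poly (F k) x\<bar> \<le> I k / phi a ^ r" for k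
  proof (rule iter_deriv_close[OF f, of a])
    show "\<bar>iter_deriv (r - 1) f y - poly ((pderiv ^^ (r - 1)) (F k)) y\<bar> \<le> I k / phi a ^ r" if "y \<in> {-a..a}" for y
      unfolding I_def using that r a F by (intro iter_deriv_top_close[OF f r] absint_phi_diff_poly[OF g]) auto
  qed (use a F in auto)
  then have ev: "\<forall>\<^sub>F k in sequentially. norm (f x - poly (F k) x) \<le> I k / phi a ^ r" by simp
  have "I \<longlonglongrightarrow> 0" unfolding I_def by (rule lim)
  then have "(\<lambda>k. I k / phi a ^ r) \<longlonglongrightarrow> 0" by (rule tendsto_divide_zero)
  with ev have "(\<lambda>k. f x - poly (F k) x) \<longlonglongrightarrow> 0" by (rule Lim_null_comparison)
  from tendsto_diff[OF tendsto_const[of "f x"] this] show ?thesis by simp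
qed

text \<open>
  Nikolskii's inequality upgrades the summability hypothesis to convergence of \<open>(pderiv ^^ r) (F k)\<close> in weighted
  \<open>L\<^sub>1\<close>, which identifies \<open>f\<close> as the pointwise limit of the \<open>F k\<close>; the rate in \<open>L\<^sub>p\<close> then follows by Fatou's lemma.
\<close>

lemma antiderivatives_converge:
  fixes f :: "real \<Rightarrow> real" and p :: real
  assumes p: "0 < p" "p < 1" and r: "r \<ge> 1" and n: "n \<ge> 1"
    and f: "deriv_in_AC r f"
    and g: "(\<lambda>x. phi x ^ r * iter_deriv r f x) absolutely_integrable_on {-1..1}"
    and F: "\<And>k i. i < r \<Longrightarrow> poly ((pderiv ^^ i) (F k)) 0 = iter_deriv i f 0"
    and deg: "\<And>k. degree (F k) \<le> 2 ^ k * n"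
    and close: "\<And>K. (\<Sum>k<K. pint p (\<lambda>x. phi x ^ r * (iter_deriv r f x - poly ((pderiv ^^ r) (F k)) x))) \<le> B"
    and y: "summable (\<lambda>k. (2 powr (2 - 2 * p)) ^ Suc k * sint p (gtrig r ((pderiv ^^ r) (F (Suc k) - F k))))"
  shows "(\<lambda>k. pint p (\<lambda>x. f x - poly (F k) x)) \<longlonglongrightarrow> 0"
proof -
  define q where "q = (2::real) powr (2 - 2 * p)"
  define Q where "Q k = (pderiv ^^ r) (F k)" for k
  define Y where "Y k = q ^ Suc k * sint p (gtrig r (Q (Suc k) - Q k))" for k
  have Qd: "(pderiv ^^ r) (F i - F j) = Q i - Q j" for i j unfolding Q_def by (rule higher_pderiv_minus)
  have q0: "q > 0" unfolding q_def by simp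
  have Y0: "0 \<le> Y k" for k unfolding Y_def using q0 p sint_gtrig_nonneg[of p] by simp
  have sY: "summable Y" using y unfolding Qd q_def[symmetric] Y_def .
  have qk: "real (2 ^ k * n) powr s = q ^ k * real n powr s" if "s = 2 - 2 * p" for s k
    unfolding that q_def by (simp add: powr_mult powr_powr powr_realpow[symmetric] mult.commute)
  have dF: "degree (F (Suc k) - F k) \<le> 2 ^ Suc k * n" for k
    using deg[of k] deg[of "Suc k"] by (intro degree_diff_le) auto
  note wg = absint_phi_diff_poly[OF g]
  have fc: "continuous_on {-1..1} f" by (rule deriv_in_AC_continuous[OF f r])

  obtain C1 where C1: "C1 > 0" "\<And>n G. n \<ge> 1 \<Longrightarrow> etrig n G \<Longrightarrow> sint 1 G \<le> C1 * real n powr (2 / p - 2) * sint p G powr (1 / p)"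
    using nikolskii_sint[OF p] by blast
  obtain C0 where C0: "C0 > 0" "\<And>N S. N \<ge> 1 \<Longrightarrow> degree S \<le> N \<Longrightarrow> (\<And>i. i < r \<Longrightarrow> poly ((pderiv ^^ i) S) 0 = 0) \<Longrightarrow>
    sint p (gtrig 0 S) \<le> C0 * real N powr (2 - 2 * p) * sint p (gtrig r ((pderiv ^^ r) S))"
    using zero_taylor_sint[OF p r] by blast

  \<comment> \<open>The Nikolskii factor has exponent \<open>2 / p - 2\<close>, which is
    \<open>2 - 2 * p\<close> divided by \<open>p\<close>. So the growth in \<open>k\<close> is
    exactly the factor \<open>q ^ Suc k\<close> inside \<open>Y k powr (1 / p)\<close>.\<close>
  define d where "d k = C1 * real n powr (2 / p - 2) * Y k powr (1 / p)" for k
  have d0: "0 \<le> d k" for k unfolding d_def using C1(1) by simp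
  have step1: "sint 1 (gtrig r (Q (Suc k) - Q k)) \<le> d k" for k
  proof -
    have "etrig (2 ^ Suc k * n) (gtrig r (Q (Suc k) - Q k))"
      using etrig_gtrig_pderiv[OF dF[of k], of r] unfolding Qd .
    then have "sint 1 (gtrig r (Q (Suc k) - Q k)) \<le> C1 * real (2 ^ Suc k * n) powr (2 / p - 2) * sint p (gtrig r (Q (Suc k) - Q k)) powr (1 / p)"
      using n by (intro C1(2)) auto
    also have "real (2 ^ Suc k * n) powr (2 / p - 2) = (real (2 ^ Suc k * n) powr (2 - 2 * p)) powr (1 / p)"
      using p by (simp add: powr_powr diff_divide_distrib)
    also have "\<dots> = (q ^ Suc k) powr (1 / p) * real n powr (2 / p - 2)"
      using p q0 unfolding qk[OF refl] by (simp add: powr_mult powr_powr diff_divide_distrib)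
    also have "C1 * ((q ^ Suc k) powr (1 / p) * real n powr (2 / p - 2)) * sint p (gtrig r (Q (Suc k) - Q k)) powr (1 / p) = d k"
      unfolding d_def Y_def using p sint_gtrig_nonneg[of p r] q0 by (simp add: powr_mult mult_ac)
    finally show ?thesis .
  qed
  have sd: "summable d"
  proof (rule summable_comparison_test)
    define M where "M = suminf Y"
    have M: "Y k \<le> M" for k unfolding M_def
      using sum_le_suminf[OF sY, of "{k}"] Y0 by simp
    show "\<exists>N. \<forall>k\<ge>N. norm (d k) \<le> C1 * real n powr (2 / p - 2) * M powr (1 / p - 1) * Y k"
    proof (intro exI[of _ 0] allI impI)
      fix k
      \<comment> \<open>As \<open>1 / p > 1\<close> and \<open>Y\<close> is bounded, the powers are
        summable along with \<open>Y\<close>.\<close>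
      have "Y k powr (1 / p) \<le> M powr (1 / p - 1) * Y k"
      proof (cases "Y k = 0")
        case False
        then have "Y k powr (1 / p) = Y k powr (1 / p - 1) * Y k"
          using Y0[of k] powr_add[of "Y k" "1 / p - 1" 1] by simp
        also have "\<dots> \<le> M powr (1 / p - 1) * Y k"
          using Y0 M p by (intro mult_right_mono powr_mono2) auto
        finally show ?thesis .
      qed simp
      then have "C1 * real n powr (2 / p - 2) * Y k powr (1 / p) \<le> C1 * real n powr (2 / p - 2) * (M powr (1 / p - 1) * Y k)"
        using C1(1) by (intro mult_left_mono) auto
      then show "norm (d k) \<le> C1 * real n powr (2 / p - 2) * M powr (1 / p - 1) * Y k"
        using d0[of k] by (simp add: d_def mult_ac)
    qed
    show "summable (\<lambda>k. C1 * real n powr (2 / p - 2) * M powr (1 / p - 1) * Y k)"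
      by (intro summable_mult sY)
  qed

  \<comment> \<open>Almost everywhere convergence only needs \<open>p\<close>-th powers. It
    identifies the limit in Fatou's lemma, by which the \<open>L_1\<close> bounds on differences of
    the \<open>Q k\<close> reach the derivative of \<open>f\<close>.\<close>
  have AEQ: "AE x in lebesgue_on {-1..1}. (\<lambda>k. phi x ^ r * (iter_deriv r f x - poly (Q k) x)) \<longlonglongrightarrow> 0"
  proof -
    have "AE x in lebesgue_on {-1..1}. (\<lambda>k. \<bar>phi x ^ r * (iter_deriv r f x - poly (Q k) x)\<bar> powr p) \<longlonglongrightarrow> 0"
      by (rule AE_tendsto_zero[OF powr_absolutely_integrable[OF wg p]])
        (use close in \<open>auto simp: pint_def Q_def\<close>)
    then show ?thesis by eventually_elim (rule tendsto_zero_of_powr[OF _ p(1)])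
  qed
  have L1: "integral {-1..1} (\<lambda>x. \<bar>phi x ^ r * (iter_deriv r f x - poly (Q K) x)\<bar>) \<le> suminf d - sum d {..<K}" for K
  proof (rule fatou_integral_le[where u = "\<lambda>L x. \<bar>phi x ^ r * poly (Q L - Q K) x\<bar>"])
    show "AE x in lebesgue_on {-1..1}. (\<lambda>L. \<bar>phi x ^ r * poly (Q L - Q K) x\<bar>) \<longlonglongrightarrow> \<bar>phi x ^ r * (iter_deriv r f x - poly (Q K) x)\<bar>"
      using AEQ
    proof eventually_elim
      case (elim x)
      have "(\<lambda>L. phi x ^ r * (iter_deriv r f x - poly (Q K) x) - phi x ^ r * (iter_deriv r f x - poly (Q L) x)) \<longlonglongrightarrow> phi x ^ r * (iter_deriv r f x - poly (Q K) x)"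
        using tendsto_diff[OF tendsto_const elim] by simp
      then show ?case by (intro tendsto_rabs) (simp add: algebra_simps)
    qed
    show "\<forall>\<^sub>F L in sequentially. integral {-1..1} (\<lambda>x. \<bar>phi x ^ r * poly (Q L - Q K) x\<bar>) \<le> suminf d - sum d {..<K}"
      using eventually_ge_at_top[of K]
    proof eventually_elim
      case (elim L)
      have "integral {-1..1} (\<lambda>x. \<bar>phi x ^ r * poly (Q L - Q K) x\<bar>) = sint 1 (gtrig r (Q L - Q K))"
        by (rule integral_phi_poly)
      also have "\<dots> \<le> (\<Sum>k=K..<L. sint 1 (gtrig r (Q (Suc k) - Q k)))"
        by (rule sint_gtrig_telescope_le) (use elim in auto)
      also have "\<dots> \<le> sum d {K..<L}" by (rule sum_mono) (rule step1)
      also have "\<dots> \<le> suminf d - sum d {..<K}" by (rule sum_atLeastLessThan_le_tail[OF sd d0 elim])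
      finally show ?case .
    qed
  qed (use set_integrable_abs[OF absint_phi_poly] set_integrable_abs[OF wg] in \<open>auto simp del: poly_diff\<close>)
  have pw: "(\<lambda>k. poly (F k) x) \<longlonglongrightarrow> f x" if "-1 < x" "x < 1" for x
  proof (rule antiderivative_L1_to_pointwise[OF f r g F _ that])
    show "(\<lambda>k. integral {-1..1} (\<lambda>x. \<bar>phi x ^ r * (iter_deriv r f x - poly ((pderiv ^^ r) (F k)) x)\<bar>)) \<longlonglongrightarrow> 0"
      using suminf_tail_tendsto_zero[OF sd]
    proof (rule tendsto_sandwich[OF _ _ tendsto_const, rotated 2])
      show "\<forall>\<^sub>F k in sequentially. integral {-1..1} (\<lambda>x. \<bar>phi x ^ r * (iter_deriv r f x - poly ((pderiv ^^ r) (F k)) x)\<bar>) \<le> suminf d - sum d {..<k}"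
        using L1 by (simp add: Q_def)
      show "\<forall>\<^sub>F k in sequentially. 0 \<le> integral {-1..1} (\<lambda>x. \<bar>phi x ^ r * (iter_deriv r f x - poly ((pderiv ^^ r) (F k)) x)\<bar>)"
        by (intro always_eventually allI Henstock_Kurzweil_Integration.integral_nonneg)
          (use set_lebesgue_integral_eq_integral(1)[OF set_integrable_abs[OF wg]] in auto)
    qed
  qed

  \<comment> \<open>All \<open>F k\<close> share the Taylor data of \<open>f\<close> at 0, so their
    differences satisfy the hypothesis of \<open>zero_taylor_sint\<close> and are bounded by the
    same summable \<open>Y k\<close>.\<close>
  define e where "e k = C0 * real n powr (2 - 2 * p) * Y k" for k
  have e0: "0 \<le> e k" for k unfolding e_def using C0(1) Y0 by simp
  have se: "summable e" unfolding e_def by (intro summable_mult sY)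
  have step0: "sint p (gtrig 0 (F (Suc k) - F k)) \<le> e k" for k
  proof -
    have "sint p (gtrig 0 (F (Suc k) - F k)) \<le> C0 * real (2 ^ Suc k * n) powr (2 - 2 * p) * sint p (gtrig r (Q (Suc k) - Q k))"
      unfolding Qd[symmetric] by (rule C0(2)[OF _ dF]) (use n F in \<open>auto simp: higher_pderiv_minus\<close>)
    also have "\<dots> = e k" unfolding e_def Y_def qk[OF refl] by (simp add: mult_ac)
    finally show ?thesis .
  qed
  have absF: "(\<lambda>x. \<bar>poly P x\<bar> powr p) absolutely_integrable_on {-1..1}" for P
    by (rule powr_absolutely_integrable[OF _ p]) (intro absolutely_integrable_continuous_real continuous_intros)
  have absf: "(\<lambda>x. \<bar>f x - poly P x\<bar> powr p) absolutely_integrable_on {-1..1}" for P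
    by (rule powr_absolutely_integrable[OF _ p]) (intro absolutely_integrable_continuous_real continuous_intros fc)
  have tail: "pint p (\<lambda>x. f x - poly (F K) x) \<le> suminf e - sum e {..<K}" for K
    unfolding pint_def
  proof (rule fatou_integral_le[OF absF[of "F L - F K" for L] _ absf])
    show "AE x in lebesgue_on {-1..1}. (\<lambda>L. \<bar>poly (F L - F K) x\<bar> powr p) \<longlonglongrightarrow> \<bar>f x - poly (F K) x\<bar> powr p"
      using AE_open_interval
    proof eventually_elim
      case (elim x)
      then have "(\<lambda>L. \<bar>poly (F L - F K) x\<bar>) \<longlonglongrightarrow> \<bar>f x - poly (F K) x\<bar>"
        by (auto intro!: tendsto_intros pw)
      then show ?case by (rule tendsto_powr'[OF _ tendsto_const]) (use p in auto)
    qed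
    show "\<forall>\<^sub>F L in sequentially. integral {-1..1} (\<lambda>x. \<bar>poly (F L - F K) x\<bar> powr p) \<le> suminf e - sum e {..<K}"
      using eventually_ge_at_top[of K]
    proof eventually_elim
      case (elim L)
      have "integral {-1..1} (\<lambda>x. \<bar>poly (F L - F K) x\<bar> powr p) = sint p (gtrig 0 (F L - F K))"
        using pint_poly_0[OF p(1), of "F L - F K"] unfolding pint_def .
      also have "\<dots> \<le> (\<Sum>k=K..<L. sint p (gtrig 0 (F (Suc k) - F k)))"
        by (rule sint_gtrig_telescope_le) (use elim p in auto)
      also have "\<dots> \<le> sum e {K..<L}" by (rule sum_mono) (rule step0)
      also have "\<dots> \<le> suminf e - sum e {..<K}" by (rule sum_atLeastLessThan_le_tail[OF se e0 elim])
      finally show ?case .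
    qed
  qed auto
  show ?thesis
    by (rule tendsto_sandwich[OF _ _ tendsto_const suminf_tail_tendsto_zero[OF se]])
      (use tail pint_nonneg in auto)
qed

section \<open>Comparison with the best approximant\<close>

lemma absint_diff_poly:
  fixes f :: "real \<Rightarrow> real"
  assumes "continuous_on {-1..1} f"
  shows "(\<lambda>x. f x - poly P x) absolutely_integrable_on {-1..1}"
  by (intro absolutely_integrable_continuous_real continuous_intros assms)

text \<open>\<open>G K\<close>, the sum of \<open>F 0\<close> and of degree-\<open>n\<close>
  substitutes for the differences before \<open>K\<close>, has degree at most \<open>n\<close> for
  every \<open>K\<close> and differs from \<open>F K\<close> by a \<open>p\<close>-th power of order
  \<open>real n powr (- (real r * p)) * B\<close>. As \<open>P\<close> is best,
  \<open>G K - P\<close> is equally small up to the error of \<open>F K\<close>, and Bernstein's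
  factor \<open>real n powr (real r * p)\<close> cancels the gain. The majorants \<open>b\<close>
  leave room for approximants that are only nearly best.\<close>

lemma best_polynomial_derivative_le:
  fixes p :: real
  assumes p: "0 < p" "p < 1" and r: "r \<ge> 1"
  shows "\<exists>C>0. \<forall>f P n F b B. deriv_in_AC r f \<longrightarrow>
    (\<lambda>x. phi x ^ r * iter_deriv r f x) absolutely_integrable_on {-1..1} \<longrightarrow>
    r \<le> n \<longrightarrow> degree P \<le> n \<longrightarrow>
    (\<forall>G. degree G \<le> n \<longrightarrow> pint p (\<lambda>x. f x - poly P x) \<le> pint p (\<lambda>x. f x - poly G x)) \<longrightarrow>
    (\<forall>k. \<forall>i<r. poly ((pderiv ^^ i) (F k)) 0 = iter_deriv i f 0) \<longrightarrow>
    (\<forall>k. degree (F k) \<le> 2 ^ k * n) \<longrightarrow>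
    (\<forall>k. pint p (\<lambda>x. phi x ^ r * (iter_deriv r f x - poly ((pderiv ^^ r) (F k)) x)) \<le> b k) \<longrightarrow>
    (\<forall>K. (\<Sum>k<K. (2 powr (2 - 2 * p)) ^ k * b k) \<le> B) \<longrightarrow>
    pint p (\<lambda>x. phi x ^ r * (iter_deriv r f x - poly ((pderiv ^^ r) P) x)) \<le> C * B"
proof -
  define q where "q = (2::real) powr (2 - 2 * p)"
  have q: "1 \<le> q" "q \<le> 4"
    unfolding q_def using powr_mono[of "2 - 2 * p" 2 2] p by (auto simp: powr_numeral ge_one_powr_ge_zero)
  obtain C1 where C1: "C1 > 0" "\<And>n k S. r \<le> n \<Longrightarrow> degree S \<le> 2 ^ k * n \<Longrightarrow>
    (\<exists>T. degree T \<le> n \<and>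
      sint p (gtrig 0 (S - T)) \<le> C1 * real n powr (- (real r * p)) * q ^ k * sint p (gtrig r ((pderiv ^^ r) S)) \<and>
      sint p (gtrig r ((pderiv ^^ r) T)) \<le> C1 * q ^ k * sint p (gtrig r ((pderiv ^^ r) S)))"
    using simultaneous_sint[OF p r] unfolding q_def[symmetric] by blast
  obtain C2 where C2: "C2 > 0" "\<And>n Q. n \<ge> 1 \<Longrightarrow> degree Q \<le> n \<Longrightarrow>
    sint p (gtrig r ((pderiv ^^ r) Q)) \<le> C2 * real n powr (real r * p) * sint p (gtrig 0 Q)"
    using bernstein_sint[OF p, of r] by blast
  show ?thesis
  \<comment> \<open>The 1 is the error of \<open>F 0\<close>, \<open>5 * C1\<close> the passage from
    \<open>F 0\<close> to \<open>G K\<close>, and \<open>10 * C2 * C1\<close> Bernstein's inequality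
    for \<open>G K - P\<close>. The 5 is from \<open>Ysum\<close>: each difference is charged to two
    consecutive majorants, one of them with a shift costing \<open>q \<le> 4\<close>. It doubles
    because \<open>G K\<close> and \<open>P\<close> are compared through \<open>f\<close>.\<close>
  proof (intro exI[of _ "1 + 5 * C1 + 10 * C2 * C1"] conjI allI impI)
    show "0 < 1 + 5 * C1 + 10 * C2 * C1" using C1(1) C2(1) by (simp add: add_pos_pos)
    fix f :: "real \<Rightarrow> real" and P and n and F :: "nat \<Rightarrow> real poly" and b B
    assume f: "deriv_in_AC r f"
      and g: "(\<lambda>x. phi x ^ r * iter_deriv r f x) absolutely_integrable_on {-1..1}"
      and n: "r \<le> n" and P: "degree P \<le> n"
      and best: "\<forall>G. degree G \<le> n \<longrightarrow> pint p (\<lambda>x. f x - poly P x) \<le> pint p (\<lambda>x. f x - poly G x)"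
      and F: "\<forall>k. \<forall>i<r. poly ((pderiv ^^ i) (F k)) 0 = iter_deriv i f 0"
      and deg: "\<forall>k. degree (F k) \<le> 2 ^ k * n"
      and b: "\<forall>k. pint p (\<lambda>x. phi x ^ r * (iter_deriv r f x - poly ((pderiv ^^ r) (F k)) x)) \<le> b k"
      and B: "\<forall>K. (\<Sum>k<K. (2 powr (2 - 2 * p)) ^ k * b k) \<le> B"
    have n1: "n \<ge> 1" using n r by simp
    note wg = absint_phi_diff_poly[OF g]
    have fP: "(\<lambda>x. f x - poly G x) absolutely_integrable_on {-1..1}" for G
      by (rule absint_diff_poly[OF deriv_in_AC_continuous[OF f r]])
    have absp: "poly G absolutely_integrable_on {-1..1}" for G :: "real poly"
      by (intro absolutely_integrable_continuous_real continuous_intros)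
    define D where "D H = pint p (\<lambda>x. phi x ^ r * (iter_deriv r f x - poly ((pderiv ^^ r) H) x))" for H
    define s where "s H = sint p (gtrig r ((pderiv ^^ r) H))" for H
    have b0: "0 \<le> b k" for k using b pint_nonneg order_trans by blast
    have B': "(\<Sum>k<K. q ^ k * b k) \<le> B" for K using B unfolding q_def by blast
    have s_le: "s (G - H) \<le> D G + D H" for G H
    proof -
      have "s (G - H) = pint p (\<lambda>x. phi x ^ r * poly ((pderiv ^^ r) (G - H)) x)"
        unfolding s_def by (rule pint_poly[OF p(1), symmetric])
      also have "\<dots> \<le> pint p (\<lambda>x. phi x ^ r * (poly ((pderiv ^^ r) G) x - iter_deriv r f x)) + D H"
        unfolding D_def
      proof (rule pint_le_add[OF _ wg absint_phi_poly p])
        show "(\<lambda>x. phi x ^ r * (poly ((pderiv ^^ r) G) x - iter_deriv r f x)) absolutely_integrable_on {-1..1}"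
          using set_integral_diff(1)[OF absint_phi_poly[of r "(pderiv ^^ r) G"] g] by (simp add: right_diff_distrib)
      qed (simp add: higher_pderiv_minus algebra_simps)
      also have "pint p (\<lambda>x. phi x ^ r * (poly ((pderiv ^^ r) G) x - iter_deriv r f x)) = D G"
        unfolding D_def by (rule pint_commute)
      finally show ?thesis .
    qed
    have D_le: "D H \<le> D G + s (G - H)" for G H
    proof -
      have "D H \<le> D G + pint p (\<lambda>x. phi x ^ r * poly ((pderiv ^^ r) (G - H)) x)"
        unfolding D_def
        by (rule pint_le_add[OF wg absint_phi_poly wg p]) (simp add: higher_pderiv_minus algebra_simps)
      then show ?thesis unfolding s_def pint_poly[OF p(1)] .
    qed
    define S where "S k = F (Suc k) - F k" for k
    define Y where "Y k = q ^ Suc k * s (S k)" for k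
    have Y0: "0 \<le> Y k" for k unfolding Y_def s_def using q p sint_gtrig_nonneg[of p] by simp
    have Ysum: "(\<Sum>k<K. Y k) \<le> 5 * B" for K
    proof -
      have "(\<Sum>k<K. Y k) \<le> (\<Sum>k<K. q ^ Suc k * b (Suc k) + q * (q ^ k * b k))"
      proof (rule sum_mono)
        fix k
        have "s (S k) \<le> b (Suc k) + b k"
          unfolding S_def using s_le[of "F (Suc k)" "F k"] b[rule_format, of k] b[rule_format, of "Suc k"] by (simp add: D_def)
        then have "q ^ Suc k * s (S k) \<le> q ^ Suc k * (b (Suc k) + b k)" using q by (intro mult_left_mono) auto
        then show "Y k \<le> q ^ Suc k * b (Suc k) + q * (q ^ k * b k)" by (simp add: Y_def algebra_simps)
      qed
      also have "\<dots> = (\<Sum>k<K. q ^ Suc k * b (Suc k)) + q * (\<Sum>k<K. q ^ k * b k)"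
        by (simp add: sum.distrib sum_distrib_left)
      also have "(\<Sum>k<K. q ^ Suc k * b (Suc k)) \<le> (\<Sum>k<Suc K. q ^ k * b k)"
        unfolding sum.lessThan_Suc_shift using b0[of 0] by simp
      also have "\<dots> \<le> B" by (rule B')
      also have "q * (\<Sum>k<K. q ^ k * b k) \<le> 4 * B"
        using q b0 B' by (intro mult_mono) (auto intro!: sum_nonneg)
      finally show ?thesis by simp
    qed
    have sY: "summable Y"
      by (rule summableI_nonneg_bounded[OF Y0 Ysum])
    have B0: "b 0 \<le> B" using B'[of 1] by simp
    have conv: "(\<lambda>k. pint p (\<lambda>x. f x - poly (F k) x)) \<longlonglongrightarrow> 0"
    proof (rule antiderivatives_converge[OF p r n1 f g])
      show "(\<Sum>k<K. pint p (\<lambda>x. phi x ^ r * (iter_deriv r f x - poly ((pderiv ^^ r) (F k)) x))) \<le> B" for K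
      proof -
        have "(\<Sum>k<K. pint p (\<lambda>x. phi x ^ r * (iter_deriv r f x - poly ((pderiv ^^ r) (F k)) x))) \<le> (\<Sum>k<K. q ^ k * b k)"
        proof (rule sum_mono)
          fix k
          have "1 * b k \<le> q ^ k * b k" using q b0 by (intro mult_right_mono one_le_power) auto
          then show "pint p (\<lambda>x. phi x ^ r * (iter_deriv r f x - poly ((pderiv ^^ r) (F k)) x)) \<le> q ^ k * b k"
            using b[rule_format, of k] by linarith
        qed
        then show ?thesis using B'[of K] by linarith
      qed
      show "summable (\<lambda>k. (2 powr (2 - 2 * p)) ^ Suc k * sint p (gtrig r ((pderiv ^^ r) (F (Suc k) - F k))))"
        using sY unfolding Y_def s_def S_def q_def .
    qed (use F deg in auto)
    have "degree (S k) \<le> 2 ^ Suc k * n" for k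
      unfolding S_def using deg[rule_format, of k] deg[rule_format, of "Suc k"] by (intro degree_diff_le) auto
    then have "\<exists>T. degree T \<le> n \<and> sint p (gtrig 0 (S k - T)) \<le> C1 * real n powr (- (real r * p)) * Y k \<and> s T \<le> C1 * Y k" for k
      using C1(2)[OF n, of "S k" "Suc k"] unfolding Y_def s_def by (simp only: mult.assoc)
    then obtain T where T: "\<And>k. degree (T k) \<le> n"
      "\<And>k. sint p (gtrig 0 (S k - T k)) \<le> C1 * real n powr (- (real r * p)) * Y k" "\<And>k. s (T k) \<le> C1 * Y k"
      by metis
    define G where "G K = F 0 + (\<Sum>k<K. T k)" for K
    have FK: "F K = F 0 + (\<Sum>k<K. S k)" for K unfolding S_def by (simp add: sum_lessThan_telescope)
    have dG: "degree (G K) \<le> n" for K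
      unfolding G_def using deg[rule_format, of 0] T(1) by (intro degree_add_le degree_sum_le) auto
    define R where "R = real n powr (- (real r * p))"
    have FG: "sint p (gtrig 0 (F K - G K)) \<le> 5 * C1 * R * B" for K
    proof -
      have "F K - G K = (\<Sum>k<K. S k - T k)" by (simp add: FK[of K] G_def sum_subtractf)
      then have "sint p (gtrig 0 (F K - G K)) \<le> (\<Sum>k<K. sint p (gtrig 0 (S k - T k)))"
        using sint_gtrig_sum_le[of p 0 "\<lambda>k. S k - T k" "{..<K}"] p by simp
      also have "\<dots> \<le> (\<Sum>k<K. C1 * R * Y k)" unfolding R_def by (rule sum_mono) (rule T(2))
      also have "\<dots> = C1 * R * (\<Sum>k<K. Y k)" by (simp add: sum_distrib_left)
      also have "\<dots> \<le> C1 * R * (5 * B)" using C1(1) Ysum by (intro mult_left_mono) (auto simp: R_def)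
      finally show ?thesis by (simp add: mult_ac)
    qed
    have sG: "s (F 0 - G K) \<le> 5 * C1 * B" for K
    proof -
      have "s (F 0 - G K) = s (G K - F 0)" unfolding s_def higher_pderiv_minus by (rule sint_gtrig_minus)
      also have "\<dots> \<le> (\<Sum>k<K. s (T k))"
        unfolding s_def G_def using sint_gtrig_sum_le[of p r "\<lambda>k. (pderiv ^^ r) (T k)" "{..<K}"] p
        by (simp add: higher_pderiv_sum)
      also have "\<dots> \<le> (\<Sum>k<K. C1 * Y k)" by (rule sum_mono) (rule T(3))
      also have "\<dots> = C1 * (\<Sum>k<K. Y k)" by (simp add: sum_distrib_left)
      also have "\<dots> \<le> C1 * (5 * B)" using C1(1) Ysum by (intro mult_left_mono) auto
      finally show ?thesis by (simp add: mult_ac)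
    qed
    define \<eta> where "\<eta> K = pint p (\<lambda>x. f x - poly (F K) x)" for K
    have bound: "D P \<le> (1 + 5 * C1 + 10 * C2 * C1) * B + 2 * C2 * real n powr (real r * p) * \<eta> K" for K
    proof -
      have fG: "pint p (\<lambda>x. f x - poly (G K) x) \<le> \<eta> K + 5 * C1 * R * B"
      proof -
        have "pint p (\<lambda>x. f x - poly (G K) x) \<le> \<eta> K + pint p (poly (F K - G K))"
          unfolding \<eta>_def by (rule pint_le_add[OF fP absp fP p]) simp
        then show ?thesis using FG[of K] unfolding pint_poly_0[OF p(1)] by linarith
      qed
      have "sint p (gtrig 0 (G K - P)) = pint p (poly (G K - P))" by (rule pint_poly_0[OF p(1), symmetric])
      also have "\<dots> \<le> pint p (\<lambda>x. 1 * (poly (G K) x - f x)) + pint p (\<lambda>x. f x - poly P x)"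
      proof (rule pint_le_add[OF _ fP absp p])
        show "(\<lambda>x. 1 * (poly (G K) x - f x)) absolutely_integrable_on {-1..1}"
          by (intro absolutely_integrable_continuous_real continuous_intros deriv_in_AC_continuous[OF f r])
      qed simp
      also have "pint p (\<lambda>x. 1 * (poly (G K) x - f x)) = pint p (\<lambda>x. f x - poly (G K) x)"
        by (subst pint_commute) simp
      also have "pint p (\<lambda>x. f x - poly P x) \<le> pint p (\<lambda>x. f x - poly (G K) x)" using best dG by blast
      finally have GP: "sint p (gtrig 0 (G K - P)) \<le> 2 * \<eta> K + 10 * C1 * R * B" using fG by linarith
      have RR: "real n powr (real r * p) * R = 1" unfolding R_def using n1 by (simp add: powr_add[symmetric])
      have "s (G K - P) \<le> C2 * real n powr (real r * p) * sint p (gtrig 0 (G K - P))"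
        unfolding s_def by (rule C2(2)[OF n1]) (use dG P in \<open>auto intro: degree_diff_le\<close>)
      also have "\<dots> \<le> C2 * real n powr (real r * p) * (2 * \<eta> K + 10 * C1 * R * B)"
        using GP C2(1) by (intro mult_left_mono) auto
      also have "\<dots> = 2 * C2 * real n powr (real r * p) * \<eta> K + 10 * C2 * C1 * (real n powr (real r * p) * R) * B"
        by (simp add: algebra_simps)
      finally have sGP: "s (G K - P) \<le> 2 * C2 * real n powr (real r * p) * \<eta> K + 10 * C2 * C1 * B"
        unfolding RR by simp
      have "D P \<le> D (G K) + s (G K - P)" by (rule D_le)
      also have "D (G K) \<le> D (F 0) + s (F 0 - G K)" by (rule D_le)
      also have "D (F 0) \<le> B" using b[rule_format, of 0] B0 unfolding D_def by linarith
      finally show ?thesis using sG[of K] sGP by (simp add: distrib_right)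
    qed
    \<comment> \<open>Here \<open>n\<close> is fixed, so its power in front of
      \<open>\<eta> K\<close> does no harm: convergence of the \<open>F K\<close> to
      \<open>f\<close> is needed without any rate.\<close>
    have "(\<lambda>K. (1 + 5 * C1 + 10 * C2 * C1) * B + 2 * C2 * real n powr (real r * p) * \<eta> K) \<longlonglongrightarrow>
      (1 + 5 * C1 + 10 * C2 * C1) * B + 2 * C2 * real n powr (real r * p) * 0"
      unfolding \<eta>_def by (intro tendsto_intros conv)
    then have "D P \<le> (1 + 5 * C1 + 10 * C2 * C1) * B + 2 * C2 * real n powr (real r * p) * 0"
      by (rule LIMSEQ_le_const) (use bound in blast)
    then show "pint p (\<lambda>x. phi x ^ r * (iter_deriv r f x - poly ((pderiv ^^ r) P) x)) \<le> (1 + 5 * C1 + 10 * C2 * C1) * B"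
      unfolding D_def by simp
  qed
qed

lemma best_approx_derivative_pint:
  fixes p :: real
  assumes p: "0 < p" "p < 1" and r: "r \<ge> 1"
  shows "\<exists>C>0. \<forall>f P n. deriv_in_AC r f \<longrightarrow>
    (\<lambda>x. phi x ^ r * iter_deriv r f x) absolutely_integrable_on {-1..1} \<longrightarrow>
    (\<lambda>\<nu>. real \<nu> powr (1 - 2 * p) * best_approx (\<nu> - r) p (\<lambda>x. phi x ^ r) (iter_deriv r f) powr p)
      summable_on {r + 1..} \<longrightarrow>
    r \<le> n \<longrightarrow> degree P \<le> n \<longrightarrow>
    (\<forall>G. degree G \<le> n \<longrightarrow> pint p (\<lambda>x. f x - poly P x) \<le> pint p (\<lambda>x. f x - poly G x)) \<longrightarrow>
    pint p (\<lambda>x. phi x ^ r * (iter_deriv r f x - poly ((pderiv ^^ r) P) x)) \<le>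
      C * (best_approx (n - r) p (\<lambda>x. phi x ^ r) (iter_deriv r f) powr p + real n powr (2 * p - 2) *
        (\<Sum>\<^sub>\<infinity>\<nu>\<in>{n + 1..}. real \<nu> powr (1 - 2 * p) * best_approx (\<nu> - r) p (\<lambda>x. phi x ^ r) (iter_deriv r f) powr p))"
proof -
  obtain C where C: "C > 0" "\<And>f P n F b B. deriv_in_AC r f \<Longrightarrow>
    (\<lambda>x. phi x ^ r * iter_deriv r f x) absolutely_integrable_on {-1..1} \<Longrightarrow>
    r \<le> n \<Longrightarrow> degree P \<le> n \<Longrightarrow>
    (\<forall>G. degree G \<le> n \<longrightarrow> pint p (\<lambda>x. f x - poly P x) \<le> pint p (\<lambda>x. f x - poly G x)) \<Longrightarrow>
    (\<forall>k. \<forall>i<r. poly ((pderiv ^^ i) (F k)) 0 = iter_deriv i f 0) \<Longrightarrow>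
    (\<forall>k. degree (F k) \<le> 2 ^ k * n) \<Longrightarrow>
    (\<forall>k. pint p (\<lambda>x. phi x ^ r * (iter_deriv r f x - poly ((pderiv ^^ r) (F k)) x)) \<le> b k) \<Longrightarrow>
    (\<forall>K. (\<Sum>k<K. (2 powr (2 - 2 * p)) ^ k * b k) \<le> B) \<Longrightarrow>
    pint p (\<lambda>x. phi x ^ r * (iter_deriv r f x - poly ((pderiv ^^ r) P) x)) \<le> C * B"
    using best_polynomial_derivative_le[OF p r] by blast
  show ?thesis
  proof (intro exI[of _ "8 * C"] conjI allI impI)
    show "0 < 8 * C" using C(1) by simp
    fix f P n
    assume f: "deriv_in_AC r f"
      and g: "(\<lambda>x. phi x ^ r * iter_deriv r f x) absolutely_integrable_on {-1..1}"
      and sm: "(\<lambda>\<nu>. real \<nu> powr (1 - 2 * p) * best_approx (\<nu> - r) p (\<lambda>x. phi x ^ r) (iter_deriv r f) powr p)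
        summable_on {r + 1..}"
      and n: "r \<le> n" and P: "degree P \<le> n"
      and best: "\<forall>G. degree G \<le> n \<longrightarrow> pint p (\<lambda>x. f x - poly P x) \<le> pint p (\<lambda>x. f x - poly G x)"
    have n1: "n \<ge> 1" using n r by simp
    define q where "q = (2::real) powr (2 - 2 * p)"
    have q: "q > 0" unfolding q_def by simp
    define a where "a \<nu> = best_approx (\<nu> - r) p (\<lambda>x. phi x ^ r) (iter_deriv r f) powr p" for \<nu>
    define A where "A = (\<Sum>\<^sub>\<infinity>\<nu>\<in>{n + 1..}. real \<nu> powr (1 - 2 * p) * a \<nu>)"
    have a0: "0 \<le> a \<nu>" for \<nu> unfolding a_def by simp
    have sa: "(\<lambda>\<nu>. real \<nu> powr (1 - 2 * p) * a \<nu>) summable_on {n + 1..}"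
      unfolding a_def by (rule summable_on_subset_banach[OF sm]) (use n in auto)
    have dy: "(\<Sum>k<K. q ^ k * a (2 ^ k * n)) \<le> a n + 8 * real n powr (2 * p - 2) * A" for K
      unfolding q_def A_def
    proof (rule dyadic_sum_le[OF p n1 a0 _ sa])
      show "a \<nu> \<le> a \<mu>" if "\<mu> \<le> \<nu>" for \<mu> \<nu>
        unfolding a_def using that p
        by (intro powr_mono2 best_approx_antimono best_approx_nonneg diff_le_mono) auto
    qed
    have "pint p (\<lambda>x. phi x ^ r * (iter_deriv r f x - poly ((pderiv ^^ r) P) x)) \<le> C * (8 * (a n + real n powr (2 * p - 2) * A)) + \<epsilon>"
      if eps: "\<epsilon> > 0" for \<epsilon>
    proof -
      \<comment> \<open>The slack has to survive multiplication by \<open>q ^ k\<close>. The ratio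
        \<open>1 / (2 * q)\<close> leaves a geometric series of ratio \<open>1 / 2\<close>, in total
        at most \<open>\<epsilon> / C\<close>, which \<open>C\<close> turns into
        \<open>\<epsilon>\<close>.\<close>
      define b where "b k = a (2 ^ k * n) + \<epsilon> / (2 * C) * (1 / (2 * q)) ^ k" for k
      have "\<exists>H. degree H \<le> 2 ^ k * n \<and> (\<forall>i<r. poly ((pderiv ^^ i) H) 0 = iter_deriv i f 0) \<and>
        pint p (\<lambda>x. phi x ^ r * (iter_deriv r f x - poly ((pderiv ^^ r) H) x)) \<le> b k" for k
      proof -
        obtain Q where Q: "degree Q \<le> 2 ^ k * n - r" "pint p (\<lambda>x. phi x ^ r * (iter_deriv r f x - poly Q x)) \<le> b k"
          using near_best_approx[OF p _ g, of "\<epsilon> / (2 * C) * (1 / (2 * q)) ^ k" "2 ^ k * n - r"] C(1) eps q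
          unfolding b_def a_def by auto
        obtain H where H: "(pderiv ^^ r) H = Q" "\<forall>i<r. poly ((pderiv ^^ i) H) 0 = iter_deriv i f 0" "degree H \<le> degree Q + r"
          using poly_iterated_antideriv[of r Q "\<lambda>i. iter_deriv i f 0"] by blast
        have "r \<le> 2 ^ k * n" using n by (metis le_trans mult_1 mult_le_mono1 one_le_numeral one_le_power)
        then have "degree H \<le> 2 ^ k * n" using Q(1) H(3) by linarith
        then show ?thesis using Q H by (intro exI[of _ H]) auto
      qed
      then have "\<exists>F. \<forall>k. degree (F k) \<le> 2 ^ k * n \<and> (\<forall>i<r. poly ((pderiv ^^ i) (F k)) 0 = iter_deriv i f 0) \<and>
        pint p (\<lambda>x. phi x ^ r * (iter_deriv r f x - poly ((pderiv ^^ r) (F k)) x)) \<le> b k"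
        by (intro choice allI)
      then obtain F where F: "\<And>k. degree (F k) \<le> 2 ^ k * n" "\<And>k. \<forall>i<r. poly ((pderiv ^^ i) (F k)) 0 = iter_deriv i f 0"
        "\<And>k. pint p (\<lambda>x. phi x ^ r * (iter_deriv r f x - poly ((pderiv ^^ r) (F k)) x)) \<le> b k"
        by blast
      have "pint p (\<lambda>x. phi x ^ r * (iter_deriv r f x - poly ((pderiv ^^ r) P) x)) \<le> C * (a n + 8 * real n powr (2 * p - 2) * A + \<epsilon> / C)"
      proof (rule C(2)[OF f g n P best, where F = F and b = b])
        show "\<forall>K. (\<Sum>k<K. (2 powr (2 - 2 * p)) ^ k * b k) \<le> a n + 8 * real n powr (2 * p - 2) * A + \<epsilon> / C"
        proof
          fix K
          have "(\<Sum>k<K. q ^ k * b k) = (\<Sum>k<K. q ^ k * a (2 ^ k * n)) + \<epsilon> / (2 * C) * (\<Sum>k<K. (1 / 2) ^ k)"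
            unfolding b_def using q
            by (simp add: distrib_left sum.distrib sum_distrib_left power_mult_distrib power_divide mult.assoc)
          also have "\<epsilon> / (2 * C) * (\<Sum>k<K. (1 / 2) ^ k) \<le> \<epsilon> / (2 * C) * 2"
          proof (rule mult_left_mono)
            show "(\<Sum>k<K. (1 / 2 :: real) ^ k) \<le> 2" by (subst geometric_sum) auto
          qed (use C(1) eps in simp)
          finally show "(\<Sum>k<K. (2 powr (2 - 2 * p)) ^ k * b k) \<le> a n + 8 * real n powr (2 * p - 2) * A + \<epsilon> / C"
            using dy[of K] unfolding q_def by simp
        qed
      qed (use F in auto)
      also have "\<dots> = C * (a n + 8 * real n powr (2 * p - 2) * A) + \<epsilon>"
        using C(1) by (simp add: distrib_left)
      also have "\<dots> \<le> C * (8 * (a n + real n powr (2 * p - 2) * A)) + \<epsilon>"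
        using C(1) a0[of n] by simp
      finally show ?thesis .
    qed
    then have "pint p (\<lambda>x. phi x ^ r * (iter_deriv r f x - poly ((pderiv ^^ r) P) x)) \<le> C * (8 * (a n + real n powr (2 * p - 2) * A))"
      by (rule field_le_epsilon)
    then show "pint p (\<lambda>x. phi x ^ r * (iter_deriv r f x - poly ((pderiv ^^ r) P) x)) \<le>
      8 * C * (best_approx (n - r) p (\<lambda>x. phi x ^ r) (iter_deriv r f) powr p + real n powr (2 * p - 2) *
        (\<Sum>\<^sub>\<infinity>\<nu>\<in>{n + 1..}. real \<nu> powr (1 - 2 * p) * best_approx (\<nu> - r) p (\<lambda>x. phi x ^ r) (iter_deriv r f) powr p))"
      unfolding A_def a_def by (simp add: mult_ac)
  qed
qed

lemma add_powr_le:
  fixes x y q :: real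
  assumes "0 \<le> x" "0 \<le> y" "0 \<le> q"
  shows "(x + y) powr q \<le> 2 powr q * (x powr q + y powr q)"
proof -
  have "(x + y) powr q \<le> (2 * max x y) powr q" using assms by (intro powr_mono2) auto
  also have "\<dots> = 2 powr q * max x y powr q" using assms by (simp add: powr_mult)
  also have "max x y powr q \<le> x powr q + y powr q" by (simp add: max_def)
  finally show ?thesis by simp
qed

theorem theorem4p4:
  fixes r :: nat
  assumes "r \<ge> 1"
  shows "\<exists>n0::nat. n0 \<ge> 1 \<and> (\<forall>p::real. 0 < p \<and> p < 1 \<longrightarrow> (\<exists>C::real.
    \<forall>(f :: real \<Rightarrow> real) (P :: nat \<Rightarrow> real poly).
      deriv_in_AC r f \<longrightarrow>
      (\<lambda>x. phi x ^ r * iter_deriv r f x) absolutely_integrable_on {-1..1} \<longrightarrow>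
      (\<lambda>\<nu>. real \<nu> powr (1 - 2 * p) *
            best_approx (\<nu> - r) p (\<lambda>x. phi x ^ r) (iter_deriv r f) powr p)
        summable_on {r + 1..} \<longrightarrow>
      (\<forall>n\<ge>1. degree (P n) \<le> n \<and>
         Lp_norm p (\<lambda>x. f x - poly (P n) x) = best_approx n p (\<lambda>x. 1) f) \<longrightarrow>
      (\<forall>n\<ge>n0.
         Lp_norm p (\<lambda>x. phi x ^ r * (iter_deriv r f x - poly ((pderiv ^^ r) (P n)) x))
         \<le> C * (best_approx (n - r) p (\<lambda>x. phi x ^ r) (iter_deriv r f) +
                real n powr (2 - 2 / p) *
                (\<Sum>\<^sub>\<infinity>\<nu>\<in>{n + 1..}. real \<nu> powr (1 - 2 * p) *
                   best_approx (\<nu> - r) p (\<lambda>x. phi x ^ r) (iter_deriv r f) powr p) powr (1 / p)))))"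
\<comment> \<open>\<open>n0 = r\<close> works for every \<open>p\<close>: from \<open>n = r\<close>
  on, \<open>n - r\<close> is a true difference of naturals and the Jackson estimates for
  derivatives of order \<open>r\<close> apply.\<close>
proof (intro exI[of _ r] conjI assms allI impI)
  fix p :: real assume p: "0 < p \<and> p < 1"
  then have p0: "0 < p" and p1: "p < 1" by auto
  obtain C where C: "C > 0" "\<And>f P n. deriv_in_AC r f \<Longrightarrow>
    (\<lambda>x. phi x ^ r * iter_deriv r f x) absolutely_integrable_on {-1..1} \<Longrightarrow>
    (\<lambda>\<nu>. real \<nu> powr (1 - 2 * p) * best_approx (\<nu> - r) p (\<lambda>x. phi x ^ r) (iter_deriv r f) powr p)
      summable_on {r + 1..} \<Longrightarrow>
    r \<le> n \<Longrightarrow> degree P \<le> n \<Longrightarrow>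
    (\<forall>G. degree G \<le> n \<longrightarrow> pint p (\<lambda>x. f x - poly P x) \<le> pint p (\<lambda>x. f x - poly G x)) \<Longrightarrow>
    pint p (\<lambda>x. phi x ^ r * (iter_deriv r f x - poly ((pderiv ^^ r) P) x)) \<le>
      C * (best_approx (n - r) p (\<lambda>x. phi x ^ r) (iter_deriv r f) powr p + real n powr (2 * p - 2) *
        (\<Sum>\<^sub>\<infinity>\<nu>\<in>{n + 1..}. real \<nu> powr (1 - 2 * p) * best_approx (\<nu> - r) p (\<lambda>x. phi x ^ r) (iter_deriv r f) powr p))"
    using best_approx_derivative_pint[OF p0 p1 assms] by blast
  \<comment> \<open>The root of order \<open>p\<close> is taken only here; splitting the root of a
    sum of two terms costs \<open>2 powr (1 / p)\<close>, and the exponent \<open>2 * p - 2\<close>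
    becomes \<open>2 - 2 / p\<close>.\<close>
  define M where "M = C powr (1 / p) * 2 powr (1 / p)"
  show "\<exists>C. \<forall>f P. deriv_in_AC r f \<longrightarrow>
      (\<lambda>x. phi x ^ r * iter_deriv r f x) absolutely_integrable_on {-1..1} \<longrightarrow>
      (\<lambda>\<nu>. real \<nu> powr (1 - 2 * p) *
            best_approx (\<nu> - r) p (\<lambda>x. phi x ^ r) (iter_deriv r f) powr p)
        summable_on {r + 1..} \<longrightarrow>
      (\<forall>n\<ge>1. degree (P n) \<le> n \<and>
         Lp_norm p (\<lambda>x. f x - poly (P n) x) = best_approx n p (\<lambda>x. 1) f) \<longrightarrow>
      (\<forall>n\<ge>r.
         Lp_norm p (\<lambda>x. phi x ^ r * (iter_deriv r f x - poly ((pderiv ^^ r) (P n)) x))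
         \<le> C * (best_approx (n - r) p (\<lambda>x. phi x ^ r) (iter_deriv r f) +
                real n powr (2 - 2 / p) *
                (\<Sum>\<^sub>\<infinity>\<nu>\<in>{n + 1..}. real \<nu> powr (1 - 2 * p) *
                   best_approx (\<nu> - r) p (\<lambda>x. phi x ^ r) (iter_deriv r f) powr p) powr (1 / p)))"
  proof (intro exI[of _ M] allI impI)
    fix f :: "real \<Rightarrow> real" and P :: "nat \<Rightarrow> real poly" and n
    assume f: "deriv_in_AC r f"
      and g: "(\<lambda>x. phi x ^ r * iter_deriv r f x) absolutely_integrable_on {-1..1}"
      and sm: "(\<lambda>\<nu>. real \<nu> powr (1 - 2 * p) * best_approx (\<nu> - r) p (\<lambda>x. phi x ^ r) (iter_deriv r f) powr p)
        summable_on {r + 1..}"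
      and P: "\<forall>n\<ge>1. degree (P n) \<le> n \<and> Lp_norm p (\<lambda>x. f x - poly (P n) x) = best_approx n p (\<lambda>x. 1) f"
      and n: "n \<ge> r"
    have Pn: "degree (P n) \<le> n" "Lp_norm p (\<lambda>x. f x - poly (P n) x) = best_approx n p (\<lambda>x. 1) f"
      using P n assms by auto
    have fc: "continuous_on {-1..1} f" by (rule deriv_in_AC_continuous[OF f assms])
    have best: "pint p (\<lambda>x. f x - poly (P n) x) \<le> pint p (\<lambda>x. f x - poly G x)" if "degree G \<le> n" for G
    proof -
      have "Lp_norm p (\<lambda>x. f x - poly (P n) x) \<le> Lp_norm p (\<lambda>x. f x - poly G x)"
        using best_approx_le[OF that, of p "\<lambda>x. 1" f] Pn(2) by simp
      then have "(pint p (\<lambda>x. f x - poly (P n) x) powr (1 / p)) powr p \<le> (pint p (\<lambda>x. f x - poly G x) powr (1 / p)) powr p"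
        unfolding Lp_norm_pint[OF absint_diff_poly[OF fc] p0 p1] by (rule powr_mono2[rotated 2]) (use p0 in auto)
      moreover have "(pint p F powr (1 / p)) powr p = pint p F" for F using p0 by (simp add: powr_powr pint_nonneg)
      ultimately show ?thesis by simp
    qed
    define a where "a = best_approx (n - r) p (\<lambda>x. phi x ^ r) (iter_deriv r f)"
    define A where "A = (\<Sum>\<^sub>\<infinity>\<nu>\<in>{n + 1..}. real \<nu> powr (1 - 2 * p) * best_approx (\<nu> - r) p (\<lambda>x. phi x ^ r) (iter_deriv r f) powr p)"
    have a0: "0 \<le> a" unfolding a_def by (rule best_approx_nonneg)
    have A0: "0 \<le> A" unfolding A_def by (intro infsum_nonneg) simp
    have "Lp_norm p (\<lambda>x. phi x ^ r * (iter_deriv r f x - poly ((pderiv ^^ r) (P n)) x)) =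
        pint p (\<lambda>x. phi x ^ r * (iter_deriv r f x - poly ((pderiv ^^ r) (P n)) x)) powr (1 / p)"
      by (rule Lp_norm_pint[OF absint_phi_diff_poly[OF g] p0 p1])
    also have "\<dots> \<le> (C * (a powr p + real n powr (2 * p - 2) * A)) powr (1 / p)"
      unfolding a_def A_def using C(2)[OF f g sm n Pn(1)] best p0 by (intro powr_mono2) (auto simp: pint_nonneg)
    also have "\<dots> = C powr (1 / p) * (a powr p + real n powr (2 * p - 2) * A) powr (1 / p)"
      using C(1) A0 by (simp add: powr_mult)
    also have "\<dots> \<le> C powr (1 / p) * (2 powr (1 / p) * ((a powr p) powr (1 / p) + (real n powr (2 * p - 2) * A) powr (1 / p)))"
      using A0 p0 by (intro mult_left_mono add_powr_le) auto
    also have "(a powr p) powr (1 / p) = a" using a0 p0 by (simp add: powr_powr)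
    also have "(real n powr (2 * p - 2) * A) powr (1 / p) = real n powr (2 - 2 / p) * A powr (1 / p)"
      using A0 p0 by (simp add: powr_mult powr_powr diff_divide_distrib)
    finally show "Lp_norm p (\<lambda>x. phi x ^ r * (iter_deriv r f x - poly ((pderiv ^^ r) (P n)) x)) \<le> M * (a + real n powr (2 - 2 / p) * A powr (1 / p))"
      unfolding M_def by (simp add: mult_ac)
  qed
qed

end
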